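(* Suppose $X$ is a doubling nondegenerate metric measure space, $p_0,p_1\in[1,\infty]$ not both equal to $\infty$, $q_0,q_1\in(1,\infty)$, $s_0,s_1\in\mathbb{R}$ and $\theta\in(0,1)$. Then $[T^{p_0,q_0}_{s_0},T^{p_1,q_1}_{s_1}]_\theta = T^{p_\theta,q_\theta}_{s_\theta}$ with equivalent norms, where $1/p_\theta=(1-\theta)/p_0+\theta/p_1$, $1/q_\theta=(1-\theta)/q_0+\theta/q_1$, and $s_\theta=(1-\theta)s_0+\theta s_1$.
   Context: $[\cdot,\cdot]_\theta$ is the complex interpolation functor. $(X,d,\mu)$ metric space with Borel measure, nondegenerate ($0<V(x,r):=\mu(B(x,r))<\infty$) and doubling. $X^+ := X\times(0,\infty)$ with measure $d\mu\,dt/t$. $\Gamma(x):=\{(y,t):d(x,y)<t\}$, $T(B):=\{(y,t):B(y,t)\subset B\}$. $\mathcal{A}^q f(x) := (\iint_{\Gamma(x)}|f|^q\frac{d\mu(y)}{V(y,t)}\frac{dt}{t})^{1/q}$. $(V^sf)(y,t):=V(y,t)^sf(y,t)$. For $p<\infty$: $T^{p,q}_s$ is the space of $f\in L^0(X^+)$ with $\|f\|_{T^{p,q}_s}:=\|\mathcal{A}^q(V^{-s}f)\|_{L^p(X)}<\infty$. For $p=\infty$: $T^{\infty,q}_s$ is the space with norm $\|f\|_{T^{\infty,q}_s}:=\sup_B\mu(B)^{-1/q}\|V^{-s}f\|_{L^q(T(B),d\mu\,dt/t)}$ (supremum over balls). *)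

theory Defs
  imports "HOL-Analysis.Analysis"
begin

text \<open>Nonnegative real power on ennreal (used for exponents a > 0); infinity stays infinity.\<close>
definition epow :: "ennreal \<Rightarrow> real \<Rightarrow> ennreal" where
  "epow x a = (if x = \<infinity> then \<infinity> else ennreal (enn2real x powr a))"

definition nondegenerate :: "'a::metric_space measure \<Rightarrow> bool" where
  "nondegenerate M \<longleftrightarrow> (\<forall>x r. r > 0 \<longrightarrow> 0 < emeasure M (ball x r) \<and> emeasure M (ball x r) < \<infinity>)"

definition doubling :: "'a::metric_space measure \<Rightarrow> bool" where
  "doubling M \<longleftrightarrow> (\<exists>C::real. \<forall>x r. r > 0 \<longrightarrow>
      emeasure M (ball x (2 * r)) \<le> ennreal C * emeasure M (ball x r))"

definition Vol :: "'a::metric_space measure \<Rightarrow> 'a \<Rightarrow> real \<Rightarrow> real" where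
  "Vol M x r = measure M (ball x r)"

definition dt_over_t :: "real measure" where
  "dt_over_t = density (restrict_space lborel {0<..}) (\<lambda>t. ennreal (1 / t))"

definition Xplus :: "'a::metric_space measure \<Rightarrow> ('a \<times> real) measure" where
  "Xplus M = M \<Otimes>\<^sub>M dt_over_t"

definition cone :: "'a::metric_space \<Rightarrow> ('a \<times> real) set" where
  "cone x = {(y, t). t > 0 \<and> dist x y < t}"

definition tent :: "'a::metric_space set \<Rightarrow> ('a \<times> real) set" where
  "tent B = {(y, t). t > 0 \<and> ball y t \<subseteq> B}"

definition Vpow :: "'a::metric_space measure \<Rightarrow> real \<Rightarrow> ('a \<times> real \<Rightarrow> complex) \<Rightarrow> 'a \<times> real \<Rightarrow> complex" where
  "Vpow M s f = (\<lambda>(y, t). complex_of_real (Vol M y t powr s) * f (y, t))"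

definition Aq :: "'a::metric_space measure \<Rightarrow> real \<Rightarrow> ('a \<times> real \<Rightarrow> complex) \<Rightarrow> 'a \<Rightarrow> ennreal" where
  "Aq M q f x = epow (\<integral>\<^sup>+ z. indicator (cone x) z *
       ennreal (cmod (f z) powr q / Vol M (fst z) (snd z)) \<partial>Xplus M) (1 / q)"

definition tent_norm :: "'a::metric_space measure \<Rightarrow> ennreal \<Rightarrow> real \<Rightarrow> real \<Rightarrow> ('a \<times> real \<Rightarrow> complex) \<Rightarrow> ennreal" where
  "tent_norm M p q s f =
     (if p = \<infinity> then
        (SUP xr \<in> {(x, r). r > (0::real)}.
           ennreal (measure M (ball (fst xr) (snd xr)) powr (- 1 / q)) *
           epow (\<integral>\<^sup>+ z. indicator (tent (ball (fst xr) (snd xr))) z *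
                   ennreal (cmod (Vpow M (- s) f z) powr q) \<partial>Xplus M) (1 / q))
      else epow (\<integral>\<^sup>+ x. epow (Aq M q (Vpow M (- s) f) x) (enn2real p) \<partial>M) (1 / enn2real p))"

definition L0plus :: "'a::metric_space measure \<Rightarrow> ('a \<times> real \<Rightarrow> complex) set" where
  "L0plus M = borel_measurable (Xplus M)"

definition nspace :: "('b \<Rightarrow> complex) set \<Rightarrow> (('b \<Rightarrow> complex) \<Rightarrow> ennreal) \<Rightarrow> ('b \<Rightarrow> complex) set" where
  "nspace L N = {f \<in> L. N f < \<infinity>}"

definition sum_norm :: "('b \<Rightarrow> complex) set \<Rightarrow> (('b \<Rightarrow> complex) \<Rightarrow> ennreal) \<Rightarrow> (('b \<Rightarrow> complex) \<Rightarrow> ennreal)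
    \<Rightarrow> ('b \<Rightarrow> complex) \<Rightarrow> ennreal" where
  "sum_norm L N0 N1 f = (INF ab \<in> {(a, b). a \<in> nspace L N0 \<and> b \<in> nspace L N1 \<and> f = (\<lambda>y. a y + b y)}.
                           N0 (fst ab) + N1 (snd ab))"

definition sum_space :: "('b \<Rightarrow> complex) set \<Rightarrow> (('b \<Rightarrow> complex) \<Rightarrow> ennreal) \<Rightarrow> (('b \<Rightarrow> complex) \<Rightarrow> ennreal)
    \<Rightarrow> ('b \<Rightarrow> complex) set" where
  "sum_space L N0 N1 = {(\<lambda>y. a y + b y) | a b. a \<in> nspace L N0 \<and> b \<in> nspace L N1}"

definition strip :: "complex set" where "strip = {z. 0 \<le> Re z \<and> Re z \<le> 1}"
definition ostrip :: "complex set" where "ostrip = {z. 0 < Re z \<and> Re z < 1}"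

text \<open>The Calderon class F(X0,X1) (Bergh--Loefstroem): bounded continuous X0+X1-valued on the closed strip,
  holomorphic in the open strip, with boundary values continuous into X_j and tending to 0 at infinity.\<close>
definition calderon :: "('b \<Rightarrow> complex) set \<Rightarrow> (('b \<Rightarrow> complex) \<Rightarrow> ennreal) \<Rightarrow> (('b \<Rightarrow> complex) \<Rightarrow> ennreal)
    \<Rightarrow> (complex \<Rightarrow> 'b \<Rightarrow> complex) \<Rightarrow> bool" where
  "calderon L N0 N1 F \<longleftrightarrow>
     (\<forall>z\<in>strip. F z \<in> sum_space L N0 N1) \<and>
     (\<exists>B::real. \<forall>z\<in>strip. sum_norm L N0 N1 (F z) \<le> ennreal B) \<and>
     (\<forall>z\<in>strip. \<forall>e>0. \<exists>d>0. \<forall>w\<in>strip. cmod (w - z) < d \<longrightarrow>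
         sum_norm L N0 N1 (\<lambda>y. F w y - F z y) < ennreal e) \<and>
     (\<forall>z\<in>ostrip. \<exists>v \<in> sum_space L N0 N1. \<forall>e>0. \<exists>d>0. \<forall>w\<in>ostrip.
         0 < cmod (w - z) \<and> cmod (w - z) < d \<longrightarrow>
         sum_norm L N0 N1 (\<lambda>y. (F w y - F z y) / (w - z) - v y) < ennreal e) \<and>
     (\<forall>t. F (Complex 0 t) \<in> nspace L N0 \<and> F (Complex 1 t) \<in> nspace L N1) \<and>
     (\<forall>t. \<forall>e>0. \<exists>d>0. \<forall>t'. \<bar>t' - t\<bar> < d \<longrightarrow>
         N0 (\<lambda>y. F (Complex 0 t') y - F (Complex 0 t) y) < ennreal e \<and>
         N1 (\<lambda>y. F (Complex 1 t') y - F (Complex 1 t) y) < ennreal e) \<and>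
     (\<forall>e>0. \<exists>R. \<forall>t. \<bar>t\<bar> \<ge> R \<longrightarrow> N0 (F (Complex 0 t)) < ennreal e \<and> N1 (F (Complex 1 t)) < ennreal e)"

definition calderon_norm :: "(('b \<Rightarrow> complex) \<Rightarrow> ennreal) \<Rightarrow> (('b \<Rightarrow> complex) \<Rightarrow> ennreal)
    \<Rightarrow> (complex \<Rightarrow> 'b \<Rightarrow> complex) \<Rightarrow> ennreal" where
  "calderon_norm N0 N1 F = max (SUP t. N0 (F (Complex 0 t))) (SUP t. N1 (F (Complex 1 t)))"

definition interp_space :: "('b \<Rightarrow> complex) set \<Rightarrow> (('b \<Rightarrow> complex) \<Rightarrow> ennreal) \<Rightarrow> (('b \<Rightarrow> complex) \<Rightarrow> ennreal)
    \<Rightarrow> real \<Rightarrow> ('b \<Rightarrow> complex) set" where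
  "interp_space L N0 N1 \<theta> = {F (complex_of_real \<theta>) | F. calderon L N0 N1 F}"

definition interp_norm :: "('b \<Rightarrow> complex) set \<Rightarrow> (('b \<Rightarrow> complex) \<Rightarrow> ennreal) \<Rightarrow> (('b \<Rightarrow> complex) \<Rightarrow> ennreal)
    \<Rightarrow> real \<Rightarrow> ('b \<Rightarrow> complex) \<Rightarrow> ennreal" where
  "interp_norm L N0 N1 \<theta> f =
     (INF F \<in> {F. calderon L N0 N1 F \<and> F (complex_of_real \<theta>) = f}. calderon_norm N0 N1 F)"

end

theory Submission
  imports Defs "HOL-Complex_Analysis.Complex_Analysis"
begin

text \<open>
  Let \<open>avg h (y, t)\<close> be the average of \<open>h\<close> over \<open>B(y, t)\<close>; integrals over cones and averages are dual to each other
  by Fubini's theorem.  For \<open>f\<close> in \<open>T\<^sup>p\<^sup>,\<^sup>q\<close> choose \<open>a > 0\<close> in \<open>L\<^sup>p\<close> above the conical functional of \<open>f\<close>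
  and put \<open>w = (avg (a\<^sup>r))\<^sup>1\<^sup>/\<^sup>r\<close> with \<open>r < p\<close>.  Negative powers of \<open>w\<close> are bounded by averages of negative powers
  of \<open>a\<close> (Jensen), positive powers by the maximal function of \<open>a\<^sup>r\<close>.  This makes
  \<open>f\<^sub>j = |f|\<^bsup>q/q\<^sub>j\<^esup> w\<^bsup>p/p\<^sub>j - q/q\<^sub>j\<^esup>\<close> a factorisation \<open>|f| = f\<^sub>0\<^bsup>1-\<theta>\<^esup> f\<^sub>1\<^bsup>\<theta>\<^esup>\<close> with norms controlled by the norm of \<open>f\<close>, also at the
  endpoint \<open>p\<^sub>j = \<infinity>\<close>, and \<open>f\<close> is the value at \<open>\<theta>\<close> of an explicit analytic family.  Conversely, the value at \<open>\<theta>\<close> of a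
  Calderon family \<open>F\<close> is paired with the dual family built from the same weight for \<open>f = F \<theta>\<close>; the boundary
  values are bounded by Hoelder's inequality on cones (for \<open>p\<^sub>j = \<infinity>\<close> by the Carleson embedding theorem), and the
  maximum principle on the strip bounds the pairing at \<open>\<theta>\<close>, which is comparable to the norm of \<open>f\<close>.
  No duality theory of tent spaces is needed.
\<close>

section \<open>Powers and Lebesgue integrals of extended nonnegative functions\<close>

text \<open>A factor has to be a function of \<open>(y, t)\<close>, while the conical functional
  lives on the base; averaging that functional itself would fail at \<open>p = 1\<close>, where the
  maximal operator is unbounded. Averaging the power \<open>r < p\<close> puts the maximal theorem
  at the exponent \<open>p / r > 1\<close>. The upper bounds hold for every such \<open>r\<close>;
  if \<open>q < p\<close>, the value \<open>r = p - q\<close> turns the last pairing integral into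
  an exact Fubini identity. Analysis takes place on sets where \<open>V\<close>, \<open>t\<close>,
  \<open>cmod f\<close> and therefore \<open>w\<close> are bounded above and below, so that all
  exponents of the analytic families are bounded. The constants must not see these sets: after
  division by the norm, \<open>a\<close> is the conical functional plus a positive function of
  integral at most 1, which bounds the integral of \<open>a powr p\<close> by
  \<open>2 * 2 powr p\<close> for every \<open>f\<close>. General functions are then reached by a
  geometrically convergent sum of pieces when a Calderon family is constructed, and by monotone
  convergence when its value at \<open>\<theta>\<close> is estimated. The exponents of
  \<open>V\<close>, of the modulus and of \<open>w\<close> are affine in \<open>z\<close>, which is
  why correct exponents on the two boundary lines produce the correct ones at
  \<open>\<theta>\<close>.\<close>

lemma epow_ennreal: "0 \<le> r \<Longrightarrow> epow (ennreal r) a = ennreal (r powr a)"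
  by (simp add: epow_def)

lemma epow_top [simp]: "epow \<infinity> a = \<infinity>" "epow top a = top"
  by (auto simp: epow_def)

lemma epow_0 [simp]: "epow 0 a = 0"
  by (simp add: epow_def)

lemma epow_one [simp]: "epow 1 a = 1"
  by (simp add: epow_def)

lemma epow_1 [simp]: "epow x 1 = x"
  by (cases x) (auto simp: epow_ennreal)

lemma epow_less_top [simp]: "epow x a < top \<longleftrightarrow> x < top"
  by (cases x) (auto simp: epow_ennreal)

lemma epow_eq_top [simp]: "epow x a = top \<longleftrightarrow> x = top"
  by (cases x) (auto simp: epow_ennreal)

lemma epow_eq_0 [simp]: "epow x a = 0 \<longleftrightarrow> x = 0"
  by (cases x) (auto simp: epow_ennreal)

lemma epow_mono: "x \<le> y \<Longrightarrow> 0 \<le> a \<Longrightarrow> epow x a \<le> epow y a"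
  by (cases x; cases y) (auto simp: epow_ennreal top_unique intro!: ennreal_leI powr_mono2)

lemma epow_mult: "epow (x * y) a = epow x a * epow y a"
proof (cases "x = 0 \<or> y = 0")
  case False
  then show ?thesis
    by (cases x; cases y)
      (auto simp: epow_ennreal powr_mult ennreal_mult_top ennreal_top_mult ennreal_mult[symmetric])
qed auto

lemma epow_epow: "epow (epow x a) b = epow x (a * b)"
  by (cases x) (auto simp: epow_ennreal powr_powr)

lemma epow_add: "epow x (a + b) = epow x a * epow x b"
  by (cases x) (auto simp: epow_ennreal powr_add ennreal_mult)

lemma epow_le_iff: "0 < a \<Longrightarrow> epow x a \<le> y \<longleftrightarrow> x \<le> epow y (1 / a)"
  using epow_mono[of "epow x a" y "1 / a"] epow_mono[of x "epow y (1 / a)" a]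
  by (auto simp: epow_epow)

lemma epow_le_cancel: "0 < a \<Longrightarrow> epow x a \<le> epow y a \<longleftrightarrow> x \<le> y"
  by (simp add: epow_le_iff epow_epow)

lemma epow_less_cancel: "0 < a \<Longrightarrow> epow x a < epow y a \<longleftrightarrow> x < y"
  using epow_le_cancel[of a y x] by (simp add: not_le[symmetric])

lemma epow_SUP:
  assumes "0 < a"
  shows "epow (SUP i\<in>I. f i) a = (SUP i\<in>I. epow (f i) a)"
proof (rule antisym)
  have "f i \<le> epow (SUP i\<in>I. epow (f i) a) (1 / a)" if "i \<in> I" for i
    using that assms by (subst epow_le_iff[symmetric]) (auto intro: SUP_upper)
  then show "epow (SUP i\<in>I. f i) a \<le> (SUP i\<in>I. epow (f i) a)"
    using assms by (subst epow_le_iff) (auto intro: SUP_least)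
  show "(SUP i\<in>I. epow (f i) a) \<le> epow (SUP i\<in>I. f i) a"
    using assms by (auto intro!: SUP_least epow_mono SUP_upper)
qed

lemma borel_measurable_epow [measurable (raw)]:
  assumes [measurable]: "f \<in> borel_measurable M"
  shows "(\<lambda>x. epow (f x) a) \<in> borel_measurable M"
  unfolding epow_def by measurable

lemma epow_Youngs:
  assumes "0 < \<alpha>" "\<alpha> < 1"
  shows "epow x \<alpha> * epow y (1 - \<alpha>) \<le> ennreal \<alpha> * x + ennreal (1 - \<alpha>) * y"
proof (cases "x = 0 \<or> y = 0")
  case False
  then show ?thesis
    using assms
    by (cases x; cases y) (auto simp: epow_ennreal ennreal_mult_top ennreal_top_mult ennreal_mult[symmetric]
        ennreal_plus[symmetric] intro!: ennreal_leI Youngs_inequality_0 simp del: ennreal_plus)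
qed auto

text \<open>Stated with \<open>\<alpha>\<close> and \<open>1 - \<alpha>\<close>, so that it serves
  both for conjugate exponents and for splitting a power below 1. If an integral is 0, the product
  vanishes almost everywhere; if one is infinite and neither is 0, the right side is
  \<open>top\<close>; otherwise Young's inequality is integrated after normalising both integrals to
  1.\<close>

lemma nn_integral_Holder:
  assumes [measurable]: "f \<in> borel_measurable M" "g \<in> borel_measurable M" and \<alpha>: "0 < \<alpha>" "\<alpha> < 1"
  shows "(\<integral>\<^sup>+x. epow (f x) \<alpha> * epow (g x) (1 - \<alpha>) \<partial>M)
           \<le> epow (\<integral>\<^sup>+x. f x \<partial>M) \<alpha> * epow (\<integral>\<^sup>+x. g x \<partial>M) (1 - \<alpha>)" (is "?L \<le> epow ?A \<alpha> * epow ?B (1 - \<alpha>)")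
proof (cases "?A = 0 \<or> ?B = 0")
  case True
  then have "AE x in M. epow (f x) \<alpha> * epow (g x) (1 - \<alpha>) = 0"
  proof
    assume "?A = 0"
    then have "AE x in M. f x = 0" by (simp add: nn_integral_0_iff_AE)
    then show ?thesis by eventually_elim auto
  next
    assume "?B = 0"
    then have "AE x in M. g x = 0" by (simp add: nn_integral_0_iff_AE)
    then show ?thesis by eventually_elim auto
  qed
  then have "?L = 0" by (subst nn_integral_0_iff_AE) auto
  then show ?thesis by simp
next
  case False
  show ?thesis
  proof (cases "?A = top \<or> ?B = top")
    case True
    with False \<alpha> have "epow ?A \<alpha> * epow ?B (1 - \<alpha>) = top"
      by (auto simp: ennreal_mult_eq_top_iff)
    then show ?thesis by simp
  next
    case fin: False
    obtain A where A: "?A = ennreal A" "0 < A"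
      using False fin by (cases ?A) (auto simp: less_le)
    obtain B where B: "?B = ennreal B" "0 < B"
      using False fin by (cases ?B) (auto simp: less_le)
    define c where "c = A powr \<alpha> * B powr (1 - \<alpha>)"
    have c: "0 < c" using A B by (simp add: c_def)
    have "epow (f x) \<alpha> * epow (g x) (1 - \<alpha>)
        \<le> ennreal c * (ennreal (\<alpha> / A) * f x + ennreal ((1 - \<alpha>) / B) * g x)" for x
    proof -
      have "f x = ennreal A * (ennreal (1 / A) * f x)" "g x = ennreal B * (ennreal (1 / B) * g x)"
        using A B by (simp_all add: mult.assoc[symmetric] ennreal_mult[symmetric])
      then have "epow (f x) \<alpha> * epow (g x) (1 - \<alpha>)
        = epow (ennreal A * (ennreal (1 / A) * f x)) \<alpha> * epow (ennreal B * (ennreal (1 / B) * g x)) (1 - \<alpha>)" by simp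
      also have "\<dots> = ennreal c * (epow (ennreal (1 / A) * f x) \<alpha> * epow (ennreal (1 / B) * g x) (1 - \<alpha>))"
        unfolding epow_mult[of "ennreal A"] epow_mult[of "ennreal B"]
        using A B by (simp add: epow_ennreal c_def ennreal_mult mult_ac)
      also have "\<dots> \<le> ennreal c * (ennreal \<alpha> * (ennreal (1 / A) * f x) + ennreal (1 - \<alpha>) * (ennreal (1 / B) * g x))"
        by (intro mult_left_mono epow_Youngs \<alpha>) auto
      also have "\<dots> = ennreal c * (ennreal (\<alpha> / A) * f x + ennreal ((1 - \<alpha>) / B) * g x)"
        using A B \<alpha> by (simp add: mult.assoc[symmetric] ennreal_mult[symmetric])
      finally show ?thesis .
    qed
    then have "?L \<le> (\<integral>\<^sup>+x. ennreal c * (ennreal (\<alpha> / A) * f x + ennreal ((1 - \<alpha>) / B) * g x) \<partial>M)"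
      by (intro nn_integral_mono)
    also have "\<dots> = ennreal c * (ennreal (\<alpha> / A) * ?A + ennreal ((1 - \<alpha>) / B) * ?B)"
      by (simp add: nn_integral_cmult nn_integral_add)
    also have "\<dots> = ennreal c"
      using A B \<alpha> by (simp add: ennreal_mult[symmetric] ennreal_plus[symmetric] del: ennreal_plus)
    also have "\<dots> = epow ?A \<alpha> * epow ?B (1 - \<alpha>)"
      using A B by (simp add: epow_ennreal c_def ennreal_mult)
    finally show ?thesis .
  qed
qed

lemma nn_integral_Holder':
  assumes [measurable]: "f \<in> borel_measurable M" "g \<in> borel_measurable M" and q: "1 < q"
  shows "(\<integral>\<^sup>+x. f x * g x \<partial>M)
           \<le> epow (\<integral>\<^sup>+x. epow (f x) q \<partial>M) (1 / q) * epow (\<integral>\<^sup>+x. epow (g x) (q / (q - 1)) \<partial>M) (1 - 1 / q)"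
proof -
  have "q / (q - 1) * (1 - 1 / q) = 1" using q by (simp add: field_simps)
  then show ?thesis
    using nn_integral_Holder[of "\<lambda>x. epow (f x) q" M "\<lambda>x. epow (g x) (q / (q - 1))" "1 / q"] q
    by (simp add: epow_epow)
qed

lemma powr_convex_combination:
  assumes "1 \<le> q" "0 \<le> x" "0 \<le> y" "0 < a" "0 < b" "a + b = 1"
  shows "(a * x + b * y) powr q \<le> a * x powr q + b * y powr (q::real)"
proof -
  have le: "c powr q \<le> c" if "0 < c" "c \<le> 1" for c :: real
    using powr_mono'[of 1 q c] that assms by simp
  consider "x = 0" | "y = 0" | "x > 0" "y > 0" using assms by linarith
  then show ?thesis
  proof cases
    case 1
    then show ?thesis using assms le[of b] by (simp add: powr_mult mult_right_mono)
  next
    case 2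
    then show ?thesis using assms le[of a] by (simp add: powr_mult mult_right_mono)
  next
    case 3
    then show ?thesis
      using convex_onD[OF powr_convex[OF assms(1)], of b x y] assms
      by (simp add: eq_diff_eq[THEN iffD2, OF assms(6)])
  qed
qed

text \<open>\<open>(x + y) / (l + m)\<close> is the convex combination of \<open>x / l\<close> and
  \<open>y / m\<close> with weights \<open>l / (l + m)\<close> and \<open>m / (l + m)\<close>. With
  \<open>l\<close> and \<open>m\<close> near the two norms, integration gives Minkowski's
  inequality.\<close>

lemma epow_convex:
  assumes "1 \<le> q" "0 < l" "0 < m"
  shows "epow (x + y) q \<le> ennreal ((l + m) powr q) *
     (ennreal (l / (l + m)) * (ennreal (1 / l powr q) * epow x q)
      + ennreal (m / (l + m)) * (ennreal (1 / m powr q) * epow y q))"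
proof (cases "x = top \<or> y = top")
  case True
  then show ?thesis using assms by (auto simp: ennreal_mult_top ennreal_top_mult ennreal_mult_eq_top_iff)
next
  case False
  obtain u v where uv: "x = ennreal u" "y = ennreal v" "0 \<le> u" "0 \<le> v"
    using False by (cases x; cases y) auto
  have "u + v = (l + m) * (l / (l + m) * (u / l) + m / (l + m) * (v / m))"
    using assms by (simp add: distrib_left)
  then have "(u + v) powr q = ((l + m) * (l / (l + m) * (u / l) + m / (l + m) * (v / m))) powr q" by simp
  also have "\<dots> = (l + m) powr q * (l / (l + m) * (u / l) + m / (l + m) * (v / m)) powr q"
    using assms uv by (intro powr_mult) 
  also have "\<dots> \<le> (l + m) powr q * (l / (l + m) * (u / l) powr q + m / (l + m) * (v / m) powr q)"
    using assms uv by (intro mult_left_mono powr_convex_combination) (auto simp flip: add_divide_distrib)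
  also have "\<dots> = (l + m) powr q * (l / (l + m) * (1 / l powr q * u powr q) + m / (l + m) * (1 / m powr q * v powr q))"
    using assms uv by (simp add: powr_divide)
  finally show ?thesis
    using uv assms
    by (simp add: epow_ennreal ennreal_plus[symmetric] ennreal_mult[symmetric] ennreal_leI del: ennreal_plus)
qed

section \<open>Minkowski's inequality for countable sums\<close>

definition Lnorm :: "'b measure \<Rightarrow> real \<Rightarrow> ('b \<Rightarrow> ennreal) \<Rightarrow> ennreal" where
  "Lnorm M q f = epow (\<integral>\<^sup>+x. epow (f x) q \<partial>M) (1 / q)"

lemma Lnorm_mono_AE: "0 < q \<Longrightarrow> AE x in M. f x \<le> g x \<Longrightarrow> Lnorm M q f \<le> Lnorm M q g"
  unfolding Lnorm_def
  by (intro epow_mono nn_integral_mono_AE) (auto elim!: eventually_mono intro: epow_mono)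

lemma Lnorm_mono: "0 < q \<Longrightarrow> (\<And>x. f x \<le> g x) \<Longrightarrow> Lnorm M q f \<le> Lnorm M q g"
  by (intro Lnorm_mono_AE) auto

lemma Lnorm_cmult:
  "0 < q \<Longrightarrow> f \<in> borel_measurable M \<Longrightarrow> Lnorm M q (\<lambda>x. c * f x) = c * Lnorm M q f"
  unfolding Lnorm_def
  by (simp add: epow_mult nn_integral_cmult epow_epow)

lemma Lnorm_add:
  assumes [measurable]: "f \<in> borel_measurable M" "g \<in> borel_measurable M" and q: "1 \<le> q"
  shows "Lnorm M q (\<lambda>x. f x + g x) \<le> Lnorm M q f + Lnorm M q g"
proof (cases "Lnorm M q f = top \<or> Lnorm M q g = top")
  case False
  obtain F G where FG: "Lnorm M q f = ennreal F" "Lnorm M q g = ennreal G" "0 \<le> F" "0 \<le> G"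
    using False by (cases "Lnorm M q f"; cases "Lnorm M q g") auto
  have bound: "Lnorm M q (\<lambda>x. f x + g x) \<le> ennreal (F + G + e)" if e: "0 < e" for e
  proof -
    \<comment> \<open>The extra \<open>e / 2\<close> keeps both divisors positive when a norm
      vanishes.\<close>
    define l m where "l = F + e / 2" and "m = G + e / 2"
    have lm: "0 < l" "0 < m" "l + m = F + G + e" using e FG by (auto simp: l_def m_def)
    have f: "(\<integral>\<^sup>+x. epow (f x) q \<partial>M) \<le> ennreal (l powr q)"
    proof -
      have "(\<integral>\<^sup>+x. epow (f x) q \<partial>M) = epow (ennreal F) q"
        using q unfolding FG(1)[symmetric] Lnorm_def by (simp add: epow_epow)
      then show ?thesis using FG q e by (simp add: epow_ennreal l_def powr_mono2 ennreal_leI)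
    qed
    have g: "(\<integral>\<^sup>+x. epow (g x) q \<partial>M) \<le> ennreal (m powr q)"
    proof -
      have "(\<integral>\<^sup>+x. epow (g x) q \<partial>M) = epow (ennreal G) q"
        using q unfolding FG(2)[symmetric] Lnorm_def by (simp add: epow_epow)
      then show ?thesis using FG q e by (simp add: epow_ennreal m_def powr_mono2 ennreal_leI)
    qed
    have "(\<integral>\<^sup>+x. epow (f x + g x) q \<partial>M) \<le> (\<integral>\<^sup>+x. ennreal ((l + m) powr q) *
     (ennreal (l / (l + m)) * (ennreal (1 / l powr q) * epow (f x) q)
      + ennreal (m / (l + m)) * (ennreal (1 / m powr q) * epow (g x) q)) \<partial>M)"
      by (intro nn_integral_mono epow_convex q lm)
    also have "\<dots> = ennreal ((l + m) powr q) *
     (ennreal (l / (l + m)) * (ennreal (1 / l powr q) * (\<integral>\<^sup>+x. epow (f x) q \<partial>M))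
      + ennreal (m / (l + m)) * (ennreal (1 / m powr q) * (\<integral>\<^sup>+x. epow (g x) q \<partial>M)))"
      by (simp add: nn_integral_cmult nn_integral_add)
    also have "\<dots> \<le> ennreal ((l + m) powr q) *
     (ennreal (l / (l + m)) * (ennreal (1 / l powr q) * ennreal (l powr q))
      + ennreal (m / (l + m)) * (ennreal (1 / m powr q) * ennreal (m powr q)))"
      by (intro mult_left_mono add_mono f g) auto
    also have "\<dots> = ennreal ((l + m) powr q)"
      using lm(1,2) by (simp add: ennreal_mult[symmetric] ennreal_plus[symmetric] add_divide_distrib[symmetric] del: ennreal_plus)
    also have "\<dots> = epow (ennreal (l + m)) q" using lm by (simp add: epow_ennreal)
    finally show ?thesis
      using q lm unfolding Lnorm_def by (subst epow_le_iff) auto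
  qed
  have "Lnorm M q (\<lambda>x. f x + g x) \<le> ennreal (F + G)"
  proof (rule ennreal_le_epsilon)
    fix e :: real assume "0 < e"
    then show "Lnorm M q (\<lambda>x. f x + g x) \<le> ennreal (F + G) + ennreal e"
      using bound[of e] FG by (simp add: ennreal_plus[symmetric] del: ennreal_plus)
  qed
  then show ?thesis using FG by simp
qed auto

text \<open>Minkowski for the partial sums and monotone convergence. This countable form makes the
  tent norms countably subadditive, so that infinitely many pieces of a function can be
  added.\<close>

lemma Lnorm_suminf:
  assumes [measurable]: "f \<in> borel_measurable M" "\<And>k. g k \<in> borel_measurable M"
    and q: "1 \<le> q" and le: "\<And>x. f x \<le> (\<Sum>k. g k x)"
  shows "Lnorm M q f \<le> (\<Sum>k. Lnorm M q (g k))"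
proof -
  have fin: "Lnorm M q (\<lambda>x. \<Sum>k<n. g k x) \<le> (\<Sum>k<n. Lnorm M q (g k))" for n
  proof (induction n)
    case 0
    then show ?case using q by (simp add: Lnorm_def)
  next
    case (Suc n)
    have "Lnorm M q (\<lambda>x. (\<Sum>k<n. g k x) + g n x) \<le> Lnorm M q (\<lambda>x. \<Sum>k<n. g k x) + Lnorm M q (g n)"
      by (intro Lnorm_add q) auto
    with Suc show ?case by (auto intro: order_trans add_mono)
  qed
  have "Lnorm M q f \<le> Lnorm M q (\<lambda>x. SUP n. \<Sum>k<n. g k x)"
    using le q by (intro Lnorm_mono) (auto simp: suminf_eq_SUP)
  also have "\<dots> = epow (\<integral>\<^sup>+x. (SUP n. epow (\<Sum>k<n. g k x) q) \<partial>M) (1 / q)"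
    using q unfolding Lnorm_def by (subst epow_SUP) auto
  also have "(\<integral>\<^sup>+x. (SUP n. epow (\<Sum>k<n. g k x) q) \<partial>M) = (SUP n. \<integral>\<^sup>+x. epow (\<Sum>k<n. g k x) q \<partial>M)"
    using q by (intro nn_integral_monotone_convergence_SUP)
      (auto simp: incseq_def le_fun_def intro!: epow_mono sum_mono2)
  also have "epow \<dots> (1 / q) = (SUP n. Lnorm M q (\<lambda>x. \<Sum>k<n. g k x))"
    using q unfolding Lnorm_def by (subst epow_SUP) auto
  also have "\<dots> \<le> (\<Sum>k. Lnorm M q (g k))"
    using fin by (auto simp: suminf_eq_SUP intro!: SUP_mono)
  finally show ?thesis .
qed

lemma nn_integral_powr_lessThan:
  assumes s: "0 < s"
  shows "(\<integral>\<^sup>+l. indicator {l. 0 < l \<and> ennreal l < x} l * ennreal (s * l powr (s - 1)) \<partial>lborel) = epow x s"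
proof -
  have fin: "(\<integral>\<^sup>+l. indicator {l. 0 < l \<and> ennreal l < ennreal c} l * ennreal (s * l powr (s - 1)) \<partial>lborel) = ennreal (c powr s)"
    if c: "0 \<le> c" for c
  proof -
    have "((\<lambda>x. s * x powr (s - 1)) has_integral s * (c powr (s - 1 + 1) / (s - 1 + 1))) {0..c}"
      by (intro has_integral_mult_right has_integral_powr_from_0) (use s c in auto)
    then have "((\<lambda>x. s * x powr (s - 1)) has_integral c powr s) {0..c}" using s by simp
    then have "(\<integral>\<^sup>+l. indicator {0..c} l * ennreal (s * l powr (s - 1)) \<partial>lborel) = ennreal (c powr s)"
      using s nn_integral_has_integral_lebesgue[of "{0..c}" "\<lambda>x. s * x powr (s - 1)" "c powr s"]
      by (simp add: ennreal_mult ennreal_indicator)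
    moreover have "(\<integral>\<^sup>+l. indicator {0..c} l * ennreal (s * l powr (s - 1)) \<partial>lborel)
        = (\<integral>\<^sup>+l. indicator {l. 0 < l \<and> ennreal l < ennreal c} l * ennreal (s * l powr (s - 1)) \<partial>lborel)"
    proof (intro nn_integral_cong_AE)
      have "AE l in lborel. l \<noteq> 0 \<and> l \<noteq> c" by (intro AE_conjI AE_lborel_singleton)
      then show "AE l in lborel. indicator {0..c} l * ennreal (s * l powr (s - 1)) =
        indicator {l. 0 < l \<and> ennreal l < ennreal c} l * ennreal (s * l powr (s - 1))"
        by eventually_elim (auto simp: ennreal_less_iff split: split_indicator)
    qed
    ultimately show ?thesis by simp
  qed
  show ?thesis
  proof (cases x)
    case (real c)
    then show ?thesis using fin by (simp add: epow_ennreal)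
  next
    case top
    \<comment> \<open>For infinite \<open>x\<close> the domain of integration contains the one for
      \<open>c = n powr (1 / s)\<close>, whose integral is \<open>n\<close>.\<close>
    have "ennreal (real n) \<le> (\<integral>\<^sup>+l. indicator {l. 0 < l \<and> ennreal l < x} l * ennreal (s * l powr (s - 1)) \<partial>lborel)" for n
    proof -
      have "ennreal (real n) = ennreal ((real n powr (1 / s)) powr s)" using s by (simp add: powr_powr)
      also have "\<dots> \<le> (\<integral>\<^sup>+l. indicator {l. 0 < l \<and> ennreal l < x} l * ennreal (s * l powr (s - 1)) \<partial>lborel)"
        using top by (subst fin[symmetric]) (auto intro!: nn_integral_mono split: split_indicator)
      finally show ?thesis .
    qed
    then have "(\<integral>\<^sup>+l. indicator {l. 0 < l \<and> ennreal l < x} l * ennreal (s * l powr (s - 1)) \<partial>lborel) = top"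
      by (metis ennreal_of_nat_eq_real_of_nat ennreal_top_neq_of_nat leD less_top ennreal_Ex_less_of_nat)
    then show ?thesis using top by simp
  qed
qed

lemma (in sigma_finite_measure) nn_integral_weighted_layer_cake:
  assumes [measurable]: "g \<in> borel_measurable M" "f \<in> borel_measurable M" and s: "0 < s"
  shows "(\<integral>\<^sup>+x. g x * epow (f x) s \<partial>M) =
     (\<integral>\<^sup>+l. indicator {0<..} l * ennreal (s * l powr (s - 1)) * (\<integral>\<^sup>+x. g x * indicator {x. ennreal l < f x} x \<partial>M) \<partial>lborel)"
proof -
  interpret pair_sigma_finite M lborel ..
  have "(\<integral>\<^sup>+x. g x * epow (f x) s \<partial>M) =
    (\<integral>\<^sup>+x. (\<integral>\<^sup>+l. g x * (indicator {l. 0 < l \<and> ennreal l < f x} l * ennreal (s * l powr (s - 1))) \<partial>lborel) \<partial>M)"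
    by (simp add: nn_integral_cmult nn_integral_powr_lessThan s)
  also have "\<dots> = (\<integral>\<^sup>+l. (\<integral>\<^sup>+x. g x * (indicator {l. 0 < l \<and> ennreal l < f x} l * ennreal (s * l powr (s - 1))) \<partial>M) \<partial>lborel)"
    by (intro Fubini'[symmetric]) measurable
  also have "\<dots> = (\<integral>\<^sup>+l. (\<integral>\<^sup>+x. indicator {0<..} l * ennreal (s * l powr (s - 1)) * (g x * indicator {x. ennreal l < f x} x) \<partial>M) \<partial>lborel)"
    by (intro nn_integral_cong) (auto split: split_indicator simp: mult_ac)
  also have "\<dots> = (\<integral>\<^sup>+l. indicator {0<..} l * ennreal (s * l powr (s - 1)) * (\<integral>\<^sup>+x. g x * indicator {x. ennreal l < f x} x \<partial>M) \<partial>lborel)"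
    by (intro nn_integral_cong nn_integral_cmult) measurable
  finally show ?thesis .
qed

text \<open>The two functions live on different spaces and meet only through the measures of their
  superlevel sets. In the Carleson embedding \<open>g\<close> is a density on the half space and
  \<open>h\<close> a maximal function on the base.\<close>

lemma nn_integral_distribution_comparison:
  assumes "sigma_finite_measure M" "sigma_finite_measure N"
    and [measurable]: "g \<in> borel_measurable M" "f \<in> borel_measurable M" "h \<in> borel_measurable N" and s: "0 < s"
    and le: "\<And>l::real. 0 < l \<Longrightarrow> (\<integral>\<^sup>+x. g x * indicator {x. ennreal l < f x} x \<partial>M)
        \<le> C * (\<integral>\<^sup>+x. indicator {x. ennreal l < h x} x \<partial>N)"
  shows "(\<integral>\<^sup>+x. g x * epow (f x) s \<partial>M) \<le> C * (\<integral>\<^sup>+x. epow (h x) s \<partial>N)"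
proof -
  interpret M: sigma_finite_measure M by fact
  interpret N: sigma_finite_measure N by fact
  have [measurable]: "(\<lambda>l. \<integral>\<^sup>+x. indicator {x. ennreal l < h x} x \<partial>N) \<in> borel_measurable lborel"
    by measurable
  have "(\<integral>\<^sup>+x. g x * epow (f x) s \<partial>M) =
     (\<integral>\<^sup>+l. indicator {0<..} l * ennreal (s * l powr (s - 1)) * (\<integral>\<^sup>+x. g x * indicator {x. ennreal l < f x} x \<partial>M) \<partial>lborel)"
    by (intro M.nn_integral_weighted_layer_cake s) auto
  also have "\<dots> \<le> (\<integral>\<^sup>+l. C * (indicator {0<..} l * ennreal (s * l powr (s - 1)) * (\<integral>\<^sup>+x. 1 * indicator {x. ennreal l < h x} x \<partial>N)) \<partial>lborel)"
    using le by (intro nn_integral_mono) (auto split: split_indicator simp: mult.left_commute[of C] intro!: mult_left_mono)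
  also have "\<dots> = C * (\<integral>\<^sup>+l. indicator {0<..} l * ennreal (s * l powr (s - 1)) * (\<integral>\<^sup>+x. 1 * indicator {x. ennreal l < h x} x \<partial>N) \<partial>lborel)"
    by (intro nn_integral_cmult) measurable
  also have "\<dots> = C * (\<integral>\<^sup>+x. 1 * epow (h x) s \<partial>N)"
    by (subst N.nn_integral_weighted_layer_cake[of "\<lambda>_. 1" h]) (use s in auto)
  finally show ?thesis by simp
qed

section \<open>Doubling spaces\<close>

locale tent_space_setting =
  fixes M :: "'a::metric_space measure"
  assumes sets_M: "sets M = sets borel"
    and nondeg: "nondegenerate M"
    and dbl: "doubling M"
begin

lemma space_M [simp]: "space M = UNIV"
  using sets_eq_imp_space_eq[OF sets_M] by simp

lemma open_sets_M [measurable]: "open U \<Longrightarrow> U \<in> sets M"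
  by (simp add: sets_M)

lemma borel_measurable_M: "f \<in> borel_measurable borel \<Longrightarrow> f \<in> borel_measurable M"
  using measurable_cong_sets[OF sets_M refl] by auto

abbreviation V :: "'a \<times> real \<Rightarrow> real" where
  "V z \<equiv> Vol M (fst z) (snd z)"

lemma emeasure_ball: "emeasure M (ball x r) = ennreal (Vol M x r)"
proof (cases "r > 0")
  case True
  then show ?thesis using nondeg unfolding nondegenerate_def Vol_def
    by (metis emeasure_eq_ennreal_measure infinity_ennreal_def order_less_irrefl)
next
  case False
  then have "ball x r = {}" by simp
  then show ?thesis unfolding Vol_def by (simp only: emeasure_empty measure_empty ennreal_0)
qed

lemma Vol_pos: "0 < r \<Longrightarrow> 0 < Vol M x r"
  using nondeg emeasure_ball[of x r] unfolding nondegenerate_def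
  by (metis ennreal_less_zero_iff)

lemma Vol_nonneg [simp]: "0 \<le> Vol M x r"
  by (simp add: Vol_def)

lemma Vol_mono: "ball x r \<subseteq> ball y s \<Longrightarrow> Vol M x r \<le> Vol M y s"
  using emeasure_mono[of "ball x r" "ball y s" M] by (simp add: emeasure_ball)

text \<open>The doubling constant is fixed once, for real volumes and at least 1, so that its powers
  are at least 1 as well.\<close>

definition D :: real where
  "D = (SOME D. 1 \<le> D \<and> (\<forall>x r. 0 < r \<longrightarrow> Vol M x (2 * r) \<le> D * Vol M x r))"

lemma D: "1 \<le> D" "0 < r \<Longrightarrow> Vol M x (2 * r) \<le> D * Vol M x r"
proof -
  obtain C where C: "0 < r \<Longrightarrow> emeasure M (ball x (2 * r)) \<le> ennreal C * emeasure M (ball x r)" for x r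
    using dbl unfolding doubling_def by auto
  have "Vol M x (2 * r) \<le> max 1 C * Vol M x r" if r: "0 < r" for x r
  proof -
    have "ennreal (Vol M x (2 * r)) \<le> ennreal (max 1 C) * ennreal (Vol M x r)"
      using order_trans[OF C[OF r, of x] mult_right_mono[OF ennreal_leI[of C "max 1 C"]]]
      by (simp add: emeasure_ball)
    also have "\<dots> = ennreal (max 1 C * Vol M x r)" by (simp add: ennreal_mult)
    finally show ?thesis by (simp add: ennreal_le_iff mult_nonneg_nonneg)
  qed
  then have "\<exists>D. 1 \<le> D \<and> (\<forall>x r. 0 < r \<longrightarrow> Vol M x (2 * r) \<le> D * Vol M x r)"
    by (intro exI[of _ "max 1 C"]) auto
  from someI_ex[OF this] show "1 \<le> D" "0 < r \<Longrightarrow> Vol M x (2 * r) \<le> D * Vol M x r"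
    unfolding D_def by auto
qed

lemma Vol_doubling_power: "0 < r \<Longrightarrow> Vol M x (2 ^ m * r) \<le> D ^ m * Vol M x r"
proof (induction m)
  case (Suc m)
  have "Vol M x (2 * (2 ^ m * r)) \<le> D * Vol M x (2 ^ m * r)" using Suc by (intro D) auto
  also have "\<dots> \<le> D * (D ^ m * Vol M x r)" using Suc D(1) by (intro mult_left_mono) auto
  finally show ?case by (simp add: mult_ac)
qed simp

text \<open>Three doublings reach the radius \<open>8 * r\<close>. Every \<open>D ^ 3\<close> below
  comes from here, because Vitali balls are enlarged five times.\<close>

lemma Vol_5: "0 < r \<Longrightarrow> Vol M x (5 * r) \<le> D ^ 3 * Vol M x r"
  using Vol_doubling_power[of r x 3] Vol_mono[of x "5 * r" x "8 * r"] subset_ball[of "5 * r" "8 * r" x]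
  by (auto intro: order_trans)

section \<open>Sigma-finiteness, separability and covering by balls\<close>

lemma sigma_finite_M: "sigma_finite_measure M"
proof
  define A where "A = range (\<lambda>n::nat. ball (undefined :: 'a) (real n))"
  have "\<Union> A = space M"
    using reals_Archimedean2 by (auto simp: A_def)
  then show "\<exists>A. countable A \<and> A \<subseteq> sets M \<and> \<Union> A = space M \<and> (\<forall>a\<in>A. emeasure M a \<noteq> \<infinity>)"
    by (intro exI[of _ A]) (auto simp: A_def emeasure_ball)
qed

sublocale sigma_finite_measure M
  by (rule sigma_finite_M)

text \<open>By doubling, each ball of radius \<open>e / 2\<close> centred in \<open>E\<close> has at
  least the fixed volume \<open>c\<close>. These balls are disjoint and lie in
  \<open>ball x0 (R + e)\<close>, so the volume of the latter limits their number.\<close>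

lemma separated_card_bound:
  fixes x0 :: 'a
  assumes R: "0 < R" and e: "0 < e"
  shows "\<exists>N. \<forall>E. finite E \<and> E \<subseteq> ball x0 R \<and> (\<forall>x\<in>E. \<forall>y\<in>E. x \<noteq> y \<longrightarrow> e \<le> dist x y) \<longrightarrow> card E \<le> N"
proof -
  obtain m where m: "4 * R / e < 2 ^ m" using real_arch_pow[of 2] by auto
  define c where "c = Vol M x0 R / D ^ m"
  have c: "0 < c" using Vol_pos[OF R] D by (auto simp: c_def)
  have "card E \<le> nat \<lceil>Vol M x0 (R + e) / c\<rceil>"
    if E: "finite E" "E \<subseteq> ball x0 R" "\<And>x y. x \<in> E \<Longrightarrow> y \<in> E \<Longrightarrow> x \<noteq> y \<Longrightarrow> e \<le> dist x y" for E
  proof -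
    have vol: "c \<le> Vol M y (e / 2)" if "y \<in> E" for y
    proof -
      have "ball x0 R \<subseteq> ball y (2 ^ m * (e / 2))"
      proof
        fix z assume z: "z \<in> ball x0 R"
        have "dist y z \<le> dist x0 y + dist x0 z" by (metis dist_commute dist_triangle)
        also have "\<dots> < 2 * R" using z E that by auto
        also have "\<dots> < 2 ^ m * (e / 2)" using m e by (simp add: field_simps)
        finally show "z \<in> ball y (2 ^ m * (e / 2))" by simp
      qed
      then have "Vol M x0 R \<le> Vol M y (2 ^ m * (e / 2))" by (rule Vol_mono)
      also have "\<dots> \<le> D ^ m * Vol M y (e / 2)" using e by (intro Vol_doubling_power) auto
      finally show ?thesis using D by (simp add: c_def divide_simps mult.commute)
    qed
    have disj: "disjoint_family_on (\<lambda>y. ball y (e / 2)) E"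
      unfolding disjoint_family_on_def
    proof (intro ballI impI)
      fix x y assume "x \<in> E" "y \<in> E" "x \<noteq> y"
      then have "e \<le> dist x y" using E by blast
      then show "ball x (e / 2) \<inter> ball y (e / 2) = {}"
        by (auto simp: dist_commute) (smt (verit) dist_commute dist_triangle field_sum_of_halves)
    qed
    have "ennreal (card E * c) = (\<Sum>y\<in>E. ennreal c)" using c by (simp add: ennreal_mult ennreal_of_nat_eq_real_of_nat)
    also have "\<dots> \<le> (\<Sum>y\<in>E. emeasure M (ball y (e / 2)))"
      using vol by (intro sum_mono) (simp add: emeasure_ball ennreal_leI)
    also have "\<dots> = emeasure M (\<Union>y\<in>E. ball y (e / 2))"
      using disj E by (intro sum_emeasure) auto
    also have "\<dots> \<le> emeasure M (ball x0 (R + e))"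
    proof (intro emeasure_mono)
      have "dist x0 z < R + e" if "dist x0 y < R" "dist y z < e / 2" for y z
        using that e dist_triangle[of x0 z y] by linarith
      then show "(\<Union>y\<in>E. ball y (e / 2)) \<subseteq> ball x0 (R + e)"
        using E by (auto simp: subset_iff)
    qed simp
    finally have "card E * c \<le> Vol M x0 (R + e)" by (simp add: emeasure_ball)
    then have "real (card E) \<le> Vol M x0 (R + e) / c" using c by (simp add: field_simps)
    then show ?thesis by linarith
  qed
  then show ?thesis by (intro exI[of _ "nat \<lceil>Vol M x0 (R + e) / c\<rceil>"] allI impI) (elim conjE, metis)
qed

text \<open>A separated set of maximal cardinality is a net, since a point far from all its members
  could be added.\<close>

lemma finite_net:
  fixes x0 :: 'a
  assumes R: "0 < R" and e: "0 < e"
  shows "\<exists>E. finite E \<and> (\<forall>y\<in>ball x0 R. \<exists>x\<in>E. dist x y < e)"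
proof -
  define P where "P E \<longleftrightarrow> finite E \<and> E \<subseteq> ball x0 R \<and> (\<forall>x\<in>E. \<forall>y\<in>E. x \<noteq> y \<longrightarrow> e \<le> dist x y)" for E
  obtain N where N: "\<forall>E. P E \<longrightarrow> card E < Suc N"
    using separated_card_bound[OF assms, of x0] unfolding P_def less_Suc_eq_le ..
  have "P {}" by (simp add: P_def)
  then have "\<exists>E. P E \<and> (\<forall>F. P F \<longrightarrow> card F \<le> card E)"
    by (rule ex_has_greatest_nat) (rule N)
  then obtain E where E: "P E" "\<And>F. P F \<Longrightarrow> card F \<le> card E" by blast
  have "\<exists>x\<in>E. dist x y < e" if y: "y \<in> ball x0 R" for y
  proof (rule ccontr)
    assume "\<not> ?thesis"
    then have far: "\<And>x. x \<in> E \<Longrightarrow> e \<le> dist x y" by force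
    then have "P (insert y E)" using E(1) y unfolding P_def by (simp add: dist_commute[of y])
    moreover have "y \<notin> E" using far[of y] e by auto
    ultimately show False using E(2)[of "insert y E"] E(1) by (simp add: P_def)
  qed
  then show ?thesis using E(1) unfolding P_def by (intro exI[of _ E] conjI ballI) simp_all
qed

text \<open>Separability is a consequence of doubling: finite nets of all scales in growing balls
  are collected. It yields measurability in the product space and countable families of balls. As
  elsewhere, \<open>undefined\<close> is the base point.\<close>

lemma ex_countable_dense: "\<exists>Q::'a set. countable Q \<and> (\<forall>x. \<forall>e>0. \<exists>q\<in>Q. dist x q < e)"
proof -
  have "\<forall>n k. \<exists>E. finite E \<and> (\<forall>y\<in>ball (undefined :: 'a) (real (Suc n)). \<exists>x\<in>E. dist x y < 1 / real (Suc k))"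
    by (intro allI finite_net) auto
  then obtain E where E: "\<And>n k. finite (E n k)"
    "\<And>n k y. y \<in> ball (undefined :: 'a) (real (Suc n)) \<Longrightarrow> \<exists>x\<in>E n k. dist x y < 1 / real (Suc k)"
    by metis
  have "\<exists>q\<in>(\<Union>n k. E n k). dist x q < e" if "0 < e" for x e
  proof -
    obtain n where n: "dist undefined x < real (Suc n)"
      by (metis Suc_n_not_le_n le_less_linear less_trans of_nat_less_iff reals_Archimedean2)
    obtain k where k: "1 / real (Suc k) < e" using nat_approx_posE[OF \<open>0 < e\<close>] by blast
    obtain q where "q \<in> E n k" "dist q x < 1 / real (Suc k)" using E(2)[of x n k] n by auto
    then show ?thesis using k by (intro bexI[of _ q]) (auto simp: dist_commute)
  qed
  moreover have "countable (\<Union>n k. E n k)" using E(1) by (simp add: countable_finite)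
  ultimately show ?thesis by blast
qed

text \<open>The inner ball serves for covering open sets and for disjointness; its triple serves for
  tents, since a tent over the triple contains the given point of the half space.\<close>

definition ball_base :: "('a \<times> real) set \<Rightarrow> bool" where
  "ball_base B \<longleftrightarrow> countable B \<and> (\<forall>b\<in>B. 0 < snd b) \<and>
     (\<forall>y t. 0 < t \<longrightarrow> (\<exists>b\<in>B. y \<in> ball (fst b) (snd b) \<and> ball (fst b) (snd b) \<subseteq> ball y t \<and> ball y t \<subseteq> ball (fst b) (3 * snd b)))"

lemma ball_baseD:
  assumes "ball_base B"
  shows "countable B" "b \<in> B \<Longrightarrow> 0 < snd b"
    "0 < t \<Longrightarrow> \<exists>b\<in>B. y \<in> ball (fst b) (snd b) \<and> ball (fst b) (snd b) \<subseteq> ball y t \<and> ball y t \<subseteq> ball (fst b) (3 * snd b)"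
  using assms unfolding ball_base_def by simp_all

lemma ex_ball_base: "\<exists>B. ball_base B"
proof -
  obtain Q :: "'a set" where Q: "countable Q" "\<And>x e. 0 < e \<Longrightarrow> \<exists>q\<in>Q. dist x q < e"
    using ex_countable_dense by blast
  let ?B = "Q \<times> ({0<..} \<inter> \<rat>)"
  have "\<exists>b\<in>?B. y \<in> ball (fst b) (snd b) \<and> ball (fst b) (snd b) \<subseteq> ball y t \<and> ball y t \<subseteq> ball (fst b) (3 * snd b)"
    if t: "0 < t" for y t
  proof -
    \<comment> \<open>A centre within \<open>t / 4\<close> and a radius
      \<open>t / 2 < r < 3 * t / 4\<close> give \<open>t / 4 + r < t\<close> for the inner inclusion
      and \<open>t / 4 + t < 3 * r\<close> for the outer one.\<close>
    obtain q where q: "q \<in> Q" "dist y q < t / 4" using Q(2)[of "t / 4"] t by auto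
    obtain r where r: "r \<in> \<rat>" "t / 2 < r" "r < 3 * t / 4" using Rats_dense_in_real[of "t / 2" "3 * t / 4"] t by auto
    have "dist y z < t" if "dist q z < r" for z using dist_triangle[of y z q] that q r by linarith
    moreover have "dist q z < 3 * r" if "dist y z < t" for z
      using dist_triangle[of q z y] that q r t by (simp add: dist_commute)
    ultimately show ?thesis
      using q r t by (intro bexI[of _ "(q, r)"]) (auto simp: dist_commute)
  qed
  moreover have "countable ?B" using Q by (intro countable_SIGMA) (auto intro: countable_subset[OF _ countable_rat])
  ultimately show ?thesis unfolding ball_base_def by (intro exI[of _ ?B]) auto
qed

text \<open>Greedy selection by largest radius. A ball meeting the selected one has no larger
  radius, so its triple stays within \<open>1 + 1 + 3\<close> radii of the selected centre. Tripled
  balls are treated because \<open>ball_base\<close> approximates from outside only after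
  tripling.\<close>

lemma Vitali_finite:
  fixes I :: "('a \<times> real) set"
  assumes "finite I" "\<forall>i\<in>I. 0 < snd i"
  shows "\<exists>J\<subseteq>I. disjoint_family_on (\<lambda>j. ball (fst j) (snd j)) J \<and>
     (\<forall>i\<in>I. \<exists>j\<in>J. ball (fst i) (3 * snd i) \<subseteq> ball (fst j) (5 * snd j))"
  using assms
proof (induction "card I" arbitrary: I rule: less_induct)
  case less
  show ?case
  proof (cases "I = {}")
    case False
    obtain m where m: "m \<in> I" "\<And>i. i \<in> I \<Longrightarrow> snd i \<le> snd m"
    proof -
      have "Max (snd ` I) \<in> snd ` I" using False less.prems(1) by (intro Max_in) auto
      then obtain m where "m \<in> I" "snd m = Max (snd ` I)" by auto
      then show ?thesis using that less.prems(1) by simp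
    qed
    define I' where "I' = {i \<in> I. ball (fst i) (snd i) \<inter> ball (fst m) (snd m) = {}}"
    have "fst m \<in> ball (fst m) (snd m)" using less.prems(2) m(1) by simp
    then have "m \<notin> I'" by (auto simp: I'_def)
    then have "I' \<subset> I" using m(1) unfolding I'_def by blast
    then have "card I' < card I" using less.prems(1) by (rule psubset_card_mono[rotated])
    then obtain J where J: "J \<subseteq> I'" "disjoint_family_on (\<lambda>j. ball (fst j) (snd j)) J"
      "\<And>i. i \<in> I' \<Longrightarrow> \<exists>j\<in>J. ball (fst i) (3 * snd i) \<subseteq> ball (fst j) (5 * snd j)"
      using less.hyps[of I'] less.prems by (auto simp: I'_def)
    have "disjoint_family_on (\<lambda>j. ball (fst j) (snd j)) (insert m J)"
      using J(1,2) unfolding disjoint_family_on_def I'_def by (auto simp: Int_commute)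
    moreover have "\<exists>j\<in>insert m J. ball (fst i) (3 * snd i) \<subseteq> ball (fst j) (5 * snd j)" if i: "i \<in> I" for i
    proof (cases "i \<in> I'")
      case False
      then obtain z where z: "dist (fst i) z < snd i" "dist (fst m) z < snd m" using i by (auto simp: I'_def)
      have "dist (fst m) y < 5 * snd m" if "dist (fst i) y < 3 * snd i" for y
        using that z m(2)[OF i] dist_triangle[of "fst m" y z] dist_triangle[of z y "fst i"]
        by (simp add: dist_commute)
      then show ?thesis by (auto simp: subset_iff)
    qed (use J(3) in auto)
    ultimately show ?thesis using J(1) m(1) \<open>I' \<subset> I\<close> by (intro exI[of _ "insert m J"]) auto
  qed (simp add: disjoint_family_on_def)
qed

section \<open>The upper half space over a doubling space\<close>

lemma sigma_finite_dt_over_t: "sigma_finite_measure dt_over_t"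
proof -
  have "sigma_finite_measure (restrict_space lborel {0::real<..})"
    by (intro sigma_finite_measure_restrict_space sigma_finite_lborel) auto
  then interpret s: sigma_finite_measure "restrict_space lborel {0::real<..}" .
  show ?thesis unfolding dt_over_t_def
    by (subst s.sigma_finite_iff_density_finite) (auto intro!: measurable_restrict_space1)
qed

lemma sigma_finite_Xplus: "sigma_finite_measure (Xplus M)"
proof -
  interpret pair_sigma_finite M dt_over_t
    by (intro pair_sigma_finite.intro sigma_finite_M sigma_finite_dt_over_t)
  show ?thesis unfolding Xplus_def ..
qed

lemma space_Xplus: "space (Xplus M) = UNIV \<times> {0<..}"
  by (auto simp: Xplus_def space_pair_measure dt_over_t_def space_restrict_space)

lemma space_XplusD: "z \<in> space (Xplus M) \<Longrightarrow> 0 < snd z"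
  by (auto simp: space_Xplus)

lemma measurable_fst_Xplus [measurable]: "fst \<in> Xplus M \<rightarrow>\<^sub>M M"
  by (simp add: Xplus_def)

lemma measurable_snd_Xplus [measurable]: "snd \<in> borel_measurable (Xplus M)"
proof -
  have "snd \<in> Xplus M \<rightarrow>\<^sub>M dt_over_t" by (simp add: Xplus_def)
  moreover have "(\<lambda>x::real. x) \<in> borel_measurable dt_over_t"
    by (simp add: dt_over_t_def measurable_restrict_space1)
  ultimately show ?thesis using measurable_compose by blast
qed

lemma measurable_dist_left [measurable]: "(\<lambda>y. dist (x::'a) y) \<in> borel_measurable M"
  by (intro borel_measurable_M borel_measurable_continuous_onI continuous_intros)

text \<open>Openness alone does not place a set in a product sigma-algebra. Passing through a point
  \<open>q\<close> of a countable dense set and a rational radius \<open>r\<close> separates the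
  conditions on \<open>x\<close> and on \<open>(y, t)\<close>, which leaves a countable union of
  products.\<close>

lemma measurable_incidence:
  "{p \<in> space (M \<Otimes>\<^sub>M Xplus M). dist (fst p) (fst (snd p)) < snd (snd p)} \<in> sets (M \<Otimes>\<^sub>M Xplus M)"
proof -
  obtain Q :: "'a set" where Q: "countable Q" "\<And>x e. 0 < e \<Longrightarrow> \<exists>q\<in>Q. dist x q < e"
    using ex_countable_dense by blast
  have *: "dist x y < t \<longleftrightarrow> (\<exists>q\<in>Q. \<exists>r\<in>\<rat>. dist q x < r \<and> dist q y + r < t)" for x y t
  proof
    assume xy: "dist x y < t"
    obtain q where q: "q \<in> Q" "dist x q < (t - dist x y) / 4" using Q(2)[of "(t - dist x y) / 4"] xy by auto
    obtain r where r: "r \<in> \<rat>" "(t - dist x y) / 4 < r" "r < (t - dist x y) / 2"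
      using Rats_dense_in_real[of "(t - dist x y) / 4" "(t - dist x y) / 2"] xy by auto
    have "dist q y + r < t" using dist_triangle[of q y x] q r by (simp add: dist_commute field_simps)
    moreover have "dist q x < r" using q r by (simp add: dist_commute)
    ultimately show "\<exists>q\<in>Q. \<exists>r\<in>\<rat>. dist q x < r \<and> dist q y + r < t" using q r by blast
  next
    assume "\<exists>q\<in>Q. \<exists>r\<in>\<rat>. dist q x < r \<and> dist q y + r < t"
    then obtain q r where "dist q x < r" "dist q y + r < t" by blast
    then show "dist x y < t" using dist_triangle[of x y q] by (simp add: dist_commute)
  qed
  have "{p \<in> space (M \<Otimes>\<^sub>M Xplus M). dist (fst p) (fst (snd p)) < snd (snd p)}
    = (\<Union>q\<in>Q. \<Union>r\<in>\<rat>. {p \<in> space (M \<Otimes>\<^sub>M Xplus M). dist q (fst p) < r \<and> dist q (fst (snd p)) + r < snd (snd p)})" (is "_ = ?R")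
  proof (rule set_eqI)
    fix p
    show "p \<in> {p \<in> space (M \<Otimes>\<^sub>M Xplus M). dist (fst p) (fst (snd p)) < snd (snd p)} \<longleftrightarrow> p \<in> ?R"
      using *[of "fst p" "fst (snd p)" "snd (snd p)"] by blast
  qed
  also have "\<dots> \<in> sets (M \<Otimes>\<^sub>M Xplus M)"
    by (intro sets.countable_UN'' Q countable_rat) measurable
  finally show ?thesis .
qed

lemma pred_incidence [measurable]:
  assumes [measurable]: "f \<in> N \<rightarrow>\<^sub>M M" "g \<in> N \<rightarrow>\<^sub>M Xplus M"
  shows "Measurable.pred N (\<lambda>x. dist (f x) (fst (g x)) < snd (g x))"
proof -
  have "(\<lambda>x. (f x, g x)) -` {p \<in> space (M \<Otimes>\<^sub>M Xplus M). dist (fst p) (fst (snd p)) < snd (snd p)} \<inter> space N \<in> sets N"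
    by (intro measurable_sets[OF _ measurable_incidence]) measurable
  also have "(\<lambda>x. (f x, g x)) -` {p \<in> space (M \<Otimes>\<^sub>M Xplus M). dist (fst p) (fst (snd p)) < snd (snd p)} \<inter> space N
     = {x \<in> space N. dist (f x) (fst (g x)) < snd (g x)}"
    using measurable_space[OF assms(2)] by (auto simp: space_pair_measure)
  finally show ?thesis by (simp add: pred_def)
qed

lemma ball_indicator: "indicator (ball y t) x = (if dist x y < t then 1 else 0 :: ennreal)"
  by (auto simp: dist_commute split: split_indicator)

lemma cone_indicator: "0 < snd z \<Longrightarrow> indicator (cone x) z = (if dist x (fst z) < snd z then 1 else 0 :: ennreal)"
  by (cases z) (auto simp: cone_def split: split_indicator)

lemma in_coneD: "z \<in> cone x \<Longrightarrow> 0 < snd z \<and> dist x (fst z) < snd z"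
  by (auto simp: cone_def)

lemma measurable_ball_integral [measurable]:
  assumes [measurable]: "h \<in> borel_measurable M"
  shows "(\<lambda>z. \<integral>\<^sup>+x. indicator (ball (fst z) (snd z)) x * h x \<partial>M) \<in> borel_measurable (Xplus M)"
  unfolding ball_indicator by measurable

lemma measurable_V [measurable]: "V \<in> borel_measurable (Xplus M)"
proof -
  have "V z = enn2real (\<integral>\<^sup>+x. indicator (ball (fst z) (snd z)) x * 1 \<partial>M)" for z
    by (simp add: Vol_def measure_def)
  then show ?thesis by (simp only:) measurable
qed

section \<open>Averages over balls and integrals over cones\<close>

definition avg :: "('a \<Rightarrow> ennreal) \<Rightarrow> 'a \<times> real \<Rightarrow> ennreal" where
  "avg h z = ennreal (1 / V z) * (\<integral>\<^sup>+x. indicator (ball (fst z) (snd z)) x * h x \<partial>M)"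

definition cone_int :: "('a \<times> real \<Rightarrow> ennreal) \<Rightarrow> 'a \<Rightarrow> ennreal" where
  "cone_int G x = (\<integral>\<^sup>+z. indicator (cone x) z * (ennreal (1 / V z) * G z) \<partial>Xplus M)"

lemma measurable_avg [measurable]: "h \<in> borel_measurable M \<Longrightarrow> avg h \<in> borel_measurable (Xplus M)"
  unfolding avg_def[abs_def] by measurable

lemma cone_int_eq:
  "cone_int G x = (\<integral>\<^sup>+z. (if dist x (fst z) < snd z then ennreal (1 / V z) * G z else 0) \<partial>Xplus M)"
  unfolding cone_int_def by (intro nn_integral_cong) (simp add: cone_indicator space_XplusD)

lemma measurable_cone_int [measurable]:
  assumes [measurable]: "G \<in> borel_measurable (Xplus M)"
  shows "cone_int G \<in> borel_measurable M"
proof -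
  interpret X: sigma_finite_measure "Xplus M" by (rule sigma_finite_Xplus)
  show ?thesis unfolding cone_int_eq[abs_def] by measurable
qed

lemma cone_int_swap:
  assumes [measurable]: "G \<in> borel_measurable (Xplus M)" "h \<in> borel_measurable M"
  shows "(\<integral>\<^sup>+x. h x * cone_int G x \<partial>M) = (\<integral>\<^sup>+z. G z * avg h z \<partial>Xplus M)"
proof -
  interpret X: sigma_finite_measure "Xplus M" by (rule sigma_finite_Xplus)
  interpret pair_sigma_finite M "Xplus M" ..
  have "(\<integral>\<^sup>+x. h x * cone_int G x \<partial>M) =
    (\<integral>\<^sup>+x. \<integral>\<^sup>+z. h x * (if dist x (fst z) < snd z then ennreal (1 / V z) * G z else 0) \<partial>Xplus M \<partial>M)"
    unfolding cone_int_eq by (intro nn_integral_cong nn_integral_cmult[symmetric]) measurable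
  also have "\<dots> = (\<integral>\<^sup>+z. \<integral>\<^sup>+x. h x * (if dist x (fst z) < snd z then ennreal (1 / V z) * G z else 0) \<partial>M \<partial>Xplus M)"
    by (intro Fubini'[symmetric]) measurable
  also have "\<dots> = (\<integral>\<^sup>+z. \<integral>\<^sup>+x. (G z * ennreal (1 / V z)) * (indicator (ball (fst z) (snd z)) x * h x) \<partial>M \<partial>Xplus M)"
    by (intro nn_integral_cong) (auto simp: ball_indicator mult_ac)
  also have "\<dots> = (\<integral>\<^sup>+z. G z * avg h z \<partial>Xplus M)"
    by (intro nn_integral_cong) (subst nn_integral_cmult, auto simp: avg_def mult.assoc sets_M intro!: borel_measurable_times)
  finally show ?thesis .
qed

lemma avg_mono_AE: "AE x in M. x \<in> ball (fst z) (snd z) \<longrightarrow> h x \<le> k x \<Longrightarrow> avg h z \<le> avg k z"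
  unfolding avg_def
  by (intro mult_left_mono nn_integral_mono_AE) (auto split: split_indicator elim!: eventually_mono)

lemma avg_mono: "(\<And>x. x \<in> ball (fst z) (snd z) \<Longrightarrow> h x \<le> k x) \<Longrightarrow> avg h z \<le> avg k z"
  by (intro avg_mono_AE AE_I2) blast

lemma avg_const: "0 < snd z \<Longrightarrow> avg (\<lambda>x. c) z = c"
proof -
  assume z: "0 < snd z"
  have "avg (\<lambda>x. c) z = ennreal (1 / V z) * (ennreal (V z) * c)"
    by (simp add: avg_def nn_integral_multc emeasure_ball)
  also have "\<dots> = c" using Vol_pos[OF z, of "fst z"] by (simp add: mult.assoc[symmetric] ennreal_mult[symmetric])
  finally show ?thesis .
qed

lemma avg_cmult: "h \<in> borel_measurable M \<Longrightarrow> avg (\<lambda>x. c * h x) z = c * avg h z"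
  unfolding avg_def by (simp add: mult.left_commute[of _ c] nn_integral_cmult)

lemma avg_add: "h \<in> borel_measurable M \<Longrightarrow> k \<in> borel_measurable M \<Longrightarrow> avg (\<lambda>x. h x + k x) z = avg h z + avg k z"
  unfolding avg_def by (simp add: distrib_left nn_integral_add)

lemma cone_int_mono: "(\<And>z. z \<in> cone x \<Longrightarrow> G z \<le> H z) \<Longrightarrow> cone_int G x \<le> cone_int H x"
  unfolding cone_int_def by (intro nn_integral_mono) (auto split: split_indicator intro!: mult_left_mono)

lemma in_tent_iff: "z \<in> tent U \<longleftrightarrow> 0 < snd z \<and> ball (fst z) (snd z) \<subseteq> U"
  by (cases z) (auto simp: tent_def)

text \<open>Membership compares \<open>t\<close> with the distance from the centre to the
  complement, a continuous function. An empty complement is separate because \<open>infdist\<close>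
  to the empty set is 0.\<close>

lemma measurable_tent [measurable]: "tent U \<inter> space (Xplus M) \<in> sets (Xplus M)"
proof (cases "-U = {}")
  case True
  then have "tent U \<inter> space (Xplus M) = space (Xplus M)" by (auto simp: tent_def space_Xplus)
  then show ?thesis by simp
next
  case False
  have "ball y t \<subseteq> U \<longleftrightarrow> t \<le> infdist y (-U)" for y t
    using False by (auto simp: infdist_def subset_iff le_cINF_iff not_le[symmetric])
  then have "tent U \<inter> space (Xplus M) = {z \<in> space (Xplus M). snd z \<le> infdist (fst z) (-U)}"
    by (auto simp: tent_def space_Xplus)
  moreover have [measurable]: "(\<lambda>y. infdist y (-U)) \<in> borel_measurable M"
    by (intro borel_measurable_M borel_measurable_continuous_onI continuous_intros)
  ultimately show ?thesis by simp
qed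

lemma measurable_tent_indicator [measurable]: "(\<lambda>z. indicator (tent U) z :: ennreal) \<in> borel_measurable (Xplus M)"
  using measurable_tent[of U] by (simp add: borel_measurable_indicator_iff)

end

lemma emeasure_UN_le:
  fixes A :: "nat \<Rightarrow> 'b set"
  assumes A: "\<And>i. A i \<in> sets N" and le: "\<And>n. emeasure N (\<Union>i<n. A i) \<le> c"
  shows "emeasure N (\<Union>i. A i) \<le> c"
proof -
  have "incseq (\<lambda>n. \<Union>i<n. A i)" by (intro incseq_SucI) (auto simp: less_Suc_eq)
  then have "(SUP n. emeasure N (\<Union>i<n. A i)) = emeasure N (\<Union>n. \<Union>i<n. A i)"
    using A by (intro SUP_emeasure_incseq) auto
  also have "(\<Union>n. \<Union>i<n. A i) = (\<Union>i. A i)" by auto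
  finally show ?thesis using le by (metis SUP_least)
qed

lemma sum_indicator_disjoint_le:
  assumes "finite J" "disjoint_family_on A J"
  shows "(\<Sum>j\<in>J. indicator (A j) x) \<le> (1::ennreal)"
  using assms by (simp add: indicator_UN_disjoint[symmetric] split: split_indicator)

context tent_space_setting
begin

section \<open>The maximal function\<close>

definition Mx :: "('a \<Rightarrow> ennreal) \<Rightarrow> 'a \<Rightarrow> ennreal" where
  "Mx h x = (SUP z\<in>{z. dist x (fst z) < snd z}. avg h z)"

lemma avg_le_Mx: "dist x (fst z) < snd z \<Longrightarrow> avg h z \<le> Mx h x"
  unfolding Mx_def by (intro SUP_upper) auto

lemma Mx_superlevel: "{x. l < Mx h x} = (\<Union>z\<in>{z. l < avg h z}. ball (fst z) (snd z))"
  by (simp add: set_eq_iff Mx_def less_SUP_iff dist_commute) metis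

lemma open_Mx_superlevel: "open {x. l < Mx h x}"
  unfolding Mx_superlevel by auto

lemma sets_Mx_superlevel [simp]: "{x. l < Mx h x} \<in> sets M"
  by (intro open_sets_M open_Mx_superlevel)

lemma measurable_Mx [measurable]: "Mx h \<in> borel_measurable M"
  by (rule borel_measurableI_greater) (simp add: open_sets_M open_Mx_superlevel)

lemma disjoint_balls_sum:
  assumes J: "finite J" "disjoint_family_on (\<lambda>j. ball (fst j) (snd j)) J" "\<And>j. j \<in> J \<Longrightarrow> ball (fst j) (snd j) \<subseteq> U"
    and [measurable]: "h \<in> borel_measurable M" "U \<in> sets M"
  shows "(\<Sum>j\<in>J. \<integral>\<^sup>+x. indicator (ball (fst j) (snd j)) x * h x \<partial>M) \<le> (\<integral>\<^sup>+x. indicator U x * h x \<partial>M)"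
proof -
  have "(\<Sum>j\<in>J. indicator (ball (fst j) (snd j)) x) \<le> (indicator U x :: ennreal)" for x
  proof (cases "x \<in> U")
    case True
    then show ?thesis using sum_indicator_disjoint_le[OF J(1,2), of x] by simp
  next
    case False
    then have "(\<Sum>j\<in>J. indicator (ball (fst j) (snd j)) x) = (\<Sum>j\<in>J. 0 :: ennreal)"
      using J(3) by (intro sum.cong refl) (auto simp del: mem_ball split: split_indicator)
    then show ?thesis by simp
  qed
  then have "(\<integral>\<^sup>+x. (\<Sum>j\<in>J. indicator (ball (fst j) (snd j)) x) * h x \<partial>M) \<le> (\<integral>\<^sup>+x. indicator U x * h x \<partial>M)"
    by (intro nn_integral_mono mult_right_mono) auto
  then show ?thesis by (simp add: sum_distrib_right nn_integral_sum)
qed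

text \<open>Countably many balls with average above \<open>l\<close> cover the superlevel set. A
  Vitali selection from finitely many of them loses the factor \<open>D ^ 3\<close>; each selected
  ball \<open>j\<close> has \<open>l * V j\<close> at most the integral of \<open>h\<close> over it,
  and disjointness adds these integrals.\<close>

lemma Mx_weak_type:
  assumes h [measurable]: "h \<in> borel_measurable M"
  shows "l * emeasure M {x. l < Mx h x} \<le> ennreal (D ^ 3) * (\<integral>\<^sup>+x. h x \<partial>M)"
proof -
  obtain B where "ball_base B" using ex_ball_base ..
  note B = ball_baseD[OF this]
  \<comment> \<open>Base balls act only as indices: each one contained in some ball of large average
    is assigned one such ball \<open>\<zeta> b\<close>, which makes the covering family
    countable.\<close>
  define B' where "B' = {b \<in> B. \<exists>z. l < avg h z \<and> ball (fst b) (snd b) \<subseteq> ball (fst z) (snd z)}"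
  have "\<forall>b\<in>B'. \<exists>z. l < avg h z \<and> ball (fst b) (snd b) \<subseteq> ball (fst z) (snd z)"
    unfolding B'_def by blast
  from bchoice[OF this] obtain \<zeta> where "\<forall>b\<in>B'. l < avg h (\<zeta> b) \<and> ball (fst b) (snd b) \<subseteq> ball (fst (\<zeta> b)) (snd (\<zeta> b))" ..
  then have \<zeta>: "l < avg h (\<zeta> b)" "ball (fst b) (snd b) \<subseteq> ball (fst (\<zeta> b)) (snd (\<zeta> b))" if "b \<in> B'" for b
    using that by simp_all
  have pos: "0 < snd z" if "l < avg h z" for z
  proof (rule ccontr)
    assume "\<not> 0 < snd z"
    then have "ball (fst z) (snd z) = {}" by simp
    then have "avg h z = 0" unfolding avg_def by (auto simp del: ball_eq_empty)
    then show False using that by simp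
  qed
  have cover: "{x. l < Mx h x} \<subseteq> (\<Union>b\<in>B'. ball (fst (\<zeta> b)) (snd (\<zeta> b)))"
  proof
    fix x assume "x \<in> {x. l < Mx h x}"
    then obtain z where z: "l < avg h z" "x \<in> ball (fst z) (snd z)" unfolding Mx_superlevel by blast
    then obtain e where e: "0 < e" "ball x e \<subseteq> ball (fst z) (snd z)" using open_ball open_contains_ball by blast
    then obtain b where "b \<in> B" "x \<in> ball (fst b) (snd b)" "ball (fst b) (snd b) \<subseteq> ball x e" using B(3)[OF e(1), of x] by blast
    then have "b \<in> B'" "x \<in> ball (fst b) (snd b)" using z e unfolding B'_def by blast+
    then show "x \<in> (\<Union>b\<in>B'. ball (fst (\<zeta> b)) (snd (\<zeta> b)))" using \<zeta> by blast
  qed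
  show ?thesis
  proof (cases "B' = {}")
    case True
    then have "{x. l < Mx h x} = {}" using cover by blast
    then show ?thesis by simp
  next
    case False
    define A where "A n = \<zeta> (from_nat_into B' n)" for n
    have A: "l < avg h (A n)" for n using \<zeta> from_nat_into[OF False] by (simp add: A_def)
    have "countable B'" using B(1) unfolding B'_def by simp
    then have "(\<Union>b\<in>B'. ball (fst (\<zeta> b)) (snd (\<zeta> b))) = (\<Union>n. ball (fst (A n)) (snd (A n)))"
      unfolding A_def using range_from_nat_into[OF False] by (metis (no_types, lifting) SUP_cong image_image)
    moreover have fin: "l * emeasure M (\<Union>i<n. ball (fst (A i)) (snd (A i))) \<le> ennreal (D ^ 3) * (\<integral>\<^sup>+x. h x \<partial>M)" for n
    proof -
      obtain J where J: "J \<subseteq> A ` {..<n}" "disjoint_family_on (\<lambda>j. ball (fst j) (snd j)) J"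
        "\<And>i. i \<in> A ` {..<n} \<Longrightarrow> \<exists>j\<in>J. ball (fst i) (3 * snd i) \<subseteq> ball (fst j) (5 * snd j)"
        proof -
          have "\<forall>i\<in>A ` {..<n}. 0 < snd i" using pos[OF A] by blast
          from Vitali_finite[of "A ` {..<n}", OF finite_imageI[OF finite_lessThan] this] show ?thesis
            by (elim exE conjE) (rule that, assumption, assumption, erule (1) bspec)
        qed
      have finJ: "finite J" using J(1) finite_subset by blast
      have Jpos: "0 < snd j" "l < avg h j" if "j \<in> J" for j
      proof -
        obtain i where "j = A i" using \<open>j \<in> J\<close> J(1) by blast
        then show "0 < snd j" "l < avg h j" using pos[OF A] A by simp_all
      qed
      have "ball (fst (A i)) (snd (A i)) \<subseteq> (\<Union>j\<in>J. ball (fst j) (5 * snd j))" if "i < n" for i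
        using J(3)[of "A i"] that subset_ball[of "snd (A i)" "3 * snd (A i)" "fst (A i)"] pos[OF A, of i] by fastforce
      then have "emeasure M (\<Union>i<n. ball (fst (A i)) (snd (A i))) \<le> emeasure M (\<Union>j\<in>J. ball (fst j) (5 * snd j))"
        using finJ by (intro emeasure_mono sets.finite_UN) auto
      also have "\<dots> \<le> (\<Sum>j\<in>J. emeasure M (ball (fst j) (5 * snd j)))"
        using finJ by (intro emeasure_subadditive_finite) auto
      also have "\<dots> \<le> (\<Sum>j\<in>J. ennreal (D ^ 3) * ennreal (V j))"
        using Vol_5 Jpos D by (intro sum_mono) (auto simp: emeasure_ball ennreal_mult[symmetric] intro!: ennreal_leI)
      finally have "l * emeasure M (\<Union>i<n. ball (fst (A i)) (snd (A i))) \<le> l * (\<Sum>j\<in>J. ennreal (D ^ 3) * ennreal (V j))"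
        by (rule mult_left_mono) simp
      also have "\<dots> = ennreal (D ^ 3) * (\<Sum>j\<in>J. l * ennreal (V j))"
        by (simp add: sum_distrib_left mult_ac del: sum_ennreal)
      also have "\<dots> \<le> ennreal (D ^ 3) * (\<Sum>j\<in>J. \<integral>\<^sup>+x. indicator (ball (fst j) (snd j)) x * h x \<partial>M)"
      proof (intro mult_left_mono sum_mono)
        fix j assume j: "j \<in> J"
        have "l * ennreal (V j) \<le> avg h j * ennreal (V j)" using Jpos[OF j] by (intro mult_right_mono) auto
        also have "\<dots> = (ennreal (V j) * ennreal (1 / V j)) * (\<integral>\<^sup>+x. indicator (ball (fst j) (snd j)) x * h x \<partial>M)"
          unfolding avg_def by (simp add: mult_ac)
        also have "ennreal (V j) * ennreal (1 / V j) = 1"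
          using Vol_pos[OF Jpos(1)[OF j], of "fst j"] by (simp add: ennreal_mult[symmetric])
        finally show "l * ennreal (V j) \<le> (\<integral>\<^sup>+x. indicator (ball (fst j) (snd j)) x * h x \<partial>M)" by simp
      qed auto
      also have "\<dots> \<le> ennreal (D ^ 3) * (\<integral>\<^sup>+x. indicator UNIV x * h x \<partial>M)"
        using finJ J(2) by (intro mult_left_mono disjoint_balls_sum) auto
      finally show ?thesis by simp
    qed
    moreover have "l * emeasure M (\<Union>n. ball (fst (A n)) (snd (A n))) \<le> ennreal (D ^ 3) * (\<integral>\<^sup>+x. h x \<partial>M)"
    \<comment> \<open>Division by \<open>l\<close> needs a finite nonzero level. The value
      \<open>top\<close> is impossible because \<open>l < avg h (A 0)\<close>, and 0 is
      trivial.\<close>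
    proof (cases "l = 0 \<or> l = top")
      case False
      have "emeasure M (\<Union>n. ball (fst (A n)) (snd (A n))) \<le> (ennreal (D ^ 3) * (\<integral>\<^sup>+x. h x \<partial>M)) / l"
      proof (intro emeasure_UN_le)
        fix n
        have "emeasure M (\<Union>i<n. ball (fst (A i)) (snd (A i))) = (l * emeasure M (\<Union>i<n. ball (fst (A i)) (snd (A i)))) / l"
          using False by (subst mult.commute) (simp add: ennreal_mult_divide_eq)
        also have "\<dots> \<le> (ennreal (D ^ 3) * (\<integral>\<^sup>+x. h x \<partial>M)) / l" using fin by (intro divide_right_mono_ennreal)
        finally show "emeasure M (\<Union>i<n. ball (fst (A i)) (snd (A i))) \<le> (ennreal (D ^ 3) * (\<integral>\<^sup>+x. h x \<partial>M)) / l" .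
      qed auto
      then have "l * emeasure M (\<Union>n. ball (fst (A n)) (snd (A n))) \<le> l * ((ennreal (D ^ 3) * (\<integral>\<^sup>+x. h x \<partial>M)) / l)"
        by (intro mult_left_mono) auto
      also have "\<dots> = ennreal (D ^ 3) * (\<integral>\<^sup>+x. h x \<partial>M)"
        using False by (simp add: ennreal_times_divide mult.commute[of l] ennreal_mult_divide_eq)
      finally show ?thesis .
    qed (use A[of 0] in auto)
    moreover have "l * emeasure M {x. l < Mx h x} \<le> l * emeasure M (\<Union>b\<in>B'. ball (fst (\<zeta> b)) (snd (\<zeta> b)))"
      using cover by (intro mult_left_mono emeasure_mono open_sets_M) auto
    ultimately show ?thesis by simp
  qed
qed

text \<open>Dropping the values of \<open>h\<close> up to \<open>l / 2\<close> lowers every average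
  by at most \<open>l / 2\<close>, so the truncated function still has maximal function above
  \<open>l / 2\<close>. The weak type bound at that level gives the factor 2.\<close>

lemma Mx_superlevel_estimate:
  assumes h [measurable]: "h \<in> borel_measurable M" and l: "0 < l"
  shows "ennreal l * emeasure M {x. ennreal l < Mx h x}
    \<le> ennreal (2 * D ^ 3) * (\<integral>\<^sup>+x. h x * indicator {x. ennreal l < 2 * h x} x \<partial>M)"
proof -
  let ?h = "\<lambda>x. h x * indicator {x. ennreal l < 2 * h x} x"
  have sub: "{x. ennreal l < Mx h x} \<subseteq> {x. ennreal (l / 2) < Mx ?h x}"
  proof
    fix x assume "x \<in> {x. ennreal l < Mx h x}"
    then obtain z where z: "ennreal l < avg h z" "dist x (fst z) < snd z" by (auto simp: Mx_def less_SUP_iff)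
    have zpos: "0 < snd z" using z(2) by (smt (verit) zero_le_dist)
    have half: "2 * ennreal (l / 2) = ennreal l" using l by (simp add: ennreal_mult'[symmetric] flip: ennreal_numeral)
    have "h x \<le> ?h x + ennreal (l / 2)" for x
    proof (cases "ennreal l < 2 * h x")
      case False
      then have "2 * h x \<le> 2 * ennreal (l / 2)" using half by simp
      then have "h x \<le> ennreal (l / 2)"
        by (cases "h x") (auto simp: top_unique ennreal_mult_top ennreal_mult[symmetric] ennreal_le_iff l less_imp_le simp flip: ennreal_numeral)
      then show ?thesis by (simp add: add_increasing)
    qed simp
    then have "avg h z \<le> avg (\<lambda>x. ?h x + ennreal (l / 2)) z" by (intro avg_mono)
    also have "\<dots> = avg ?h z + ennreal (l / 2)" using zpos by (subst avg_add) (auto simp: avg_const)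
    finally have "ennreal (l / 2) + ennreal (l / 2) < avg ?h z + ennreal (l / 2)"
      using z(1) l by (simp add: ennreal_plus[symmetric] del: ennreal_plus)
    then have "ennreal (l / 2) < avg ?h z" by (metis add_mono leD le_less_linear order_refl)
    then show "x \<in> {x. ennreal (l / 2) < Mx ?h x}" using avg_le_Mx[OF z(2), of ?h] by auto
  qed
  have "ennreal l * emeasure M {x. ennreal l < Mx h x} \<le> ennreal l * emeasure M {x. ennreal (l / 2) < Mx ?h x}"
    using sub open_Mx_superlevel by (intro mult_left_mono emeasure_mono open_sets_M) auto
  also have "\<dots> = 2 * (ennreal (l / 2) * emeasure M {x. ennreal (l / 2) < Mx ?h x})"
    using l by (simp add: mult.assoc[symmetric] ennreal_mult'[symmetric] flip: ennreal_numeral)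
  also have "\<dots> \<le> 2 * (ennreal (D ^ 3) * (\<integral>\<^sup>+x. ?h x \<partial>M))"
    by (intro mult_left_mono Mx_weak_type) auto
  also have "\<dots> = ennreal (2 * D ^ 3) * (\<integral>\<^sup>+x. ?h x \<partial>M)"
    by (simp add: mult.assoc[symmetric] ennreal_mult'[symmetric] flip: ennreal_numeral)
  finally show ?thesis .
qed

text \<open>The constant of Marcinkiewicz interpolation: \<open>2 * D ^ 3\<close> from the level
  estimate, \<open>2 powr (s - 1)\<close> from a power of \<open>2 * h\<close>, and
  \<open>s / (s - 1)\<close> from passing between layer cake formulas of exponents \<open>s\<close>
  and \<open>s - 1\<close>.\<close>

definition Mx_const :: "real \<Rightarrow> real" where
  "Mx_const s = s / (s - 1) * 2 powr (s - 1) * (2 * D ^ 3)"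

lemma Mx_const_nonneg: "1 < s \<Longrightarrow> 0 \<le> Mx_const s"
  using D by (simp add: Mx_const_def)

text \<open>One power of \<open>l\<close> in the layer cake formula for \<open>Mx h\<close> is spent
  on the level estimate; what remains is the layer cake formula of exponent \<open>s - 1\<close> for
  \<open>2 * h\<close>, weighted by \<open>h\<close>.\<close>

lemma Mx_strong_type:
  assumes h [measurable]: "h \<in> borel_measurable M" and s: "1 < s"
  shows "(\<integral>\<^sup>+x. epow (Mx h x) s \<partial>M) \<le> ennreal (Mx_const s) * (\<integral>\<^sup>+x. epow (h x) s \<partial>M)"
proof -
  have [measurable]: "(\<lambda>l. \<integral>\<^sup>+x. h x * indicator {x. ennreal l < 2 * h x} x \<partial>M) \<in> borel_measurable lborel"
    by measurable
  have "(\<integral>\<^sup>+x. epow (Mx h x) s \<partial>M) =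
     (\<integral>\<^sup>+l. indicator {0<..} l * ennreal (s * l powr (s - 1)) * (\<integral>\<^sup>+x. 1 * indicator {x. ennreal l < Mx h x} x \<partial>M) \<partial>lborel)"
    using nn_integral_weighted_layer_cake[of "\<lambda>_. 1" "Mx h" s] s by simp
  also have "\<dots> \<le> (\<integral>\<^sup>+l. ennreal (s / (s - 1) * (2 * D ^ 3)) * (indicator {0<..} l * ennreal ((s - 1) * l powr (s - 1 - 1)) *
       (\<integral>\<^sup>+x. h x * indicator {x. ennreal l < 2 * h x} x \<partial>M)) \<partial>lborel)"
  proof (intro nn_integral_mono)
    fix l :: real
    show "indicator {0<..} l * ennreal (s * l powr (s - 1)) * (\<integral>\<^sup>+x. 1 * indicator {x. ennreal l < Mx h x} x \<partial>M)
      \<le> ennreal (s / (s - 1) * (2 * D ^ 3)) * (indicator {0<..} l * ennreal ((s - 1) * l powr (s - 1 - 1)) *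
       (\<integral>\<^sup>+x. h x * indicator {x. ennreal l < 2 * h x} x \<partial>M))"
    proof (cases "0 < l")
      case True
      have e: "l powr (s - 1) = l powr (s - 2) * l" using True powr_add[of l "s - 2" 1] by simp
      have "ennreal (s * l powr (s - 1)) * emeasure M {x. ennreal l < Mx h x}
        = ennreal (s * l powr (s - 2)) * (ennreal l * emeasure M {x. ennreal l < Mx h x})"
        using True s unfolding e by (simp add: mult.assoc[symmetric] ennreal_mult[symmetric])
      also have "\<dots> \<le> ennreal (s * l powr (s - 2)) * (ennreal (2 * D ^ 3) * (\<integral>\<^sup>+x. h x * indicator {x. ennreal l < 2 * h x} x \<partial>M))"
        by (intro mult_left_mono Mx_superlevel_estimate True) auto
      also have "\<dots> = ennreal (s / (s - 1) * (2 * D ^ 3)) * (ennreal ((s - 1) * l powr (s - 1 - 1)) *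
       (\<integral>\<^sup>+x. h x * indicator {x. ennreal l < 2 * h x} x \<partial>M))"
      proof -
        have "s * l powr (s - 2) * (2 * D ^ 3) = s / (s - 1) * (2 * D ^ 3) * ((s - 1) * l powr (s - 1 - 1))"
          using s by (simp add: divide_simps)
        then have "ennreal (s * l powr (s - 2)) * ennreal (2 * D ^ 3)
            = ennreal (s / (s - 1) * (2 * D ^ 3)) * ennreal ((s - 1) * l powr (s - 1 - 1))"
          using s D by (subst (1 2) ennreal_mult[symmetric]) auto
        then show ?thesis by (simp only: mult.assoc[symmetric])
      qed
      finally show ?thesis using True by (simp add: mult.assoc)
    qed simp
  qed
  also have "\<dots> = ennreal (s / (s - 1) * (2 * D ^ 3)) * (\<integral>\<^sup>+x. h x * epow (2 * h x) (s - 1) \<partial>M)"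
    using s by (subst nn_integral_cmult) (auto simp: nn_integral_weighted_layer_cake)
  also have "(\<lambda>x. h x * epow (2 * h x) (s - 1)) = (\<lambda>x. ennreal (2 powr (s - 1)) * epow (h x) s)"
  proof
    fix x
    have "epow (h x) s = h x * epow (h x) (s - 1)" using epow_add[of "h x" 1 "s - 1"] by simp
    moreover have "epow 2 (s - 1) = ennreal (2 powr (s - 1))" using epow_ennreal[of 2 "s - 1"] by simp
    ultimately show "h x * epow (2 * h x) (s - 1) = ennreal (2 powr (s - 1)) * epow (h x) s"
      by (simp add: epow_mult mult_ac)
  qed
  also have "ennreal (s / (s - 1) * (2 * D ^ 3)) * (\<integral>\<^sup>+x. ennreal (2 powr (s - 1)) * epow (h x) s \<partial>M)
     = ennreal (Mx_const s) * (\<integral>\<^sup>+x. epow (h x) s \<partial>M)"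
  proof -
    have "ennreal (s / (s - 1) * (2 * D ^ 3)) * ennreal (2 powr (s - 1)) = ennreal (Mx_const s)"
      using s D by (subst ennreal_mult[symmetric]) (auto simp: Mx_const_def)
    then show ?thesis by (simp add: nn_integral_cmult mult.assoc[symmetric])
  qed
  finally show ?thesis .
qed

section \<open>The Carleson embedding\<close>

lemma tent_mono: "U \<subseteq> W \<Longrightarrow> tent U \<subseteq> tent W"
  by (auto simp: tent_def)

text \<open>A point of \<open>tent U\<close> lies in the tent over the triple of a base ball
  contained in \<open>U\<close>. Vitali selects disjoint base balls whose fivefold enlargements
  carry these tents; the hypothesis on balls and disjointness inside \<open>U\<close> finish the
  estimate.\<close>

lemma Carleson_open:
  assumes g [measurable]: "g \<in> borel_measurable (Xplus M)" and U: "open U"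
    and K: "\<And>x r. 0 < r \<Longrightarrow> (\<integral>\<^sup>+z. indicator (tent (ball x r)) z * g z \<partial>Xplus M) \<le> K * emeasure M (ball x r)"
  shows "(\<integral>\<^sup>+z. indicator (tent U) z * g z \<partial>Xplus M) \<le> K * ennreal (D ^ 3) * emeasure M U"
proof -
  obtain B where "ball_base B" using ex_ball_base ..
  note B = ball_baseD[OF this]
  define N where "N = density (Xplus M) g"
  define T where "T W = tent W \<inter> space (Xplus M)" for W :: "'a set"
  have T [measurable]: "T W \<in> sets N" for W using measurable_tent[of W] by (simp add: N_def T_def)
  have N: "emeasure N (T W) = (\<integral>\<^sup>+z. indicator (tent W) z * g z \<partial>Xplus M)" for W
    unfolding N_def T_def using measurable_tent[of W]
    by (subst emeasure_density) (auto intro!: nn_integral_cong split: split_indicator)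
  define B' where "B' = {b \<in> B. ball (fst b) (snd b) \<subseteq> U}"
  have cover: "T U \<subseteq> (\<Union>b\<in>B'. T (ball (fst b) (3 * snd b)))"
  proof
    fix z assume z: "z \<in> T U"
    then have z': "0 < snd z" "ball (fst z) (snd z) \<subseteq> U" by (auto simp: T_def in_tent_iff)
    then obtain b where "b \<in> B" "ball (fst b) (snd b) \<subseteq> ball (fst z) (snd z)" "ball (fst z) (snd z) \<subseteq> ball (fst b) (3 * snd b)"
      using B(3)[OF z'(1), of "fst z"] by blast
    then show "z \<in> (\<Union>b\<in>B'. T (ball (fst b) (3 * snd b)))" using z z'
      by (intro UN_I[of b]) (auto simp: T_def in_tent_iff B'_def)
  qed
  have "emeasure N (T U) \<le> K * ennreal (D ^ 3) * emeasure M U"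
  proof (cases "B' = {}")
    case True
    then have "T U = {}" using cover by blast
    then show ?thesis by simp
  next
    case False
    define A where "A n = from_nat_into B' n" for n
    have A: "A n \<in> B'" for n using from_nat_into[OF False] by (simp add: A_def)
    have "countable B'" using B(1) unfolding B'_def by simp
    then have "(\<Union>b\<in>B'. T (ball (fst b) (3 * snd b))) = (\<Union>n. T (ball (fst (A n)) (3 * snd (A n))))"
      unfolding A_def using range_from_nat_into[OF False] by (metis (no_types, lifting) SUP_cong image_image)
    then have "emeasure N (T U) \<le> emeasure N (\<Union>n. T (ball (fst (A n)) (3 * snd (A n))))"
      using cover by (intro emeasure_mono) auto
    also have "\<dots> \<le> K * ennreal (D ^ 3) * emeasure M U"
    proof (intro emeasure_UN_le T)
      fix n
      have Apos: "0 < snd (A i)" "ball (fst (A i)) (snd (A i)) \<subseteq> U" for i using A[of i] B(2) by (auto simp: B'_def)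
      obtain J where J: "J \<subseteq> A ` {..<n}" "disjoint_family_on (\<lambda>j. ball (fst j) (snd j)) J"
        "\<And>i. i \<in> A ` {..<n} \<Longrightarrow> \<exists>j\<in>J. ball (fst i) (3 * snd i) \<subseteq> ball (fst j) (5 * snd j)"
        proof -
          have "\<forall>i\<in>A ` {..<n}. 0 < snd i" using Apos(1) by blast
          from Vitali_finite[of "A ` {..<n}", OF finite_imageI[OF finite_lessThan] this] show ?thesis
            by (elim exE conjE) (rule that, assumption, assumption, erule (1) bspec)
        qed
      have finJ: "finite J" using J(1) finite_subset by blast
      have Jpos: "0 < snd j" "ball (fst j) (snd j) \<subseteq> U" if "j \<in> J" for j using that J(1) Apos by blast+
      have "T (ball (fst (A i)) (3 * snd (A i))) \<subseteq> (\<Union>j\<in>J. T (ball (fst j) (5 * snd j)))" if i: "i < n" for i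
      proof -
        obtain j where "j \<in> J" "ball (fst (A i)) (3 * snd (A i)) \<subseteq> ball (fst j) (5 * snd j)"
          using J(3)[of "A i"] i by blast
        then have "T (ball (fst (A i)) (3 * snd (A i))) \<subseteq> T (ball (fst j) (5 * snd j))"
          unfolding T_def using tent_mono by blast
        with \<open>j \<in> J\<close> show ?thesis by blast
      qed
      then have "emeasure N (\<Union>i<n. T (ball (fst (A i)) (3 * snd (A i)))) \<le> emeasure N (\<Union>j\<in>J. T (ball (fst j) (5 * snd j)))"
        using finJ by (intro emeasure_mono sets.finite_UN) auto
      also have "\<dots> \<le> (\<Sum>j\<in>J. emeasure N (T (ball (fst j) (5 * snd j))))"
        using finJ by (intro emeasure_subadditive_finite) auto
      also have "\<dots> \<le> (\<Sum>j\<in>J. K * (ennreal (D ^ 3) * ennreal (V j)))"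
      proof (intro sum_mono)
        fix j assume j: "j \<in> J"
        have "emeasure N (T (ball (fst j) (5 * snd j))) \<le> K * emeasure M (ball (fst j) (5 * snd j))"
          unfolding N using Jpos[OF j] by (intro K) auto
        also have "\<dots> \<le> K * (ennreal (D ^ 3) * ennreal (V j))"
          using Vol_5[OF Jpos(1)[OF j], of "fst j"] D
          by (intro mult_left_mono) (auto simp: emeasure_ball ennreal_mult[symmetric] intro!: ennreal_leI)
        finally show "emeasure N (T (ball (fst j) (5 * snd j))) \<le> K * (ennreal (D ^ 3) * ennreal (V j))" .
      qed
      also have "\<dots> = K * ennreal (D ^ 3) * (\<Sum>j\<in>J. \<integral>\<^sup>+x. indicator (ball (fst j) (snd j)) x * 1 \<partial>M)"
        by (simp add: sum_distrib_left mult.assoc emeasure_ball del: sum_ennreal)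
      also have "\<dots> \<le> K * ennreal (D ^ 3) * (\<integral>\<^sup>+x. indicator U x * 1 \<partial>M)"
        using finJ J(2) Jpos U by (intro mult_left_mono disjoint_balls_sum) auto
      finally show "emeasure N (\<Union>i<n. T (ball (fst (A i)) (3 * snd (A i)))) \<le> K * ennreal (D ^ 3) * emeasure M U"
        using U by (simp add: open_sets_M)
    qed
    finally show ?thesis .
  qed
  then show ?thesis by (simp add: N)
qed

text \<open>\<open>K\<close> is the Carleson constant of the density \<open>g\<close>. Where
  \<open>w z\<close> exceeds \<open>l\<close>, the whole ball of \<open>z\<close> lies in the
  superlevel set of \<open>Mx h\<close>, so \<open>z\<close> lies in the tent over that open set,
  and the distributions can be compared level by level.\<close>

lemma Carleson_embedding:
  assumes g [measurable]: "g \<in> borel_measurable (Xplus M)" and w [measurable]: "w \<in> borel_measurable (Xplus M)"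
    and K: "\<And>x r. 0 < r \<Longrightarrow> (\<integral>\<^sup>+z. indicator (tent (ball x r)) z * g z \<partial>Xplus M) \<le> K * emeasure M (ball x r)"
    and wm: "\<And>x z. dist x (fst z) < snd z \<Longrightarrow> w z \<le> Mx h x" and s: "0 < s"
  shows "(\<integral>\<^sup>+z. g z * epow (w z) s \<partial>Xplus M) \<le> K * ennreal (D ^ 3) * (\<integral>\<^sup>+x. epow (Mx h x) s \<partial>M)"
proof (intro nn_integral_distribution_comparison sigma_finite_Xplus sigma_finite_M s g w measurable_Mx)
  fix l :: real assume "0 < l"
  have "(\<integral>\<^sup>+z. g z * indicator {z. ennreal l < w z} z \<partial>Xplus M) \<le> (\<integral>\<^sup>+z. indicator (tent {x. ennreal l < Mx h x}) z * g z \<partial>Xplus M)"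
  proof (intro nn_integral_mono)
    fix z assume "z \<in> space (Xplus M)"
    then have "z \<in> tent {x. ennreal l < Mx h x}" if "ennreal l < w z"
      using that wm[of _ z] by (auto simp: in_tent_iff space_XplusD dist_commute intro: less_le_trans)
    then show "g z * indicator {z. ennreal l < w z} z \<le> indicator (tent {x. ennreal l < Mx h x}) z * g z"
      by (auto split: split_indicator)
  qed
  also have "\<dots> \<le> K * ennreal (D ^ 3) * emeasure M {x. ennreal l < Mx h x}"
    by (intro Carleson_open K open_Mx_superlevel g)
  finally show "(\<integral>\<^sup>+z. g z * indicator {z. ennreal l < w z} z \<partial>Xplus M)
      \<le> K * ennreal (D ^ 3) * (\<integral>\<^sup>+x. indicator {x. ennreal l < Mx h x} x \<partial>M)"
    by simp
qed

end

section \<open>Averaged weights and the cone functional\<close>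

lemma ennreal_powr_mult: "0 < x \<Longrightarrow> ennreal (x powr s) * ennreal (x powr t) = ennreal (x powr (s + t))"
  by (simp add: ennreal_mult[symmetric] powr_add)

lemma epow_ennreal_powr: "0 \<le> x \<Longrightarrow> epow (ennreal (x powr s)) t = ennreal (x powr (s * t))"
  by (simp add: epow_ennreal powr_powr)

text \<open>The supporting line at \<open>c\<close> of the convex function
  \<open>u powr (- k)\<close>, rearranged without subtraction so that it can be averaged in
  \<open>ennreal\<close>.\<close>

lemma powr_neg_tangent:
  fixes u c k :: real
  assumes "0 < u" "0 < c" "0 < k"
  shows "(1 + k) * c powr (- k) \<le> u powr (- k) + k * c powr (- k - 1) * u"
proof -
  define v where "v = u / c"
  have v: "0 < v" "u = v * c" using assms by (auto simp: v_def)
  have "(v powr (- k)) powr (1 / (1 + k)) * v powr (k / (1 + k)) \<le> 1 / (1 + k) * v powr (- k) + k / (1 + k) * v"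
    using assms v by (intro Youngs_inequality_0) (auto simp: field_simps)
  moreover have "(v powr (- k)) powr (1 / (1 + k)) * v powr (k / (1 + k)) = 1"
    using v assms by (simp add: powr_powr powr_add[symmetric])
  ultimately have "1 + k \<le> v powr (- k) + k * v"
    using assms by (simp add: add_divide_distrib[symmetric] divide_simps)
  then have "(1 + k) * c powr (- k) \<le> (v powr (- k) + k * v) * c powr (- k)"
    by (intro mult_right_mono) auto
  also have "\<dots> = u powr (- k) + k * c powr (- k - 1) * u"
  proof -
    have "c powr (- k - 1) * c = c powr (- k)" using assms powr_add[of c "- k - 1" 1] by simp
    then show ?thesis using v assms by (simp add: powr_mult algebra_simps)
  qed
  finally show ?thesis .
qed

text \<open>The density \<open>1 / V\<close> is distributed over the two factors with powers
  \<open>1 / Q\<close> and \<open>1 - 1 / Q\<close>.\<close>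

lemma (in tent_space_setting) cone_int_Holder:
  assumes [measurable]: "u \<in> borel_measurable (Xplus M)" "G \<in> borel_measurable (Xplus M)" and Q: "1 < Q"
  shows "cone_int (\<lambda>z. u z * epow (G z) (1 - 1 / Q)) x
    \<le> epow (cone_int (\<lambda>z. epow (u z) Q) x) (1 / Q) * epow (cone_int G x) (1 - 1 / Q)"
proof -
  let ?i = "\<lambda>z. if dist x (fst z) < snd z then ennreal (1 / V z) else 0"
  have "cone_int (\<lambda>z. u z * epow (G z) (1 - 1 / Q)) x
    = (\<integral>\<^sup>+z. epow (?i z * epow (u z) Q) (1 / Q) * epow (?i z * G z) (1 - 1 / Q) \<partial>Xplus M)"
    unfolding cone_int_eq
  proof (intro nn_integral_cong)
    fix z
    let ?c = "ennreal (1 / V z)"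
    have "?c = epow ?c (1 / Q) * epow ?c (1 - 1 / Q)" by (simp add: epow_add[symmetric])
    then have "?c * (u z * epow (G z) (1 - 1 / Q)) = (epow ?c (1 / Q) * epow ?c (1 - 1 / Q)) * (u z * epow (G z) (1 - 1 / Q))"
      by (rule arg_cong)
    also have "\<dots> = (epow ?c (1 / Q) * u z) * (epow ?c (1 - 1 / Q) * epow (G z) (1 - 1 / Q))"
      by (simp only: mult_ac)
    finally show "(if dist x (fst z) < snd z then ?c * (u z * epow (G z) (1 - 1 / Q)) else 0)
      = epow (?i z * epow (u z) Q) (1 / Q) * epow (?i z * G z) (1 - 1 / Q)"
      using Q by (simp add: epow_mult epow_epow)
  qed
  also have "\<dots> \<le> epow (\<integral>\<^sup>+z. ?i z * epow (u z) Q \<partial>Xplus M) (1 / Q) * epow (\<integral>\<^sup>+z. ?i z * G z \<partial>Xplus M) (1 - 1 / Q)"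
    using Q by (intro nn_integral_Holder) (auto simp: field_simps)
  also have "(\<integral>\<^sup>+z. ?i z * epow (u z) Q \<partial>Xplus M) = cone_int (\<lambda>z. epow (u z) Q) x"
    unfolding cone_int_eq by (intro nn_integral_cong) auto
  also have "(\<integral>\<^sup>+z. ?i z * G z \<partial>Xplus M) = cone_int G x"
    unfolding cone_int_eq by (intro nn_integral_cong) auto
  finally show ?thesis .
qed

text \<open>The weight \<open>w\<close> substitutes on the half space for \<open>a\<close>, which only lives on the base space.\<close>

locale tent_weight = tent_space_setting +
  fixes p q r A :: real and a :: "'a \<Rightarrow> real" and G :: "'a \<times> real \<Rightarrow> ennreal"
  assumes p: "1 \<le> p" and q: "1 < q" and r: "0 < r" "r < p"
    and a_pos: "\<And>x. 0 < a x" and a_meas [measurable]: "a \<in> borel_measurable M"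
    and a_int: "(\<integral>\<^sup>+x. ennreal (a x powr p) \<partial>M) \<le> ennreal A" and A: "0 \<le> A"
    and G_meas [measurable]: "G \<in> borel_measurable (Xplus M)"
    and G_cone: "AE x in M. cone_int G x \<le> ennreal (a x powr q)"
begin

section \<open>The weight on the half space and its majorant on the base\<close>

definition ar :: "'a \<Rightarrow> ennreal" where "ar x = ennreal (a x powr r)"

definition w :: "'a \<times> real \<Rightarrow> real" where "w z = enn2real (avg ar z) powr (1 / r)"

text \<open>One majorant for two purposes: it dominates \<open>a\<close> and, for almost every
  \<open>x\<close>, all \<open>w z\<close> whose ball contains \<open>x\<close>. Its
  \<open>p\<close>-th power is still integrable because the maximal theorem is used at the exponent
  \<open>p / r > 1\<close>.\<close>

definition b :: "'a \<Rightarrow> real" where "b x = max (a x) (enn2real (Mx ar x) powr (1 / r))"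

definition Cb :: real where "Cb = (1 + Mx_const (p / r)) * A"

lemma ar_meas [measurable]: "ar \<in> borel_measurable M"
  unfolding ar_def[abs_def] by measurable

lemma w_meas [measurable]: "w \<in> borel_measurable (Xplus M)"
  unfolding w_def[abs_def] by measurable

lemma b_meas [measurable]: "b \<in> borel_measurable M"
  unfolding b_def[abs_def] by measurable

lemma a_le_b: "a x \<le> b x"
  by (simp add: b_def)

lemma b_pos: "0 < b x"
  using a_pos[of x] a_le_b[of x] by linarith

lemma avg_ar_finite: "avg ar z < top"
proof -
  have "(\<integral>\<^sup>+x. indicator (ball (fst z) (snd z)) x * ar x \<partial>M)
      \<le> (\<integral>\<^sup>+x. indicator (ball (fst z) (snd z)) x + ennreal (a x powr p) \<partial>M)"
  proof (intro nn_integral_mono)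
    fix x
    have "a x powr r \<le> 1 + a x powr p"
      using powr_mono[of r p "a x"] powr_mono2[of r "a x" 1] a_pos[of x] r
      by (cases "1 \<le> a x") (auto intro: add_increasing add_increasing2)
    then have "ar x \<le> ennreal (1 + a x powr p)" unfolding ar_def by (intro ennreal_leI)
    then have "ar x \<le> 1 + ennreal (a x powr p)" by simp
    then show "indicator (ball (fst z) (snd z)) x * ar x \<le> indicator (ball (fst z) (snd z)) x + ennreal (a x powr p)"
      by (auto split: split_indicator)
  qed
  also have "\<dots> = emeasure M (ball (fst z) (snd z)) + (\<integral>\<^sup>+x. ennreal (a x powr p) \<partial>M)"
    by (simp add: nn_integral_add)
  also have "\<dots> < top" using a_int by (auto simp: emeasure_ball intro: le_less_trans)
  finally show ?thesis unfolding avg_def by (intro ennreal_mult_less_top[THEN iffD2]) auto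
qed

lemma avg_ar_pos:
  assumes z: "0 < snd z"
  shows "0 < avg ar z"
proof -
  have "(\<integral>\<^sup>+x. indicator (ball (fst z) (snd z)) x * ar x \<partial>M) \<noteq> 0"
  proof
    assume "(\<integral>\<^sup>+x. indicator (ball (fst z) (snd z)) x * ar x \<partial>M) = 0"
    then have "AE x in M. indicator (ball (fst z) (snd z)) x * ar x = 0"
      by (subst (asm) nn_integral_0_iff_AE) auto
    then have "AE x in M. x \<notin> ball (fst z) (snd z)"
    proof eventually_elim
      case (elim x)
      then show ?case using a_pos[of x] by (auto simp: ar_def split: split_indicator)
    qed
    then have "emeasure M (ball (fst z) (snd z)) = 0"
      by (subst (asm) AE_iff_measurable[of "ball (fst z) (snd z)"]) (auto simp del: mem_ball)
    then show False using Vol_pos[OF z, of "fst z"] by (simp add: emeasure_ball)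
  qed
  then show ?thesis using Vol_pos[OF z, of "fst z"] unfolding avg_def
    by (simp add: zero_less_iff_neq_zero)
qed

lemma w_nonneg: "0 \<le> w z"
  by (simp add: w_def)

lemma w_pos: "0 < snd z \<Longrightarrow> 0 < w z"
  using enn2real_positive_iff[of "avg ar z"] avg_ar_pos[of z] avg_ar_finite[of z] by (simp add: w_def)

lemma w_powr: "0 < snd z \<Longrightarrow> ennreal (w z powr s) = epow (avg ar z) (s / r)"
  using avg_ar_finite[of z] by (simp add: w_def powr_powr epow_def)

lemma w_powr_r: "0 < snd z \<Longrightarrow> ennreal (w z powr r) = avg ar z"
  using w_powr[of z r] r by simp

lemma Mx_ar_int: "(\<integral>\<^sup>+x. epow (Mx ar x) (p / r) \<partial>M) \<le> ennreal (Mx_const (p / r) * A)"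
proof -
  have "(\<integral>\<^sup>+x. epow (Mx ar x) (p / r) \<partial>M) \<le> ennreal (Mx_const (p / r)) * (\<integral>\<^sup>+x. epow (ar x) (p / r) \<partial>M)"
    using r by (intro Mx_strong_type) auto
  also have "(\<lambda>x. epow (ar x) (p / r)) = (\<lambda>x. ennreal (a x powr p))"
    using r a_pos by (auto simp: ar_def epow_ennreal_powr less_imp_le)
  also have "ennreal (Mx_const (p / r)) * (\<integral>\<^sup>+x. ennreal (a x powr p) \<partial>M) \<le> ennreal (Mx_const (p / r)) * ennreal A"
    by (intro mult_left_mono a_int) auto
  also have "\<dots> = ennreal (Mx_const (p / r) * A)" using A r by (intro ennreal_mult[symmetric] Mx_const_nonneg) auto
  finally show ?thesis .
qed

lemma A_le_Cb: "A \<le> Cb"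
  using A Mx_const_nonneg[of "p / r"] r by (simp add: Cb_def mult_left_le_one_le algebra_simps)

lemma b_int: "(\<integral>\<^sup>+x. ennreal (b x powr p) \<partial>M) \<le> ennreal Cb"
proof -
  have "ennreal (b x powr p) \<le> ennreal (a x powr p) + epow (Mx ar x) (p / r)" for x
  proof -
    \<comment> \<open>Where \<open>Mx ar x\<close> is infinite, the left side is 0 by the convention
      of \<open>enn2real\<close> and the right side is infinite.\<close>
    have "ennreal ((enn2real (Mx ar x) powr (1 / r)) powr p) \<le> epow (Mx ar x) (p / r)"
      by (simp add: epow_def powr_powr)
    then show ?thesis by (auto simp: b_def max_def intro: add_increasing add_increasing2)
  qed
  then have "(\<integral>\<^sup>+x. ennreal (b x powr p) \<partial>M) \<le> (\<integral>\<^sup>+x. ennreal (a x powr p) + epow (Mx ar x) (p / r) \<partial>M)"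
    by (intro nn_integral_mono)
  also have "\<dots> = (\<integral>\<^sup>+x. ennreal (a x powr p) \<partial>M) + (\<integral>\<^sup>+x. epow (Mx ar x) (p / r) \<partial>M)"
    by (intro nn_integral_add) auto
  also have "\<dots> \<le> ennreal A + ennreal (Mx_const (p / r) * A)"
    by (intro add_mono a_int Mx_ar_int)
  also have "\<dots> = ennreal Cb"
    using A r by (subst ennreal_plus[symmetric]) (auto simp: Cb_def algebra_simps Mx_const_nonneg)
  finally show ?thesis .
qed

text \<open>Only almost everywhere, since \<open>enn2real\<close> sends an infinite maximal function
  to 0; by \<open>Mx_ar_int\<close> this happens on a null set. The exceptional set is common to all
  \<open>z\<close>.\<close>

lemma w_le_b: "AE x in M. \<forall>z. dist x (fst z) < snd z \<longrightarrow> w z \<le> b x"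
proof -
  have "AE x in M. epow (Mx ar x) (p / r) \<noteq> \<infinity>"
    using Mx_ar_int by (intro nn_integral_PInf_AE) (auto simp: top_unique)
  then show ?thesis
  proof eventually_elim
    case (elim x)
    then have "Mx ar x < top" by (auto simp: less_top)
    then have "enn2real (avg ar z) \<le> enn2real (Mx ar x)" if "dist x (fst z) < snd z" for z
      using avg_le_Mx[OF that, of ar] by (intro enn2real_mono) auto
    then show ?case using r by (auto simp: w_def b_def intro!: max.coboundedI2 powr_mono2)
  qed
qed

text \<open>Jensen's inequality for \<open>u powr (- k)\<close> with \<open>k = g / r\<close>: the
  supporting line at \<open>c\<close>, the average of \<open>a powr r\<close>, is averaged over the
  ball. The linear term averages to the finite number \<open>k * c powr (- k)\<close>, which
  cancels.\<close>

lemma w_neg_powr_le: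
  assumes z: "0 < snd z" and g: "0 \<le> g"
  shows "ennreal (w z powr (- g)) \<le> avg (\<lambda>x. ennreal (a x powr (- g))) z"
proof (cases "g = 0")
  case True
  have "(\<lambda>x. ennreal (a x powr - 0)) = (\<lambda>x. 1)" using a_pos by (auto simp: less_imp_neq[THEN not_sym])
  then show ?thesis using True z w_pos[OF z] by (simp add: avg_const)
next
  case False
  define k c where "k = g / r" and "c = w z powr r"
  have k: "0 < k" and c: "0 < c" using False g r w_pos[OF z] by (auto simp: k_def c_def)
  have "ennreal ((1 + k) * c powr (- k)) = avg (\<lambda>x. ennreal ((1 + k) * c powr (- k))) z"
    using z by (simp add: avg_const)
  also have "\<dots> \<le> avg (\<lambda>x. ennreal (a x powr (- g)) + ennreal (k * c powr (- k - 1)) * ar x) z"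
  proof (intro avg_mono)
    fix x
    have "(1 + k) * c powr (- k) \<le> (a x powr r) powr (- k) + k * c powr (- k - 1) * a x powr r"
      using a_pos[of x] c k by (intro powr_neg_tangent) auto
    also have "(a x powr r) powr (- k) = a x powr (- g)" using r by (simp add: powr_powr k_def)
    finally show "ennreal ((1 + k) * c powr (- k)) \<le> ennreal (a x powr (- g)) + ennreal (k * c powr (- k - 1)) * ar x"
      using k by (simp add: ar_def ennreal_mult[symmetric] ennreal_plus[symmetric] ennreal_leI del: ennreal_plus)
  qed
  also have "\<dots> = avg (\<lambda>x. ennreal (a x powr (- g))) z + ennreal (k * c powr (- k - 1)) * avg ar z"
    by (subst avg_add) (auto simp: avg_cmult)
  also have "avg ar z = ennreal c" using w_powr_r[OF z] by (simp add: c_def)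
  also have "ennreal (k * c powr (- k - 1)) * ennreal c = ennreal (k * c powr (- k))"
  proof -
    have "c powr (- k - 1) * c = c powr (- k)" using c powr_add[of c "- k - 1" 1] by simp
    then show ?thesis using k c by (simp add: ennreal_mult[symmetric] mult.assoc)
  qed
  finally have "ennreal (c powr (- k)) + ennreal (k * c powr (- k)) \<le> avg (\<lambda>x. ennreal (a x powr (- g))) z + ennreal (k * c powr (- k))"
    using k by (simp add: ennreal_plus[symmetric] algebra_simps del: ennreal_plus)
  then have "ennreal (c powr (- k)) \<le> avg (\<lambda>x. ennreal (a x powr (- g))) z"
    by (simp add: add.commute ennreal_add_left_cancel_le)
  also have "c powr (- k) = w z powr (- g)" using r by (simp add: c_def powr_powr k_def)
  finally show ?thesis .
qed

lemma integral_neg_powr_le: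
  assumes [measurable]: "u \<in> borel_measurable (Xplus M)" and g: "0 \<le> g"
  shows "(\<integral>\<^sup>+z. u z * ennreal (w z powr (- g)) \<partial>Xplus M) \<le> (\<integral>\<^sup>+x. ennreal (a x powr (- g)) * cone_int u x \<partial>M)"
proof -
  have "(\<integral>\<^sup>+z. u z * ennreal (w z powr (- g)) \<partial>Xplus M) \<le> (\<integral>\<^sup>+z. u z * avg (\<lambda>x. ennreal (a x powr (- g))) z \<partial>Xplus M)"
    by (intro nn_integral_mono mult_left_mono w_neg_powr_le g) (auto simp: space_XplusD)
  also have "\<dots> = (\<integral>\<^sup>+x. ennreal (a x powr (- g)) * cone_int u x \<partial>M)"
    by (intro cone_int_swap[symmetric]) auto
  finally show ?thesis .
qed

lemma cone_int_pos_powr_le: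
  assumes [measurable]: "u \<in> borel_measurable (Xplus M)" and d: "0 \<le> d"
  shows "AE x in M. cone_int (\<lambda>z. u z * ennreal (w z powr d)) x \<le> ennreal (b x powr d) * cone_int u x"
  using w_le_b
proof eventually_elim
  case (elim x)
  have "cone_int (\<lambda>z. u z * ennreal (w z powr d)) x \<le> cone_int (\<lambda>z. ennreal (b x powr d) * u z) x"
    using elim d by (intro cone_int_mono)
      (auto simp: mult.commute[of "u _"] dest!: in_coneD intro!: mult_right_mono ennreal_leI powr_mono2 w_nonneg)
  also have "\<dots> = ennreal (b x powr d) * cone_int u x"
    unfolding cone_int_eq by (subst nn_integral_cmult[symmetric]) (auto intro!: nn_integral_cong simp: mult_ac)
  finally show ?case .
qed

lemma integral_eq_cone_int:
  assumes [measurable]: "u \<in> borel_measurable (Xplus M)"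
  shows "(\<integral>\<^sup>+z. u z \<partial>Xplus M) = (\<integral>\<^sup>+x. cone_int u x \<partial>M)"
proof -
  have "(\<integral>\<^sup>+z. u z \<partial>Xplus M) = (\<integral>\<^sup>+z. u z * avg (\<lambda>_. 1) z \<partial>Xplus M)"
    by (intro nn_integral_cong) (simp add: avg_const space_XplusD)
  also have "\<dots> = (\<integral>\<^sup>+x. 1 * cone_int u x \<partial>M)" by (intro cone_int_swap[symmetric]) auto
  finally show ?thesis by simp
qed

text \<open>Opposite in direction to \<open>w_neg_powr_le\<close>: with \<open>b\<close> in place of
  \<open>a\<close> the average of a negative power is at most that power of \<open>w\<close>, since
  \<open>w z\<close> is at most \<open>b\<close> almost everywhere on the ball.\<close>

lemma avg_b_neg_le:
  assumes z: "0 < snd z" and s: "0 \<le> s"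
  shows "avg (\<lambda>x. ennreal (b x powr (- s))) z \<le> ennreal (w z powr (- s))"
proof -
  have "avg (\<lambda>x. ennreal (b x powr (- s))) z \<le> avg (\<lambda>x. ennreal (w z powr (- s))) z"
    using w_le_b
  proof (intro avg_mono_AE, eventually_elim)
    case (elim x)
    show ?case using s w_pos[OF z] elim(2)[rule_format, of z] by (auto simp: dist_commute intro!: ennreal_leI powr_mono2')
  qed
  then show ?thesis using z by (simp add: avg_const)
qed

lemma integral_G_neg:
  assumes g: "0 \<le> g" 
  shows "(\<integral>\<^sup>+z. G z * ennreal (w z powr (- g)) \<partial>Xplus M) \<le> (\<integral>\<^sup>+x. ennreal (a x powr (q - g)) \<partial>M)"
proof -
  have "(\<integral>\<^sup>+z. G z * ennreal (w z powr (- g)) \<partial>Xplus M) \<le> (\<integral>\<^sup>+x. ennreal (a x powr (- g)) * cone_int G x \<partial>M)"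
    by (intro integral_neg_powr_le g) auto
  also have "\<dots> \<le> (\<integral>\<^sup>+x. ennreal (a x powr (- g)) * ennreal (a x powr q) \<partial>M)"
    using G_cone by (intro nn_integral_mono_AE) (auto elim!: eventually_mono intro!: mult_left_mono)
  also have "\<dots> = (\<integral>\<^sup>+x. ennreal (a x powr (q - g)) \<partial>M)"
    using a_pos by (simp add: ennreal_powr_mult)
  finally show ?thesis .
qed

lemma integral_G_pos:
  assumes d: "0 \<le> d"
  shows "(\<integral>\<^sup>+z. G z * ennreal (w z powr d) \<partial>Xplus M) \<le> (\<integral>\<^sup>+x. ennreal (b x powr d) * ennreal (a x powr q) \<partial>M)"
proof -
  have "(\<integral>\<^sup>+z. G z * ennreal (w z powr d) \<partial>Xplus M) = (\<integral>\<^sup>+x. cone_int (\<lambda>z. G z * ennreal (w z powr d)) x \<partial>M)"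
    by (intro integral_eq_cone_int) auto
  also have "\<dots> \<le> (\<integral>\<^sup>+x. ennreal (b x powr d) * ennreal (a x powr q) \<partial>M)"
  proof (intro nn_integral_mono_AE)
    have "AE x in M. cone_int (\<lambda>z. G z * ennreal (w z powr d)) x \<le> ennreal (b x powr d) * cone_int G x"
      by (intro cone_int_pos_powr_le d) auto
    then show "AE x in M. cone_int (\<lambda>z. G z * ennreal (w z powr d)) x \<le> ennreal (b x powr d) * ennreal (a x powr q)"
      using G_cone by eventually_elim (rule order_trans, assumption, rule mult_left_mono, assumption, simp)
  qed
  finally show ?thesis .
qed

subsection \<open>Upper bounds for the factors\<close>

text \<open>For a target space with outer exponent \<open>P\<close> and inner exponent
  \<open>Q\<close>, and for \<open>e = (p / P - q / Q) * Q\<close>, this is the \<open>Q\<close>-th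
  power of the conical functional of the factor. The power \<open>\<alpha> = P / Q\<close> below
  yields its \<open>P\<close>-th power, and \<open>(q + e) * \<alpha> = p\<close> is the homogeneity
  relation.\<close>

definition S :: "real \<Rightarrow> 'a \<Rightarrow> ennreal" where
  "S e x = cone_int (\<lambda>z. G z * ennreal (w z powr e)) x"

lemma S_meas [measurable]: "S e \<in> borel_measurable M"
  unfolding S_def[abs_def] by measurable

lemma S_pos_bound:
  assumes \<alpha>: "0 < \<alpha>" and e: "0 \<le> e" "(q + e) * \<alpha> = p"
  shows "(\<integral>\<^sup>+x. epow (S e x) \<alpha> \<partial>M) \<le> ennreal Cb"
proof -
  have "AE x in M. S e x \<le> ennreal (b x powr e) * cone_int G x"
    unfolding S_def by (intro cone_int_pos_powr_le e) auto
  then have "AE x in M. epow (S e x) \<alpha> \<le> ennreal (b x powr p)"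
    using G_cone
  proof eventually_elim
    case (elim x)
    have "S e x \<le> ennreal (b x powr e) * ennreal (b x powr q)"
      using elim a_le_b[of x] a_pos[of x] q
      by (intro order_trans[OF elim(1)] mult_left_mono order_trans[OF elim(2)] ennreal_leI powr_mono2) auto
    then have "epow (S e x) \<alpha> \<le> epow (ennreal (b x powr (q + e))) \<alpha>"
      using \<alpha> b_pos[of x] by (intro epow_mono) (auto simp: ennreal_powr_mult add.commute)
    then show ?case using e b_pos[of x] by (simp add: epow_ennreal_powr less_imp_le)
  qed
  then have "(\<integral>\<^sup>+x. epow (S e x) \<alpha> \<partial>M) \<le> (\<integral>\<^sup>+x. ennreal (b x powr p) \<partial>M)" by (intro nn_integral_mono_AE)
  then show ?thesis using b_int by (rule order_trans)
qed

text \<open>For \<open>\<alpha> = 1\<close> this is Fubini and Jensen. For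
  \<open>\<alpha> < 1\<close> a power of \<open>b\<close> is inserted and removed, so that Hoelder's
  inequality leaves only a weighted integral of the first power of \<open>S\<close>.\<close>

lemma S_neg_bound_le1:
  assumes \<alpha>: "0 < \<alpha>" "\<alpha> \<le> 1" and g: "0 \<le> g" "(q - g) * \<alpha> = p"
  shows "(\<integral>\<^sup>+x. epow (S (- g) x) \<alpha> \<partial>M) \<le> ennreal Cb"
proof (cases "\<alpha> = 1")
  case True
  have "(\<integral>\<^sup>+x. S (- g) x \<partial>M) = (\<integral>\<^sup>+z. G z * ennreal (w z powr (- g)) \<partial>Xplus M)"
    unfolding S_def by (intro integral_eq_cone_int[symmetric]) auto
  also have "\<dots> \<le> (\<integral>\<^sup>+x. ennreal (a x powr (q - g)) \<partial>M)" by (intro integral_G_neg g)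
  also have "\<dots> \<le> ennreal Cb" using a_int A_le_Cb True g by (auto intro: order_trans ennreal_leI)
  finally show ?thesis using True by simp
next
  case False
  \<comment> \<open>Chosen so that the powers of \<open>b\<close> in the Hoelder splitting cancel.
    Then also \<open>q - (g + s) = p\<close>, and the weighted integral of \<open>S\<close> is
    bounded by that of \<open>a powr p\<close>.\<close>
  define s where "s = p * (1 - \<alpha>) / \<alpha>"
  have s: "0 \<le> s" "s * \<alpha> = p * (1 - \<alpha>)" using \<alpha> p by (auto simp: s_def)
  have eq: "q - (g + s) = p"
  proof -
    have "(q - g - s) * \<alpha> = p * \<alpha>" using g(2) s(2) by (simp add: algebra_simps)
    then show ?thesis using \<alpha> by simp
  qed
  have "(\<integral>\<^sup>+x. ennreal (b x powr (- s)) * S (- g) x \<partial>M)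
      = (\<integral>\<^sup>+z. (G z * ennreal (w z powr (- g))) * avg (\<lambda>x. ennreal (b x powr (- s))) z \<partial>Xplus M)"
    unfolding S_def by (intro cone_int_swap) auto
  also have "\<dots> \<le> (\<integral>\<^sup>+z. G z * ennreal (w z powr (- (g + s))) \<partial>Xplus M)"
  proof (intro nn_integral_mono)
    fix z assume "z \<in> space (Xplus M)"
    then have z: "0 < snd z" by (rule space_XplusD)
    have "(G z * ennreal (w z powr (- g))) * avg (\<lambda>x. ennreal (b x powr (- s))) z
      \<le> (G z * ennreal (w z powr (- g))) * ennreal (w z powr (- s))"
      by (intro mult_left_mono avg_b_neg_le z s) auto
    also have "\<dots> = G z * ennreal (w z powr (- (g + s)))"
      using ennreal_powr_mult[OF w_pos[OF z], of "- g" "- s"] by (simp add: mult.assoc)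
    finally show "(G z * ennreal (w z powr (- g))) * avg (\<lambda>x. ennreal (b x powr (- s))) z \<le> G z * ennreal (w z powr (- (g + s)))" .
  qed
  also have "\<dots> \<le> (\<integral>\<^sup>+x. ennreal (a x powr (q - (g + s))) \<partial>M)" using g s by (intro integral_G_neg) auto
  also have "\<dots> \<le> ennreal Cb" unfolding eq using a_int A_le_Cb by (auto intro: order_trans ennreal_leI)
  finally have 1: "(\<integral>\<^sup>+x. ennreal (b x powr (- s)) * S (- g) x \<partial>M) \<le> ennreal Cb" .
  have "(\<integral>\<^sup>+x. epow (S (- g) x) \<alpha> \<partial>M) = (\<integral>\<^sup>+x. epow (ennreal (b x powr (- s)) * S (- g) x) \<alpha> * epow (ennreal (b x powr p)) (1 - \<alpha>) \<partial>M)"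
  proof (intro nn_integral_cong)
    fix x
    have "ennreal (b x powr (- s * \<alpha>)) * ennreal (b x powr (p * (1 - \<alpha>))) = 1"
      using s b_pos[of x] by (simp add: ennreal_powr_mult)
    then show "epow (S (- g) x) \<alpha> = epow (ennreal (b x powr (- s)) * S (- g) x) \<alpha> * epow (ennreal (b x powr p)) (1 - \<alpha>)"
      using b_pos[of x] by (simp add: epow_mult epow_ennreal_powr less_imp_le mult.commute[of _ "epow (S (- g) x) \<alpha>"] mult.assoc)
  qed
  also have "\<dots> \<le> epow (\<integral>\<^sup>+x. ennreal (b x powr (- s)) * S (- g) x \<partial>M) \<alpha> * epow (\<integral>\<^sup>+x. ennreal (b x powr p) \<partial>M) (1 - \<alpha>)"
    using False \<alpha> by (intro nn_integral_Holder) auto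
  also have "\<dots> \<le> epow (ennreal Cb) \<alpha> * epow (ennreal Cb) (1 - \<alpha>)"
    using \<alpha> by (intro mult_mono epow_mono 1 b_int) auto
  also have "\<dots> = ennreal Cb" by (simp add: epow_add[symmetric])
  finally show ?thesis .
qed

text \<open>Duality between the exponents \<open>\<alpha>\<close> and \<open>\<beta>\<close>: tested
  against \<open>k\<close>, the integral is moved to the half space, \<open>w\<close> is replaced by
  averages of \<open>a\<close>, and moving back costs the maximal function of \<open>k\<close>,
  which is bounded at the exponent \<open>\<beta>\<close>.\<close>

lemma S_neg_bound_gt1:
  assumes \<alpha>: "1 < \<alpha>" and g: "0 \<le> g" "(q - g) * \<alpha> = p"
  shows "(\<integral>\<^sup>+x. epow (S (- g) x) \<alpha> \<partial>M) \<le> ennreal (Mx_const (\<alpha> / (\<alpha> - 1)) powr (\<alpha> - 1) * A)"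
proof -
  define \<beta> where "\<beta> = \<alpha> / (\<alpha> - 1)"
  have \<beta>: "1 < \<beta>" "\<beta> / (\<beta> - 1) = \<alpha>" "1 - 1 / \<beta> = 1 / \<alpha>" "(\<alpha> - 1) * \<beta> = \<alpha>"
    using \<alpha> by (auto simp: \<beta>_def divide_simps)
  define c where "c = Mx_const \<beta>"
  have c: "0 \<le> c" using Mx_const_nonneg[OF \<beta>(1)] by (simp add: c_def)
  \<comment> \<open>The extremal test function is \<open>S powr (\<alpha> - 1)\<close>. Truncation
    in height and to a ball makes the integral \<open>H\<close> finite, so that a power of it can be
    divided out.\<close>
  define T where "T n x = min (S (- g) x) (of_nat n)" for n x
  define h where "h n x = indicator (ball undefined (real n)) x * epow (T n x) (\<alpha> - 1)" for n x
  have [measurable]: "T n \<in> borel_measurable M" "h n \<in> borel_measurable M" for n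
    unfolding T_def[abs_def] h_def[abs_def] by measurable
  have dual: "(\<integral>\<^sup>+x. k x * S (- g) x \<partial>M) \<le> epow (ennreal c * (\<integral>\<^sup>+x. epow (k x) \<beta> \<partial>M)) (1 / \<beta>) * epow (ennreal A) (1 / \<alpha>)"
    if [measurable]: "k \<in> borel_measurable M" for k
  proof -
    have "(\<integral>\<^sup>+x. k x * S (- g) x \<partial>M) = (\<integral>\<^sup>+z. (G z * ennreal (w z powr (- g))) * avg k z \<partial>Xplus M)"
      unfolding S_def by (intro cone_int_swap) auto
    also have "\<dots> \<le> (\<integral>\<^sup>+z. G z * avg (\<lambda>x. Mx k x * ennreal (a x powr (- g))) z \<partial>Xplus M)"
    proof (intro nn_integral_mono)
      fix z assume "z \<in> space (Xplus M)"
      then have z: "0 < snd z" by (rule space_XplusD)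
      \<comment> \<open>A product of two averages becomes one average: \<open>avg k z\<close> is at
        most \<open>Mx k x\<close> at each point \<open>x\<close> of the ball, so it can be moved
        inside.\<close>
      have "ennreal (w z powr (- g)) * avg k z \<le> avg k z * avg (\<lambda>x. ennreal (a x powr (- g))) z"
        using w_neg_powr_le[OF z g(1)] by (subst mult.commute) (intro mult_left_mono, auto)
      also have "\<dots> = avg (\<lambda>x. avg k z * ennreal (a x powr (- g))) z" by (simp add: avg_cmult)
      also have "\<dots> \<le> avg (\<lambda>x. Mx k x * ennreal (a x powr (- g))) z"
        by (intro avg_mono mult_right_mono avg_le_Mx) (auto simp: dist_commute)
      finally show "(G z * ennreal (w z powr (- g))) * avg k z \<le> G z * avg (\<lambda>x. Mx k x * ennreal (a x powr (- g))) z"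
        by (simp add: mult.assoc mult_left_mono)
    qed
    also have "\<dots> = (\<integral>\<^sup>+x. (Mx k x * ennreal (a x powr (- g))) * cone_int G x \<partial>M)"
      by (intro cone_int_swap[symmetric]) auto
    also have "\<dots> \<le> (\<integral>\<^sup>+x. Mx k x * ennreal (a x powr (q - g)) \<partial>M)"
    proof (intro nn_integral_mono_AE)
      show "AE x in M. (Mx k x * ennreal (a x powr (- g))) * cone_int G x \<le> Mx k x * ennreal (a x powr (q - g))"
        using G_cone
      proof eventually_elim
        case (elim x)
        have "(Mx k x * ennreal (a x powr (- g))) * cone_int G x \<le> (Mx k x * ennreal (a x powr (- g))) * ennreal (a x powr q)"
          by (intro mult_left_mono elim) auto
        then show ?case using a_pos[of x] by (simp add: mult.assoc ennreal_powr_mult)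
      qed
    qed
    also have "\<dots> \<le> epow (\<integral>\<^sup>+x. epow (Mx k x) \<beta> \<partial>M) (1 / \<beta>) * epow (\<integral>\<^sup>+x. epow (ennreal (a x powr (q - g))) (\<beta> / (\<beta> - 1)) \<partial>M) (1 - 1 / \<beta>)"
      by (intro nn_integral_Holder' \<beta>) auto
    also have "\<dots> = epow (\<integral>\<^sup>+x. epow (Mx k x) \<beta> \<partial>M) (1 / \<beta>) * epow (\<integral>\<^sup>+x. ennreal (a x powr p) \<partial>M) (1 / \<alpha>)"
      unfolding \<beta> using a_pos g by (simp add: epow_ennreal_powr less_imp_le)
    also have "\<dots> \<le> epow (ennreal c * (\<integral>\<^sup>+x. epow (k x) \<beta> \<partial>M)) (1 / \<beta>) * epow (ennreal A) (1 / \<alpha>)"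
      unfolding c_def using \<alpha> \<beta> by (intro mult_mono epow_mono Mx_strong_type a_int) auto
    finally show ?thesis .
  qed
  have bound: "(\<integral>\<^sup>+x. epow (h n x) \<beta> \<partial>M) \<le> ennreal (c powr (\<alpha> - 1) * A)" for n
  proof -
    define H where "H = (\<integral>\<^sup>+x. epow (h n x) \<beta> \<partial>M)"
    have hb: "epow (h n x) \<beta> = indicator (ball undefined (real n)) x * epow (T n x) \<alpha>" for x
      using \<beta> by (auto simp: h_def epow_mult epow_epow split: split_indicator)
    have "H \<le> (\<integral>\<^sup>+x. epow (of_nat n) \<alpha> * indicator (ball undefined (real n)) x \<partial>M)"
      unfolding H_def hb using \<alpha> by (intro nn_integral_mono) (auto simp: T_def split: split_indicator intro!: epow_mono)
    also have "\<dots> < top" by (simp add: nn_integral_cmult emeasure_ball ennreal_mult_less_top of_nat_less_top)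
    finally have fin: "H < top" .
    have "H \<le> (\<integral>\<^sup>+x. h n x * S (- g) x \<partial>M)"
      unfolding H_def hb
    proof (intro nn_integral_mono)
      fix x
      have "epow (T n x) \<alpha> = epow (T n x) (\<alpha> - 1) * T n x" using epow_add[of "T n x" "\<alpha> - 1" 1] by simp
      also have "\<dots> \<le> epow (T n x) (\<alpha> - 1) * S (- g) x" by (intro mult_left_mono) (auto simp: T_def)
      finally show "indicator (ball undefined (real n)) x * epow (T n x) \<alpha> \<le> h n x * S (- g) x"
        by (auto simp: h_def split: split_indicator)
    qed
    also have "\<dots> \<le> epow (ennreal c * H) (1 / \<beta>) * epow (ennreal A) (1 / \<alpha>)"
      unfolding H_def by (intro dual) auto
    finally have HH: "H \<le> epow (ennreal c * H) (1 / \<beta>) * epow (ennreal A) (1 / \<alpha>)" .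
    obtain H' where H': "H = ennreal H'" "0 \<le> H'" using fin by (cases H) auto
    have le: "H' \<le> (c * H') powr (1 / \<beta>) * A powr (1 / \<alpha>)"
      using HH c A unfolding H'(1) by (simp add: epow_ennreal ennreal_mult[symmetric] H'(2))
    \<comment> \<open>The inequality \<open>le\<close> is solved for \<open>H'\<close>: cancelling
      \<open>H' powr (1 / \<beta>)\<close> and taking the power \<open>\<alpha>\<close> gives the
      exponent \<open>\<alpha> / \<beta> = \<alpha> - 1\<close> on \<open>c\<close>.\<close>
    have "H' \<le> c powr (\<alpha> - 1) * A"
    proof (cases "H' = 0")
      case False
      then have pos: "0 < H'" using H' by simp
      have "H' powr (1 / \<beta>) * H' powr (1 / \<alpha>) = H'" using \<beta>(3) pos by (simp add: powr_add[symmetric] algebra_simps)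
      then have "H' powr (1 / \<beta>) * H' powr (1 / \<alpha>) \<le> H' powr (1 / \<beta>) * (c powr (1 / \<beta>) * A powr (1 / \<alpha>))"
        using le c pos by (simp add: powr_mult mult_ac)
      then have "H' powr (1 / \<alpha>) \<le> c powr (1 / \<beta>) * A powr (1 / \<alpha>)" using pos by simp
      then have "(H' powr (1 / \<alpha>)) powr \<alpha> \<le> (c powr (1 / \<beta>) * A powr (1 / \<alpha>)) powr \<alpha>"
        using \<alpha> by (intro powr_mono2) auto
      moreover have "1 / \<beta> * \<alpha> = \<alpha> - 1" using \<alpha> by (simp add: \<beta>_def)
      ultimately show ?thesis using \<alpha> c A pos by (simp add: powr_powr powr_mult)
    qed (use c A in auto)
    then show ?thesis unfolding H_def[symmetric] H' by (rule ennreal_leI)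
  qed
  have "(\<integral>\<^sup>+x. epow (S (- g) x) \<alpha> \<partial>M) = (\<integral>\<^sup>+x. (SUP n. epow (h n x) \<beta>) \<partial>M)"
  proof (intro nn_integral_cong)
    fix x
    have hb: "epow (h n x) \<beta> = indicator (ball undefined (real n)) x * epow (T n x) \<alpha>" for n
      using \<beta> by (auto simp: h_def epow_mult epow_epow split: split_indicator)
    obtain N :: nat where N: "dist undefined x < real N" using reals_Archimedean2 by blast
    have "epow (S (- g) x) \<alpha> \<le> (SUP n. epow (h n x) \<beta>)"
    proof -
      \<comment> \<open>Shifting the index by \<open>N\<close> keeps \<open>x\<close> inside the
        truncating ball throughout the supremum.\<close>
      have "S (- g) x \<le> (SUP n. T (n + N) x)"
      proof (cases "S (- g) x = top")
        case True
        have "(SUP n. of_nat (n + N) :: ennreal) = top"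
        proof (rule ccontr)
          assume "(SUP n. of_nat (n + N) :: ennreal) \<noteq> top"
          then obtain m :: nat where "(SUP n. of_nat (n + N) :: ennreal) < of_nat m"
            using ennreal_Ex_less_of_nat less_top by blast
          also have "(of_nat m :: ennreal) \<le> of_nat (m + N)" by simp
          also have "\<dots> \<le> (SUP n. of_nat (n + N))" by (rule SUP_upper) simp
          finally show False by simp
        qed
        then show ?thesis unfolding T_def True by (simp only: min_absorb2[OF top_greatest])
      next
        case False
        then obtain m :: nat where "S (- g) x < of_nat m" using ennreal_Ex_less_of_nat less_top by blast
        then have "S (- g) x \<le> T (m + N) x" by (auto simp: T_def less_imp_le intro: order_trans add_increasing2)
        then show ?thesis by (intro SUP_upper2[of m]) auto
      qed
      then have "epow (S (- g) x) \<alpha> \<le> (SUP n. epow (T (n + N) x) \<alpha>)"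
        using \<alpha> by (subst epow_SUP[symmetric]) (auto intro: epow_mono)
      also have "\<dots> \<le> (SUP n. epow (h n x) \<beta>)"
        unfolding hb using N by (intro SUP_mono bexI[of _ "_ + N"]) (auto simp: split: split_indicator)
      finally show ?thesis .
    qed
    moreover have "(SUP n. epow (h n x) \<beta>) \<le> epow (S (- g) x) \<alpha>"
      unfolding hb using \<alpha> by (intro SUP_least) (auto simp: T_def split: split_indicator intro!: epow_mono)
    ultimately show "epow (S (- g) x) \<alpha> = (SUP n. epow (h n x) \<beta>)" by simp
  qed
  also have "\<dots> = (SUP n. \<integral>\<^sup>+x. epow (h n x) \<beta> \<partial>M)"
  proof (intro nn_integral_monotone_convergence_SUP)
    show "incseq (\<lambda>n x. epow (h n x) \<beta>)"
      unfolding incseq_def le_fun_def h_def T_def using \<alpha> \<beta>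
      by (intro allI impI epow_mono mult_mono) (auto split: split_indicator intro: min.coboundedI2)
  qed auto
  also have "\<dots> \<le> ennreal (c powr (\<alpha> - 1) * A)" by (intro SUP_least bound)
  finally show ?thesis by (simp add: c_def \<beta>_def)
qed

text \<open>A sum in place of a case distinction on \<open>\<alpha>\<close>: both summands are
  nonnegative, so each of the bounds lies below it.\<close>

definition CS :: "real \<Rightarrow> real" where
  "CS \<alpha> = Cb + Mx_const (\<alpha> / (\<alpha> - 1)) powr (\<alpha> - 1) * A"

lemma S_bound:
  assumes \<alpha>: "0 < \<alpha>" and e: "(q + e) * \<alpha> = p"
  shows "(\<integral>\<^sup>+x. epow (S e x) \<alpha> \<partial>M) \<le> ennreal (CS \<alpha>)"
proof -
  have "0 \<le> Cb" using A A_le_Cb by simp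
  then have "Cb \<le> CS \<alpha>" "Mx_const (\<alpha> / (\<alpha> - 1)) powr (\<alpha> - 1) * A \<le> CS \<alpha>" using A by (auto simp: CS_def)
  then show ?thesis
    using S_pos_bound[of \<alpha> e] S_neg_bound_le1[of \<alpha> "- e"] S_neg_bound_gt1[of \<alpha> "- e"] assms
    by (cases "0 \<le> e"; cases "\<alpha> \<le> 1") (auto intro: order_trans ennreal_leI)
qed

text \<open>The factor at an infinite exponent. Jensen and Fubini move the integral to the base,
  where \<open>a powr (- q) * a powr q = 1\<close>. For \<open>y\<close> outside the ball the cone
  misses the tent, because \<open>y\<close> lies in the ball of every \<open>z\<close> in its
  cone.\<close>

lemma tent_integral_bound:
  "(\<integral>\<^sup>+z. indicator (tent (ball x r')) z * (G z * ennreal (w z powr (- q))) \<partial>Xplus M) \<le> emeasure M (ball x r')"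
proof -
  have "(\<integral>\<^sup>+z. indicator (tent (ball x r')) z * (G z * ennreal (w z powr (- q))) \<partial>Xplus M)
    = (\<integral>\<^sup>+z. (indicator (tent (ball x r')) z * G z) * ennreal (w z powr (- q)) \<partial>Xplus M)"
    by (simp add: mult.assoc)
  also have "\<dots> \<le> (\<integral>\<^sup>+y. ennreal (a y powr (- q)) * cone_int (\<lambda>z. indicator (tent (ball x r')) z * G z) y \<partial>M)"
    using q by (intro integral_neg_powr_le) auto
  also have "\<dots> \<le> (\<integral>\<^sup>+y. indicator (ball x r') y \<partial>M)"
  proof (intro nn_integral_mono_AE)
    show "AE y in M. ennreal (a y powr (- q)) * cone_int (\<lambda>z. indicator (tent (ball x r')) z * G z) y \<le> indicator (ball x r') y"
      using G_cone
    proof eventually_elim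
      case (elim y)
      show ?case
      proof (cases "y \<in> ball x r'")
        case True
        have "cone_int (\<lambda>z. indicator (tent (ball x r')) z * G z) y \<le> cone_int G y"
          by (intro cone_int_mono) (auto split: split_indicator)
        then have "ennreal (a y powr (- q)) * cone_int (\<lambda>z. indicator (tent (ball x r')) z * G z) y
          \<le> ennreal (a y powr (- q)) * ennreal (a y powr q)"
          using elim by (intro mult_left_mono) auto
        then show ?thesis using True a_pos[of y] by (simp add: ennreal_powr_mult)
      next
        case False
        have "cone_int (\<lambda>z. indicator (tent (ball x r')) z * G z) y \<le> cone_int (\<lambda>z. 0) y"
        proof (intro cone_int_mono)
          fix z assume "z \<in> cone y"
          then have "y \<in> ball (fst z) (snd z)" by (auto dest: in_coneD simp: dist_commute)
          then have "z \<notin> tent (ball x r')" using False unfolding in_tent_iff by blast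
          then show "indicator (tent (ball x r')) z * G z \<le> 0" by simp
        qed
        then show ?thesis by (simp add: cone_int_def)
      qed
    qed
  qed
  also have "\<dots> = emeasure M (ball x r')" by simp
  finally show ?thesis .
qed

subsection \<open>Pairing estimates\<close>

lemma Cb_nonneg: "0 \<le> Cb"
  using A A_le_Cb by simp

text \<open>\<open>u\<close> is paired with the dual factor of exponents \<open>P\<close> and
  \<open>Q\<close>. Hoelder on the cone produces the conical functional of \<open>u\<close> times a
  power of \<open>a\<close>. The sign of the exponent of \<open>w\<close> decides whether
  \<open>w\<close> is moved to the base by the majorant \<open>b\<close> or by Jensen; in both cases
  the powers combine to \<open>b powr (p * (1 - 1 / P))\<close>, and Hoelder on the base
  concludes.\<close>

lemma pairing_bound_finite:
  assumes u [measurable]: "u \<in> borel_measurable (Xplus M)" and P: "1 \<le> P" and Q: "1 < Q"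
  shows "(\<integral>\<^sup>+z. (u z * epow (G z) (1 - 1 / Q)) * ennreal (w z powr (p * (1 - 1 / P) - q * (1 - 1 / Q))) \<partial>Xplus M)
     \<le> ennreal (1 + Cb) * Lnorm M P (\<lambda>x. epow (cone_int (\<lambda>z. epow (u z) Q) x) (1 / Q))"
proof -
  define \<beta> where "\<beta> = p * (1 - 1 / P) - q * (1 - 1 / Q)"
  let ?U = "\<lambda>x. epow (cone_int (\<lambda>z. epow (u z) Q) x) (1 / Q)"
  let ?v = "\<lambda>z. u z * epow (G z) (1 - 1 / Q)"
  have Q': "0 \<le> 1 - 1 / Q" using Q by simp
  have cone: "AE x in M. cone_int ?v x \<le> ?U x * ennreal (a x powr (q * (1 - 1 / Q)))"
    using G_cone
  proof eventually_elim
    case (elim x)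
    have "epow (cone_int G x) (1 - 1 / Q) \<le> ennreal (a x powr (q * (1 - 1 / Q)))"
      using epow_mono[OF elim Q'] a_pos[of x] by (simp add: epow_ennreal_powr less_imp_le)
    then show ?case
      using cone_int_Holder[OF u G_meas Q, of x] by (meson mult_left_mono order_trans zero_le)
  qed
  have "(\<integral>\<^sup>+z. ?v z * ennreal (w z powr \<beta>) \<partial>Xplus M) \<le> (\<integral>\<^sup>+x. ennreal (b x powr (p * (1 - 1 / P))) * ?U x \<partial>M)"
  proof (cases "0 \<le> \<beta>")
    case True
    have "(\<integral>\<^sup>+z. ?v z * ennreal (w z powr \<beta>) \<partial>Xplus M) = (\<integral>\<^sup>+x. cone_int (\<lambda>z. ?v z * ennreal (w z powr \<beta>)) x \<partial>M)"
      by (intro integral_eq_cone_int) auto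
    also have "\<dots> \<le> (\<integral>\<^sup>+x. ennreal (b x powr (p * (1 - 1 / P))) * ?U x \<partial>M)"
    proof (intro nn_integral_mono_AE)
      have "AE x in M. cone_int (\<lambda>z. ?v z * ennreal (w z powr \<beta>)) x \<le> ennreal (b x powr \<beta>) * cone_int ?v x"
        by (intro cone_int_pos_powr_le True) auto
      then show "AE x in M. cone_int (\<lambda>z. ?v z * ennreal (w z powr \<beta>)) x \<le> ennreal (b x powr (p * (1 - 1 / P))) * ?U x"
        using cone
      proof eventually_elim
        case (elim x)
        have "cone_int ?v x \<le> ?U x * ennreal (b x powr (q * (1 - 1 / Q)))"
          using q Q a_le_b[of x] a_pos[of x]
          by (intro order_trans[OF elim(2)] mult_left_mono ennreal_leI powr_mono2) (auto intro: mult_nonneg_nonneg)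
        then have "cone_int (\<lambda>z. ?v z * ennreal (w z powr \<beta>)) x \<le> ennreal (b x powr \<beta>) * (?U x * ennreal (b x powr (q * (1 - 1 / Q))))"
          by (intro order_trans[OF elim(1)] mult_left_mono) auto
        also have "\<dots> = (ennreal (b x powr \<beta>) * ennreal (b x powr (q * (1 - 1 / Q)))) * ?U x" by (simp only: mult_ac)
        also have "\<dots> = ennreal (b x powr (p * (1 - 1 / P))) * ?U x"
          using b_pos[of x] by (simp add: ennreal_powr_mult \<beta>_def)
        finally show ?case .
      qed
    qed
    finally show ?thesis .
  next
    case False
    then have "(\<integral>\<^sup>+z. ?v z * ennreal (w z powr \<beta>) \<partial>Xplus M) \<le> (\<integral>\<^sup>+x. ennreal (a x powr \<beta>) * cone_int ?v x \<partial>M)"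
      using integral_neg_powr_le[of ?v "- \<beta>"] by simp
    also have "\<dots> \<le> (\<integral>\<^sup>+x. ennreal (b x powr (p * (1 - 1 / P))) * ?U x \<partial>M)"
    proof (intro nn_integral_mono_AE)
      show "AE x in M. ennreal (a x powr \<beta>) * cone_int ?v x \<le> ennreal (b x powr (p * (1 - 1 / P))) * ?U x"
        using cone
      proof eventually_elim
        case (elim x)
        have "ennreal (a x powr \<beta>) * cone_int ?v x \<le> ennreal (a x powr \<beta>) * (?U x * ennreal (a x powr (q * (1 - 1 / Q))))"
          by (intro mult_left_mono elim) auto
        also have "\<dots> = (ennreal (a x powr \<beta>) * ennreal (a x powr (q * (1 - 1 / Q)))) * ?U x" by (simp only: mult_ac)
        also have "\<dots> = ennreal (a x powr (p * (1 - 1 / P))) * ?U x"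
          using a_pos[of x] by (simp add: ennreal_powr_mult \<beta>_def)
        also have "\<dots> \<le> ennreal (b x powr (p * (1 - 1 / P))) * ?U x"
          using p P a_le_b[of x] a_pos[of x] by (intro mult_right_mono ennreal_leI powr_mono2) auto
        finally show ?case .
      qed
    qed
    finally show ?thesis .
  qed
  also have "\<dots> \<le> ennreal (1 + Cb) * Lnorm M P ?U"
  \<comment> \<open>For \<open>P = 1\<close> the power of \<open>b\<close> is the constant 1 and
    there is no finite conjugate exponent.\<close>
  proof (cases "P = 1")
    case True
    have "(\<integral>\<^sup>+x. ennreal (b x powr (p * (1 - 1 / P))) * ?U x \<partial>M) = 1 * Lnorm M P ?U"
      using True b_pos by (simp add: Lnorm_def less_imp_neq[THEN not_sym])
    also have "\<dots> \<le> ennreal (1 + Cb) * Lnorm M P ?U"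
      using Cb_nonneg by (intro mult_right_mono) (auto simp: ennreal_1[symmetric] simp del: ennreal_1)
    finally show ?thesis .
  next
    case False
    then have P: "1 < P" "(1 - 1 / P) * (P / (P - 1)) = 1" using P by (auto simp: divide_simps)
    have "(\<integral>\<^sup>+x. ennreal (b x powr (p * (1 - 1 / P))) * ?U x \<partial>M)
        \<le> epow (\<integral>\<^sup>+x. epow (?U x) P \<partial>M) (1 / P) * epow (\<integral>\<^sup>+x. epow (ennreal (b x powr (p * (1 - 1 / P)))) (P / (P - 1)) \<partial>M) (1 - 1 / P)"
      by (subst mult.commute) (intro nn_integral_Holder' P, auto)
    also have "\<dots> = Lnorm M P ?U * epow (\<integral>\<^sup>+x. ennreal (b x powr p) \<partial>M) (1 - 1 / P)"
      using P b_pos unfolding Lnorm_def by (simp add: epow_ennreal_powr less_imp_le mult.assoc)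
    also have "\<dots> \<le> Lnorm M P ?U * ennreal (1 + Cb)"
    proof (intro mult_left_mono)
      have "epow (\<integral>\<^sup>+x. ennreal (b x powr p) \<partial>M) (1 - 1 / P) \<le> epow (ennreal (1 + Cb)) (1 - 1 / P)"
        using P Cb_nonneg by (intro epow_mono order_trans[OF b_int] ennreal_leI) auto
      also have "\<dots> = ennreal ((1 + Cb) powr (1 - 1 / P))" using Cb_nonneg by (intro epow_ennreal) simp
      also have "\<dots> \<le> ennreal ((1 + Cb) powr 1)" using Cb_nonneg P by (intro ennreal_leI powr_mono) auto
      finally show "epow (\<integral>\<^sup>+x. ennreal (b x powr p) \<partial>M) (1 - 1 / P) \<le> ennreal (1 + Cb)" using Cb_nonneg by simp
    qed auto
    finally show ?thesis by (simp add: mult.commute)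
  qed
  finally show ?thesis by (simp add: \<beta>_def)
qed

text \<open>The pairing of the normalised function with its own dual. This upper bound supplies the
  second Hoelder factor at an infinite exponent; the matching lower bound is
  \<open>integral_G_lower\<close>.\<close>

lemma integral_G_self: "(\<integral>\<^sup>+z. G z * ennreal (w z powr (p - q)) \<partial>Xplus M) \<le> ennreal Cb"
proof (cases "p < q")
  case True
  have "(\<integral>\<^sup>+z. G z * ennreal (w z powr (- (q - p))) \<partial>Xplus M) \<le> (\<integral>\<^sup>+x. ennreal (a x powr (q - (q - p))) \<partial>M)"
    using True by (intro integral_G_neg) auto
  also have "\<dots> \<le> ennreal Cb" using a_int A_le_Cb by (auto intro: order_trans ennreal_leI)
  finally show ?thesis by simp
next
  case False
  then have "(\<integral>\<^sup>+z. G z * ennreal (w z powr (p - q)) \<partial>Xplus M) \<le> (\<integral>\<^sup>+x. ennreal (b x powr (p - q)) * ennreal (a x powr q) \<partial>M)"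
    by (intro integral_G_pos) auto
  also have "\<dots> \<le> (\<integral>\<^sup>+x. ennreal (b x powr (p - q)) * ennreal (b x powr q) \<partial>M)"
    using a_le_b a_pos q by (intro nn_integral_mono mult_left_mono ennreal_leI powr_mono2) (auto simp: less_imp_le)
  also have "\<dots> = (\<integral>\<^sup>+x. ennreal (b x powr p) \<partial>M)" using b_pos by (simp add: ennreal_powr_mult)
  finally show ?thesis using b_int by (rule order_trans)
qed

text \<open>The exponent of \<open>w\<close> is \<open>p * (1 / Q) + (p - q) * (1 - 1 / Q)\<close>.
  Hoelder on the half space therefore separates \<open>u powr Q * w powr p\<close>, controlled by
  the Carleson embedding with \<open>h = ar\<close>, from \<open>G * w powr (p - q)\<close>.\<close>

lemma pairing_bound_infinite:
  assumes u [measurable]: "u \<in> borel_measurable (Xplus M)" and Q: "1 < Q"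
    and K: "\<And>x r. 0 < r \<Longrightarrow> (\<integral>\<^sup>+z. indicator (tent (ball x r)) z * epow (u z) Q \<partial>Xplus M) \<le> K * emeasure M (ball x r)"
  shows "(\<integral>\<^sup>+z. (u z * epow (G z) (1 - 1 / Q)) * ennreal (w z powr (p - q * (1 - 1 / Q))) \<partial>Xplus M)
     \<le> ennreal (D ^ 3 * Cb) * epow K (1 / Q)"
proof -
  have "(\<integral>\<^sup>+z. (u z * epow (G z) (1 - 1 / Q)) * ennreal (w z powr (p - q * (1 - 1 / Q))) \<partial>Xplus M)
    = (\<integral>\<^sup>+z. epow (epow (u z) Q * epow (avg ar z) (p / r)) (1 / Q) * epow (G z * ennreal (w z powr (p - q))) (1 - 1 / Q) \<partial>Xplus M)"
  proof (intro nn_integral_cong)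
    fix z assume "z \<in> space (Xplus M)"
    then have z: "0 < snd z" by (rule space_XplusD)
    have 1: "epow (avg ar z) (p / r) = ennreal (w z powr p)" using w_powr[OF z] by simp
    have 2: "p - q * (1 - 1 / Q) = p * (1 / Q) + (p - q) * (1 - 1 / Q)" by (simp add: algebra_simps diff_divide_distrib)
    have "epow (ennreal (w z powr p)) (1 / Q) * epow (ennreal (w z powr (p - q))) (1 - 1 / Q) = ennreal (w z powr (p - q * (1 - 1 / Q)))"
      unfolding 2 using w_pos[OF z] by (simp add: epow_ennreal_powr less_imp_le ennreal_powr_mult)
    then show "(u z * epow (G z) (1 - 1 / Q)) * ennreal (w z powr (p - q * (1 - 1 / Q)))
      = epow (epow (u z) Q * epow (avg ar z) (p / r)) (1 / Q) * epow (G z * ennreal (w z powr (p - q))) (1 - 1 / Q)"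
      unfolding 1 epow_mult epow_epow[of "u z"] using Q by (simp add: mult_ac)
  qed
  also have "\<dots> \<le> epow (\<integral>\<^sup>+z. epow (u z) Q * epow (avg ar z) (p / r) \<partial>Xplus M) (1 / Q)
      * epow (\<integral>\<^sup>+z. G z * ennreal (w z powr (p - q)) \<partial>Xplus M) (1 - 1 / Q)"
    using Q by (intro nn_integral_Holder) (auto simp: field_simps)
  also have "\<dots> \<le> epow (K * (ennreal (D ^ 3) * ennreal Cb)) (1 / Q) * epow (ennreal Cb) (1 - 1 / Q)"
  proof (intro mult_mono epow_mono integral_G_self)
    have "(\<integral>\<^sup>+z. epow (u z) Q * epow (avg ar z) (p / r) \<partial>Xplus M) \<le> K * ennreal (D ^ 3) * (\<integral>\<^sup>+x. epow (Mx ar x) (p / r) \<partial>M)"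
      using r p K by (intro Carleson_embedding avg_le_Mx) auto
    also have "\<dots> \<le> K * ennreal (D ^ 3) * ennreal Cb"
      using A by (intro mult_left_mono order_trans[OF Mx_ar_int] ennreal_leI) (auto simp: Cb_def algebra_simps)
    finally show "(\<integral>\<^sup>+z. epow (u z) Q * epow (avg ar z) (p / r) \<partial>Xplus M) \<le> K * (ennreal (D ^ 3) * ennreal Cb)"
      by (simp add: mult.assoc)
  qed (use Q in auto)
  also have "\<dots> = epow K (1 / Q) * epow (ennreal (D ^ 3)) (1 / Q) * (epow (ennreal Cb) (1 / Q) * epow (ennreal Cb) (1 - 1 / Q))"
    unfolding epow_mult by (simp only: mult_ac)
  also have "\<dots> = epow K (1 / Q) * epow (ennreal (D ^ 3)) (1 / Q) * ennreal Cb" by (simp add: epow_add[symmetric])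
  also have "\<dots> \<le> epow K (1 / Q) * ennreal (D ^ 3) * ennreal Cb"
  proof (intro mult_mono order_refl)
    have D1: "1 \<le> D ^ 3" using D by (simp add: one_le_power)
    then have "(D ^ 3) powr (1 / Q) \<le> (D ^ 3) powr 1" using Q by (intro powr_mono) auto
    then show "epow (ennreal (D ^ 3)) (1 / Q) \<le> ennreal (D ^ 3)" using D1 D(1) by (subst epow_ennreal) (auto intro: ennreal_leI)
  qed auto
  also have "\<dots> = ennreal (D ^ 3 * Cb) * epow K (1 / Q)" using D Cb_nonneg by (simp add: ennreal_mult mult_ac)
  finally show ?thesis .
qed

text \<open>For \<open>p < q\<close> the bound \<open>w \<le> b\<close> becomes a lower bound for
  \<open>w powr (p - q)\<close>, and Hoelder with exponent \<open>p / q\<close> recovers the norm.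
  For \<open>q < p\<close> a lower bound for a positive power of \<open>w\<close> is needed; with
  \<open>r = p - q\<close> that power is exactly the average of \<open>a powr (p - q)\<close>,
  Fubini is an equality, and \<open>a\<close> dominates the conical functional.\<close>

lemma integral_G_lower:
  assumes rq: "q < p \<Longrightarrow> r = p - q" and I: "1 \<le> (\<integral>\<^sup>+x. epow (cone_int G x) (p / q) \<partial>M)"
  shows "1 \<le> ennreal (1 + Cb powr (q / p - 1)) * (\<integral>\<^sup>+z. G z * ennreal (w z powr (p - q)) \<partial>Xplus M)" (is "_ \<le> _ * ?X")
proof -
  consider "p < q" | "p = q" | "q < p" by linarith
  then show ?thesis
  proof cases
    case 1
    have pq: "0 < p / q" "p / q < 1" using p 1 by auto
    have "AE x in M. ennreal (b x powr (p - q)) * cone_int G x \<le> cone_int (\<lambda>z. G z * ennreal (w z powr (p - q))) x"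
      using w_le_b
    proof eventually_elim
      case (elim x)
      have "ennreal (b x powr (p - q)) * cone_int G x = cone_int (\<lambda>z. ennreal (b x powr (p - q)) * G z) x"
        unfolding cone_int_eq by (subst nn_integral_cmult[symmetric]) (auto intro!: nn_integral_cong simp: mult_ac)
      also have "\<dots> \<le> cone_int (\<lambda>z. G z * ennreal (w z powr (p - q))) x"
      proof (intro cone_int_mono)
        fix z assume "z \<in> cone x"
        from in_coneD[OF this] have "0 < w z" "w z \<le> b x" using elim[rule_format, of z] w_pos[of z] by simp_all
        then have "b x powr (p - q) \<le> w z powr (p - q)" using 1 by (intro powr_mono2') auto
        then show "ennreal (b x powr (p - q)) * G z \<le> G z * ennreal (w z powr (p - q))"
          by (subst mult.commute) (intro mult_left_mono ennreal_leI, auto)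
      qed
      finally show ?case .
    qed
    then have "(\<integral>\<^sup>+x. ennreal (b x powr (p - q)) * cone_int G x \<partial>M) \<le> (\<integral>\<^sup>+x. cone_int (\<lambda>z. G z * ennreal (w z powr (p - q))) x \<partial>M)"
      by (rule nn_integral_mono_AE)
    also have "\<dots> = ?X" by (intro integral_eq_cone_int[symmetric]) auto
    finally have X: "(\<integral>\<^sup>+x. ennreal (b x powr (p - q)) * cone_int G x \<partial>M) \<le> ?X" .
    have "1 \<le> (\<integral>\<^sup>+x. epow (ennreal (b x powr (p - q)) * cone_int G x) (p / q) * epow (ennreal (b x powr p)) (1 - p / q) \<partial>M)"
    proof (rule order_trans[OF I], intro nn_integral_mono)
      fix x
      have "(p - q) * (p / q) + p * (1 - p / q) = 0" using q by (simp add: field_simps)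
      then have "epow (ennreal (b x powr (p - q))) (p / q) * epow (ennreal (b x powr p)) (1 - p / q) = 1"
        using b_pos[of x] by (simp add: epow_ennreal_powr less_imp_le ennreal_powr_mult)
      then show "epow (cone_int G x) (p / q) \<le> epow (ennreal (b x powr (p - q)) * cone_int G x) (p / q) * epow (ennreal (b x powr p)) (1 - p / q)"
        unfolding epow_mult by (simp add: mult.commute[of _ "epow (cone_int G x) _"] mult.assoc)
    qed
    also have "\<dots> \<le> epow (\<integral>\<^sup>+x. ennreal (b x powr (p - q)) * cone_int G x \<partial>M) (p / q) * epow (\<integral>\<^sup>+x. ennreal (b x powr p) \<partial>M) (1 - p / q)"
      by (intro nn_integral_Holder pq) auto
    also have "\<dots> \<le> epow ?X (p / q) * epow (ennreal Cb) (1 - p / q)"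
      using pq by (intro mult_mono epow_mono X b_int) auto
    finally have "1 \<le> epow ?X (p / q) * epow (ennreal Cb) (1 - p / q)" .
    then have "epow 1 (q / p) \<le> epow (epow ?X (p / q) * epow (ennreal Cb) (1 - p / q)) (q / p)"
      using p q by (intro epow_mono) auto
    also have "\<dots> = ?X * ennreal (Cb powr (q / p - 1))"
    proof -
      have "epow (epow ?X (p / q)) (q / p) = ?X" using p q by (simp add: epow_epow)
      moreover have "(1 - p / q) * (q / p) = q / p - 1" using p q by (simp add: field_simps)
      then have "epow (epow (ennreal Cb) (1 - p / q)) (q / p) = ennreal (Cb powr (q / p - 1))"
        unfolding epow_epow using Cb_nonneg by (simp only: epow_ennreal)
      ultimately show ?thesis by (simp only: epow_mult)
    qed
    finally have "1 \<le> ennreal (Cb powr (q / p - 1)) * ?X" by (simp add: mult.commute)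
    also have "\<dots> \<le> ennreal (1 + Cb powr (q / p - 1)) * ?X" by (intro mult_right_mono ennreal_leI) auto
    finally show ?thesis .
  next
    case 2
    have "?X = (\<integral>\<^sup>+z. G z \<partial>Xplus M)"
      using 2 w_pos by (intro nn_integral_cong) (auto simp: less_imp_neq[THEN not_sym] space_XplusD)
    also have "\<dots> = (\<integral>\<^sup>+x. cone_int G x \<partial>M)" by (intro integral_eq_cone_int) auto
    finally have "1 \<le> 1 * ?X" using I 2 q by simp
    also have "\<dots> \<le> ennreal (1 + Cb powr (q / p - 1)) * ?X"
      by (intro mult_right_mono) (auto simp: ennreal_1[symmetric] simp del: ennreal_1)
    finally show ?thesis .
  next
    case 3
    have "1 \<le> (\<integral>\<^sup>+x. ennreal (a x powr (p - q)) * cone_int G x \<partial>M)"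
    proof (rule order_trans[OF I], intro nn_integral_mono_AE)
      show "AE x in M. epow (cone_int G x) (p / q) \<le> ennreal (a x powr (p - q)) * cone_int G x"
        using G_cone
      proof eventually_elim
        case (elim x)
        have "p / q = (p / q - 1) + 1" by simp
        then have "epow (cone_int G x) (p / q) = epow (cone_int G x) (p / q - 1) * cone_int G x"
          by (metis epow_add epow_1)
        also have "\<dots> \<le> epow (ennreal (a x powr q)) (p / q - 1) * cone_int G x"
          using 3 q by (intro mult_right_mono epow_mono elim) auto
        also have "\<dots> = ennreal (a x powr (p - q)) * cone_int G x"
        proof -
          have "q * (p / q - 1) = p - q" using q by (simp add: right_diff_distrib)
          then show ?thesis using a_pos[of x] by (simp only: epow_ennreal_powr less_imp_le)
        qed
        finally show ?case .
      qed
    qed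
    also have "\<dots> = (\<integral>\<^sup>+z. G z * avg ar z \<partial>Xplus M)"
      unfolding ar_def[abs_def] rq[OF 3, symmetric] by (intro cone_int_swap) auto
    also have "\<dots> = ?X"
      by (intro nn_integral_cong) (simp add: w_powr_r rq[OF 3, symmetric] space_XplusD)
    finally have "1 \<le> 1 * ?X" by simp
    also have "\<dots> \<le> ennreal (1 + Cb powr (q / p - 1)) * ?X"
      by (intro mult_right_mono) (auto simp: ennreal_1[symmetric] simp del: ennreal_1)
    finally show ?thesis .
  qed
qed

subsection \<open>Two-sided bounds for the weight\<close>

lemma w_le_const:
  assumes z: "0 < snd z" and c: "\<And>x. x \<in> ball (fst z) (snd z) \<Longrightarrow> a x \<le> c"
  shows "w z \<le> c"
proof -
  have c0: "0 < c" using c[of "fst z"] z a_pos[of "fst z"] by simp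
  have "avg ar z \<le> avg (\<lambda>x. ennreal (c powr r)) z"
    using c r a_pos by (intro avg_mono) (auto simp: ar_def less_imp_le intro!: ennreal_leI powr_mono2)
  then have "ennreal (w z powr r) \<le> ennreal (c powr r)" using z by (simp add: w_powr_r avg_const)
  then have "w z powr r \<le> c powr r" by simp
  then show ?thesis using r c0 w_nonneg[of z] by (meson less_imp_le linorder_not_le powr_less_mono2)
qed

lemma w_ge_const:
  assumes z: "0 < snd z" and c: "0 < c" "\<And>x. x \<in> ball (fst z) (snd z) \<Longrightarrow> c \<le> a x"
  shows "c \<le> w z"
proof -
  have "avg (\<lambda>x. ennreal (c powr r)) z \<le> avg ar z"
    using c r by (intro avg_mono) (auto simp: ar_def intro!: ennreal_leI powr_mono2)
  then have "ennreal (c powr r) \<le> ennreal (w z powr r)" using z by (simp add: w_powr_r avg_const)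
  then have "c powr r \<le> w z powr r" by simp
  then show ?thesis using r c w_nonneg[of z] by (meson less_imp_le linorder_not_le powr_less_mono2)
qed

end

section \<open>Lattice norms and an analytic family of Calderon type\<close>

text \<open>Homogeneity and one domination axiom; the latter contains monotonicity, the triangle
  inequality and countable subadditivity. Exactly these properties are used to check the Calderon
  conditions.\<close>

definition lattice_norm :: "'b measure \<Rightarrow> (('b \<Rightarrow> complex) \<Rightarrow> ennreal) \<Rightarrow> bool" where
  "lattice_norm X N \<longleftrightarrow>
     (\<forall>f\<in>borel_measurable X. \<forall>c. N (\<lambda>y. c * f y) = ennreal (cmod c) * N f) \<and>
     (\<forall>f g. f \<in> borel_measurable X \<longrightarrow> (\<forall>k::nat. g k \<in> borel_measurable X) \<longrightarrow>
        (\<forall>y. ennreal (cmod (f y)) \<le> (\<Sum>k. ennreal (cmod (g k y)))) \<longrightarrow> N f \<le> (\<Sum>k. N (g k)))"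

context
  fixes X :: "'b measure" and N :: "('b \<Rightarrow> complex) \<Rightarrow> ennreal"
  assumes N: "lattice_norm X N"
begin

lemma lattice_norm_cmult: "f \<in> borel_measurable X \<Longrightarrow> N (\<lambda>y. c * f y) = ennreal (cmod c) * N f"
  using N by (simp add: lattice_norm_def)

lemma lattice_norm_suminf:
  "f \<in> borel_measurable X \<Longrightarrow> (\<And>k::nat. g k \<in> borel_measurable X) \<Longrightarrow>
     (\<And>y. ennreal (cmod (f y)) \<le> (\<Sum>k. ennreal (cmod (g k y)))) \<Longrightarrow> N f \<le> (\<Sum>k. N (g k))"
  using N by (simp add: lattice_norm_def)

lemma lattice_norm_zero: "N (\<lambda>y. 0) = 0"
  using lattice_norm_cmult[of "\<lambda>y. 0" 0] by simp

lemma lattice_norm_add: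
  assumes "f \<in> borel_measurable X" "g \<in> borel_measurable X" "h \<in> borel_measurable X"
    and le: "\<And>y. cmod (f y) \<le> cmod (g y) + cmod (h y)"
  shows "N f \<le> N g + N h"
proof -
  define k where "k n = (if n = 0 then g else if n = Suc 0 then h else (\<lambda>y. 0))" for n :: nat
  have two: "(\<Sum>n. e (k n)) = e g + e h" if "e (\<lambda>y. 0) = 0" for e :: "('b \<Rightarrow> complex) \<Rightarrow> ennreal"
  proof -
    have "(\<Sum>n. e (k n)) = (\<Sum>n\<in>{0, Suc 0}. e (k n))"
      using that by (intro suminf_finite) (auto simp: k_def)
    then show ?thesis by (simp add: k_def)
  qed
  have "N f \<le> (\<Sum>n. N (k n))"
  proof (rule lattice_norm_suminf)
    fix y
    have "ennreal (cmod (f y)) \<le> ennreal (cmod (g y)) + ennreal (cmod (h y))"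
      using le[of y] by (simp add: ennreal_plus[symmetric] ennreal_leI del: ennreal_plus)
    also have "\<dots> = (\<Sum>n. ennreal (cmod (k n y)))" by (rule two[symmetric]) simp
    finally show "ennreal (cmod (f y)) \<le> (\<Sum>n. ennreal (cmod (k n y)))" .
  qed (use assms in \<open>auto simp: k_def\<close>)
  then show ?thesis using two[of N] lattice_norm_zero by simp
qed

lemma lattice_norm_mono:
  assumes "f \<in> borel_measurable X" "g \<in> borel_measurable X" "\<And>y. cmod (f y) \<le> cmod (g y)"
  shows "N f \<le> N g"
  using lattice_norm_add[of f g "\<lambda>y. 0"] assms lattice_norm_zero by simp

lemma lattice_norm_scaled:
  assumes "f \<in> borel_measurable X" "g \<in> borel_measurable X" "\<And>y. cmod (f y) \<le> c * cmod (g y)" "0 \<le> c"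
  shows "N f \<le> ennreal c * N g"
proof -
  have "N f \<le> N (\<lambda>y. complex_of_real c * g y)"
    using assms by (intro lattice_norm_mono) (auto simp: norm_mult)
  then show ?thesis using assms by (simp add: lattice_norm_cmult)
qed

end

lemma ennreal_double_double: "0 \<le> x \<Longrightarrow> 2 * ennreal x + 2 * ennreal x = ennreal (4 * x)"
  by (simp add: ennreal_mult distrib_right[symmetric])

text \<open>The decomposition cuts \<open>g\<close> along the set where
  \<open>cmod v \<le> cmod u\<close>; on each side the larger of the two majorants contributes a
  factor 2. Membership and smallness in the sum space are thereby reduced to pointwise
  bounds.\<close>

lemma sum_space_of_bound:
  assumes N0: "lattice_norm X N0" and N1: "lattice_norm X N1"
    and [measurable]: "g \<in> borel_measurable X" "u \<in> borel_measurable X" "v \<in> borel_measurable X"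
    and fin: "N0 u < top" "N1 v < top"
    and le: "\<And>y. cmod (g y) \<le> cmod (u y) + cmod (v y)"
  shows "g \<in> sum_space (borel_measurable X) N0 N1"
    "sum_norm (borel_measurable X) N0 N1 g \<le> 2 * N0 u + 2 * N1 v"
proof -
  define g0 where "g0 y = (if cmod (v y) \<le> cmod (u y) then g y else 0)" for y
  define g1 where "g1 y = (if cmod (v y) \<le> cmod (u y) then 0 else g y)" for y
  have [measurable]: "g0 \<in> borel_measurable X" "g1 \<in> borel_measurable X"
    unfolding g0_def[abs_def] g1_def[abs_def] by measurable
  have "N0 g0 \<le> ennreal 2 * N0 u"
  proof (rule lattice_norm_scaled[OF N0])
    fix y show "cmod (g0 y) \<le> 2 * cmod (u y)" using le[of y] by (auto simp: g0_def)
  qed auto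
  moreover have "N1 g1 \<le> ennreal 2 * N1 v"
  proof (rule lattice_norm_scaled[OF N1])
    fix y show "cmod (g1 y) \<le> 2 * cmod (v y)" using le[of y] by (auto simp: g1_def)
  qed auto
  ultimately have g01: "N0 g0 \<le> 2 * N0 u" "N1 g1 \<le> 2 * N1 v" by simp_all
  then have mem: "g0 \<in> nspace (borel_measurable X) N0" "g1 \<in> nspace (borel_measurable X) N1"
    using fin by (auto simp: nspace_def ennreal_mult_less_top intro: le_less_trans)
  have g: "g = (\<lambda>y. g0 y + g1 y)" by (auto simp: g0_def g1_def)
  show "g \<in> sum_space (borel_measurable X) N0 N1" using mem g unfolding sum_space_def by blast
  have "sum_norm (borel_measurable X) N0 N1 g \<le> N0 (fst (g0, g1)) + N1 (snd (g0, g1))"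
    unfolding sum_norm_def using mem g by (intro INF_lower) auto
  also have "\<dots> \<le> 2 * N0 u + 2 * N1 v" using g01 by (simp add: add_mono)
  finally show "sum_norm (borel_measurable X) N0 N1 g \<le> 2 * N0 u + 2 * N1 v" .
qed

text \<open>Calderon's product in logarithmic form: for \<open>b = ln (f1 / f0)\<close> and
  \<open>f = f0 powr (1 - \<theta>) * f1 powr \<theta>\<close>, the function
  \<open>f * exp ((z - \<theta>) * b)\<close> is \<open>f0 powr (1 - z) * f1 powr z\<close>. The
  Gaussian factor gives decay along vertical lines and is normalised to 1 at
  \<open>\<theta>\<close>.\<close>

definition Efam :: "real \<Rightarrow> complex \<Rightarrow> real \<Rightarrow> complex" where
  "Efam \<theta> z b = exp (z\<^sup>2 - of_real (\<theta>\<^sup>2)) * exp ((z - of_real \<theta>) * of_real b)"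

lemma Efam_theta [simp]: "Efam \<theta> (of_real \<theta>) b = 1"
  by (simp add: Efam_def)

lemma cmod_Efam: "cmod (Efam \<theta> z b) = exp ((Re z)\<^sup>2 - (Im z)\<^sup>2 - \<theta>\<^sup>2) * exp ((Re z - \<theta>) * b)"
  by (simp add: Efam_def norm_mult power2_eq_square)

lemma cmod_Efam_0: "cmod (Efam \<theta> (Complex 0 t) b) \<le> exp (- t\<^sup>2) * exp (- \<theta> * b)"
  by (simp add: cmod_Efam)

lemma cmod_Efam_1: "cmod (Efam \<theta> (Complex 1 t) b) \<le> exp 1 * exp (- t\<^sup>2) * exp ((1 - \<theta>) * b)"
  by (simp add: cmod_Efam mult_exp_exp)

lemma exp_interpolate:
  fixes x b :: real
  assumes "0 \<le> x" "x \<le> 1"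
  shows "exp ((x - \<theta>) * b) \<le> exp (- \<theta> * b) + exp ((1 - \<theta>) * b)"
proof (cases "0 \<le> b")
  case True
  then have "(x - \<theta>) * b \<le> (1 - \<theta>) * b" using assms by (intro mult_right_mono) auto
  then show ?thesis by (meson add_increasing exp_ge_zero exp_le_cancel_iff order_trans)
next
  case False
  then have "(x - \<theta>) * b \<le> (- \<theta>) * b" using assms by (intro mult_right_mono_neg) auto
  then show ?thesis by (meson add_increasing2 exp_ge_zero exp_le_cancel_iff order_trans)
qed

lemma cmod_Efam_strip:
  assumes "z \<in> strip"
  shows "cmod (Efam \<theta> z b) \<le> exp 1 * exp ((Re z - \<theta>) * b)"
proof -
  have "(Re z)\<^sup>2 \<le> 1" using assms by (auto simp: strip_def power_le_one)
  then have "(Re z)\<^sup>2 - (Im z)\<^sup>2 - \<theta>\<^sup>2 \<le> 1"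
    using zero_le_power2[of "Im z"] zero_le_power2[of \<theta>] by linarith
  then show ?thesis unfolding cmod_Efam by (intro mult_right_mono) auto
qed

lemma cmod_Efam_strip':
  assumes "z \<in> strip"
  shows "cmod (Efam \<theta> z b) \<le> exp 1 * (exp (- \<theta> * b) + exp ((1 - \<theta>) * b))"
  using cmod_Efam_strip[OF assms, of \<theta> b] exp_interpolate[of "Re z" \<theta> b] assms
  by (auto simp: strip_def intro: order_trans)

text \<open>The difference is measured against both boundary weights, since either norm may be
  applied to it. Divided by \<open>exp ((s - \<theta>) * b)\<close> with \<open>s = 0\<close> or
  \<open>s = 1\<close>, the family is jointly continuous, hence uniformly continuous on a compact
  set of pairs \<open>(w, b)\<close>.\<close>

lemma Efam_uniform:
  assumes e: "0 < e"
  shows "\<exists>d>0. \<forall>w b. cmod (w - z) < d \<and> \<bar>b\<bar> \<le> B \<longrightarrow>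
    cmod (Efam \<theta> w b - Efam \<theta> z b) \<le> e * exp (- \<theta> * b) \<and> cmod (Efam \<theta> w b - Efam \<theta> z b) \<le> e * exp ((1 - \<theta>) * b)"
proof -
  have one: "\<exists>d>0. \<forall>w b. cmod (w - z) < d \<and> \<bar>b\<bar> \<le> B \<longrightarrow> cmod (Efam \<theta> w b - Efam \<theta> z b) \<le> e * exp ((s - \<theta>) * b)" for s
  proof -
    let ?H = "\<lambda>(w, b). exp (w\<^sup>2 - of_real (\<theta>\<^sup>2)) * exp ((w - of_real s) * of_real b)"
    have "uniformly_continuous_on (cball z 1 \<times> {-B..B}) ?H"
      by (intro compact_uniformly_continuous compact_Times compact_cball compact_Icc)
        (auto simp: case_prod_unfold intro!: continuous_intros)
    then obtain d where d: "0 < d" "\<And>p p'. p \<in> cball z 1 \<times> {-B..B} \<Longrightarrow> p' \<in> cball z 1 \<times> {-B..B} \<Longrightarrow> dist p' p < d \<Longrightarrow> dist (?H p') (?H p) < e"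
      using e unfolding uniformly_continuous_on_def by (elim allE[of _ e] impE exE conjE) (assumption, blast)
    have E: "Efam \<theta> w b = ?H (w, b) * of_real (exp ((s - \<theta>) * b))" for w b
      by (simp add: Efam_def exp_of_real[symmetric] mult_exp_exp algebra_simps)
    have "cmod (Efam \<theta> w b - Efam \<theta> z b) \<le> e * exp ((s - \<theta>) * b)" if "cmod (w - z) < min d 1" "\<bar>b\<bar> \<le> B" for w b
    proof -
      have "dist (?H (w, b)) (?H (z, b)) < e"
        using that by (intro d) (auto simp: dist_norm norm_minus_commute dist_Pair_Pair)
      moreover have "cmod (Efam \<theta> w b - Efam \<theta> z b) = dist (?H (w, b)) (?H (z, b)) * exp ((s - \<theta>) * b)"
        unfolding E left_diff_distrib[symmetric] norm_mult by (simp add: dist_norm)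
      ultimately show ?thesis by (simp add: mult_right_mono)
    qed
    then show ?thesis using d(1) by (intro exI[of _ "min d 1"]) auto
  qed
  obtain d0 where d0: "0 < d0" "\<And>w b. cmod (w - z) < d0 \<and> \<bar>b\<bar> \<le> B \<Longrightarrow> cmod (Efam \<theta> w b - Efam \<theta> z b) \<le> e * exp ((0 - \<theta>) * b)"
    using one[of 0] by metis
  obtain d1 where d1: "0 < d1" "\<And>w b. cmod (w - z) < d1 \<and> \<bar>b\<bar> \<le> B \<Longrightarrow> cmod (Efam \<theta> w b - Efam \<theta> z b) \<le> e * exp ((1 - \<theta>) * b)"
    using one[of 1] by metis
  show ?thesis using d0 d1 by (intro exI[of _ "min d0 d1"]) auto
qed

definition Efam' :: "real \<Rightarrow> complex \<Rightarrow> real \<Rightarrow> complex" where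
  "Efam' \<theta> z b = Efam \<theta> z b * (2 * z + of_real b)"

lemma Efam_has_derivative: "((\<lambda>z. Efam \<theta> z b) has_field_derivative Efam' \<theta> z b) (at z within S)"
  unfolding Efam_def Efam'_def by (auto intro!: derivative_eq_intros simp: algebra_simps)

lemma Efam'_has_derivative:
  "((\<lambda>z. Efam' \<theta> z b) has_field_derivative Efam \<theta> z b * ((2 * z + of_real b)\<^sup>2 + 2)) (at z within S)"
  unfolding Efam'_def
  by (auto intro!: derivative_eq_intros Efam_has_derivative simp: algebra_simps power2_eq_square Efam'_def)

text \<open>The square accounts for the growth in \<open>b\<close> caused by two derivatives. At
  distance \<open>d\<close> from the boundary it is absorbed by
  \<open>exp (d * \<bar>b\<bar>)\<close>, which only shifts the real part by \<open>d\<close> in the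
  direction of the sign of \<open>b\<close>; the shifted point is still in the strip.\<close>

lemma Efam_polynomial_bound:
  assumes d: "0 < d" and R: "0 \<le> R"
  shows "\<exists>C\<ge>0. \<forall>\<zeta> b. d \<le> Re \<zeta> \<and> Re \<zeta> \<le> 1 - d \<and> cmod \<zeta> \<le> R \<longrightarrow>
      cmod (Efam \<theta> \<zeta> b) * (2 * R + \<bar>b\<bar> + 2)\<^sup>2 \<le> C * (exp (- \<theta> * b) + exp ((1 - \<theta>) * b))"
proof -
  define C where "C = exp 1 * ((2 / d)\<^sup>2 * exp (d * (2 * R + 2)))"
  have "cmod (Efam \<theta> \<zeta> b) * (2 * R + \<bar>b\<bar> + 2)\<^sup>2 \<le> C * (exp (- \<theta> * b) + exp ((1 - \<theta>) * b))"
    if z: "d \<le> Re \<zeta>" "Re \<zeta> \<le> 1 - d" for \<zeta> b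
  proof -
    let ?T = "2 * R + \<bar>b\<bar> + 2"
    have "?T * (d / 2) \<le> exp (?T * (d / 2))" using exp_ge_add_one_self[of "?T * (d / 2)"] by linarith
    then have "(?T * (d / 2))\<^sup>2 \<le> (exp (?T * (d / 2)))\<^sup>2" using R d by (intro power_mono) auto
    also have "(exp (?T * (d / 2)))\<^sup>2 = exp (d * (2 * R + 2)) * exp (d * \<bar>b\<bar>)"
      by (simp add: power2_eq_square mult_exp_exp algebra_simps)
    finally have "(2 / d)\<^sup>2 * (?T * (d / 2))\<^sup>2 \<le> (2 / d)\<^sup>2 * (exp (d * (2 * R + 2)) * exp (d * \<bar>b\<bar>))"
      by (intro mult_left_mono) auto
    moreover have "(2 / d)\<^sup>2 * (?T * (d / 2))\<^sup>2 = ?T\<^sup>2" 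
    proof -
      have "2 / d * (?T * (d / 2)) = ?T" using d by (simp add: field_simps)
      then show ?thesis by (metis power_mult_distrib)
    qed
    ultimately have T: "?T\<^sup>2 \<le> (2 / d)\<^sup>2 * exp (d * (2 * R + 2)) * exp (d * \<bar>b\<bar>)" by (simp only: mult.assoc)
    define x where "x = Re \<zeta> + d * sgn b"
    have x: "0 \<le> x" "x \<le> 1" using z d by (auto simp: x_def sgn_if)
    have "cmod (Efam \<theta> \<zeta> b) * ?T\<^sup>2 \<le> (exp 1 * exp ((Re \<zeta> - \<theta>) * b)) * ((2 / d)\<^sup>2 * exp (d * (2 * R + 2)) * exp (d * \<bar>b\<bar>))"
      using z d by (intro mult_mono T cmod_Efam_strip) (auto simp: strip_def)
    also have "\<dots> = C * (exp ((Re \<zeta> - \<theta>) * b) * exp (d * \<bar>b\<bar>))" by (simp add: C_def)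
    also have "exp ((Re \<zeta> - \<theta>) * b) * exp (d * \<bar>b\<bar>) = exp ((x - \<theta>) * b)"
      by (auto simp: mult_exp_exp x_def sgn_if abs_if algebra_simps)
    also have "C * exp ((x - \<theta>) * b) \<le> C * (exp (- \<theta> * b) + exp ((1 - \<theta>) * b))"
      by (intro mult_left_mono exp_interpolate x) (auto simp: C_def)
    finally show ?thesis .
  qed
  then show ?thesis by (intro exI[of _ C]) (auto simp: C_def)
qed

text \<open>Second order Taylor estimate. In the open strip the constant is uniform in
  \<open>b\<close>, so the derivative is obtained for all pieces simultaneously.\<close>

lemma Efam_difference_quotient:
  assumes z: "z \<in> ostrip"
  shows "\<exists>C\<ge>0. \<exists>d>0. \<forall>b. cmod (Efam' \<theta> z b) \<le> C * (exp (- \<theta> * b) + exp ((1 - \<theta>) * b)) \<and>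
     (\<forall>w. 0 < cmod (w - z) \<and> cmod (w - z) < d \<longrightarrow>
        cmod ((Efam \<theta> w b - Efam \<theta> z b) / (w - z) - Efam' \<theta> z b) \<le> C * cmod (w - z) * (exp (- \<theta> * b) + exp ((1 - \<theta>) * b)))"
proof -
  define d where "d = min (Re z) (1 - Re z) / 2"
  have d: "0 < d" "d \<le> 1" "2 * d \<le> Re z" "Re z \<le> 1 - 2 * d" using z by (auto simp: d_def ostrip_def)
  define R where "R = cmod z + 1"
  obtain C where C: "0 \<le> C" "\<And>\<zeta> b. d \<le> Re \<zeta> \<and> Re \<zeta> \<le> 1 - d \<and> cmod \<zeta> \<le> R \<Longrightarrow>
      cmod (Efam \<theta> \<zeta> b) * (2 * R + \<bar>b\<bar> + 2)\<^sup>2 \<le> C * (exp (- \<theta> * b) + exp ((1 - \<theta>) * b))"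
    using Efam_polynomial_bound[OF d(1), of R \<theta>] by (auto simp: R_def)
  have "cmod (Efam' \<theta> z b) \<le> C * (exp (- \<theta> * b) + exp ((1 - \<theta>) * b))" for b
  proof -
    have "cmod (2 * z + of_real b) \<le> 2 * cmod z + \<bar>b\<bar>" by (rule order_trans[OF norm_triangle_ineq]) (simp add: norm_mult)
    also have "\<dots> \<le> (2 * R + \<bar>b\<bar> + 2) * 1" by (simp add: R_def)
    also have "\<dots> \<le> (2 * R + \<bar>b\<bar> + 2)\<^sup>2" unfolding power2_eq_square by (intro mult_left_mono) (auto simp: R_def add_increasing)
    finally have "cmod (Efam' \<theta> z b) \<le> cmod (Efam \<theta> z b) * (2 * R + \<bar>b\<bar> + 2)\<^sup>2"
      by (simp add: Efam'_def norm_mult mult_left_mono)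
    also have "\<dots> \<le> C * (exp (- \<theta> * b) + exp ((1 - \<theta>) * b))" using d by (intro C) (auto simp: R_def)
    finally show ?thesis .
  qed
  moreover have "cmod ((Efam \<theta> w b - Efam \<theta> z b) / (w - z) - Efam' \<theta> z b) \<le> C * cmod (w - z) * (exp (- \<theta> * b) + exp ((1 - \<theta>) * b))"
    if w: "0 < cmod (w - z)" "cmod (w - z) < d" for w b
  proof -
    let ?K = "C * (exp (- \<theta> * b) + exp ((1 - \<theta>) * b))"
    define g where "g i = (if i = 0 then \<lambda>z. Efam \<theta> z b else if i = Suc 0 then \<lambda>z. Efam' \<theta> z b
        else (\<lambda>z. Efam \<theta> z b * ((2 * z + of_real b)\<^sup>2 + 2)))" for i :: nat
    have "cmod (g 0 w - (\<Sum>i\<le>1. g i z * (w - z) ^ i / fact i)) \<le> ?K * cmod (w - z) ^ Suc 1 / fact 1"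
    proof (rule complex_Taylor[where S="ball z d"])
      show "convex (ball z d)" by simp
      show "(g i has_field_derivative g (Suc i) x) (at x within ball z d)" if "x \<in> ball z d" "i \<le> 1" for i x
        using that Efam_has_derivative Efam'_has_derivative by (cases i) (auto simp: g_def)
      show "cmod (g (Suc 1) \<zeta>) \<le> ?K" if "\<zeta> \<in> ball z d" for \<zeta>
      proof -
        have dz: "cmod (z - \<zeta>) < d" using that by (simp add: dist_norm)
        then have re: "\<bar>Re z - Re \<zeta>\<bar> < d" using abs_Re_le_cmod[of "z - \<zeta>"] by simp
        have "cmod \<zeta> \<le> cmod z + cmod (z - \<zeta>)" by (metis norm_minus_commute norm_triangle_sub)
        then have zR: "cmod \<zeta> \<le> R" using dz d by (simp add: R_def)
        have "cmod ((2 * \<zeta> + of_real b)\<^sup>2 + 2) \<le> (cmod (2 * \<zeta> + of_real b))\<^sup>2 + 2"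
          by (rule order_trans[OF norm_triangle_ineq]) (simp add: norm_power)
        also have "\<dots> \<le> (2 * R + \<bar>b\<bar>)\<^sup>2 + 2"
        proof (intro add_right_mono power_mono)
          show "cmod (2 * \<zeta> + of_real b) \<le> 2 * R + \<bar>b\<bar>"
            using zR by (intro order_trans[OF norm_triangle_ineq]) (simp add: norm_mult)
        qed simp
        also have "\<dots> \<le> (2 * R + \<bar>b\<bar> + 2)\<^sup>2"
        proof -
          have "0 \<le> (2 * R + \<bar>b\<bar>) * 4 + 2" by (simp add: R_def add_nonneg_nonneg)
          then show ?thesis by (simp add: power2_eq_square algebra_simps)
        qed
        finally have "cmod (g (Suc 1) \<zeta>) \<le> cmod (Efam \<theta> \<zeta> b) * (2 * R + \<bar>b\<bar> + 2)\<^sup>2"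
          by (simp add: g_def norm_mult mult_left_mono)
        also have "\<dots> \<le> ?K" using re d zR by (intro C) auto
        finally show ?thesis .
      qed
      show "z \<in> ball z d" "w \<in> ball z d" using w d by (auto simp: dist_norm norm_minus_commute)
    qed
    then have "cmod (Efam \<theta> w b - Efam \<theta> z b - Efam' \<theta> z b * (w - z)) \<le> ?K * cmod (w - z) * cmod (w - z)"
      by (simp add: g_def power2_eq_square algebra_simps)
    moreover have "(Efam \<theta> w b - Efam \<theta> z b) / (w - z) - Efam' \<theta> z b = (Efam \<theta> w b - Efam \<theta> z b - Efam' \<theta> z b * (w - z)) / (w - z)"
      using w by (simp add: field_simps)
    ultimately have "cmod ((Efam \<theta> w b - Efam \<theta> z b) / (w - z) - Efam' \<theta> z b) \<le> ?K * cmod (w - z)"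
      using w by (simp add: norm_divide divide_le_eq)
    then show ?thesis by (simp add: mult_ac)
  qed
  ultimately show ?thesis using C(1) d(1) by (intro exI[of _ C] conjI exI[of _ d] allI impI) auto
qed

text \<open>The pieces \<open>\<kappa> = k\<close>, on each of which \<open>b\<close> is bounded, are needed because the boundary values
  of the family have to be norm continuous, which fails for unbounded \<open>b\<close> when the norm is not order continuous.\<close>

locale analytic_family =
  fixes X :: "'b measure" and N0 N1 :: "('b \<Rightarrow> complex) \<Rightarrow> ennreal" and \<theta> :: real
    and f :: "'b \<Rightarrow> complex" and b :: "'b \<Rightarrow> real" and \<kappa> :: "'b \<Rightarrow> nat" and c :: "nat \<Rightarrow> real"
  assumes N0: "lattice_norm X N0" and N1: "lattice_norm X N1"
    and f_meas [measurable]: "f \<in> borel_measurable X" and b_meas [measurable]: "b \<in> borel_measurable X"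
    and \<kappa>_meas [measurable]: "\<kappa> \<in> measurable X (count_space UNIV)"
    and b_bounded: "\<And>k. \<exists>B. \<forall>y. \<kappa> y = k \<longrightarrow> \<bar>b y\<bar> \<le> B"
    and c_nonneg: "\<And>k. 0 \<le> c k" and c_summable: "summable c"
    and piece0: "\<And>k. N0 (\<lambda>y. if \<kappa> y = k then f y * of_real (exp (- \<theta> * b y)) else 0) \<le> ennreal (c k)"
    and piece1: "\<And>k. N1 (\<lambda>y. if \<kappa> y = k then f y * of_real (exp ((1 - \<theta>) * b y)) else 0) \<le> ennreal (c k)"
begin

section \<open>Membership of the analytic family in the Calderon class\<close>

definition g0 where "g0 y = f y * of_real (exp (- \<theta> * b y))" for y
definition g1 where "g1 y = f y * of_real (exp ((1 - \<theta>) * b y))" for y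
definition F where "F z y = f y * Efam \<theta> z (b y)" for z y

abbreviation L where "L \<equiv> borel_measurable X"

lemma meas [measurable]: "g0 \<in> L" "g1 \<in> L" "F z \<in> L" "(\<lambda>y. Efam' \<theta> z (b y)) \<in> L"
  unfolding g0_def[abs_def] g1_def[abs_def] F_def[abs_def] Efam'_def Efam_def by measurable

lemma cmod_g: "cmod (g0 y) = cmod (f y) * exp (- \<theta> * b y)" "cmod (g1 y) = cmod (f y) * exp ((1 - \<theta>) * b y)"
  by (simp_all add: g0_def g1_def norm_mult)

lemma cmod_le_g:
  assumes "cmod e \<le> d * (exp (- \<theta> * b y) + exp ((1 - \<theta>) * b y))"
  shows "cmod (f y * e) \<le> cmod (of_real d * g0 y) + cmod (of_real d * g1 y)"
proof -
  have "cmod (f y * e) \<le> cmod (f y) * (d * (exp (- \<theta> * b y) + exp ((1 - \<theta>) * b y)))"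
    unfolding norm_mult by (intro mult_left_mono assms) auto
  also have "\<dots> \<le> cmod (f y) * (\<bar>d\<bar> * (exp (- \<theta> * b y) + exp ((1 - \<theta>) * b y)))"
    by (intro mult_left_mono mult_right_mono) auto
  also have "\<dots> = cmod (of_real d * g0 y) + cmod (of_real d * g1 y)"
    by (simp add: norm_mult cmod_g algebra_simps)
  finally show ?thesis .
qed

text \<open>Countable subadditivity over the pieces from index \<open>m\<close> on; at each point at
  most one of them is nonzero.\<close>

lemma tail_bound:
  assumes g: "g = g0 \<and> N = N0 \<or> g = g1 \<and> N = N1"
  shows "N (\<lambda>y. if m \<le> \<kappa> y then g y else 0) \<le> ennreal (\<Sum>k. c (k + m))"
proof -
  have NL: "lattice_norm X N" and [measurable]: "g \<in> L" using g N0 N1 by auto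
  have piece: "N (\<lambda>y. if \<kappa> y = k then g y else 0) \<le> ennreal (c k)" for k
  proof -
    have "N0 (\<lambda>y. if \<kappa> y = k then g0 y else 0) \<le> ennreal (c k)" unfolding g0_def by (rule piece0)
    moreover have "N1 (\<lambda>y. if \<kappa> y = k then g1 y else 0) \<le> ennreal (c k)" unfolding g1_def by (rule piece1)
    ultimately show ?thesis using g by auto
  qed
  have "N (\<lambda>y. if m \<le> \<kappa> y then g y else 0) \<le> (\<Sum>k. N (\<lambda>y. if \<kappa> y = k + m then g y else 0))"
  proof (rule lattice_norm_suminf[OF NL])
    fix y
    show "ennreal (cmod (if m \<le> \<kappa> y then g y else 0)) \<le> (\<Sum>k. ennreal (cmod (if \<kappa> y = k + m then g y else 0)))"
    proof (cases "m \<le> \<kappa> y")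
      case True
      have "ennreal (cmod (g y)) = (\<Sum>k\<in>{\<kappa> y - m}. ennreal (cmod (if \<kappa> y = k + m then g y else 0)))"
        using True by simp
      also have "\<dots> \<le> (\<Sum>k. ennreal (cmod (if \<kappa> y = k + m then g y else 0)))"
        by (intro sum_le_suminf) auto
      finally show ?thesis using True by simp
    qed simp
  qed measurable
  also have "\<dots> \<le> (\<Sum>k. ennreal (c (k + m)))" by (intro suminf_le piece) auto
  also have "\<dots> = ennreal (\<Sum>k. c (k + m))"
    using c_nonneg c_summable by (intro suminf_ennreal2) (auto simp: summable_iff_shift)
  finally show ?thesis .
qed

lemma g_bound: "N0 g0 \<le> ennreal (suminf c)" "N1 g1 \<le> ennreal (suminf c)"
  using tail_bound[of g0 N0 0] tail_bound[of g1 N1 0] by simp_all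

lemma suminf_c_nonneg: "0 \<le> suminf c"
  using c_nonneg c_summable by (intro suminf_nonneg) auto

lemma sum_estimate:
  assumes [measurable]: "h \<in> L" and d: "0 \<le> d"
    and le: "\<And>y. cmod (h y) \<le> cmod (of_real d * g0 y) + cmod (of_real d * g1 y)"
  shows "h \<in> sum_space L N0 N1" "sum_norm L N0 N1 h \<le> ennreal (4 * d * suminf c)"
proof -
  have n: "N0 (\<lambda>y. of_real d * g0 y) \<le> ennreal (d * suminf c)" "N1 (\<lambda>y. of_real d * g1 y) \<le> ennreal (d * suminf c)"
    using d g_bound suminf_c_nonneg by (auto simp: lattice_norm_cmult[OF N0] lattice_norm_cmult[OF N1] ennreal_mult intro!: mult_left_mono)
  have fin: "N0 (\<lambda>y. of_real d * g0 y) < top" "N1 (\<lambda>y. of_real d * g1 y) < top"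
    using n by (auto intro: le_less_trans)
  show "h \<in> sum_space L N0 N1"
    by (rule sum_space_of_bound(1)[OF N0 N1 assms(1) _ _ fin le]) measurable
  have "sum_norm L N0 N1 h \<le> 2 * N0 (\<lambda>y. of_real d * g0 y) + 2 * N1 (\<lambda>y. of_real d * g1 y)"
    by (rule sum_space_of_bound(2)[OF N0 N1 assms(1) _ _ fin le]) measurable
  also have "\<dots> \<le> ennreal 2 * ennreal (d * suminf c) + ennreal 2 * ennreal (d * suminf c)"
    using n by (auto intro!: add_mono mult_left_mono)
  also have "\<dots> = ennreal (4 * (d * suminf c))"
    using d suminf_c_nonneg by (simp add: ennreal_double_double)
  finally show "sum_norm L N0 N1 h \<le> ennreal (4 * d * suminf c)" by (simp add: algebra_simps)
qed

lemma tail_small: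
  assumes e: "0 < e"
  obtains m where "(\<Sum>k. c (k + m)) < e"
proof -
  from suminf_exist_split[OF e c_summable] obtain m where "\<forall>n\<ge>m. norm (\<Sum>k. c (k + n)) < e" ..
  then have "norm (\<Sum>k. c (k + m)) < e" by simp
  then show ?thesis using that[of m] by simp
qed

lemma bounded_up_to: "\<exists>B. \<forall>y. \<kappa> y < m \<longrightarrow> \<bar>b y\<bar> \<le> B"
proof -
  obtain B where B: "\<And>k y. \<kappa> y = k \<Longrightarrow> \<bar>b y\<bar> \<le> B k" using b_bounded by metis
  have "\<bar>b y\<bar> \<le> (\<Sum>k<m. \<bar>B k\<bar>)" if "\<kappa> y < m" for y
  proof -
    have "\<bar>b y\<bar> \<le> \<bar>B (\<kappa> y)\<bar>" using B[OF refl, of y] by linarith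
    also have "\<dots> \<le> (\<Sum>k<m. \<bar>B k\<bar>)" using that by (intro member_le_sum) auto
    finally show ?thesis .
  qed
  then show ?thesis by blast
qed

text \<open>On finitely many pieces \<open>b\<close> is bounded and \<open>Efam_uniform\<close>
  applies; the remaining pieces have small norm. The two facts are kept separate because they are
  combined differently for the sum norm and for the boundary norms.\<close>

lemma continuity_estimate:
  assumes e: "0 < e"
  obtains d m where "0 < d" "(\<Sum>k. c (k + m)) < e"
    "\<And>w y. cmod (w - z) < d \<Longrightarrow> \<kappa> y < m \<Longrightarrow>
       cmod (F w y - F z y) \<le> e * cmod (g0 y) \<and> cmod (F w y - F z y) \<le> e * cmod (g1 y)"
proof -
  obtain m where m: "(\<Sum>k. c (k + m)) < e" using tail_small[OF e] .
  obtain B where B: "\<And>y. \<kappa> y < m \<Longrightarrow> \<bar>b y\<bar> \<le> B" using bounded_up_to by blast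
  obtain d where d: "0 < d" "\<And>w b. cmod (w - z) < d \<and> \<bar>b\<bar> \<le> B \<Longrightarrow>
    cmod (Efam \<theta> w b - Efam \<theta> z b) \<le> e * exp (- \<theta> * b) \<and> cmod (Efam \<theta> w b - Efam \<theta> z b) \<le> e * exp ((1 - \<theta>) * b)"
    using Efam_uniform[OF e, of z B \<theta>] by blast
  have "cmod (F w y - F z y) \<le> e * cmod (g0 y) \<and> cmod (F w y - F z y) \<le> e * cmod (g1 y)"
    if "cmod (w - z) < d" "\<kappa> y < m" for w y
  proof -
    have "cmod (F w y - F z y) = cmod (f y) * cmod (Efam \<theta> w (b y) - Efam \<theta> z (b y))"
      by (simp add: F_def right_diff_distrib[symmetric] norm_mult)
    then show ?thesis using d(2)[of w "b y"] B[of y] that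
      by (auto simp: cmod_g mult.left_commute[of e] intro: mult_left_mono)
  qed
  then show ?thesis using that d(1) m by blast
qed

lemma F_strip_bound:
  assumes "z \<in> strip"
  shows "cmod (F z y) \<le> cmod (of_real (exp 1) * g0 y) + cmod (of_real (exp 1) * g1 y)"
  unfolding F_def using cmod_Efam_strip'[OF assms] by (rule cmod_le_g)

lemma F_boundary:
  "cmod (F (Complex 0 t) y) \<le> exp (- t\<^sup>2) * cmod (g0 y)"
  "cmod (F (Complex 1 t) y) \<le> exp 1 * exp (- t\<^sup>2) * cmod (g1 y)"
  using mult_left_mono[OF cmod_Efam_0[of \<theta> t "b y"], of "cmod (f y)"]
    mult_left_mono[OF cmod_Efam_1[of \<theta> t "b y"], of "cmod (f y)"]
  by (simp_all add: F_def norm_mult cmod_g mult_ac)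

lemma F_boundary_norm:
  "N0 (F (Complex 0 t)) \<le> ennreal (exp 1 * exp (- t\<^sup>2) * suminf c)"
  "N1 (F (Complex 1 t)) \<le> ennreal (exp 1 * exp (- t\<^sup>2) * suminf c)"
proof -
  have "N0 (F (Complex 0 t)) \<le> ennreal (exp 1 * exp (- t\<^sup>2)) * N0 g0"
  proof (rule lattice_norm_scaled[OF N0])
    fix y
    have "exp (- t\<^sup>2) * cmod (g0 y) \<le> exp 1 * exp (- t\<^sup>2) * cmod (g0 y)"
      by (intro mult_right_mono) (auto simp: mult_exp_exp)
    then show "cmod (F (Complex 0 t) y) \<le> exp 1 * exp (- t\<^sup>2) * cmod (g0 y)" using F_boundary(1)[of t y] by linarith
  qed auto
  also have "\<dots> \<le> ennreal (exp 1 * exp (- t\<^sup>2)) * ennreal (suminf c)" by (intro mult_left_mono g_bound) auto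
  finally show "N0 (F (Complex 0 t)) \<le> ennreal (exp 1 * exp (- t\<^sup>2) * suminf c)"
    using suminf_c_nonneg by (simp add: ennreal_mult)
  have "N1 (F (Complex 1 t)) \<le> ennreal (exp 1 * exp (- t\<^sup>2)) * N1 g1"
    by (rule lattice_norm_scaled[OF N1]) (use F_boundary(2) in auto)
  also have "\<dots> \<le> ennreal (exp 1 * exp (- t\<^sup>2)) * ennreal (suminf c)" by (intro mult_left_mono g_bound) auto
  finally show "N1 (F (Complex 1 t)) \<le> ennreal (exp 1 * exp (- t\<^sup>2) * suminf c)"
    using suminf_c_nonneg by (simp add: ennreal_mult)
qed

lemma strip_continuity:
  assumes z: "z \<in> strip" and e: "0 < e"
  shows "\<exists>d>0. \<forall>w\<in>strip. cmod (w - z) < d \<longrightarrow> sum_norm L N0 N1 (\<lambda>y. F w y - F z y) < ennreal e"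
proof -
  \<comment> \<open>The final bound is \<open>e' * (4 * suminf c + 8 * exp 1)\<close>; the added 1
    makes the inequality strict and the divisor positive.\<close>
  define e' where "e' = e / (4 * suminf c + 8 * exp 1 + 1)"
  have den: "0 < 4 * suminf c + 8 * exp 1 + 1" using suminf_c_nonneg by (intro add_nonneg_pos add_nonneg_nonneg) auto
  have e': "0 < e'" using e den by (simp add: e'_def)
  obtain d m where d: "0 < d" and m: "(\<Sum>k. c (k + m)) < e'" and cont: "\<And>w y. cmod (w - z) < d \<Longrightarrow> \<kappa> y < m \<Longrightarrow>
       cmod (F w y - F z y) \<le> e' * cmod (g0 y) \<and> cmod (F w y - F z y) \<le> e' * cmod (g1 y)"
    using continuity_estimate[OF e', of z] by metis
  have "sum_norm L N0 N1 (\<lambda>y. F w y - F z y) < ennreal e" if w: "w \<in> strip" "cmod (w - z) < d" for w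
  proof -
    \<comment> \<open>The majorant consists of a small multiple of \<open>g\<close> and of the tail.
      On the tail each of the two values of \<open>F\<close> is bounded by \<open>exp 1\<close>
      times \<open>g0\<close> and \<open>g1\<close>, hence \<open>2 * exp 1\<close>.\<close>
    define u where "u g y = (of_real e' * g y + of_real (2 * exp 1) * (if m \<le> \<kappa> y then g y else 0) :: complex)" for g y
    have [measurable]: "u g \<in> L" if [measurable]: "g \<in> L" for g unfolding u_def[abs_def] by measurable
    have cu: "cmod (u g y) = (e' + 2 * exp 1 * (if m \<le> \<kappa> y then 1 else 0)) * cmod (g y)" for g y
    proof -
      have "u g y = of_real (e' + 2 * exp 1 * (if m \<le> \<kappa> y then 1 else 0)) * g y" by (simp add: u_def algebra_simps)
      moreover have "0 \<le> e' + 2 * exp 1 * (if m \<le> \<kappa> y then 1 else 0)" using e' by simp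
      ultimately show ?thesis by (simp only: norm_mult norm_of_real abs_of_nonneg)
    qed
    have un: "N (u g) \<le> ennreal (e' * suminf c + 2 * exp 1 * e')" if g: "g = g0 \<and> N = N0 \<or> g = g1 \<and> N = N1" for g N
    proof -
      have NL: "lattice_norm X N" and [measurable]: "g \<in> L" and gb: "N g \<le> ennreal (suminf c)" using g N0 N1 g_bound by auto
      have "N (u g) \<le> N (\<lambda>y. of_real e' * g y) + N (\<lambda>y. of_real (2 * exp 1) * (if m \<le> \<kappa> y then g y else 0))"
        by (rule lattice_norm_add[OF NL]) (auto simp: u_def norm_triangle_ineq)
      also have "\<dots> = ennreal e' * N g + ennreal (2 * exp 1) * N (\<lambda>y. if m \<le> \<kappa> y then g y else 0)"
        using e' by (subst (1 2) lattice_norm_cmult[OF NL]) (auto simp: norm_mult)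
      also have "\<dots> \<le> ennreal e' * ennreal (suminf c) + ennreal (2 * exp 1) * ennreal e'"
        using m by (intro add_mono mult_left_mono gb order_trans[OF tail_bound[OF g]] ennreal_leI) auto
      also have "\<dots> = ennreal (e' * suminf c + 2 * exp 1 * e')"
        using e' suminf_c_nonneg by (simp add: ennreal_mult[symmetric] ennreal_plus[symmetric] del: ennreal_plus)
      finally show ?thesis .
    qed
    have le: "cmod (F w y - F z y) \<le> cmod (u g0 y) + cmod (u g1 y)" for y
    proof (cases "m \<le> \<kappa> y")
      case True
      have "cmod (F w y - F z y) \<le> cmod (F w y) + cmod (F z y)" by (rule norm_triangle_ineq4)
      also have "\<dots> \<le> 2 * (exp 1 * cmod (g0 y) + exp 1 * cmod (g1 y))"
        using F_strip_bound[OF w(1), of y] F_strip_bound[OF z, of y] by (simp add: norm_mult)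
      also have "\<dots> \<le> cmod (u g0 y) + cmod (u g1 y)"
        using True e' by (simp add: cu algebra_simps add_nonneg_nonneg)
      finally show ?thesis .
    next
      case False
      then show ?thesis using cont[OF w(2), of y] e' by (auto simp: cu intro: add_increasing2)
    qed
    have "sum_norm L N0 N1 (\<lambda>y. F w y - F z y) \<le> 2 * N0 (u g0) + 2 * N1 (u g1)"
      using un[of g0 N0] un[of g1 N1] le
      by (intro sum_space_of_bound[OF N0 N1]) (auto intro: le_less_trans)
    also have "\<dots> \<le> ennreal 2 * ennreal (e' * suminf c + 2 * exp 1 * e') + ennreal 2 * ennreal (e' * suminf c + 2 * exp 1 * e')"
      using un[of g0 N0] un[of g1 N1] by (auto intro!: add_mono mult_left_mono)
    also have "\<dots> = ennreal (e' * (4 * suminf c + 8 * exp 1))"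
    proof -
      from ennreal_double_double[of "e' * suminf c + 2 * exp 1 * e'"] show ?thesis
        using e' suminf_c_nonneg by (simp add: algebra_simps)
    qed
    also have "\<dots> < ennreal e"
    proof (intro ennreal_lessI e)
      have "e' * (4 * suminf c + 8 * exp 1) < e' * (4 * suminf c + 8 * exp 1 + 1)" using e' by (intro mult_strict_left_mono) auto
      also have "\<dots> = e" using den by (simp add: e'_def)
      finally show "e' * (4 * suminf c + 8 * exp 1) < e" .
    qed
    finally show ?thesis .
  qed
  then show ?thesis using d by blast
qed

lemma boundary_continuity:
  assumes e: "0 < e"
  shows "\<exists>d>0. \<forall>t'. \<bar>t' - t\<bar> < d \<longrightarrow>
         N0 (\<lambda>y. F (Complex 0 t') y - F (Complex 0 t) y) < ennreal e \<and>
         N1 (\<lambda>y. F (Complex 1 t') y - F (Complex 1 t) y) < ennreal e"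
proof -
  \<comment> \<open>Both boundary lines at once: on the line with real part \<open>s\<close> only
    the matching norm and the matching \<open>g\<close> occur.\<close>
  have one: "\<exists>d>0. \<forall>t'. \<bar>t' - t\<bar> < d \<longrightarrow> N (\<lambda>y. F (Complex s t') y - F (Complex s t) y) < ennreal e"
    if g: "s = 0 \<and> g = g0 \<and> N = N0 \<or> s = 1 \<and> g = g1 \<and> N = N1" for s g N
  proof -
    have NL: "lattice_norm X N" and [measurable]: "g \<in> L" and gb: "N g \<le> ennreal (suminf c)" using g N0 N1 g_bound by auto
    have gN: "g = g0 \<and> N = N0 \<or> g = g1 \<and> N = N1" using g by blast
    have bd: "cmod (F (Complex s r) y) \<le> exp 1 * cmod (g y)" for r y
    proof -
      have e: "exp (- r\<^sup>2) \<le> 1" "(1::real) \<le> exp 1" by simp_all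
      from e have "exp (- r\<^sup>2) \<le> exp 1" by (rule order_trans)
      moreover have "exp 1 * exp (- r\<^sup>2) \<le> exp 1" using mult_left_mono[OF e(1), of "exp 1"] by simp
      ultimately have e01: "exp (- r\<^sup>2) * cmod (g y) \<le> exp 1 * cmod (g y)" "exp 1 * exp (- r\<^sup>2) * cmod (g y) \<le> exp 1 * cmod (g y)"
        by (intro mult_right_mono; simp)+
      have "cmod (F (Complex 0 r) y) \<le> exp 1 * cmod (g y)" if "g = g0"
        using that order_trans[OF F_boundary(1)[of r y]] e01(1) by simp
      moreover have "cmod (F (Complex 1 r) y) \<le> exp 1 * cmod (g y)" if "g = g1"
        by (rule order_trans[OF F_boundary(2)[of r y]]) (use that e01(2) in \<open>simp only:\<close>)
      ultimately show ?thesis using g by metis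
    qed
    define e' where "e' = e / (suminf c + 2 * exp 1 + 1)"
    have den: "0 < suminf c + 2 * exp 1 + 1" using suminf_c_nonneg by (intro add_nonneg_pos add_nonneg_nonneg) auto
    have e': "0 < e'" using e den by (simp add: e'_def)
    obtain d m where d: "0 < d" and m: "(\<Sum>k. c (k + m)) < e'" and cont: "\<And>w y. cmod (w - Complex s t) < d \<Longrightarrow> \<kappa> y < m \<Longrightarrow>
         cmod (F w y - F (Complex s t) y) \<le> e' * cmod (g0 y) \<and> cmod (F w y - F (Complex s t) y) \<le> e' * cmod (g1 y)"
      using continuity_estimate[OF e', of "Complex s t"] by metis
    have "N (\<lambda>y. F (Complex s t') y - F (Complex s t) y) < ennreal e" if t': "\<bar>t' - t\<bar> < d" for t'
    proof -
      have "cmod (Complex s t' - Complex s t) < d" using t' by (simp add: complex_diff cmod_def)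
      note cont' = cont[OF this]
      have "N (\<lambda>y. F (Complex s t') y - F (Complex s t) y)
          \<le> N (\<lambda>y. of_real e' * g y) + N (\<lambda>y. of_real (2 * exp 1) * (if m \<le> \<kappa> y then g y else 0))"
      proof (rule lattice_norm_add[OF NL])
        fix y
        show "cmod (F (Complex s t') y - F (Complex s t) y)
          \<le> cmod (of_real e' * g y) + cmod (of_real (2 * exp 1) * (if m \<le> \<kappa> y then g y else 0))"
        proof (cases "m \<le> \<kappa> y")
          case True
          have "cmod (F (Complex s t') y - F (Complex s t) y) \<le> 2 * exp 1 * cmod (g y)"
            using norm_triangle_ineq4[of "F (Complex s t') y" "F (Complex s t) y"] bd[of t' y] bd[of t y] by simp
          then show ?thesis using True by (simp add: norm_mult add_increasing)
        next
          case False
          then show ?thesis using cont'[of y] g e' by (auto simp: norm_mult)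
        qed
      qed measurable
      also have "\<dots> = ennreal e' * N g + ennreal (2 * exp 1) * N (\<lambda>y. if m \<le> \<kappa> y then g y else 0)"
        using e' by (subst (1 2) lattice_norm_cmult[OF NL]) (auto simp: norm_mult)
      also have "\<dots> \<le> ennreal e' * ennreal (suminf c) + ennreal (2 * exp 1) * ennreal e'"
        using m by (intro add_mono mult_left_mono gb order_trans[OF tail_bound[OF gN]] ennreal_leI) auto
      also have "\<dots> = ennreal (e' * (suminf c + 2 * exp 1))"
        using e' suminf_c_nonneg by (simp add: ennreal_mult[symmetric] ennreal_plus[symmetric] algebra_simps del: ennreal_plus)
      also have "\<dots> < ennreal e"
      proof (intro ennreal_lessI e)
        have "e' * (suminf c + 2 * exp 1) < e' * (suminf c + 2 * exp 1 + 1)" using e' by (intro mult_strict_left_mono) auto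
        also have "\<dots> = e" using den by (simp add: e'_def)
        finally show "e' * (suminf c + 2 * exp 1) < e" .
      qed
      finally show ?thesis .
    qed
    then show ?thesis using d by blast
  qed
  obtain d0 where d0: "0 < d0" "\<forall>t'. \<bar>t' - t\<bar> < d0 \<longrightarrow> N0 (\<lambda>y. F (Complex 0 t') y - F (Complex 0 t) y) < ennreal e"
    using one[of 0 g0 N0] by blast
  obtain d1 where d1: "0 < d1" "\<forall>t'. \<bar>t' - t\<bar> < d1 \<longrightarrow> N1 (\<lambda>y. F (Complex 1 t') y - F (Complex 1 t) y) < ennreal e"
    using one[of 1 g1 N1] by blast
  show ?thesis using d0 d1 by (intro exI[of _ "min d0 d1"]) auto
qed

lemma strip_derivative:
  assumes z: "z \<in> ostrip"
  shows "\<exists>v \<in> sum_space L N0 N1. \<forall>e>0. \<exists>d>0. \<forall>w\<in>ostrip. 0 < cmod (w - z) \<and> cmod (w - z) < d \<longrightarrow>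
         sum_norm L N0 N1 (\<lambda>y. (F w y - F z y) / (w - z) - v y) < ennreal e"
proof -
  obtain C d where C: "0 \<le> C" and d: "0 < d"
    and E': "\<And>b. cmod (Efam' \<theta> z b) \<le> C * (exp (- \<theta> * b) + exp ((1 - \<theta>) * b))"
    and E: "\<And>b w. 0 < cmod (w - z) \<Longrightarrow> cmod (w - z) < d \<Longrightarrow>
        cmod ((Efam \<theta> w b - Efam \<theta> z b) / (w - z) - Efam' \<theta> z b) \<le> C * cmod (w - z) * (exp (- \<theta> * b) + exp ((1 - \<theta>) * b))"
    using Efam_difference_quotient[OF z, of \<theta>] by metis
  define v where "v y = f y * Efam' \<theta> z (b y)" for y
  have [measurable]: "v \<in> L" unfolding v_def[abs_def] by measurable
  show ?thesis
  proof (intro bexI[of _ v] allI impI)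
    show "v \<in> sum_space L N0 N1"
      by (rule sum_estimate(1)[OF _ C]) (auto simp: v_def intro!: cmod_le_g E')
    fix e :: real assume e: "0 < e"
    define d' where "d' = min d (e / (4 * C * suminf c + 1))"
    have den: "0 < 4 * C * suminf c + 1" using C suminf_c_nonneg by (intro add_nonneg_pos mult_nonneg_nonneg) auto
    have d': "0 < d'" using d e den by (simp add: d'_def)
    have "sum_norm L N0 N1 (\<lambda>y. (F w y - F z y) / (w - z) - v y) < ennreal e"
      if w: "0 < cmod (w - z)" "cmod (w - z) < d'" for w
    proof -
      have eq: "(F w y - F z y) / (w - z) - v y = f y * ((Efam \<theta> w (b y) - Efam \<theta> z (b y)) / (w - z) - Efam' \<theta> z (b y))" for y
        by (simp add: F_def v_def algebra_simps diff_divide_distrib)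
      have "sum_norm L N0 N1 (\<lambda>y. (F w y - F z y) / (w - z) - v y) \<le> ennreal (4 * (C * cmod (w - z)) * suminf c)"
      proof (rule sum_estimate(2))
        fix y
        show "cmod ((F w y - F z y) / (w - z) - v y) \<le> cmod (of_real (C * cmod (w - z)) * g0 y) + cmod (of_real (C * cmod (w - z)) * g1 y)"
          unfolding eq using w by (intro cmod_le_g E) (auto simp: d'_def)
      qed (use C in auto)
      also have "\<dots> < ennreal e"
      proof (intro ennreal_lessI e)
        have "4 * (C * cmod (w - z)) * suminf c \<le> (4 * C * suminf c + 1) * cmod (w - z)" by (simp add: algebra_simps)
        also have "\<dots> < (4 * C * suminf c + 1) * (e / (4 * C * suminf c + 1))"
          using w den by (intro mult_strict_left_mono) (auto simp: d'_def)
        also have "\<dots> = e" using den by simp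
        finally show "4 * (C * cmod (w - z)) * suminf c < e" .
      qed
      finally show ?thesis .
    qed
    then show "\<exists>d>0. \<forall>w\<in>ostrip. 0 < cmod (w - z) \<and> cmod (w - z) < d \<longrightarrow>
         sum_norm L N0 N1 (\<lambda>y. (F w y - F z y) / (w - z) - v y) < ennreal e"
      using d' by blast
  qed
qed

lemma F_calderon: "calderon L N0 N1 F"
  unfolding calderon_def
proof (intro conjI)
  show "\<forall>z\<in>strip. F z \<in> sum_space L N0 N1"
    using F_strip_bound by (intro ballI sum_estimate(1)[of _ "exp 1"]) auto
  have "\<forall>z\<in>strip. sum_norm L N0 N1 (F z) \<le> ennreal (4 * exp 1 * suminf c)"
    using F_strip_bound by (intro ballI sum_estimate(2)[of _ "exp 1"]) auto
  then show "\<exists>B::real. \<forall>z\<in>strip. sum_norm L N0 N1 (F z) \<le> ennreal B" by blast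
  show "\<forall>t. F (Complex 0 t) \<in> nspace L N0 \<and> F (Complex 1 t) \<in> nspace L N1"
    using le_less_trans[OF F_boundary_norm(1) ennreal_less_top] le_less_trans[OF F_boundary_norm(2) ennreal_less_top]
    by (simp add: nspace_def)
  show "\<forall>e>0. \<exists>R. \<forall>t. R \<le> \<bar>t\<bar> \<longrightarrow> N0 (F (Complex 0 t)) < ennreal e \<and> N1 (F (Complex 1 t)) < ennreal e"
  proof (intro allI impI)
    fix e :: real assume e: "0 < e"
    define K where "K = exp 1 * suminf c"
    have K: "0 \<le> K" using suminf_c_nonneg by (simp add: K_def)
    \<comment> \<open>Only the Gaussian factor provides the decay; for \<open>\<bar>t\<bar>\<close>
      at least 1 the square of \<open>t\<close>, and so its exponential, is at least
      \<open>\<bar>t\<bar>\<close>.\<close>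
    have "exp 1 * exp (- t\<^sup>2) * suminf c < e" if t: "K / e + 1 \<le> \<bar>t\<bar>" for t
    proof -
      have "1 \<le> \<bar>t\<bar>" using t K e by (smt (verit) divide_nonneg_pos)
      then have "\<bar>t\<bar> * 1 \<le> \<bar>t\<bar> * \<bar>t\<bar>" by (intro mult_left_mono) auto
      then have "\<bar>t\<bar> \<le> t\<^sup>2" by (simp add: power2_eq_square)
      also have "t\<^sup>2 < exp (t\<^sup>2)" using exp_ge_add_one_self[of "t\<^sup>2"] by linarith
      finally have "K / e < exp (t\<^sup>2)" using t by linarith
      then have "K < e * exp (t\<^sup>2)" using e by (simp add: divide_less_eq mult.commute)
      then have "K * exp (- t\<^sup>2) < e * exp (t\<^sup>2) * exp (- t\<^sup>2)" by (intro mult_strict_right_mono) auto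
      then show ?thesis by (simp add: K_def mult_exp_exp mult_ac)
    qed
    then show "\<exists>R. \<forall>t. R \<le> \<bar>t\<bar> \<longrightarrow> N0 (F (Complex 0 t)) < ennreal e \<and> N1 (F (Complex 1 t)) < ennreal e"
      using le_less_trans[OF F_boundary_norm(1) ennreal_lessI[OF e]] le_less_trans[OF F_boundary_norm(2) ennreal_lessI[OF e]]
      by (intro exI[of _ "K / e + 1"]) simp
  qed
qed (intro ballI allI impI strip_continuity boundary_continuity strip_derivative; assumption)+

lemma F_theta: "F (of_real \<theta>) = f"
  by (auto simp: F_def)

lemma F_calderon_norm: "calderon_norm N0 N1 F \<le> ennreal (exp 1 * suminf c)"
proof -
  have le: "ennreal (exp 1 * exp (- t\<^sup>2) * suminf c) \<le> ennreal (exp 1 * suminf c)" for t :: real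
    using suminf_c_nonneg by (intro ennreal_leI mult_right_mono) auto
  show ?thesis unfolding calderon_norm_def
    using F_boundary_norm le by (auto intro!: SUP_least intro: order_trans)
qed

end

section \<open>Analytic pairings\<close>

text \<open>Three lines argument: the factor \<open>exp (e * z * z)\<close> makes the horizontal
  sides of a tall rectangle harmless, and \<open>e\<close> tends to 0. The a priori bound
  \<open>A\<close> enters only through the height of the rectangle.\<close>

lemma strip_maximum_modulus:
  fixes \<Phi> :: "complex \<Rightarrow> complex"
  assumes cont: "continuous_on strip \<Phi>" and hol: "\<Phi> holomorphic_on ostrip"
    and bdd: "\<And>z. z \<in> strip \<Longrightarrow> cmod (\<Phi> z) \<le> A"
    and bd: "\<And>t. cmod (\<Phi> (Complex 0 t)) \<le> B" "\<And>t. cmod (\<Phi> (Complex 1 t)) \<le> B"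
    and z: "z \<in> strip"
  shows "cmod (\<Phi> z) \<le> B"
proof -
  have B: "0 \<le> B" using bd(1)[of 0] norm_ge_zero order_trans by blast
  have A: "0 \<le> A" using bdd[OF z] norm_ge_zero order_trans by blast
  have eps: "cmod (\<Phi> z * exp (of_real e * z\<^sup>2)) \<le> exp e * B + e" if e: "0 < e" for e
  proof -
    define f where "f w = \<Phi> w * exp (of_real e * w\<^sup>2)" for w
    have cf: "cmod (f w) = cmod (\<Phi> w) * exp (e * ((Re w)\<^sup>2 - (Im w)\<^sup>2))" for w
      by (simp add: f_def norm_mult power2_eq_square)
    \<comment> \<open>With this height the exponential factor on the horizontal sides is at most
      \<open>exp (- (A / e))\<close>, and \<open>A * exp (- (A / e)) \<le> e\<close> because
      \<open>A / e \<le> exp (A / e)\<close>.\<close>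
    define T where "T = max (\<bar>Im z\<bar> + 1) (sqrt (1 + A / e\<^sup>2))"
    have T: "\<bar>Im z\<bar> < T" "1 + A / e\<^sup>2 \<le> T\<^sup>2"
    proof -
      show "\<bar>Im z\<bar> < T" by (simp add: T_def)
      have "(sqrt (1 + A / e\<^sup>2))\<^sup>2 \<le> T\<^sup>2" using A by (intro power_mono) (auto simp: T_def add_nonneg_nonneg)
      then show "1 + A / e\<^sup>2 \<le> T\<^sup>2" using A by (simp add: add_nonneg_nonneg)
    qed
    define S where "S = cbox (Complex 0 (-T)) (Complex 1 T)"
    have S: "w \<in> S \<longleftrightarrow> 0 \<le> Re w \<and> Re w \<le> 1 \<and> - T \<le> Im w \<and> Im w \<le> T" for w
      by (auto simp: S_def in_cbox_complex_iff)
    have Sstrip: "S \<subseteq> strip" by (auto simp: S strip_def)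
    have int: "interior S = {w. 0 < Re w \<and> Re w < 1 \<and> - T < Im w \<and> Im w < T}"
      by (auto simp: S_def interior_cbox in_box_complex_iff)
    show ?thesis
    proof (rule maximum_modulus_frontier[of f S "exp e * B + e" z, unfolded f_def])
      have "interior S \<subseteq> ostrip" by (auto simp: int ostrip_def)
      then show "(\<lambda>w. \<Phi> w * exp (of_real e * w\<^sup>2)) holomorphic_on interior S"
        using hol by (auto intro!: holomorphic_intros elim: holomorphic_on_subset)
      show "continuous_on (closure S) (\<lambda>w. \<Phi> w * exp (of_real e * w\<^sup>2))"
        using continuous_on_subset[OF cont Sstrip] by (auto simp: S_def closure_closed intro!: continuous_intros)
      show "bounded S" by (simp add: S_def)
      show "z \<in> S" using z T by (auto simp: S strip_def)
      fix w assume "w \<in> frontier S"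
      then have wS: "w \<in> S" and wi: "w \<notin> interior S" by (auto simp: frontier_def S_def)
      then consider "Re w = 0" | "Re w = 1" | "\<bar>Im w\<bar> = T" by (auto simp: int S abs_if)
      then have "cmod (f w) \<le> exp e * B + e"
      proof cases
        case 1
        then have "w = Complex 0 (Im w)" by (simp add: complex_eq_iff)
        then have "cmod (f w) \<le> B * exp (e * (0 - (Im w)\<^sup>2))"
          using bd(1)[of "Im w"] 1 unfolding cf by (intro mult_mono) (auto simp: B)
        also have "\<dots> \<le> B * exp e" using B e by (intro mult_left_mono) (auto intro: order_trans[of _ 0])
        finally show ?thesis using e by (simp add: mult.commute)
      next
        case 2
        then have "w = Complex 1 (Im w)" by (simp add: complex_eq_iff)
        then have "cmod (f w) \<le> B * exp (e * (1 - (Im w)\<^sup>2))"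
          using bd(2)[of "Im w"] 2 unfolding cf by (intro mult_mono) (auto simp: B)
        also have "\<dots> \<le> B * exp e" using B e by (intro mult_left_mono) (auto simp: mult_le_cancel_left1 algebra_simps)
        finally show ?thesis using e by (simp add: mult.commute)
      next
        case 3
        have "(Re w)\<^sup>2 \<le> 1" using wS by (auto simp: S power_le_one)
        moreover have "(Im w)\<^sup>2 = T\<^sup>2" using 3 by (metis power2_abs)
        ultimately have "(Re w)\<^sup>2 - (Im w)\<^sup>2 \<le> - (A / e\<^sup>2)" using T(2) by linarith
        then have "e * ((Re w)\<^sup>2 - (Im w)\<^sup>2) \<le> e * (- (A / e\<^sup>2))" using e by (intro mult_left_mono) auto
        also have "\<dots> = - (A / e)" using e by (simp add: power2_eq_square)
        finally have "cmod (f w) \<le> A * exp (- (A / e))"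
          unfolding cf using bdd[of w] wS Sstrip A by (intro mult_mono) auto
        also have "\<dots> \<le> e"
        proof -
          have "A / e \<le> exp (A / e)" using exp_ge_add_one_self[of "A / e"] by linarith
          then have "A \<le> e * exp (A / e)" using e by (simp add: divide_le_eq mult.commute)
          then have "A * exp (- (A / e)) \<le> e * exp (A / e) * exp (- (A / e))" by (intro mult_right_mono) auto
          also have "\<dots> = e" by (simp only: mult.assoc mult_exp_exp) simp
          finally show ?thesis .
        qed
        also have "\<dots> \<le> exp e * B + e" using B by simp
        finally show ?thesis .
      qed
      then show "cmod (\<Phi> w * exp (of_real e * w\<^sup>2)) \<le> exp e * B + e" by (simp add: f_def)
    qed
  qed
  have "((\<lambda>e. cmod (\<Phi> z * exp (of_real e * z\<^sup>2))) \<longlongrightarrow> cmod (\<Phi> z * exp (of_real 0 * z\<^sup>2))) (at_right 0)"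
    by (intro tendsto_intros)
  moreover have "((\<lambda>e. exp e * B + e) \<longlongrightarrow> exp 0 * B + 0) (at_right (0::real))" by (intro tendsto_intros)
  moreover have "eventually (\<lambda>e. cmod (\<Phi> z * exp (of_real e * z\<^sup>2)) \<le> exp e * B + e) (at_right 0)"
    using eps by (auto simp: eventually_at_right_less intro: eventually_at_rightI[of 0 1])
  ultimately have "cmod (\<Phi> z * exp (of_real 0 * z\<^sup>2)) \<le> exp 0 * B + 0"
    by (intro tendsto_le[of "at_right (0::real)"]) auto
  then show ?thesis by simp
qed

text \<open>The dual family is \<open>G z\<close>, supported on a set \<open>K\<close> with bounded
  exponents, and both norms dominate the integral of the modulus over \<open>K\<close>. The
  constants \<open>CK\<close> and \<open>B\<close> only make the pairing a bounded analytic
  function; they do not occur in the bound of \<open>pairing_le\<close>.\<close>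

locale analytic_pairing =
  fixes X :: "'b measure" and N0 N1 :: "('b \<Rightarrow> complex) \<Rightarrow> ennreal" and F :: "complex \<Rightarrow> 'b \<Rightarrow> complex"
    and K :: "'b set" and \<sigma> :: "'b \<Rightarrow> complex" and c0 c1 :: "'b \<Rightarrow> real" and CK B :: real
  assumes cal: "calderon (borel_measurable X) N0 N1 F"
    and K_meas [measurable]: "K \<inter> space X \<in> sets X"
    and \<sigma>_meas [measurable]: "\<sigma> \<in> borel_measurable X" and c_meas [measurable]: "c0 \<in> borel_measurable X" "c1 \<in> borel_measurable X"
    and \<sigma>_le: "\<And>y. cmod (\<sigma> y) \<le> 1" and c_le: "\<And>y. y \<in> K \<Longrightarrow> \<bar>c0 y\<bar> \<le> B" "\<And>y. y \<in> K \<Longrightarrow> \<bar>c1 y\<bar> \<le> B"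
    and CK: "0 < CK" and B: "0 \<le> B"
    and N0_K: "\<And>u. u \<in> borel_measurable X \<Longrightarrow> (\<integral>\<^sup>+y. indicator K y * ennreal (cmod (u y)) \<partial>X) \<le> ennreal CK * N0 u"
    and N1_K: "\<And>u. u \<in> borel_measurable X \<Longrightarrow> (\<integral>\<^sup>+y. indicator K y * ennreal (cmod (u y)) \<partial>X) \<le> ennreal CK * N1 u"
begin

abbreviation L where "L \<equiv> borel_measurable X"
definition nK :: "('b \<Rightarrow> complex) \<Rightarrow> ennreal" where "nK u = (\<integral>\<^sup>+y. indicator K y * ennreal (cmod (u y)) \<partial>X)"
definition G where "G z y = indicator K y * \<sigma> y * exp (of_real (c0 y) + z * of_real (c1 y))" for z y
definition \<Phi> where "\<Phi> z = (LINT y|X. F z y * G z y)" for z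

lemma K_ind [measurable]: "(\<lambda>y. indicator K y :: complex) \<in> L" "(\<lambda>y. indicator K y :: ennreal) \<in> borel_measurable X"
  using K_meas by (simp_all add: borel_measurable_indicator_iff)

lemma G_meas [measurable]: "G z \<in> L"
  unfolding G_def[abs_def] by measurable

lemma sum_space_meas: "u \<in> sum_space L N0 N1 \<Longrightarrow> u \<in> L"
  by (auto simp: sum_space_def nspace_def)

lemma F_meas [measurable]: "z \<in> strip \<Longrightarrow> F z \<in> L"
  using cal unfolding calderon_def by (blast intro: sum_space_meas)

text \<open>All limits in the Calderon class are limits in the sum norm; this estimate turns them
  into limits of integrals over \<open>K\<close>. The constant is moved to the left side before the
  infimum over decompositions is taken.\<close>

lemma nK_le: "nK u \<le> ennreal CK * sum_norm L N0 N1 u"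
proof -
  have le0: "nK u \<le> ennreal CK * (N0 a + N1 b)" if "a \<in> nspace L N0" "b \<in> nspace L N1" "u = (\<lambda>y. a y + b y)" for a b
  proof -
    have [measurable]: "a \<in> L" "b \<in> L" using that by (auto simp: nspace_def)
    have "nK u \<le> (\<integral>\<^sup>+y. indicator K y * ennreal (cmod (a y)) + indicator K y * ennreal (cmod (b y)) \<partial>X)"
      unfolding nK_def that(3)
      by (intro nn_integral_mono)
        (auto split: split_indicator simp: ennreal_plus[symmetric] norm_triangle_ineq simp del: ennreal_plus intro!: ennreal_leI)
    also have "\<dots> = nK a + nK b" unfolding nK_def by (intro nn_integral_add) auto
    also have "\<dots> \<le> ennreal CK * N0 a + ennreal CK * N1 b" unfolding nK_def by (intro add_mono N0_K N1_K) auto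
    finally show ?thesis by (simp add: distrib_left)
  qed
  have le: "ennreal (1 / CK) * nK u \<le> sum_norm L N0 N1 u"
    unfolding sum_norm_def
  proof (intro INF_greatest)
    fix ab assume "ab \<in> {(a, b). a \<in> nspace L N0 \<and> b \<in> nspace L N1 \<and> u = (\<lambda>y. a y + b y)}"
    then have "nK u \<le> ennreal CK * (N0 (fst ab) + N1 (snd ab))"
      by (intro le0) auto
    then have "ennreal (1 / CK) * nK u \<le> ennreal (1 / CK) * (ennreal CK * (N0 (fst ab) + N1 (snd ab)))"
      by (intro mult_left_mono) auto
    then show "ennreal (1 / CK) * nK u \<le> N0 (fst ab) + N1 (snd ab)"
      using CK by (simp add: mult.assoc[symmetric] ennreal_mult[symmetric])
  qed
  have "nK u = ennreal CK * (ennreal (1 / CK) * nK u)"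
    using CK by (simp add: mult.assoc[symmetric] ennreal_mult[symmetric])
  also have "\<dots> \<le> ennreal CK * sum_norm L N0 N1 u" by (intro mult_left_mono le) auto
  finally show ?thesis .
qed

lemma nK_finite: "u \<in> sum_space L N0 N1 \<Longrightarrow> nK u < top"
proof -
  assume "u \<in> sum_space L N0 N1"
  then obtain a b where ab: "a \<in> nspace L N0" "b \<in> nspace L N1" "u = (\<lambda>y. a y + b y)" by (auto simp: sum_space_def)
  have "sum_norm L N0 N1 u \<le> N0 (fst (a, b)) + N1 (snd (a, b))"
    unfolding sum_norm_def using ab by (intro INF_lower) auto
  also have "\<dots> < top" using ab by (simp add: nspace_def)
  finally have "ennreal CK * sum_norm L N0 N1 u < top" by (simp add: ennreal_mult_less_top)
  then show ?thesis using nK_le[of u] by (rule le_less_trans[rotated])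
qed

lemma G_bound:
  assumes "z \<in> strip"
  shows "cmod (G z y) \<le> exp (2 * B) * indicator K y"
proof (cases "y \<in> K")
  case True
  have "cmod (G z y) \<le> 1 * exp (c0 y + Re z * c1 y)"
    using True \<sigma>_le[of y] unfolding G_def norm_mult by (intro mult_mono) auto
  also have "\<dots> \<le> exp (2 * B)"
  proof -
    have "\<bar>Re z * c1 y\<bar> \<le> 1 * B" unfolding abs_mult using assms c_le(2)[OF True] by (intro mult_mono) (auto simp: strip_def)
    then show ?thesis using c_le(1)[OF True] by simp
  qed
  finally show ?thesis using True by simp
qed (simp add: G_def)

lemma pair_bound:
  assumes [measurable]: "u \<in> L" "h \<in> L" and fin: "nK u < top" and h: "\<And>y. cmod (h y) \<le> C * indicator K y" and C: "0 \<le> C"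
  shows "integrable X (\<lambda>y. u y * h y)" "cmod (LINT y|X. u y * h y) \<le> C * enn2real (nK u)"
proof -
  have le: "(\<integral>\<^sup>+y. ennreal (cmod (u y * h y)) \<partial>X) \<le> ennreal C * nK u"
    unfolding nK_def
  proof (subst nn_integral_cmult[symmetric], measurable, intro nn_integral_mono)
    fix y
    have "cmod (u y * h y) \<le> C * (indicator K y * cmod (u y))"
      unfolding norm_mult using mult_left_mono[OF h[of y], of "cmod (u y)"] by (simp add: mult_ac)
    then have "ennreal (cmod (u y * h y)) \<le> ennreal (C * (indicator K y * cmod (u y)))" by (rule ennreal_leI)
    also have "\<dots> = ennreal C * (indicator K y * ennreal (cmod (u y)))"
      using C by (simp add: ennreal_mult ennreal_indicator)
    finally show "ennreal (cmod (u y * h y)) \<le> ennreal C * (indicator K y * ennreal (cmod (u y)))" .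
  qed
  also have lt: "\<dots> < top" using fin by (simp add: ennreal_mult_less_top)
  finally show int: "integrable X (\<lambda>y. u y * h y)" by (intro integrableI_bounded) auto
  have "cmod (LINT y|X. u y * h y) \<le> (LINT y|X. cmod (u y * h y))" by (rule integral_norm_bound)
  also have "\<dots> = enn2real (\<integral>\<^sup>+y. ennreal (cmod (u y * h y)) \<partial>X)"
    by (intro integral_eq_nn_integral) auto
  also have "\<dots> \<le> enn2real (ennreal C * nK u)" using le lt by (intro enn2real_mono) auto
  also have "\<dots> = C * enn2real (nK u)" using C by (simp add: enn2real_mult)
  finally show "cmod (LINT y|X. u y * h y) \<le> C * enn2real (nK u)" .
qed

text \<open>\<open>c1 y * G z y\<close> is the derivative in \<open>z\<close>. One constant covers
  the derivative, of size \<open>B\<close>, and the second order remainder, of size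
  \<open>B * B\<close>.\<close>

lemma G_Taylor:
  "\<exists>C\<ge>0. \<forall>y. cmod (of_real (c1 y) * G z y) \<le> C * indicator K y \<and> (\<forall>w. cmod (w - z) < 1 \<longrightarrow>
      cmod (G w y - G z y - of_real (c1 y) * G z y * (w - z)) \<le> C * (cmod (w - z))\<^sup>2 * indicator K y)"
proof -
  define R where "R = exp (B + (cmod z + 1) * B)"
  define C where "C = (B + B\<^sup>2) * R"
  have C: "0 \<le> C" using B by (simp add: C_def R_def)
  have ex: "cmod (\<sigma> y * exp (of_real (c0 y) + w * of_real (c1 y))) \<le> R" if "y \<in> K" "cmod (w - z) < 1" for y w
  proof -
    have "cmod w \<le> cmod z + 1" using that(2) norm_triangle_sub[of w z] by linarith
    then have "\<bar>Re w\<bar> \<le> cmod z + 1" using abs_Re_le_cmod[of w] by linarith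
    then have "\<bar>Re w * c1 y\<bar> \<le> (cmod z + 1) * B" unfolding abs_mult using c_le(2)[OF that(1)] by (intro mult_mono) auto
    then have "exp (c0 y + Re w * c1 y) \<le> R" using c_le(1)[OF that(1)] by (simp add: R_def)
    moreover have "cmod (\<sigma> y * exp (of_real (c0 y) + w * of_real (c1 y))) \<le> 1 * exp (c0 y + Re w * c1 y)"
      unfolding norm_mult by (intro mult_mono \<sigma>_le) auto
    ultimately show ?thesis by simp
  qed
  have "cmod (of_real (c1 y) * G z y) \<le> C * indicator K y" for y
  proof (cases "y \<in> K")
    case True
    have "cmod (of_real (c1 y) * G z y) \<le> B * R"
      unfolding norm_mult using ex[OF True, of z] True c_le(2)[OF True] B by (intro mult_mono) (auto simp: G_def norm_mult)
    also have "\<dots> \<le> C" using B by (simp add: C_def R_def)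
    finally show ?thesis using True by simp
  qed (simp add: G_def)
  moreover have "cmod (G w y - G z y - of_real (c1 y) * G z y * (w - z)) \<le> C * (cmod (w - z))\<^sup>2 * indicator K y"
    if w: "cmod (w - z) < 1" for w y
  proof (cases "y \<in> K")
    case True
    define g where "g i w = of_real (c1 y) ^ i * (\<sigma> y * exp (of_real (c0 y) + w * of_real (c1 y)))" for i :: nat and w
    have "cmod (g 0 w - (\<Sum>i\<le>1. g i z * (w - z) ^ i / fact i)) \<le> C * cmod (w - z) ^ Suc 1 / fact 1"
    proof (rule complex_Taylor[where S="ball z 1"])
      show "(g i has_field_derivative g (Suc i) x) (at x within ball z 1)" for i x
        unfolding g_def[abs_def] by (auto intro!: derivative_eq_intros simp: mult_ac)
      show "cmod (g (Suc 1) x) \<le> C" if "x \<in> ball z 1" for x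
      proof -
        have "cmod (of_real (c1 y) ^ Suc 1) \<le> B\<^sup>2"
          using power_mono[OF c_le(2)[OF True], of 2] by (simp add: norm_mult power2_eq_square)
        moreover have "cmod (\<sigma> y * exp (of_real (c0 y) + x * of_real (c1 y))) \<le> R"
          using that by (intro ex[OF True]) (simp add: dist_norm norm_minus_commute)
        ultimately have "cmod (g (Suc 1) x) \<le> B\<^sup>2 * R"
          unfolding g_def norm_mult[of "of_real (c1 y) ^ _"] by (intro mult_mono) auto
        also have "\<dots> \<le> C" using B by (simp add: C_def R_def)
        finally show ?thesis .
      qed
    qed (use w in \<open>auto simp: dist_norm norm_minus_commute\<close>)
    then show ?thesis using True by (simp add: g_def G_def power2_eq_square algebra_simps)
  qed (simp add: G_def)
  ultimately show ?thesis using C by blast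
qed

lemma G_diff_bound:
  assumes C: "0 \<le> C" "cmod (of_real (c1 y) * G z y) \<le> C * indicator K y"
    "cmod (G w y - G z y - of_real (c1 y) * G z y * (w - z)) \<le> C * (cmod (w - z))\<^sup>2 * indicator K y"
    and w: "cmod (w - z) < 1"
  shows "cmod (G w y - G z y) \<le> (2 * C * cmod (w - z)) * indicator K y"
proof -
  have "cmod (G w y - G z y) \<le> cmod (G w y - G z y - of_real (c1 y) * G z y * (w - z)) + cmod (of_real (c1 y) * G z y * (w - z))"
    by (metis add.commute diff_add_cancel norm_triangle_ineq)
  also have "\<dots> \<le> C * (cmod (w - z))\<^sup>2 * indicator K y + C * indicator K y * cmod (w - z)"
    using C(3) mult_right_mono[OF C(2), of "cmod (w - z)"] by (intro add_mono) (auto simp: norm_mult)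
  also have "\<dots> \<le> C * cmod (w - z) * indicator K y + C * indicator K y * cmod (w - z)"
  proof -
    have "(cmod (w - z))\<^sup>2 \<le> 1 * cmod (w - z)" unfolding power2_eq_square using w by (intro mult_right_mono) auto
    then show ?thesis using C(1) by (intro add_right_mono mult_right_mono mult_left_mono) auto
  qed
  finally show ?thesis by (simp add: algebra_simps)
qed

lemma Phi_bound: "\<exists>A. \<forall>z\<in>strip. cmod (\<Phi> z) \<le> A"
proof -
  obtain B' where B': "\<And>z. z \<in> strip \<Longrightarrow> sum_norm L N0 N1 (F z) \<le> ennreal B'"
  proof -
    have "\<exists>B'. \<forall>z\<in>strip. sum_norm L N0 N1 (F z) \<le> ennreal B'" using cal by (simp add: calderon_def)
    then show ?thesis using that by blast
  qed
  have "cmod (\<Phi> z) \<le> exp (2 * B) * (CK * max 0 B')" if z: "z \<in> strip" for z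
  proof -
    have [measurable]: "F z \<in> L" using z by (rule F_meas)
    have "nK (F z) \<le> ennreal CK * ennreal (max 0 B')"
      by (intro order_trans[OF nK_le] mult_left_mono order_trans[OF B'[OF z]] ennreal_leI) auto
    also have "\<dots> = ennreal (CK * max 0 B')" using CK by (simp add: ennreal_mult)
    finally have n: "nK (F z) \<le> ennreal (CK * max 0 B')" .
    then have "cmod (\<Phi> z) \<le> exp (2 * B) * enn2real (nK (F z))"
      unfolding \<Phi>_def using G_bound[OF z] by (intro pair_bound(2)) (auto intro: le_less_trans)
    also have "enn2real (nK (F z)) \<le> CK * max 0 B'"
      using n CK by (simp add: enn2real_leI)
    finally show ?thesis by simp
  qed
  then show ?thesis by blast
qed

lemma enn2real_nK_less:
  assumes "sum_norm L N0 N1 u < ennreal e" "0 < e"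
  shows "nK u < top" "enn2real (nK u) \<le> CK * e"
proof -
  have "nK u \<le> ennreal CK * ennreal e"
    using assms by (intro order_trans[OF nK_le] mult_left_mono) auto
  also have "\<dots> = ennreal (CK * e)" using CK assms by (simp add: ennreal_mult)
  finally have n: "nK u \<le> ennreal (CK * e)" .
  then show "nK u < top" by (rule le_less_trans) simp
  show "enn2real (nK u) \<le> CK * e" using n CK assms by (intro enn2real_leI) auto
qed

lemma Phi_continuous: "continuous_on strip \<Phi>"
  unfolding continuous_on_iff
proof (intro ballI allI impI)
  fix z :: complex and e :: real assume z: "z \<in> strip" and e: "0 < e"
  have [measurable]: "F z \<in> L" using z by (rule F_meas)
  have Fz: "nK (F z) < top" using cal z by (intro nK_finite) (auto simp: calderon_def)
  obtain C where C: "0 \<le> C" "\<And>y. cmod (of_real (c1 y) * G z y) \<le> C * indicator K y"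
    "\<And>w y. cmod (w - z) < 1 \<Longrightarrow> cmod (G w y - G z y - of_real (c1 y) * G z y * (w - z)) \<le> C * (cmod (w - z))\<^sup>2 * indicator K y"
    using G_Taylor[of z] by blast
  \<comment> \<open>\<open>e1\<close> is the share of the change of \<open>F\<close> against
    \<open>G w\<close>; \<open>T\<close> below handles the change of \<open>G\<close> against
    \<open>F z\<close>. Each contributes \<open>e / 2\<close>.\<close>
  define e1 where "e1 = e / (2 * (exp (2 * B) * CK))"
  have e1: "0 < e1" using e CK by (simp add: e1_def)
  define T where "T = 2 * C * enn2real (nK (F z)) + 1"
  have T: "0 < T" using C by (simp add: T_def add_nonneg_pos)
  obtain d1 where d1: "0 < d1" "\<And>w. w \<in> strip \<Longrightarrow> cmod (w - z) < d1 \<Longrightarrow> sum_norm L N0 N1 (\<lambda>y. F w y - F z y) < ennreal e1"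
    using cal z e1 unfolding calderon_def by metis
  define d where "d = min d1 (min 1 (e / (2 * T)))"
  have "cmod (\<Phi> w - \<Phi> z) < e" if w: "w \<in> strip" "cmod (w - z) < d" for w
  proof -
    have [measurable]: "F w \<in> L" using w(1) by (rule F_meas)
    have sn: "sum_norm L N0 N1 (\<lambda>y. F w y - F z y) < ennreal e1" using w d1 by (auto simp: d_def)
    note nD = enn2real_nK_less[OF sn e1]
    have w1: "cmod (w - z) < 1" using w by (simp add: d_def)
    have Gd: "cmod (G w y - G z y) \<le> (2 * C * cmod (w - z)) * indicator K y" for y
      by (intro G_diff_bound C w1)
    have "\<Phi> w - \<Phi> z = (LINT y|X. (F w y - F z y) * G w y) + (LINT y|X. F z y * (G w y - G z y))"
    proof -
      have i1: "integrable X (\<lambda>y. F z y * G w y)" "integrable X (\<lambda>y. F z y * G z y)"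
        using Fz G_bound[OF w(1)] G_bound[OF z] by (auto intro!: pair_bound(1)[of _ _ "exp (2 * B)"])
      have i2: "integrable X (\<lambda>y. (F w y - F z y) * G w y)"
        using nD(1) G_bound[OF w(1)] by (intro pair_bound(1)[of _ _ "exp (2 * B)"]) auto
      have i3: "integrable X (\<lambda>y. F w y * G w y)"
        using Bochner_Integration.integrable_add[OF i2 i1(1)] by (simp add: left_diff_distrib)
      show ?thesis unfolding \<Phi>_def left_diff_distrib right_diff_distrib
        using i1 i3 by simp
    qed
    then have "cmod (\<Phi> w - \<Phi> z) \<le> cmod (LINT y|X. (F w y - F z y) * G w y) + cmod (LINT y|X. F z y * (G w y - G z y))"
      by (simp add: norm_triangle_ineq)
    also have "\<dots> \<le> exp (2 * B) * enn2real (nK (\<lambda>y. F w y - F z y)) + 2 * C * cmod (w - z) * enn2real (nK (F z))"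
      using nD(1) Fz G_bound[OF w(1)] Gd C by (intro add_mono pair_bound(2)) auto
    also have "\<dots> \<le> exp (2 * B) * (CK * e1) + cmod (w - z) * T"
      using nD(2) by (intro add_mono mult_left_mono) (auto simp: T_def algebra_simps)
    also have "\<dots> < e / 2 + e / 2"
    proof (intro add_le_less_mono)
      show "exp (2 * B) * (CK * e1) \<le> e / 2" using CK by (simp add: e1_def)
      have "cmod (w - z) * T < e / (2 * T) * T" using w T by (intro mult_strict_right_mono) (auto simp: d_def)
      then show "cmod (w - z) * T < e / 2" using T by simp
    qed
    finally show ?thesis by simp
  qed
  moreover have "0 < d" using d1 e T by (simp add: d_def)
  ultimately show "\<exists>d>0. \<forall>x'\<in>strip. dist x' z < d \<longrightarrow> dist (\<Phi> x') (\<Phi> z) < e"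
    by (intro exI[of _ d]) (auto simp: dist_norm)
qed

text \<open>A product rule: the difference quotient of \<open>F\<close> converges in the sum norm,
  hence for integrals over \<open>K\<close>, and that of \<open>G\<close> converges uniformly on
  \<open>K\<close>.\<close>

lemma Phi_holomorphic: "\<Phi> holomorphic_on ostrip"
proof -
  have os: "ostrip = {z. 0 < Re z} \<inter> {z. Re z < 1}" by (auto simp: ostrip_def)
  have open_os: "open ostrip" unfolding os by (intro open_Int open_halfspace_Re_gt open_halfspace_Re_lt)
  have "\<exists>D. (\<Phi> has_field_derivative D) (at z)" if z: "z \<in> ostrip" for z
  proof -
    have strip: "w \<in> strip" if "w \<in> ostrip" for w using that by (auto simp: strip_def ostrip_def)
    obtain v where v: "v \<in> sum_space L N0 N1" and quot: "\<And>e. 0 < e \<Longrightarrow> \<exists>d>0. \<forall>w\<in>ostrip.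
         0 < cmod (w - z) \<and> cmod (w - z) < d \<longrightarrow> sum_norm L N0 N1 (\<lambda>y. (F w y - F z y) / (w - z) - v y) < ennreal e"
      using cal z unfolding calderon_def by blast
    have [measurable]: "v \<in> L" "F z \<in> L" using v z by (auto intro: sum_space_meas F_meas strip)
    have vfin: "nK v < top" using v by (rule nK_finite)
    have Fz: "nK (F z) < top" using cal strip[OF z] by (intro nK_finite) (auto simp: calderon_def)
    obtain C where C: "0 \<le> C" "\<And>y. cmod (of_real (c1 y) * G z y) \<le> C * indicator K y"
      "\<And>w y. cmod (w - z) < 1 \<Longrightarrow> cmod (G w y - G z y - of_real (c1 y) * G z y * (w - z)) \<le> C * (cmod (w - z))\<^sup>2 * indicator K y"
      using G_Taylor[of z] by blast
    define D where "D = (LINT y|X. v y * G z y) + (LINT y|X. F z y * (of_real (c1 y) * G z y))"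
    have "((\<lambda>w. (\<Phi> w - \<Phi> z) / (w - z)) \<longlongrightarrow> D) (at z)"
      unfolding LIM_eq
    proof (intro allI impI)
      fix e :: real assume e: "0 < e"
      define e1 where "e1 = e / (2 * (exp (2 * B) * CK))"
      have e1: "0 < e1" using e CK by (simp add: e1_def)
      define T where "T = 2 * C * enn2real (nK v) + C * enn2real (nK (F z)) + 1"
      have T: "0 < T" using C by (simp add: T_def add_nonneg_pos add_nonneg_nonneg)
      obtain d1 where d1: "0 < d1" "\<And>w. w \<in> ostrip \<Longrightarrow> 0 < cmod (w - z) \<Longrightarrow> cmod (w - z) < d1 \<Longrightarrow>
          sum_norm L N0 N1 (\<lambda>y. (F w y - F z y) / (w - z) - v y) < ennreal e1"
        using quot[OF e1] by metis
      obtain d2 where d2: "0 < d2" "ball z d2 \<subseteq> ostrip" using open_os z open_contains_ball by blast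
      define d where "d = min (min d1 d2) (min 1 (e / (2 * T)))"
      have "cmod ((\<Phi> w - \<Phi> z) / (w - z) - D) < e" if w: "w \<noteq> z" "cmod (w - z) < d" for w
      proof -
        have wo: "w \<in> ostrip" using w d2 by (auto simp: d_def dist_norm norm_minus_commute subset_iff)
        have ws: "w \<in> strip" using strip[OF wo] .
        have [measurable]: "F w \<in> L" using ws by (rule F_meas)
        let ?q = "\<lambda>y. (F w y - F z y) / (w - z) - v y"
        have sn: "sum_norm L N0 N1 ?q < ennreal e1" using w wo by (intro d1(2)) (auto simp: d_def)
        note nq = enn2real_nK_less[OF sn e1]
        have w1: "cmod (w - z) < 1" using w by (simp add: d_def)
        have w0: "0 < cmod (w - z)" using w by simp
        have Gd: "cmod (G w y - G z y) \<le> (2 * C * cmod (w - z)) * indicator K y" for y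
          by (intro G_diff_bound C w1)
        have Gq: "cmod ((G w y - G z y) / (w - z) - of_real (c1 y) * G z y) \<le> (C * cmod (w - z)) * indicator K y" for y
        proof -
          have "(G w y - G z y) / (w - z) - of_real (c1 y) * G z y = (G w y - G z y - of_real (c1 y) * G z y * (w - z)) / (w - z)"
            using w by (simp add: divide_simps)
          then have "cmod ((G w y - G z y) / (w - z) - of_real (c1 y) * G z y) = cmod (G w y - G z y - of_real (c1 y) * G z y * (w - z)) / cmod (w - z)"
            by (simp add: norm_divide)
          also have "\<dots> \<le> (C * (cmod (w - z))\<^sup>2 * indicator K y) / cmod (w - z)"
            using C(3)[OF w1] by (intro divide_right_mono) auto
          also have "\<dots> = (C * cmod (w - z)) * indicator K y" using w0 by (simp add: power2_eq_square)
          finally show ?thesis .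
        qed
        have iw: "integrable X (\<lambda>y. F z y * G w y)" "integrable X (\<lambda>y. F z y * G z y)" "integrable X (\<lambda>y. v y * G z y)" "integrable X (\<lambda>y. v y * G w y)"
          using Fz vfin G_bound[OF ws] G_bound[OF strip[OF z]] by (auto intro!: pair_bound(1)[of _ _ "exp (2 * B)"])
        have ic: "integrable X (\<lambda>y. F z y * (of_real (c1 y) * G z y))" using Fz C by (intro pair_bound(1)[of _ _ C]) auto
        have iq: "integrable X (\<lambda>y. ?q y * G w y)" using nq(1) G_bound[OF ws] by (intro pair_bound(1)[of _ _ "exp (2 * B)"]) auto
        have iF: "integrable X (\<lambda>y. F w y * G w y)"
        proof -
          have "F w y * G w y = (w - z) * (?q y * G w y + v y * G w y) + F z y * G w y" for y
            using w by (simp add: field_simps)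
          then show ?thesis using iq iw by simp
        qed
        \<comment> \<open>The three errors of the product rule: the quotient of \<open>F\<close>
          minus its limit \<open>v\<close>, the change of \<open>G\<close> against \<open>v\<close>,
          and the Taylor error of \<open>G\<close> against \<open>F z\<close>.\<close>
        have eq: "(\<Phi> w - \<Phi> z) / (w - z) - D = (LINT y|X. ?q y * G w y) + (LINT y|X. v y * (G w y - G z y))
           + (LINT y|X. F z y * ((G w y - G z y) / (w - z) - of_real (c1 y) * G z y))"
        proof -
          have "(LINT y|X. ?q y * G w y) + (LINT y|X. v y * (G w y - G z y))
             + (LINT y|X. F z y * ((G w y - G z y) / (w - z) - of_real (c1 y) * G z y))
            = (LINT y|X. ?q y * G w y + v y * (G w y - G z y) + F z y * ((G w y - G z y) / (w - z) - of_real (c1 y) * G z y))"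
          proof -
            have "integrable X (\<lambda>y. v y * (G w y - G z y))" using iw by (simp add: right_diff_distrib)
            moreover have "integrable X (\<lambda>y. F z y * ((G w y - G z y) / (w - z) - of_real (c1 y) * G z y))"
              using iw ic by (simp add: right_diff_distrib diff_divide_distrib)
            ultimately show ?thesis using iq by simp
          qed
          also have "\<dots> = (LINT y|X. (F w y * G w y - F z y * G z y) / (w - z) - (v y * G z y + F z y * (of_real (c1 y) * G z y)))"
            by (intro Bochner_Integration.integral_cong refl) (simp add: diff_divide_distrib algebra_simps)
          also have "\<dots> = (\<Phi> w - \<Phi> z) / (w - z) - D"
            using iF iw ic by (simp add: \<Phi>_def D_def)
          finally show ?thesis by simp
        qed
        have "cmod ((\<Phi> w - \<Phi> z) / (w - z) - D) \<le> cmod (LINT y|X. ?q y * G w y) + cmod (LINT y|X. v y * (G w y - G z y))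
           + cmod (LINT y|X. F z y * ((G w y - G z y) / (w - z) - of_real (c1 y) * G z y))"
          unfolding eq by (intro norm_triangle_le add_mono norm_triangle_ineq) auto
        also have "\<dots> \<le> exp (2 * B) * enn2real (nK ?q) + 2 * C * cmod (w - z) * enn2real (nK v) + C * cmod (w - z) * enn2real (nK (F z))"
          using nq(1) Fz vfin G_bound[OF ws] Gd Gq C by (intro add_mono pair_bound(2)) auto
        also have "\<dots> \<le> exp (2 * B) * (CK * e1) + cmod (w - z) * T"
        proof -
          have "exp (2 * B) * enn2real (nK ?q) \<le> exp (2 * B) * (CK * e1)" by (intro mult_left_mono nq) auto
          moreover have "2 * C * cmod (w - z) * enn2real (nK v) + C * cmod (w - z) * enn2real (nK (F z)) \<le> cmod (w - z) * T"
            by (simp add: T_def algebra_simps)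
          ultimately show ?thesis by linarith
        qed
        also have "\<dots> < e / 2 + e / 2"
        proof (intro add_le_less_mono)
          show "exp (2 * B) * (CK * e1) \<le> e / 2" using CK by (simp add: e1_def)
          have "cmod (w - z) * T < e / (2 * T) * T" using w T by (intro mult_strict_right_mono) (auto simp: d_def)
          then show "cmod (w - z) * T < e / 2" using T by simp
        qed
        finally show ?thesis by simp
      qed
      moreover have "0 < d" using d1 d2 e T by (simp add: d_def)
      ultimately show "\<exists>s>0. \<forall>x. x \<noteq> z \<and> norm (x - z) < s \<longrightarrow> norm ((\<Phi> x - \<Phi> z) / (x - z) - D) < e"
        by (intro exI[of _ d]) auto
    qed
    then show ?thesis unfolding has_field_derivative_iff by blast
  qed
  then show ?thesis using open_os by (simp add: holomorphic_on_open)
qed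

text \<open>Only absolute integrals on the two boundary lines enter the bound;
  \<open>Phi_bound\<close>, continuity and holomorphy license the maximum principle.\<close>

lemma pairing_le:
  assumes b0: "\<And>t. (\<integral>\<^sup>+y. ennreal (cmod (F (Complex 0 t) y) * cmod (G (Complex 0 t) y)) \<partial>X) \<le> ennreal A"
    and b1: "\<And>t. (\<integral>\<^sup>+y. ennreal (cmod (F (Complex 1 t) y) * cmod (G (Complex 1 t) y)) \<partial>X) \<le> ennreal A"
    and A: "0 \<le> A" and z: "z \<in> strip"
  shows "cmod (\<Phi> z) \<le> A"
proof -
  obtain A' where A': "\<And>z. z \<in> strip \<Longrightarrow> cmod (\<Phi> z) \<le> A'" using Phi_bound by blast
  have bd: "cmod (\<Phi> w) \<le> A" if w: "w \<in> strip" "(\<integral>\<^sup>+y. ennreal (cmod (F w y) * cmod (G w y)) \<partial>X) \<le> ennreal A" for w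
  proof -
    have [measurable]: "F w \<in> L" using w(1) by (rule F_meas)
    have "cmod (\<Phi> w) \<le> (LINT y|X. cmod (F w y * G w y))" unfolding \<Phi>_def by (rule integral_norm_bound)
    also have "\<dots> = enn2real (\<integral>\<^sup>+y. ennreal (cmod (F w y * G w y)) \<partial>X)" by (intro integral_eq_nn_integral) auto
    also have "\<dots> \<le> A" using w(2) A by (intro enn2real_leI) (auto simp: norm_mult)
    finally show ?thesis .
  qed
  show ?thesis
    by (rule strip_maximum_modulus[OF Phi_continuous Phi_holomorphic A' _ _ z]) (auto intro!: bd b0 b1 simp: strip_def)
qed

end

section \<open>Tent space norms\<close>

context tent_space_setting
begin

definition modw :: "real \<Rightarrow> ('a \<times> real \<Rightarrow> complex) \<Rightarrow> 'a \<times> real \<Rightarrow> ennreal" where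
  "modw s f z = ennreal (V z powr (- s)) * ennreal (cmod (f z))"

lemma modw_eq: "ennreal (cmod (Vpow M (- s) f z)) = modw s f z"
  by (cases z) (simp add: Vpow_def modw_def norm_mult ennreal_mult)

lemma modw_meas [measurable]: "f \<in> borel_measurable (Xplus M) \<Longrightarrow> modw s f \<in> borel_measurable (Xplus M)"
  unfolding modw_def[abs_def] by measurable

definition Acone :: "real \<Rightarrow> ('a \<times> real \<Rightarrow> ennreal) \<Rightarrow> 'a \<Rightarrow> ennreal" where
  "Acone q u x = epow (cone_int (\<lambda>z. epow (u z) q) x) (1 / q)"

lemma Acone_meas [measurable]: "u \<in> borel_measurable (Xplus M) \<Longrightarrow> Acone q u \<in> borel_measurable M"
  unfolding Acone_def[abs_def] by measurable

text \<open>With the density of the cone integral absorbed into the function, the conical functional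
  is an ordinary norm over \<open>Xplus M\<close> and inherits homogeneity and countable
  subadditivity from \<open>Lnorm\<close>.\<close>

lemma Acone_eq_Lnorm:
  "0 < q \<Longrightarrow> Acone q u x = Lnorm (Xplus M) q (\<lambda>z. epow (if dist x (fst z) < snd z then ennreal (1 / V z) else 0) (1 / q) * u z)"
  unfolding Acone_def Lnorm_def cone_int_eq
  by (intro arg_cong[of _ _ "\<lambda>t. epow t (1 / q)"] nn_integral_cong) (simp add: epow_mult epow_epow)

lemma Aq_eq: "Aq M q (Vpow M (- s) f) x = Acone q (modw s f) x"
  unfolding Aq_def Acone_def cone_int_def
proof (intro arg_cong[of _ _ "\<lambda>t. epow t (1 / q)"] nn_integral_cong)
  fix z
  have "ennreal (cmod (Vpow M (- s) f z) powr q / V z) = ennreal (1 / V z) * epow (modw s f z) q"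
    by (simp add: modw_eq[symmetric] epow_ennreal ennreal_mult[symmetric])
  then show "indicator (cone x) z * ennreal (cmod (Vpow M (- s) f z) powr q / V z)
    = indicator (cone x) z * (ennreal (1 / V z) * epow (modw s f z) q)" by simp
qed

lemma tent_norm_finite: "p \<noteq> \<infinity> \<Longrightarrow> tent_norm M p q s f = Lnorm M (enn2real p) (Acone q (modw s f))"
  unfolding tent_norm_def Lnorm_def Aq_eq by simp

lemma tent_norm_infinite:
  assumes "0 < q"
  shows "tent_norm M \<infinity> q s f = (SUP xr \<in> {(x, r). r > (0::real)}.
     ennreal (measure M (ball (fst xr) (snd xr)) powr (- 1 / q)) *
     Lnorm (Xplus M) q (\<lambda>z. indicator (tent (ball (fst xr) (snd xr))) z * modw s f z))"
  unfolding tent_norm_def Lnorm_def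
proof (simp, intro SUP_cong refl arg_cong[of _ _ "\<lambda>t. _ * epow t (1 / q)"] nn_integral_cong)
  fix xr :: "'a \<times> real" and z
  have "epow (indicator T z) q = (indicator T z :: ennreal)" for T :: "('a \<times> real) set"
    by (simp split: split_indicator)
  then show "indicator (tent (ball (fst xr) (snd xr))) z * ennreal (cmod (Vpow M (- s) f z) powr q)
    = epow (indicator (tent (ball (fst xr) (snd xr))) z * modw s f z) q"
    by (simp add: epow_mult modw_eq[symmetric] epow_ennreal)
qed

lemma modw_cmult: "modw s (\<lambda>z. c * f z) z = ennreal (cmod c) * modw s f z"
  by (simp add: modw_def norm_mult ennreal_mult mult_ac)

lemma modw_suminf:
  "ennreal (cmod (f z)) \<le> (\<Sum>k. ennreal (cmod (g k z))) \<Longrightarrow> modw s f z \<le> (\<Sum>k. modw s (g k) z)"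
  unfolding modw_def by (subst ennreal_suminf_cmult) (intro mult_left_mono, auto)

lemma Acone_cmult: "u \<in> borel_measurable (Xplus M) \<Longrightarrow> 0 < q \<Longrightarrow> Acone q (\<lambda>z. c * u z) x = c * Acone q u x"
  unfolding Acone_eq_Lnorm by (subst Lnorm_cmult[symmetric]) (auto simp: mult_ac)

lemma Acone_suminf:
  assumes [measurable]: "u \<in> borel_measurable (Xplus M)" "\<And>k. v k \<in> borel_measurable (Xplus M)"
    and q: "1 \<le> q" and le: "\<And>z. u z \<le> (\<Sum>k. v k z)"
  shows "Acone q u x \<le> (\<Sum>k. Acone q (v k) x)"
proof -
  have "0 < q" using q by simp
  then show ?thesis unfolding Acone_eq_Lnorm[OF \<open>0 < q\<close>]
    by (intro Lnorm_suminf q) (auto simp: le ennreal_suminf_cmult intro!: mult_left_mono)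
qed

lemma enn2real_ge_1: "1 \<le> p \<Longrightarrow> p \<noteq> \<infinity> \<Longrightarrow> 1 \<le> enn2real p"
  using enn2real_mono[of 1 p] by (simp add: less_top)

text \<open>For a finite outer exponent Minkowski is applied twice, on the cones and on the base; at
  infinity the norm is a supremum of multiples of norms over tents.\<close>

lemma lattice_norm_tent:
  assumes p: "1 \<le> p" and q: "1 < q"
  shows "lattice_norm (Xplus M) (tent_norm M p q s)"
proof (cases "p = \<infinity>")
  case False
  note P = enn2real_ge_1[OF p False]
  show ?thesis
    unfolding lattice_norm_def tent_norm_finite[OF False]
  proof (intro conjI ballI allI impI)
    fix f :: "'a \<times> real \<Rightarrow> complex" and c :: complex assume [measurable]: "f \<in> borel_measurable (Xplus M)"
    have "Acone q (modw s (\<lambda>y. c * f y)) = (\<lambda>x. ennreal (cmod c) * Acone q (modw s f) x)"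
      unfolding modw_cmult[abs_def] using q by (intro ext Acone_cmult) auto
    then show "Lnorm M (enn2real p) (Acone q (modw s (\<lambda>y. c * f y))) = ennreal (cmod c) * Lnorm M (enn2real p) (Acone q (modw s f))"
      using P by (simp add: Lnorm_cmult)
  next
    fix f :: "'a \<times> real \<Rightarrow> complex" and g :: "nat \<Rightarrow> 'a \<times> real \<Rightarrow> complex"
    assume [measurable]: "f \<in> borel_measurable (Xplus M)" and g: "\<forall>k. g k \<in> borel_measurable (Xplus M)"
      and le: "\<forall>y. ennreal (cmod (f y)) \<le> (\<Sum>k. ennreal (cmod (g k y)))"
    have [measurable]: "g k \<in> borel_measurable (Xplus M)" for k using g by simp
    show "Lnorm M (enn2real p) (Acone q (modw s f)) \<le> (\<Sum>k. Lnorm M (enn2real p) (Acone q (modw s (g k))))"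
      using q P le by (intro Lnorm_suminf Acone_suminf modw_suminf) auto
  qed
next
  case True
  have q0: "0 < q" using q by simp
  show ?thesis
    unfolding lattice_norm_def True tent_norm_infinite[OF q0]
  proof (intro conjI ballI allI impI)
    fix f :: "'a \<times> real \<Rightarrow> complex" and c :: complex assume [measurable]: "f \<in> borel_measurable (Xplus M)"
    have "Lnorm (Xplus M) q (\<lambda>z. indicator T z * modw s (\<lambda>y. c * f y) z) = ennreal (cmod c) * Lnorm (Xplus M) q (\<lambda>z. indicator T z * modw s f z)"
      if [measurable]: "(\<lambda>z. indicator T z :: ennreal) \<in> borel_measurable (Xplus M)" for T
      using q by (subst Lnorm_cmult[symmetric]) (auto simp: modw_cmult mult_ac)
    then show "(SUP xr\<in>{(x, r). 0 < r}. ennreal (measure M (ball (fst xr) (snd xr)) powr (- 1 / q)) *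
        Lnorm (Xplus M) q (\<lambda>z. indicator (tent (ball (fst xr) (snd xr))) z * modw s (\<lambda>y. c * f y) z)) =
      ennreal (cmod c) * (SUP xr\<in>{(x, r). 0 < r}. ennreal (measure M (ball (fst xr) (snd xr)) powr (- 1 / q)) *
        Lnorm (Xplus M) q (\<lambda>z. indicator (tent (ball (fst xr) (snd xr))) z * modw s f z))"
      by (subst SUP_mult_left_ennreal) (auto simp: mult_ac intro!: SUP_cong)
  next
    fix f :: "'a \<times> real \<Rightarrow> complex" and g :: "nat \<Rightarrow> 'a \<times> real \<Rightarrow> complex"
    assume [measurable]: "f \<in> borel_measurable (Xplus M)" and g: "\<forall>k. g k \<in> borel_measurable (Xplus M)"
      and le: "\<forall>y. ennreal (cmod (f y)) \<le> (\<Sum>k. ennreal (cmod (g k y)))"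
    have [measurable]: "g k \<in> borel_measurable (Xplus M)" for k using g by simp
    let ?T = "\<lambda>xr f. ennreal (measure M (ball (fst xr) (snd xr)) powr (- 1 / q)) *
        Lnorm (Xplus M) q (\<lambda>z. indicator (tent (ball (fst xr) (snd xr))) z * modw s f z)"
    show "(SUP xr\<in>{(x, r). 0 < r}. ?T xr f) \<le> (\<Sum>k. SUP xr\<in>{(x, r). 0 < r}. ?T xr (g k))"
    proof (rule SUP_least)
      fix xr :: "'a \<times> real" assume xr: "xr \<in> {(x, r). 0 < r}"
      have "Lnorm (Xplus M) q (\<lambda>z. indicator (tent (ball (fst xr) (snd xr))) z * modw s f z)
        \<le> (\<Sum>k. Lnorm (Xplus M) q (\<lambda>z. indicator (tent (ball (fst xr) (snd xr))) z * modw s (g k) z))"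
        using q le by (intro Lnorm_suminf) (auto simp: ennreal_suminf_cmult intro!: mult_left_mono modw_suminf)
      then have "?T xr f \<le> (\<Sum>k. ?T xr (g k))"
        by (simp add: ennreal_suminf_cmult mult_left_mono)
      also have "\<dots> \<le> (\<Sum>k. SUP xr\<in>{(x, r). 0 < r}. ?T xr (g k))"
        using xr by (intro suminf_le SUP_upper) auto
      finally show "?T xr f \<le> (\<Sum>k. SUP xr\<in>{(x, r). 0 < r}. ?T xr (g k))" .
    qed
  qed
qed

end

section \<open>Tent norms of the factors and pairing with the dual factors\<close>

context tent_weight
begin

text \<open>The summand 1 is the bound at an infinite exponent; the other summand belongs to finite
  exponents.\<close>

definition CN :: "ennreal \<Rightarrow> real \<Rightarrow> real" where
  "CN pj Q = 1 + max 0 (CS (enn2real pj / Q)) powr (1 / enn2real pj)"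

lemma enn2real_inverse: "pj \<noteq> \<infinity> \<Longrightarrow> enn2real (inverse pj) = 1 / enn2real pj" if "1 \<le> pj"
  using that by (cases pj) (auto simp: inverse_ennreal divide_inverse ennreal_1[symmetric] simp del: ennreal_1)

text \<open>\<open>h\<close> is the normalised factor in the target space. For finite
  \<open>pj\<close> this is \<open>S_bound\<close> with \<open>\<alpha> = P / Q\<close>; for
  infinite \<open>pj\<close> the exponent becomes \<open>e = - q\<close>, and
  \<open>tent_integral_bound\<close> gives a norm of at most 1.\<close>

lemma tent_norm_factor_bound:
  assumes pj: "1 \<le> pj" and Q: "1 < Q" and [measurable]: "h \<in> borel_measurable (Xplus M)"
    and h: "\<And>z. z \<in> space (Xplus M) \<Longrightarrow>
      modw s h z = epow (G z) (1 / Q) * ennreal (w z powr (p * enn2real (inverse pj) - q / Q))"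
  shows "tent_norm M pj Q s h \<le> ennreal (CN pj Q)"
proof -
  define e where "e = (p * enn2real (inverse pj) - q / Q) * Q"
  have hQ: "epow (modw s h z) Q = G z * ennreal (w z powr e)" if "z \<in> space (Xplus M)" for z
    unfolding h[OF that] epow_mult using Q w_nonneg[of z] by (simp add: epow_epow epow_ennreal_powr e_def)
  show ?thesis
  proof (cases "pj = \<infinity>")
    case False
    define P where "P = enn2real pj"
    have P: "1 \<le> P" using enn2real_ge_1[OF pj False] by (simp add: P_def)
    have e: "(q + e) * (P / Q) = p"
      using P Q unfolding e_def enn2real_inverse[OF pj False] P_def[symmetric] by (simp add: field_simps)
    have "tent_norm M pj Q s h = Lnorm M P (\<lambda>x. epow (S e x) (1 / Q))"
      unfolding tent_norm_finite[OF False] P_def Acone_def S_def cone_int_def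
      by (intro arg_cong[of _ _ "Lnorm M (enn2real pj)"] ext arg_cong[of _ _ "\<lambda>t. epow t (1 / Q)"] nn_integral_cong) (simp add: hQ)
    also have "\<dots> = epow (\<integral>\<^sup>+x. epow (S e x) (P / Q) \<partial>M) (1 / P)" by (simp add: Lnorm_def epow_epow)
    also have "\<dots> \<le> epow (ennreal (max 0 (CS (P / Q)))) (1 / P)"
      using P Q e by (intro epow_mono order_trans[OF S_bound] ennreal_leI) auto
    also have "\<dots> = ennreal (max 0 (CS (P / Q)) powr (1 / P))" by (simp add: epow_ennreal)
    also have "\<dots> \<le> ennreal (CN pj Q)" by (intro ennreal_leI) (simp add: CN_def P_def)
    finally show ?thesis .
  next
    case True
    have e: "e = - q" using True Q by (simp add: e_def)
    have Q0: "0 < Q" using Q by simp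
    have "tent_norm M pj Q s h \<le> 1"
      unfolding True tent_norm_infinite[OF Q0]
    proof (rule SUP_least)
      fix xr :: "'a \<times> real" assume xr: "xr \<in> {(x, r). 0 < r}"
      let ?B = "ball (fst xr) (snd xr)"
      have v: "0 < V xr" using xr by (auto intro: Vol_pos)
      have "Lnorm (Xplus M) Q (\<lambda>z. indicator (tent ?B) z * modw s h z)
        = epow (\<integral>\<^sup>+z. indicator (tent ?B) z * (G z * ennreal (w z powr (- q))) \<partial>Xplus M) (1 / Q)"
        unfolding Lnorm_def
        by (intro arg_cong[of _ _ "\<lambda>t. epow t (1 / Q)"] nn_integral_cong) (auto simp: epow_mult hQ e split: split_indicator)
      also have "\<dots> \<le> epow (emeasure M ?B) (1 / Q)"
        using Q by (intro epow_mono tent_integral_bound) auto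
      also have "\<dots> = ennreal (V xr powr (1 / Q))" by (simp add: emeasure_ball epow_ennreal)
      finally have "ennreal (measure M ?B powr (- 1 / Q)) * Lnorm (Xplus M) Q (\<lambda>z. indicator (tent ?B) z * modw s h z)
        \<le> ennreal (V xr powr (- 1 / Q)) * ennreal (V xr powr (1 / Q))"
        by (intro mult_mono) (auto simp: Vol_def)
      also have "\<dots> = 1" using v by (simp add: ennreal_powr_mult)
      finally show "ennreal (measure M ?B powr (- 1 / Q)) * Lnorm (Xplus M) Q (\<lambda>z. indicator (tent ?B) z * modw s h z) \<le> 1" .
    qed
    also have "1 \<le> ennreal (CN pj Q)" by (simp add: CN_def ennreal_1[symmetric] del: ennreal_1)
    finally show ?thesis .
  qed
qed

text \<open>The constants of \<open>pairing_bound_finite\<close> and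
  \<open>pairing_bound_infinite\<close> added, so that one constant serves all outer
  exponents.\<close>

definition CP :: real where "CP = 1 + Cb + D ^ 3 * Cb"

lemma CP_pos: "0 < CP"
  using Cb_nonneg D by (simp add: CP_def add_pos_nonneg)

lemma tent_norm_pairing:
  assumes pj: "1 \<le> pj" and Q: "1 < Q" and [measurable]: "u \<in> borel_measurable (Xplus M)"
  shows "(\<integral>\<^sup>+z. (modw s u z * epow (G z) (1 - 1 / Q)) *
      ennreal (w z powr (p * (1 - enn2real (inverse pj)) - q * (1 - 1 / Q))) \<partial>Xplus M) \<le> ennreal CP * tent_norm M pj Q s u"
proof (cases "pj = \<infinity>")
  case False
  define P where "P = enn2real pj"
  have P: "1 \<le> P" using enn2real_ge_1[OF pj False] by (simp add: P_def)
  have "(\<integral>\<^sup>+z. (modw s u z * epow (G z) (1 - 1 / Q)) *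
      ennreal (w z powr (p * (1 - enn2real (inverse pj)) - q * (1 - 1 / Q))) \<partial>Xplus M) \<le> ennreal (1 + Cb) * tent_norm M pj Q s u"
    unfolding enn2real_inverse[OF pj False] tent_norm_finite[OF False] P_def[symmetric] Acone_def[abs_def]
    using P Q by (intro pairing_bound_finite) auto
  also have "\<dots> \<le> ennreal CP * tent_norm M pj Q s u"
    using Cb_nonneg D by (intro mult_right_mono ennreal_leI) (auto simp: CP_def)
  finally show ?thesis .
next
  case True
  define N where "N = tent_norm M pj Q s u"
  have Q0: "0 < Q" using Q by simp
  \<comment> \<open>The norm at infinity is a Carleson condition: the \<open>Q\<close>-th power of
    the weighted modulus is a Carleson density with constant \<open>epow N Q\<close>.\<close>
  have K: "(\<integral>\<^sup>+z. indicator (tent (ball x r')) z * epow (modw s u z) Q \<partial>Xplus M) \<le> epow N Q * emeasure M (ball x r')"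
    if r': "0 < r'" for x r'
  proof -
    let ?I = "\<integral>\<^sup>+z. indicator (tent (ball x r')) z * epow (modw s u z) Q \<partial>Xplus M"
    have v: "0 < Vol M x r'" using r' by (rule Vol_pos)
    have "ennreal (measure M (ball (fst (x, r')) (snd (x, r'))) powr (- 1 / Q)) *
       Lnorm (Xplus M) Q (\<lambda>z. indicator (tent (ball (fst (x, r')) (snd (x, r')))) z * modw s u z) \<le> N"
      unfolding N_def True tent_norm_infinite[OF Q0] using r' by (intro SUP_upper) auto
    moreover have "Lnorm (Xplus M) Q (\<lambda>z. indicator (tent (ball x r')) z * modw s u z) = epow ?I (1 / Q)"
      unfolding Lnorm_def
      by (intro arg_cong[of _ _ "\<lambda>t. epow t (1 / Q)"] nn_integral_cong) (auto simp: epow_mult split: split_indicator)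
    ultimately have "ennreal (Vol M x r' powr (- 1 / Q)) * epow ?I (1 / Q) \<le> N" by (simp add: Vol_def)
    then have "epow (ennreal (Vol M x r' powr (- 1 / Q)) * epow ?I (1 / Q)) Q \<le> epow N Q" using Q by (intro epow_mono) auto
    then have "ennreal (Vol M x r' powr - 1) * ?I \<le> epow N Q"
      using Q v by (simp add: epow_mult epow_epow epow_ennreal_powr less_imp_le)
    then have "ennreal (Vol M x r' powr 1) * (ennreal (Vol M x r' powr - 1) * ?I) \<le> ennreal (Vol M x r' powr 1) * epow N Q"
      by (intro mult_left_mono) auto
    then have "?I \<le> ennreal (Vol M x r' powr 1) * epow N Q"
      unfolding mult.assoc[symmetric] ennreal_powr_mult[OF v] using v by simp
    then show ?thesis using v by (simp add: emeasure_ball mult.commute)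
  qed
  have "(\<integral>\<^sup>+z. (modw s u z * epow (G z) (1 - 1 / Q)) * ennreal (w z powr (p - q * (1 - 1 / Q))) \<partial>Xplus M)
      \<le> ennreal (D ^ 3 * Cb) * epow (epow N Q) (1 / Q)"
    by (intro pairing_bound_infinite K Q) auto
  also have "\<dots> = ennreal (D ^ 3 * Cb) * N" using Q by (simp add: epow_epow)
  also have "\<dots> \<le> ennreal CP * N"
    using Cb_nonneg by (intro mult_right_mono ennreal_leI) (auto simp: CP_def)
  finally show ?thesis using True by (simp add: N_def)
qed

end

section \<open>Weights for functions with nice support\<close>

context tent_space_setting
begin

text \<open>The conical functional may vanish, but a weight must be positive, and on bounded sets it
  must stay away from 0. Adding this function achieves both at the cost of an integral of at most
  1.\<close>

lemma ex_decaying_function: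
  fixes x0 :: 'a
  shows "\<exists>\<eta>. \<eta> \<in> borel_measurable M \<and> (\<forall>x. 0 < \<eta> x \<and> \<eta> x \<le> (1::real)) \<and> (\<integral>\<^sup>+x. ennreal (\<eta> x) \<partial>M) \<le> 1
    \<and> (\<forall>R. \<exists>c>0. \<forall>x\<in>ball x0 R. c \<le> \<eta> x)"
proof -
  \<comment> \<open>Times the volume of the ball of radius \<open>Suc n\<close> this is at most
    \<open>(1 / 2) ^ Suc n\<close>, and these numbers sum to 1.\<close>
  define h where "h n = (1 / 2) ^ Suc n / (1 + Vol M x0 (real (Suc n)))" for n
  define \<eta> where "\<eta> x = h (nat \<lfloor>dist x0 x\<rfloor>)" for x
  have h: "0 < h n" "h n \<le> 1" for n
  proof -
    have v: "1 \<le> 1 + Vol M x0 (real (Suc n))" by simp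
    show "0 < h n" unfolding h_def using less_le_trans[OF zero_less_one v] by (intro divide_pos_pos) auto
    have "((1::real) / 2) ^ Suc n \<le> 1" by (intro power_le_one) auto
    then have "h n \<le> 1 / 1" unfolding h_def using v by (intro frac_le) (auto simp del: power_Suc)
    then show "h n \<le> 1" by simp
  qed
  have [measurable]: "\<eta> \<in> borel_measurable M" unfolding \<eta>_def[abs_def] by measurable
  have "(\<integral>\<^sup>+x. ennreal (\<eta> x) \<partial>M) \<le> (\<integral>\<^sup>+x. (\<Sum>n. ennreal (h n) * indicator (ball x0 (real (Suc n))) x) \<partial>M)"
  proof (intro nn_integral_mono)
    fix x
    let ?n = "nat \<lfloor>dist x0 x\<rfloor>"
    have "dist x0 x < real (Suc ?n)" by (simp add: of_nat_nat) linarith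
    then have "ennreal (\<eta> x) = (\<Sum>n\<in>{?n}. ennreal (h n) * indicator (ball x0 (real (Suc n))) x)" by (simp add: \<eta>_def)
    also have "\<dots> \<le> (\<Sum>n. ennreal (h n) * indicator (ball x0 (real (Suc n))) x)" by (intro sum_le_suminf) auto
    finally show "ennreal (\<eta> x) \<le> (\<Sum>n. ennreal (h n) * indicator (ball x0 (real (Suc n))) x)" .
  qed
  also have "\<dots> = (\<Sum>n. ennreal (h n) * emeasure M (ball x0 (real (Suc n))))"
    by (subst nn_integral_suminf) (auto simp: nn_integral_cmult)
  also have "\<dots> \<le> (\<Sum>n. ennreal ((1 / 2) ^ Suc n))"
  proof (intro suminf_le)
    fix n
    have "h n * Vol M x0 (real (Suc n)) \<le> h n * (1 + Vol M x0 (real (Suc n)))" using h(1)[of n] by (intro mult_left_mono) auto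
    also have "\<dots> = (1 / 2) ^ Suc n"
    proof -
      have "1 + Vol M x0 (real (Suc n)) \<noteq> 0" using Vol_nonneg[of x0 "real (Suc n)"] by linarith
      then show ?thesis unfolding h_def times_divide_eq_left by (rule nonzero_mult_div_cancel_right)
    qed
    finally show "ennreal (h n) * emeasure M (ball x0 (real (Suc n))) \<le> ennreal ((1 / 2) ^ Suc n)"
      using h(1)[of n] by (simp add: emeasure_ball ennreal_mult[symmetric] ennreal_leI)
  qed auto
  also have "\<dots> = ennreal (\<Sum>n. (1 / 2) ^ Suc n)"
    by (intro suminf_ennreal2) (auto intro!: summable_mult simp: power_half_series[THEN sums_summable])
  also have "\<dots> = 1" using power_half_series by (simp add: sums_unique[symmetric])
  finally have int: "(\<integral>\<^sup>+x. ennreal (\<eta> x) \<partial>M) \<le> 1" .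
  have "\<exists>c>0. \<forall>x\<in>ball x0 R. c \<le> \<eta> x" for R
  proof -
    define m where "m = nat \<lceil>R\<rceil>"
    define c where "c = Min (h ` {..m})"
    have "0 < c" unfolding c_def using h by (subst Min_gr_iff) auto
    moreover have "c \<le> \<eta> x" if "x \<in> ball x0 R" for x
    proof -
      have "nat \<lfloor>dist x0 x\<rfloor> \<le> m" using that unfolding m_def by (auto intro!: nat_mono) linarith
      then show ?thesis unfolding c_def \<eta>_def by (intro Min_le) auto
    qed
    ultimately show ?thesis by blast
  qed
  then show ?thesis using h int by (intro exI[of _ \<eta>]) (auto simp: \<eta>_def)
qed

text \<open>Besides centre and height the volume is confined too, so that \<open>ln V\<close> is
  bounded directly by definition.\<close>

definition box :: "real \<Rightarrow> ('a \<times> real) set" where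
  "box n = {z. dist undefined (fst z) < n \<and> 1 / n \<le> snd z \<and> snd z \<le> n \<and> 1 / n \<le> V z \<and> V z \<le> n}"

lemma box_meas [measurable]: "box n \<inter> space (Xplus M) \<in> sets (Xplus M)"
proof -
  have "box n \<inter> space (Xplus M) = {z \<in> space (Xplus M). dist undefined (fst z) < n \<and> 1 / n \<le> snd z \<and> snd z \<le> n \<and> 1 / n \<le> V z \<and> V z \<le> n}"
    by (auto simp: box_def)
  also have "\<dots> \<in> sets (Xplus M)" by measurable
  finally show ?thesis .
qed

lemma box_measure_finite:
  assumes n: "0 < n"
  shows "(\<integral>\<^sup>+z. indicator (box n) z \<partial>Xplus M) < top"
proof -
  interpret T: sigma_finite_measure dt_over_t by (rule sigma_finite_dt_over_t)
  have m [measurable]: "{t \<in> space dt_over_t. 1 / n \<le> t \<and> t \<le> n} \<in> sets dt_over_t"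
  proof -
    have "(\<lambda>x::real. x) \<in> borel_measurable dt_over_t" by (simp add: dt_over_t_def measurable_restrict_space1)
    then show ?thesis by measurable
  qed
  have sp: "space dt_over_t = {0<..}" by (simp add: dt_over_t_def space_restrict_space)
  have set: "{t \<in> space dt_over_t. 1 / n \<le> t \<and> t \<le> n} = {1 / n..n}" using n by (auto simp: sp intro: less_le_trans[of 0 "1 / n"])
  have "emeasure dt_over_t {1 / n..n} = (\<integral>\<^sup>+t. ennreal (1 / t) * indicator {1 / n..n} t \<partial>restrict_space lborel {0<..})"
    unfolding dt_over_t_def using m[unfolded set] by (subst emeasure_density) (auto simp: dt_over_t_def intro!: measurable_restrict_space1)
  also have "\<dots> \<le> (\<integral>\<^sup>+t. ennreal n * indicator {1 / n..n} t \<partial>restrict_space lborel {0<..})"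
  proof (intro nn_integral_mono)
    fix t :: real
    have "1 / t \<le> n" if "1 / n \<le> t" using that n by (metis divide_le_eq divide_pos_pos less_le_trans mult.commute zero_less_one)
    then show "ennreal (1 / t) * indicator {1 / n..n} t \<le> ennreal n * indicator {1 / n..n} t"
      by (auto split: split_indicator intro: ennreal_leI)
  qed
  also have "\<dots> \<le> (\<integral>\<^sup>+t. ennreal n * indicator {1 / n..n} t \<partial>lborel)"
    by (subst nn_integral_restrict_space) (auto intro!: nn_integral_mono split: split_indicator)
  also have "\<dots> < top" by (simp add: nn_integral_cmult ennreal_mult_less_top emeasure_lborel_Icc_eq)
  finally have fin: "emeasure dt_over_t {1 / n..n} < top" .
  have "(\<integral>\<^sup>+z. indicator (box n) z \<partial>Xplus M) \<le> (\<integral>\<^sup>+z. indicator (ball undefined n \<times> {1 / n..n}) z \<partial>Xplus M)"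
    by (intro nn_integral_mono) (auto simp: box_def split: split_indicator)
  also have "\<dots> = emeasure M (ball undefined n) * emeasure dt_over_t {1 / n..n}"
    using m unfolding Xplus_def set by (subst nn_integral_indicator) (auto simp: T.emeasure_pair_measure_Times)
  also have "\<dots> < top" using fin by (simp add: emeasure_ball ennreal_mult_less_top)
  finally show ?thesis .
qed

text \<open>A cone that meets the box has its vertex within \<open>n + n\<close> of the base point,
  \<open>1 / V\<close> is at most \<open>n\<close> on the box, and the box has finite
  measure.\<close>

lemma cone_int_box_bound:
  assumes n: "0 < n" and supp: "\<And>z. z \<in> space (Xplus M) \<Longrightarrow> z \<notin> box n \<Longrightarrow> G z = 0" and bdd: "\<And>z. G z \<le> ennreal C"
  shows "\<exists>E<top. \<forall>x. cone_int G x \<le> E * indicator (ball undefined (2 * n)) x"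
proof -
  define E where "E = ennreal (n * \<bar>C\<bar>) * (\<integral>\<^sup>+z. indicator (box n) z \<partial>Xplus M)"
  have E: "E < top" using box_measure_finite[OF n] by (simp add: E_def ennreal_mult_less_top)
  have [measurable]: "(\<lambda>z. indicator (box n) z :: ennreal) \<in> borel_measurable (Xplus M)"
    using box_meas[of n] by (simp add: borel_measurable_indicator_iff)
  have "cone_int G x \<le> E * indicator (ball undefined (2 * n)) x" for x
  proof -
    have eq: "E * indicator (ball undefined (2 * n)) x
        = (\<integral>\<^sup>+z. indicator (ball undefined (2 * n)) x * (ennreal (n * \<bar>C\<bar>) * indicator (box n) z) \<partial>Xplus M)"
    proof -
      have "(\<integral>\<^sup>+z. indicator (ball undefined (2 * n)) x * (ennreal (n * \<bar>C\<bar>) * indicator (box n) z) \<partial>Xplus M)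
          = indicator (ball undefined (2 * n)) x * (\<integral>\<^sup>+z. ennreal (n * \<bar>C\<bar>) * indicator (box n) z \<partial>Xplus M)"
        by (rule nn_integral_cmult) measurable
      also have "(\<integral>\<^sup>+z. ennreal (n * \<bar>C\<bar>) * indicator (box n) z \<partial>Xplus M) = E"
        unfolding E_def by (rule nn_integral_cmult) measurable
      finally show ?thesis by (simp add: mult.commute)
    qed
    show ?thesis unfolding eq cone_int_def
  proof (intro nn_integral_mono)
    fix z assume z: "z \<in> space (Xplus M)"
    show "indicator (cone x) z * (ennreal (1 / V z) * G z) \<le> indicator (ball undefined (2 * n)) x * (ennreal (n * \<bar>C\<bar>) * indicator (box n) z)"
    proof (cases "z \<in> box n \<and> z \<in> cone x")
      case True
      have "1 / n \<le> V z" using True by (simp add: box_def)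
      moreover have "0 < V z" using calculation n less_le_trans[of 0 "1 / n" "V z"] by simp
      ultimately have "1 / V z \<le> n" using n by (simp add: field_simps)
      then have "ennreal (1 / V z) * G z \<le> ennreal n * ennreal \<bar>C\<bar>"
        by (intro mult_mono order_trans[OF bdd] ennreal_leI) auto
      then have "ennreal (1 / V z) * G z \<le> ennreal (n * \<bar>C\<bar>)" using n by (simp add: ennreal_mult)
      moreover have "x \<in> ball undefined (2 * n)"
        using True in_coneD[of z x] dist_triangle[of undefined x "fst z"] by (auto simp: box_def dist_commute)
      ultimately show ?thesis using True by simp
    qed (auto simp: supp z split: split_indicator)
  qed
  qed
  then show ?thesis using E by blast
qed

text \<open>The upper bounds hold for every \<open>r\<close> strictly between 0 and
  \<open>p\<close>; for \<open>q < p\<close> the value \<open>p - q\<close> is what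
  \<open>integral_G_lower\<close> asks for.\<close>

definition wexp :: "real \<Rightarrow> real \<Rightarrow> real" where
  "wexp p q = (if q < p then p - q else p / 2)"

text \<open>\<open>a\<close> is the conical functional \<open>g\<close> plus the decaying function
  \<open>\<eta>\<close>. Both \<open>g powr p\<close> and \<open>\<eta>\<close> have integral at
  most 1, and \<open>(g + \<eta>) powr p \<le> 2 powr p * (g powr p + \<eta>)\<close>, which gives a
  bound independent of \<open>G\<close> and \<open>n\<close>. The bounds for \<open>w\<close> on the
  box do depend on them.\<close>

lemma ex_tent_weight:
  assumes p: "1 \<le> p" and q: "1 < q" and n: "0 < n" and [measurable]: "G \<in> borel_measurable (Xplus M)"
    and supp: "\<And>z. z \<in> space (Xplus M) \<Longrightarrow> z \<notin> box n \<Longrightarrow> G z = 0" and bdd: "\<And>z. G z \<le> ennreal C"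
    and int: "(\<integral>\<^sup>+x. epow (cone_int G x) (p / q) \<partial>M) \<le> 1"
  shows "\<exists>a. tent_weight M p q (wexp p q) (2 * 2 powr p) a G \<and>
    (\<exists>c>0. \<forall>z\<in>box n. c \<le> tent_weight.w M (wexp p q) a z \<and> tent_weight.w M (wexp p q) a z \<le> 1 / c)"
proof -
  obtain \<eta> where [measurable]: "\<eta> \<in> borel_measurable M" and \<eta>: "\<And>x. 0 < \<eta> x" "\<And>x. \<eta> x \<le> (1::real)"
    and \<eta>_int: "(\<integral>\<^sup>+x. ennreal (\<eta> x) \<partial>M) \<le> 1" and \<eta>_low: "\<And>R. \<exists>c>0. \<forall>x\<in>ball undefined R. c \<le> \<eta> x"
    using ex_decaying_function[of undefined] by blast
  define g where "g x = enn2real (cone_int G x) powr (1 / q)" for x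
  define a where "a x = g x + \<eta> x" for x
  have [measurable]: "g \<in> borel_measurable M" "a \<in> borel_measurable M" unfolding g_def[abs_def] a_def[abs_def] by measurable
  have g0: "0 \<le> g x" for x by (simp add: g_def)
  have a_pos: "0 < a x" for x using g0[of x] \<eta>(1)[of x] by (simp add: a_def)
  obtain E where E: "E < top" and cone_ind: "\<And>x. cone_int G x \<le> E * indicator (ball undefined (2 * n)) x"
    using cone_int_box_bound[of n G C, OF n supp bdd] by blast
  have cone_le: "cone_int G x \<le> E" for x using cone_ind[of x] by (auto split: split_indicator_asm)
  have g_eq: "cone_int G x = ennreal (g x powr q)" for x
    using cone_le[of x] E q by (simp add: g_def powr_powr le_less_trans)
  have tw: "tent_weight M p q (wexp p q) (2 * 2 powr p) a G"
  proof (unfold_locales)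
    show "(\<integral>\<^sup>+x. ennreal (a x powr p) \<partial>M) \<le> ennreal (2 * 2 powr p)"
    proof -
      have "(\<integral>\<^sup>+x. ennreal (a x powr p) \<partial>M) \<le> (\<integral>\<^sup>+x. ennreal (2 powr p) * (epow (cone_int G x) (p / q) + ennreal (\<eta> x)) \<partial>M)"
      proof (intro nn_integral_mono)
        fix x
        have "a x powr p \<le> (2 * max (g x) (\<eta> x)) powr p" using p a_pos[of x] by (intro powr_mono2) (auto simp: a_def)
        also have "\<dots> = 2 powr p * max (g x) (\<eta> x) powr p" using g0[of x] by (simp add: powr_mult)
        also have "\<dots> \<le> 2 powr p * (g x powr p + \<eta> x)"
        proof (intro mult_left_mono)
          have "\<eta> x powr p \<le> \<eta> x" using powr_mono'[of 1 p "\<eta> x"] p \<eta>[of x] by (simp add: less_imp_le)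
          then show "max (g x) (\<eta> x) powr p \<le> g x powr p + \<eta> x" using \<eta>(1)[of x] by (auto simp: max_def add_increasing)
        qed simp
        finally have "ennreal (a x powr p) \<le> ennreal (2 powr p * (g x powr p + \<eta> x))" by (rule ennreal_leI)
        also have "\<dots> = ennreal (2 powr p) * (ennreal (g x powr p) + ennreal (\<eta> x))"
          using \<eta>(1)[of x] by (simp add: ennreal_mult)
        also have "ennreal (g x powr p) = epow (cone_int G x) (p / q)" using q g0[of x] by (simp add: g_eq epow_ennreal_powr)
        finally show "ennreal (a x powr p) \<le> ennreal (2 powr p) * (epow (cone_int G x) (p / q) + ennreal (\<eta> x))" .
      qed
      also have "\<dots> = ennreal (2 powr p) * ((\<integral>\<^sup>+x. epow (cone_int G x) (p / q) \<partial>M) + (\<integral>\<^sup>+x. ennreal (\<eta> x) \<partial>M))"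
        by (simp add: nn_integral_cmult nn_integral_add)
      also have "\<dots> \<le> ennreal (2 powr p) * (1 + 1)" by (intro mult_left_mono add_mono int \<eta>_int) auto
      also have "\<dots> = ennreal (2 * 2 powr p)" by (simp add: ennreal_mult' mult.commute)
      finally show ?thesis .
    qed
    show "AE x in M. cone_int G x \<le> ennreal (a x powr q)"
      unfolding g_eq using q g0 \<eta>(1) by (intro AE_I2 ennreal_leI powr_mono2) (auto simp: a_def less_imp_le)
  qed (use p q a_pos in \<open>auto simp: wexp_def\<close>)
  interpret tent_weight M p q "wexp p q" "2 * 2 powr p" a G by (rule tw)
  define c1 where "c1 = enn2real E powr (1 / q) + 1"
  have c1: "0 < c1" by (simp add: c1_def add_nonneg_pos)
  have a_le: "a x \<le> c1" for x
  proof -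
    have "g x \<le> enn2real E powr (1 / q)"
      unfolding g_def using q cone_le[of x] E by (intro powr_mono2 enn2real_mono) auto
    then show ?thesis using \<eta>(2)[of x] by (simp add: a_def c1_def)
  qed
  obtain c2 where c2: "0 < c2" "\<And>x. x \<in> ball undefined (2 * n) \<Longrightarrow> c2 \<le> \<eta> x" using \<eta>_low[of "2 * n"] by blast
  define c where "c = min c2 (1 / c1)"
  have c: "0 < c" "c \<le> c2" "c1 \<le> 1 / c" using c1 c2(1) by (auto simp: c_def min_def field_simps)
  have "c \<le> w z \<and> w z \<le> 1 / c" if z: "z \<in> box n" for z
  proof -
    have z0: "0 < snd z" using z n by (auto simp: box_def intro: less_le_trans[of 0 "1 / n"])
    have sub: "ball (fst z) (snd z) \<subseteq> ball undefined (2 * n)"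
    proof
      fix x assume "x \<in> ball (fst z) (snd z)"
      then show "x \<in> ball undefined (2 * n)" using z dist_triangle[of undefined x "fst z"] by (auto simp: box_def)
    qed
    have "c \<le> w z"
    proof (rule w_ge_const[OF z0 c(1)])
      fix x assume "x \<in> ball (fst z) (snd z)"
      then have "c2 \<le> \<eta> x" using sub c2 by blast
      then show "c \<le> a x" using c(2) g0[of x] by (simp add: a_def)
    qed
    moreover have "w z \<le> c1" by (rule w_le_const[OF z0 a_le])
    ultimately show ?thesis using c by simp
  qed
  then show ?thesis using tw c(1) by blast
qed

end

section \<open>Exhaustion and finiteness\<close>

lemma tendsto_epow_0:
  assumes "(f \<longlongrightarrow> 0) F" "0 < a"
  shows "((\<lambda>x. epow (f x) a) \<longlongrightarrow> 0) F"
proof (rule order_tendstoI)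
  fix y :: ennreal assume "0 < y"
  then have "0 < epow y (1 / a)" by (simp add: zero_less_iff_neq_zero)
  then have "\<forall>\<^sub>F x in F. f x < epow y (1 / a)" using order_tendstoD(2)[OF assms(1)] by blast
  then show "\<forall>\<^sub>F x in F. epow (f x) a < y"
  proof eventually_elim
    case (elim x)
    then have "epow (f x) a < epow (epow y (1 / a)) a" using assms(2) by (simp add: epow_less_cancel)
    then show ?case using assms(2) by (simp add: epow_epow)
  qed
qed simp

text \<open>Decay bounds the norms for large \<open>t\<close>; on the remaining compact interval
  finitely many values and a local variation below 1 suffice.\<close>

lemma calderon_norm_finite:
  assumes N0: "lattice_norm X N0" and N1: "lattice_norm X N1" and cal: "calderon (borel_measurable X) N0 N1 F"
  shows "calderon_norm N0 N1 F < top"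
proof -
  let ?L = "borel_measurable X"
  have mem: "\<forall>t. F (Complex 0 t) \<in> nspace ?L N0 \<and> F (Complex 1 t) \<in> nspace ?L N1" using cal by (simp add: calderon_def)
  have cont: "\<forall>t. \<forall>e>0. \<exists>d>0. \<forall>t'. \<bar>t' - t\<bar> < d \<longrightarrow>
         N0 (\<lambda>y. F (Complex 0 t') y - F (Complex 0 t) y) < ennreal e \<and>
         N1 (\<lambda>y. F (Complex 1 t') y - F (Complex 1 t) y) < ennreal e" using cal by (simp add: calderon_def)
  have dec: "\<forall>e>0. \<exists>R. \<forall>t. \<bar>t\<bar> \<ge> R \<longrightarrow> N0 (F (Complex 0 t)) < ennreal e \<and> N1 (F (Complex 1 t)) < ennreal e"
    using cal by (simp add: calderon_def)
  have "(SUP t. N (H t)) < top" if N: "lattice_norm X N" and mem: "\<And>t. H t \<in> nspace ?L N"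
    and cont: "\<And>t. \<exists>d>0. \<forall>t'. \<bar>t' - t\<bar> < d \<longrightarrow> N (\<lambda>y. H t' y - H t y) < ennreal 1"
    and dec: "\<exists>R. \<forall>t. \<bar>t\<bar> \<ge> R \<longrightarrow> N (H t) < ennreal 1" for N and H :: "real \<Rightarrow> 'a \<Rightarrow> complex"
  proof -
    obtain R where R: "\<And>t. \<bar>t\<bar> \<ge> R \<Longrightarrow> N (H t) < ennreal 1" using dec by blast
    obtain d where d: "\<And>t. 0 < d t" "\<And>t t'. \<bar>t' - t\<bar> < d t \<Longrightarrow> N (\<lambda>y. H t' y - H t y) < ennreal 1" using cont by metis
    have "{-R..R} \<subseteq> (\<Union>t\<in>{-R..R}. ball t (d t))" using d(1) by auto
    then obtain T where T: "T \<subseteq> {-R..R}" "finite T" "{-R..R} \<subseteq> (\<Union>t\<in>T. ball t (d t))"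
      using compactE_image[OF compact_Icc, of "{-R..R}" "\<lambda>t. ball t (d t)" "-R" R] by auto
    have "N (H t) \<le> 1 + (\<Sum>\<tau>\<in>T. N (H \<tau>))" for t
    proof (cases "\<bar>t\<bar> \<ge> R")
      case True
      then show ?thesis by (intro order_trans[OF less_imp_le[OF R[OF True]]]) simp
    next
      case False
      then have "t \<in> {-R..R}" by auto
      then obtain \<tau> where \<tau>: "\<tau> \<in> T" "\<bar>t - \<tau>\<bar> < d \<tau>" using T(3) by (auto simp: dist_real_def abs_minus_commute)
      have [measurable]: "H t \<in> ?L" "H \<tau> \<in> ?L" using mem by (auto simp: nspace_def)
      have "N (H t) \<le> N (\<lambda>y. H t y - H \<tau> y) + N (H \<tau>)"
      proof (rule lattice_norm_add[OF N])
        fix y show "cmod (H t y) \<le> cmod (H t y - H \<tau> y) + cmod (H \<tau> y)" using norm_triangle_ineq[of "H t y - H \<tau> y" "H \<tau> y"] by simp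
      qed measurable
      also have "\<dots> \<le> 1 + (\<Sum>\<tau>\<in>T. N (H \<tau>))"
        using d(2)[OF \<tau>(2)] T(2) \<tau>(1) by (intro add_mono member_le_sum) (auto simp: less_imp_le)
      finally show ?thesis .
    qed
    then have "(SUP t. N (H t)) \<le> 1 + (\<Sum>\<tau>\<in>T. N (H \<tau>))" by (intro SUP_least)
    also have "\<dots> < top" using mem T(2) by (auto simp: nspace_def)
    finally show ?thesis .
  qed
  note main = this
  have "(SUP t. N0 (F (Complex 0 t))) < top"
    by (rule main[OF N0]) (use mem cont[rule_format, OF zero_less_one] dec[rule_format, OF zero_less_one] in blast)+
  moreover have "(SUP t. N1 (F (Complex 1 t))) < top"
    by (rule main[OF N1]) (use mem cont[rule_format, OF zero_less_one] dec[rule_format, OF zero_less_one] in blast)+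
  ultimately show ?thesis by (simp add: calderon_norm_def)
qed

context tent_space_setting
begin

text \<open>The set where every quantity whose logarithm occurs is bounded above and below; the sets
  increase and exhaust the points of the half space where \<open>f\<close> is nonzero.\<close>

definition level :: "('a \<times> real \<Rightarrow> complex) \<Rightarrow> nat \<Rightarrow> ('a \<times> real) set" where
  "level f n = {z \<in> box (real (Suc n)). 1 / real (Suc n) \<le> cmod (f z) \<and> cmod (f z) \<le> real (Suc n)}"

lemma level_mono: "m \<le> n \<Longrightarrow> level f m \<subseteq> level f n"
proof -
  assume mn: "m \<le> n"
  then have le: "real (Suc m) \<le> real (Suc n)" by simp
  then have "1 / real (Suc n) \<le> 1 / real (Suc m)" by (intro divide_left_mono) auto
  moreover have "x \<in> level f n" if "x \<in> level f m" for x
  proof -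
    have "dist undefined (fst x) < real (Suc m)" "1 / real (Suc m) \<le> snd x" "snd x \<le> real (Suc m)" "1 / real (Suc m) \<le> V x"
      "V x \<le> real (Suc m)" "1 / real (Suc m) \<le> cmod (f x)" "cmod (f x) \<le> real (Suc m)"
      using that by (simp_all only: level_def box_def mem_Collect_eq)
    then show ?thesis unfolding level_def box_def using le calculation by (intro CollectI conjI) linarith+
  qed
  ultimately show ?thesis by blast
qed

lemma level_exhausts:
  assumes "0 < snd z" "f z \<noteq> 0"
  shows "\<exists>n. z \<in> level f n"
proof -
  have big: "\<exists>n. x \<le> real (Suc n)" for x :: real
  proof -
    obtain n where "x < real n" using reals_Archimedean2 by blast
    then show ?thesis by (intro exI[of _ n]) simp
  qed
  have v: "0 < V z" using assms(1) by (rule Vol_pos)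
  obtain n where n: "(dist undefined (fst z) + 1) + 1 / snd z + snd z + 1 / V z + V z + 1 / cmod (f z) + cmod (f z) \<le> real (Suc n)"
    using big by blast
  have "0 \<le> dist undefined (fst z)" "0 \<le> 1 / snd z" "0 \<le> 1 / V z" "0 \<le> V z" "0 \<le> 1 / cmod (f z)" "0 \<le> cmod (f z)"
    using assms v by simp_all
  then have le: "dist undefined (fst z) + 1 \<le> real (Suc n)" "1 / snd z \<le> real (Suc n)" "snd z \<le> real (Suc n)" "1 / V z \<le> real (Suc n)"
    "V z \<le> real (Suc n)" "1 / cmod (f z) \<le> real (Suc n)" "cmod (f z) \<le> real (Suc n)" using n assms(1) by linarith+
  have inv: "1 / real (Suc n) \<le> x" if "0 < x" "1 / x \<le> real (Suc n)" for x using that by (simp add: field_simps)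
  show ?thesis
  proof (intro exI[of _ n])
    have "dist undefined (fst z) < real (Suc n)" using le(1) by linarith
    moreover have "0 < cmod (f z)" using assms(2) by simp
    ultimately show "z \<in> level f n"
      unfolding level_def box_def using le(3,5,7) inv[OF assms(1) le(2)] inv[OF v le(4)] inv[OF _ le(6)] by blast
  qed
qed

lemma level_meas [measurable]:
  assumes [measurable]: "f \<in> borel_measurable (Xplus M)"
  shows "level f n \<inter> space (Xplus M) \<in> sets (Xplus M)"
proof -
  have "level f n \<inter> space (Xplus M) = (box (real (Suc n)) \<inter> space (Xplus M)) \<inter>
      {z \<in> space (Xplus M). 1 / real (Suc n) \<le> cmod (f z) \<and> cmod (f z) \<le> real (Suc n)}"
    unfolding level_def by blast
  also have "\<dots> \<in> sets (Xplus M)" by (intro sets.Int box_meas) measurable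
  finally show ?thesis .
qed

lemma pred_level [measurable]:
  "f \<in> borel_measurable (Xplus M) \<Longrightarrow> Measurable.pred (Xplus M) (\<lambda>z. z \<in> level f n)"
proof -
  assume f: "f \<in> borel_measurable (Xplus M)"
  have "{z \<in> space (Xplus M). z \<in> level f n} = level f n \<inter> space (Xplus M)" by auto
  then show ?thesis unfolding pred_def using level_meas[OF f, of n] by simp
qed

definition cut :: "('a \<times> real \<Rightarrow> complex) \<Rightarrow> nat \<Rightarrow> 'a \<times> real \<Rightarrow> complex" where
  "cut f n z = (if z \<in> level f n then f z else 0)"

lemma cut_meas [measurable]: "f \<in> borel_measurable (Xplus M) \<Longrightarrow> cut f n \<in> borel_measurable (Xplus M)"
  unfolding cut_def[abs_def] by (rule measurable_If) (use pred_level in \<open>auto simp: pred_def\<close>)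

lemma modw_mono: "cmod (f z) \<le> cmod (g z) \<Longrightarrow> modw s f z \<le> modw s g z"
  unfolding modw_def by (intro mult_left_mono ennreal_leI) auto

text \<open>Dominated convergence, first on the cones and then on the base. Finiteness of the outer
  exponent enters here; it holds for the interpolated exponent because \<open>p0\<close> and
  \<open>p1\<close> are not both infinite.\<close>

lemma tail_tendsto_0:
  assumes f [measurable]: "f \<in> borel_measurable (Xplus M)" and p: "1 \<le> p" and q: "1 < q"
    and fin: "Lnorm M p (Acone q (modw s f)) < top"
  shows "(\<lambda>n. Lnorm M p (Acone q (modw s (\<lambda>z. f z - cut f n z)))) \<longlonglongrightarrow> 0"
proof -
  let ?g = "\<lambda>n z. f z - cut f n z"
  have le: "modw s (?g n) z \<le> modw s f z" for n z by (intro modw_mono) (auto simp: cut_def)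
  have A: "Acone q (modw s (?g n)) x \<le> Acone q (modw s f) x" for n x
    unfolding Acone_def using q le by (intro epow_mono cone_int_mono) auto
  have int: "(\<integral>\<^sup>+x. epow (Acone q (modw s f) x) p \<partial>M) < top"
    using fin p unfolding Lnorm_def by simp
  have "AE x in M. Acone q (modw s f) x < top"
  proof -
    have "AE x in M. epow (Acone q (modw s f) x) p \<noteq> \<infinity>" using int by (intro nn_integral_PInf_AE) auto
    then show ?thesis by eventually_elim (auto simp: less_top)
  qed
  then have ae: "AE x in M. (\<lambda>n. epow (Acone q (modw s (?g n)) x) p) \<longlonglongrightarrow> 0"
  proof eventually_elim
    case (elim x)
    then have fx: "cone_int (\<lambda>z. epow (modw s f z) q) x < top" by (simp add: Acone_def)
    let ?k = "\<lambda>u z. if dist x (fst z) < snd z then ennreal (1 / V z) * epow (u z) q else 0"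
    have "(\<lambda>n. \<integral>\<^sup>+z. ?k (modw s (?g n)) z \<partial>Xplus M) \<longlonglongrightarrow> (\<integral>\<^sup>+z. 0 \<partial>Xplus M)"
    proof (rule nn_integral_dominated_convergence[where w="?k (modw s f)"])
      show "(\<integral>\<^sup>+z. ?k (modw s f) z \<partial>Xplus M) < \<infinity>" using fx by (simp add: cone_int_eq)
      show "AE z in Xplus M. ?k (modw s (?g n)) z \<le> ?k (modw s f) z" for n
        using le q by (intro AE_I2) (auto intro!: mult_left_mono epow_mono)
      show "AE z in Xplus M. (\<lambda>n. ?k (modw s (?g n)) z) \<longlonglongrightarrow> 0"
      proof (intro AE_I2)
        fix z assume z: "z \<in> space (Xplus M)"
        have "\<exists>N. \<forall>n\<ge>N. ?g n z = 0"
        proof (cases "f z = 0")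
          case False
          then obtain N where "z \<in> level f N" using level_exhausts[OF space_XplusD[OF z]] by blast
          then show ?thesis using level_mono by (intro exI[of _ N]) (auto simp: cut_def)
        qed (auto simp: cut_def)
        then have "\<forall>\<^sub>F n in sequentially. ?k (modw s (?g n)) z = 0"
          unfolding eventually_sequentially by (auto simp: modw_def)
        then show "(\<lambda>n. ?k (modw s (?g n)) z) \<longlonglongrightarrow> 0" by (rule tendsto_eventually)
      qed
    qed measurable
    then have "(\<lambda>n. cone_int (\<lambda>z. epow (modw s (?g n) z) q) x) \<longlonglongrightarrow> 0" by (simp add: cone_int_eq)
    then show ?case unfolding Acone_def epow_epow using p q by (intro tendsto_epow_0) auto
  qed
  have "(\<lambda>n. \<integral>\<^sup>+x. epow (Acone q (modw s (?g n)) x) p \<partial>M) \<longlonglongrightarrow> (\<integral>\<^sup>+x. 0 \<partial>M)"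
    by (rule nn_integral_dominated_convergence[where w="\<lambda>x. epow (Acone q (modw s f) x) p"])
      (use ae int A p in \<open>auto intro!: epow_mono\<close>)
  then show ?thesis unfolding Lnorm_def using p by (intro tendsto_epow_0) auto
qed

lemma norm_cut_SUP:
  assumes f [measurable]: "f \<in> borel_measurable (Xplus M)" and p: "1 \<le> p" and q: "1 < q"
  shows "Lnorm M p (Acone q (modw s f)) = (SUP n. Lnorm M p (Acone q (modw s (cut f n))))"
proof -
  have q0: "0 < q" and p0: "0 < p" using p q by auto
  have inc: "modw s (cut f m) z \<le> modw s (cut f n) z" if "m \<le> n" for m n z
    using level_mono[OF that, of f] by (intro modw_mono) (auto simp: cut_def)
  have Ainc: "Acone q (modw s (cut f m)) x \<le> Acone q (modw s (cut f n)) x" if "m \<le> n" for m n x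
    unfolding Acone_def using q inc[OF that] by (intro epow_mono cone_int_mono) auto
  have A: "Acone q (modw s f) x = (SUP n. Acone q (modw s (cut f n)) x)" for x
  proof -
    let ?k = "\<lambda>u z. if dist x (fst z) < snd z then ennreal (1 / V z) * epow (u z) q else 0"
    have "cone_int (\<lambda>z. epow (modw s f z) q) x = (\<integral>\<^sup>+z. (SUP n. ?k (modw s (cut f n)) z) \<partial>Xplus M)"
      unfolding cone_int_eq
    proof (intro nn_integral_cong)
      fix z assume z: "z \<in> space (Xplus M)"
      have "\<exists>N. cut f N z = f z"
      proof (cases "f z = 0")
        case False
        then show ?thesis using level_exhausts[OF space_XplusD[OF z]] by (auto simp: cut_def)
      qed (auto simp: cut_def)
      then obtain N where N: "cut f N z = f z" by blast
      have "?k (modw s f) z = ?k (modw s (cut f N)) z" by (simp add: modw_def N)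
      moreover have "?k (modw s (cut f n)) z \<le> ?k (modw s f) z" for n
        using q by (auto intro!: mult_left_mono epow_mono modw_mono simp: cut_def)
      ultimately show "?k (modw s f) z = (SUP n. ?k (modw s (cut f n)) z)"
        by (intro antisym SUP_least) (auto intro: SUP_upper2[of N])
    qed
    also have "\<dots> = (SUP n. \<integral>\<^sup>+z. ?k (modw s (cut f n)) z \<partial>Xplus M)"
      using q inc by (intro nn_integral_monotone_convergence_SUP) (auto simp: incseq_def le_fun_def intro!: mult_left_mono epow_mono)
    finally show ?thesis unfolding Acone_def using q0 by (simp add: cone_int_eq epow_SUP)
  qed
  have "(\<integral>\<^sup>+x. epow (Acone q (modw s f) x) p \<partial>M) = (\<integral>\<^sup>+x. (SUP n. epow (Acone q (modw s (cut f n)) x) p) \<partial>M)"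
    unfolding A using p0 by (simp add: epow_SUP)
  also have "\<dots> = (SUP n. \<integral>\<^sup>+x. epow (Acone q (modw s (cut f n)) x) p \<partial>M)"
    using p Ainc by (intro nn_integral_monotone_convergence_SUP) (auto simp: incseq_def le_fun_def intro!: epow_mono)
  finally show ?thesis unfolding Lnorm_def using p0 by (simp add: epow_SUP)
qed

end

section \<open>Interpolation of tent spaces\<close>

lemma abs_ln_le:
  fixes c x :: real
  assumes "0 < c" "c \<le> x" "x \<le> 1 / c"
  shows "0 < x" "\<bar>ln x\<bar> \<le> \<bar>ln c\<bar>"
proof -
  show x: "0 < x" using assms by linarith
  have "ln c \<le> ln x" using assms x by (subst ln_le_cancel_iff) auto
  moreover have "ln x \<le> ln (1 / c)" using assms x by (subst ln_le_cancel_iff) auto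
  ultimately show "\<bar>ln x\<bar> \<le> \<bar>ln c\<bar>" using assms(1) by (simp add: ln_div)
qed

locale tent_interpolation = tent_space_setting +
  fixes p0 p1 :: ennreal and q0 q1 s0 s1 \<theta> :: real
  assumes p01: "1 \<le> p0" "1 \<le> p1" "\<not> (p0 = \<infinity> \<and> p1 = \<infinity>)" and q01: "1 < q0" "1 < q1" and \<theta>: "0 < \<theta>" "\<theta> < 1"
begin

text \<open>Reciprocal exponents, equal to 0 at infinity, make the exponent arithmetic uniform in
  finite and infinite cases.\<close>

definition \<rho>0 :: real where "\<rho>0 = enn2real (inverse p0)"
definition \<rho>1 :: real where "\<rho>1 = enn2real (inverse p1)"
definition p :: real where "p = 1 / ((1 - \<theta>) * \<rho>0 + \<theta> * \<rho>1)"
definition q :: real where "q = 1 / ((1 - \<theta>) / q0 + \<theta> / q1)"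
definition s :: real where "s = (1 - \<theta>) * s0 + \<theta> * s1"
text \<open>The exponents of \<open>w\<close> in the two factors. That their
  \<open>\<theta>\<close>-mean is 0 (\<open>\<beta>_zero\<close>) is why the weight drops out of the
  product.\<close>

definition \<beta>0 :: real where "\<beta>0 = p * \<rho>0 - q / q0"
definition \<beta>1 :: real where "\<beta>1 = p * \<rho>1 - q / q1"

abbreviation L where "L \<equiv> borel_measurable (Xplus M)"
abbreviation N0 where "N0 \<equiv> tent_norm M p0 q0 s0"
abbreviation N1 where "N1 \<equiv> tent_norm M p1 q1 s1"
abbreviation N\<theta> where "N\<theta> \<equiv> tent_norm M (ennreal p) q s"

lemma inverse_ge_1: "1 \<le> x \<Longrightarrow> inverse x = ennreal (enn2real (inverse x)) \<and> 0 \<le> enn2real (inverse x) \<and> enn2real (inverse x) \<le> 1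
    \<and> (x \<noteq> \<infinity> \<longrightarrow> 0 < enn2real (inverse x))" for x :: ennreal
  by (cases x) (auto simp: inverse_ennreal field_simps ennreal_1[symmetric] simp del: ennreal_1)

lemma \<rho>: "0 \<le> \<rho>0" "\<rho>0 \<le> 1" "0 \<le> \<rho>1" "\<rho>1 \<le> 1" "inverse p0 = ennreal \<rho>0" "inverse p1 = ennreal \<rho>1"
    "0 < (1 - \<theta>) * \<rho>0 + \<theta> * \<rho>1" "(1 - \<theta>) * \<rho>0 + \<theta> * \<rho>1 \<le> 1"
proof -
  note i = inverse_ge_1[OF p01(1)] inverse_ge_1[OF p01(2)]
  show r: "0 \<le> \<rho>0" "\<rho>0 \<le> 1" "0 \<le> \<rho>1" "\<rho>1 \<le> 1" "inverse p0 = ennreal \<rho>0" "inverse p1 = ennreal \<rho>1"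
    using i unfolding \<rho>0_def \<rho>1_def by blast+
  have "0 < \<rho>0 \<or> 0 < \<rho>1" using i p01(3) unfolding \<rho>0_def \<rho>1_def by blast
  then show "0 < (1 - \<theta>) * \<rho>0 + \<theta> * \<rho>1" using r \<theta> by (auto intro: add_pos_nonneg add_nonneg_pos)
  have "(1 - \<theta>) * \<rho>0 + \<theta> * \<rho>1 \<le> (1 - \<theta>) * 1 + \<theta> * 1" using r \<theta> by (intro add_mono mult_left_mono) auto
  then show "(1 - \<theta>) * \<rho>0 + \<theta> * \<rho>1 \<le> 1" by simp
qed

lemma p_ge_1: "1 \<le> p"
  using \<rho>(7,8) by (simp add: p_def)

lemma p_theta: "inverse (ennreal (1 - \<theta>) * inverse p0 + ennreal \<theta> * inverse p1) = ennreal p"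
proof -
  have "ennreal (1 - \<theta>) * inverse p0 + ennreal \<theta> * inverse p1 = ennreal ((1 - \<theta>) * \<rho>0 + \<theta> * \<rho>1)"
    using \<theta> \<rho> by (simp add: ennreal_mult[symmetric] ennreal_plus[symmetric] del: ennreal_plus)
  then show ?thesis using \<rho>(7) by (simp add: inverse_ennreal p_def inverse_eq_divide)
qed

lemma p_rho: "p * ((1 - \<theta>) * \<rho>0 + \<theta> * \<rho>1) = 1"
  using \<rho>(7) by (simp add: p_def)

lemma q_kappa: "q * ((1 - \<theta>) / q0 + \<theta> / q1) = 1" "1 < q" "1 / q = (1 - \<theta>) / q0 + \<theta> / q1"
proof -
  have pos: "0 < (1 - \<theta>) / q0 + \<theta> / q1" using q01 \<theta> by (intro add_pos_pos divide_pos_pos) auto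
  then show "q * ((1 - \<theta>) / q0 + \<theta> / q1) = 1" "1 / q = (1 - \<theta>) / q0 + \<theta> / q1" by (simp_all add: q_def)
  have "(1 - \<theta>) / q0 < 1 - \<theta>" "\<theta> / q1 < \<theta>" using q01 \<theta> by (simp_all add: divide_less_eq)
  then have "(1 - \<theta>) / q0 + \<theta> / q1 < 1" by simp
  then show "1 < q" using pos by (simp add: q_def)
qed

lemma q_kappa': "(1 - \<theta>) * (q / q0) + \<theta> * (q / q1) = 1"
  using q_kappa(1) by (simp add: algebra_simps)

lemma \<beta>_zero: "(1 - \<theta>) * \<beta>0 + \<theta> * \<beta>1 = 0"
proof -
  have "(1 - \<theta>) * \<beta>0 + \<theta> * \<beta>1 = p * ((1 - \<theta>) * \<rho>0 + \<theta> * \<rho>1) - ((1 - \<theta>) * (q / q0) + \<theta> * (q / q1))"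
    by (simp add: \<beta>0_def \<beta>1_def algebra_simps)
  then show ?thesis by (simp only: p_rho q_kappa')
qed

lemma N\<theta>_eq: "N\<theta> f = Lnorm M p (Acone q (modw s f))"
  using p_ge_1 by (subst tent_norm_finite) auto

lemma lattice: "lattice_norm (Xplus M) N0" "lattice_norm (Xplus M) N1" "lattice_norm (Xplus M) N\<theta>"
  using p01 q01 q_kappa(2) p_ge_1 by (auto intro!: lattice_norm_tent simp: ennreal_1[symmetric] simp del: ennreal_1)

text \<open>The logarithm of the normalised modulus \<open>V powr (- s) * cmod f / l\<close>. The
  analytic families are exponentials of combinations of \<open>ln V\<close>, \<open>\<phi>\<close>
  and \<open>ln w\<close>.\<close>

definition \<phi> :: "('a \<times> real \<Rightarrow> complex) \<Rightarrow> real \<Rightarrow> 'a \<times> real \<Rightarrow> real" where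
  "\<phi> f l z = ln (cmod (f z)) - s * ln (V z) - ln l"

text \<open>The \<open>q\<close>-th power of the normalised modulus for a function supported in its
  level set; this is the \<open>G\<close> of the weight construction.\<close>

definition Gf :: "('a \<times> real \<Rightarrow> complex) \<Rightarrow> nat \<Rightarrow> real \<Rightarrow> 'a \<times> real \<Rightarrow> ennreal" where
  "Gf f n l z = (if z \<in> level f n then ennreal (exp (q * \<phi> f l z)) else 0)"

lemma level_bounds:
  assumes z: "z \<in> level f n"
  shows "0 < snd z" "z \<in> box (real (Suc n))" "0 < V z" "0 < cmod (f z)" "\<bar>ln (V z)\<bar> \<le> ln (real (Suc n))"
    "\<bar>ln (cmod (f z))\<bar> \<le> ln (real (Suc n))" "z \<in> space (Xplus M)"
proof -
  have pos: "0 < x \<and> \<bar>ln x\<bar> \<le> ln (real (Suc n))" if "1 / real (Suc n) \<le> x" "x \<le> real (Suc n)" for x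
  proof -
    have x: "0 < x" using that(1) by (rule less_le_trans[rotated]) simp
    moreover have "ln (1 / real (Suc n)) \<le> ln x" using that x by (subst ln_le_cancel_iff) auto
    then have "- ln (real (Suc n)) \<le> ln x" by (simp add: ln_div)
    moreover have "ln x \<le> ln (real (Suc n))" using that x by (subst ln_le_cancel_iff) auto
    ultimately show ?thesis by linarith
  qed
  have m: "z \<in> box (real (Suc n))" "1 / real (Suc n) \<le> snd z" "snd z \<le> real (Suc n)" "1 / real (Suc n) \<le> V z" "V z \<le> real (Suc n)"
    "1 / real (Suc n) \<le> cmod (f z)" "cmod (f z) \<le> real (Suc n)"
    using z by (simp_all only: level_def box_def mem_Collect_eq)
  show "0 < snd z" "z \<in> box (real (Suc n))" "0 < V z" "0 < cmod (f z)" "\<bar>ln (V z)\<bar> \<le> ln (real (Suc n))"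
    "\<bar>ln (cmod (f z))\<bar> \<le> ln (real (Suc n))"
    using m(1) pos[OF m(2,3)] pos[OF m(4,5)] pos[OF m(6,7)] by blast+
  then show "z \<in> space (Xplus M)" by (cases z) (simp add: space_Xplus)
qed

lemma \<phi>_bound: "z \<in> level f n \<Longrightarrow> \<bar>\<phi> f l z\<bar> \<le> ln (real (Suc n)) + \<bar>s\<bar> * ln (real (Suc n)) + \<bar>ln l\<bar>"
proof -
  assume z: "z \<in> level f n"
  have "\<bar>s * ln (V z)\<bar> \<le> \<bar>s\<bar> * ln (real (Suc n))" unfolding abs_mult using level_bounds(5)[OF z] by (intro mult_left_mono) auto
  then show ?thesis using level_bounds(6)[OF z] unfolding \<phi>_def by linarith
qed

lemma \<phi>_meas [measurable]:
  assumes [measurable]: "f \<in> L"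
  shows "\<phi> f l \<in> borel_measurable (Xplus M)"
  unfolding \<phi>_def[abs_def] by measurable

lemma measurable_level_If:
  assumes "f \<in> L" "g \<in> borel_measurable (Xplus M)" "h \<in> borel_measurable (Xplus M)"
  shows "(\<lambda>z. if z \<in> level f n then g z else h z) \<in> borel_measurable (Xplus M)"
  using assms(2,3) by (rule measurable_If) (use pred_level[OF assms(1), of n] in \<open>simp add: pred_def\<close>)

lemma Gf_meas [measurable]:
  assumes f [measurable]: "f \<in> L"
  shows "Gf f n l \<in> borel_measurable (Xplus M)"
  unfolding Gf_def[abs_def] by (intro measurable_level_If f) measurable

lemma exp_modw: "z \<in> level f n \<Longrightarrow> modw s' f z = ennreal (exp (ln (cmod (f z)) - s' * ln (V z)))"
  using level_bounds[of z f n] by (simp add: modw_def ennreal_mult[symmetric] powr_def exp_diff exp_minus divide_inverse mult.commute)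

lemma Gf_eq:
  assumes supp: "\<And>z. z \<in> space (Xplus M) \<Longrightarrow> f z \<noteq> 0 \<Longrightarrow> z \<in> level f n" and l: "0 < l" and z: "z \<in> space (Xplus M)"
  shows "Gf f n l z = epow (ennreal (1 / l) * modw s f z) q"
proof (cases "z \<in> level f n")
  case True
  have "ennreal (1 / l) * modw s f z = ennreal (exp (\<phi> f l z))"
    using l unfolding exp_modw[OF True] \<phi>_def by (simp add: ennreal_mult[symmetric] exp_diff)
  then show ?thesis using True by (simp add: Gf_def epow_ennreal powr_def)
next
  case False
  then have "f z = 0" using supp z by blast
  then show ?thesis using False by (simp add: Gf_def modw_def)
qed

lemma Gf_integral:
  assumes [measurable]: "f \<in> L" and supp: "\<And>z. z \<in> space (Xplus M) \<Longrightarrow> f z \<noteq> 0 \<Longrightarrow> z \<in> level f n" and l: "0 < l"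
  shows "(\<integral>\<^sup>+x. epow (cone_int (Gf f n l) x) (p / q) \<partial>M) = epow (ennreal (1 / l) * N\<theta> f) p"
proof -
  have q0: "0 < q" using q_kappa(2) by simp
  have "cone_int (Gf f n l) x = cone_int (\<lambda>z. epow (ennreal (1 / l) * modw s f z) q) x" for x
    unfolding cone_int_def by (intro nn_integral_cong) (simp add: Gf_eq[OF supp l])
  then have "epow (cone_int (Gf f n l) x) (p / q) = epow (Acone q (\<lambda>z. ennreal (1 / l) * modw s f z) x) p" for x
    unfolding Acone_def by (simp add: epow_epow)
  moreover have "Acone q (\<lambda>z. ennreal (1 / l) * modw s f z) x = ennreal (1 / l) * Acone q (modw s f) x" for x
    using q0 by (intro Acone_cmult) auto
  ultimately have "(\<integral>\<^sup>+x. epow (cone_int (Gf f n l) x) (p / q) \<partial>M) = (\<integral>\<^sup>+x. epow (ennreal (1 / l)) p * epow (Acone q (modw s f) x) p \<partial>M)"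
    by (simp add: epow_mult)
  also have "\<dots> = epow (ennreal (1 / l)) p * (\<integral>\<^sup>+x. epow (Acone q (modw s f) x) p \<partial>M)" by (intro nn_integral_cmult) auto
  also have "\<dots> = epow (ennreal (1 / l) * N\<theta> f) p"
    using p_ge_1 unfolding N\<theta>_eq Lnorm_def epow_mult by (simp add: epow_epow)
  finally show ?thesis .
qed

lemma Gf_le: "Gf f n l z \<le> ennreal (exp (q * (ln (real (Suc n)) + \<bar>s\<bar> * ln (real (Suc n)) + \<bar>ln l\<bar>)))"
proof (cases "z \<in> level f n")
  case True
  have "q * \<phi> f l z \<le> q * (ln (real (Suc n)) + \<bar>s\<bar> * ln (real (Suc n)) + \<bar>ln l\<bar>)"
    using \<phi>_bound[OF True, of l] q_kappa(2) by (intro mult_left_mono) auto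
  then show ?thesis using True by (simp add: Gf_def ennreal_leI)
qed (simp add: Gf_def)

lemma Gf_supp: "z \<notin> box (real (Suc n)) \<Longrightarrow> Gf f n l z = 0"
  by (simp add: Gf_def level_def)

lemma norm_nice_finite:
  assumes [measurable]: "f \<in> L" and supp: "\<And>z. z \<in> space (Xplus M) \<Longrightarrow> f z \<noteq> 0 \<Longrightarrow> z \<in> level f n"
  shows "N\<theta> f < top"
proof -
  obtain E where E: "E < top" "\<And>x. cone_int (Gf f n 1) x \<le> E * indicator (ball undefined (2 * real (Suc n))) x"
    using cone_int_box_bound[of "real (Suc n)" "Gf f n 1", OF _ Gf_supp Gf_le] by auto
  have "epow (ennreal (1 / 1) * N\<theta> f) p = (\<integral>\<^sup>+x. epow (cone_int (Gf f n 1) x) (p / q) \<partial>M)"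
    using supp by (intro Gf_integral[symmetric]) auto
  also have "\<dots> \<le> (\<integral>\<^sup>+x. epow E (p / q) * indicator (ball undefined (2 * real (Suc n))) x \<partial>M)"
  proof (intro nn_integral_mono)
    fix x
    have "epow (cone_int (Gf f n 1) x) (p / q) \<le> epow (E * indicator (ball undefined (2 * real (Suc n))) x) (p / q)"
      using p_ge_1 q_kappa(2) by (intro epow_mono E) auto
    then show "epow (cone_int (Gf f n 1) x) (p / q) \<le> epow E (p / q) * indicator (ball undefined (2 * real (Suc n))) x"
      by (auto simp: epow_mult split: split_indicator_asm)
  qed
  also have "\<dots> < top" using E(1) by (simp add: nn_integral_cmult emeasure_ball ennreal_mult_less_top)
  finally show ?thesis by simp
qed

lemma log_combination_bounded:
  assumes c: "0 < c" "\<forall>z\<in>box (real (Suc n)). c \<le> v z \<and> v z \<le> 1 / c"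
  shows "\<exists>B\<ge>0. \<forall>z. \<bar>if z \<in> level f n then x * ln (V z) + y * \<phi> f l z + e * ln (v z) else 0\<bar> \<le> B"
proof -
  let ?B = "\<bar>x\<bar> * ln (real (Suc n)) + \<bar>y\<bar> * (ln (real (Suc n)) + \<bar>s\<bar> * ln (real (Suc n)) + \<bar>ln l\<bar>) + \<bar>e\<bar> * \<bar>ln c\<bar>"
  have B0: "0 \<le> ?B" by (intro add_nonneg_nonneg mult_nonneg_nonneg) auto
  have "\<bar>if z \<in> level f n then x * ln (V z) + y * \<phi> f l z + e * ln (v z) else 0\<bar> \<le> ?B" for z
  proof (cases "z \<in> level f n")
    case True
    have "\<bar>ln (v z)\<bar> \<le> \<bar>ln c\<bar>" using bspec[OF c(2) level_bounds(2)[OF True]] abs_ln_le(2)[OF c(1)] by blast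
    then have "\<bar>x * ln (V z)\<bar> \<le> \<bar>x\<bar> * ln (real (Suc n))"
      "\<bar>y * \<phi> f l z\<bar> \<le> \<bar>y\<bar> * (ln (real (Suc n)) + \<bar>s\<bar> * ln (real (Suc n)) + \<bar>ln l\<bar>)"
      "\<bar>e * ln (v z)\<bar> \<le> \<bar>e\<bar> * \<bar>ln c\<bar>"
      unfolding abs_mult using level_bounds(5)[OF True] \<phi>_bound[OF True, of l] by (auto intro!: mult_left_mono)
    moreover have "\<bar>x + y + z\<bar> \<le> \<bar>x\<bar> + \<bar>y\<bar> + \<bar>z\<bar>" for x y z :: real by linarith
    ultimately show ?thesis unfolding if_P[OF True] by (meson add_mono order_trans)
  qed (use B0 in simp)
  then show ?thesis using B0 by blast
qed

text \<open>The bound supplied by \<open>ex_tent_weight\<close>. It is the same for all normalised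
  functions, so all constants derived from it are uniform.\<close>

definition A where "A = 2 * 2 powr p"
definition r where "r = wexp p q"
definition CA :: "ennreal \<Rightarrow> real \<Rightarrow> real" where "CA pj Q = tent_weight.CN M p r A pj Q"

lemma ex_weight:
  assumes [measurable]: "f \<in> L" and supp: "\<And>z. z \<in> space (Xplus M) \<Longrightarrow> f z \<noteq> 0 \<Longrightarrow> z \<in> level f n"
    and l: "0 < l" and N: "N\<theta> f \<le> ennreal l"
  shows "\<exists>a. tent_weight M p q r A a (Gf f n l) \<and>
    (\<exists>c>0. \<forall>z\<in>box (real (Suc n)). c \<le> tent_weight.w M r a z \<and> tent_weight.w M r a z \<le> 1 / c)"
  unfolding r_def A_def
proof (rule ex_tent_weight)
  have "ennreal (1 / l) * N\<theta> f \<le> ennreal (1 / l) * ennreal l" by (intro mult_left_mono N) auto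
  also have "\<dots> = 1" using l by (simp add: ennreal_mult[symmetric])
  finally have "epow (ennreal (1 / l) * N\<theta> f) p \<le> epow 1 p" using p_ge_1 by (intro epow_mono) auto
  then show "(\<integral>\<^sup>+x. epow (cone_int (Gf f n l) x) (p / q) \<partial>M) \<le> 1"
    using supp l by (subst Gf_integral) auto
qed (use p_ge_1 q_kappa(2) Gf_le Gf_supp in auto)

text \<open>Factorisation of a function with nice support. On the level set all logarithms are
  bounded, hence so is \<open>b\<close>, while the norm bounds involve only \<open>l\<close> and
  uniform constants.\<close>

lemma nice_piece:
  assumes f [measurable]: "f \<in> L" and supp: "\<And>z. z \<in> space (Xplus M) \<Longrightarrow> f z \<noteq> 0 \<Longrightarrow> z \<in> level f n"
    and l: "0 < l" and N: "N\<theta> f \<le> ennreal l"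
  shows "\<exists>b. b \<in> borel_measurable (Xplus M) \<and> (\<exists>B. \<forall>z. \<bar>b z\<bar> \<le> B) \<and>
     N0 (\<lambda>z. f z * of_real (exp (- \<theta> * b z))) \<le> ennreal (CA p0 q0 * l) \<and>
     N1 (\<lambda>z. f z * of_real (exp ((1 - \<theta>) * b z))) \<le> ennreal (CA p1 q1 * l)"
proof -
  obtain a c where tw: "tent_weight M p q r A a (Gf f n l)" and c: "0 < c"
    "\<forall>z\<in>box (real (Suc n)). c \<le> tent_weight.w M r a z \<and> tent_weight.w M r a z \<le> 1 / c"
    using ex_weight[OF f supp l N] by blast
  interpret W: tent_weight M p q r A a "Gf f n l" by (rule tw)
  \<comment> \<open>Up to the common factor \<open>l\<close> this is \<open>ln (f1 / f0)\<close> for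
    the factors \<open>V powr s_j * exp ((q / q_j) * \<phi>) * w powr \<beta>_j\<close>.\<close>
  define b where "b z = (if z \<in> level f n then (s1 - s0) * ln (V z) + (q / q1 - q / q0) * \<phi> f l z + (\<beta>1 - \<beta>0) * ln (W.w z) else 0)" for z
  have b_meas [measurable]: "b \<in> borel_measurable (Xplus M)"
    unfolding b_def[abs_def] by (intro measurable_level_If f) measurable
  have w: "0 < W.w z" if "z \<in> level f n" for z
    using bspec[OF c(2) level_bounds(2)[OF that]] abs_ln_le(1)[OF c(1)] by blast
  have bB: "\<exists>B. \<forall>z. \<bar>b z\<bar> \<le> B"
    using log_combination_bounded[OF c, where f = f and x = "s1 - s0" and y = "q / q1 - q / q0" and l = l and e = "\<beta>1 - \<beta>0"] unfolding b_def by blast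
  \<comment> \<open>Both ends at once, with \<open>t = 0\<close> and \<open>t = 1\<close>. The
    equations state that, after weighting with \<open>V powr (- s')\<close>, no power of
    \<open>V\<close> remains and that the modulus and the weight carry the exponents expected by
    \<open>tent_norm_factor_bound\<close>.\<close>
  have one: "tent_norm M pj Q s' (\<lambda>z. f z * of_real (exp ((t - \<theta>) * b z))) \<le> ennreal (CA pj Q * l)"
    if pj: "1 \<le> pj" and Q: "1 < Q" and e1: "s - s' + (t - \<theta>) * (s1 - s0) = 0" and e2: "1 + (t - \<theta>) * (q / q1 - q / q0) = q / Q"
      and e3: "(t - \<theta>) * (\<beta>1 - \<beta>0) = p * enn2real (inverse pj) - q / Q" for pj Q s' t
  proof -
    define h where "h z = of_real (1 / l) * (f z * of_real (exp ((t - \<theta>) * b z)))" for z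
    have [measurable]: "h \<in> L" unfolding h_def[abs_def] by measurable
    have "tent_norm M pj Q s' h \<le> ennreal (W.CN pj Q)"
    proof (rule W.tent_norm_factor_bound[OF pj Q])
      fix z assume z: "z \<in> space (Xplus M)"
      show "modw s' h z = epow (Gf f n l z) (1 / Q) * ennreal (W.w z powr (p * enn2real (inverse pj) - q / Q))"
      proof (cases "z \<in> level f n")
        case True
        let ?v = "ln (V z)" and ?f = "\<phi> f l z" and ?u = "ln (W.w z)"
        have "modw s' h z = ennreal (exp (- s' * ?v) * ((1 / l) * (cmod (f z) * exp ((t - \<theta>) * b z))))"
          using level_bounds[OF True] l by (simp add: modw_def h_def norm_mult norm_divide ennreal_mult[symmetric] powr_def)
        also have "exp (- s' * ?v) * ((1 / l) * (cmod (f z) * exp ((t - \<theta>) * b z))) = exp (- s' * ?v - ln l + ln (cmod (f z)) + (t - \<theta>) * b z)"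
          using level_bounds[OF True] l by (simp add: exp_add exp_diff)
        also have "- s' * ?v - ln l + ln (cmod (f z)) + (t - \<theta>) * b z
          = (s - s' + (t - \<theta>) * (s1 - s0)) * ?v + (1 + (t - \<theta>) * (q / q1 - q / q0)) * ?f + ((t - \<theta>) * (\<beta>1 - \<beta>0)) * ?u"
        proof -
          have id: "- s' * v - L + (F + s * v + L) + T * (S * v + K * F + E * u) = (s - s' + T * S) * v + (1 + T * K) * F + (T * E) * u"
            for v L F T S K E u :: real by (simp add: algebra_simps)
          have "ln (cmod (f z)) = ?f + s * ?v + ln l" by (simp add: \<phi>_def)
          then show ?thesis unfolding b_def if_P[OF True] by (simp only: id)
        qed
        also have "\<dots> = (q / Q) * ?f + (p * enn2real (inverse pj) - q / Q) * ?u" unfolding e1 e2 e3 by simp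
        finally show ?thesis
          using True w[OF True] by (simp add: Gf_def epow_ennreal powr_def ennreal_mult[symmetric] exp_add)
      next
        case False
        then have "f z = 0" using supp z by blast
        then show ?thesis using False by (simp add: Gf_def modw_def h_def)
      qed
    qed measurable
    then have "ennreal l * tent_norm M pj Q s' h \<le> ennreal l * ennreal (W.CN pj Q)" by (intro mult_left_mono) auto
    moreover have "tent_norm M pj Q s' (\<lambda>z. of_real l * h z) = ennreal (cmod (of_real l)) * tent_norm M pj Q s' h"
      by (rule lattice_norm_cmult[OF lattice_norm_tent[OF pj Q]]) measurable
    moreover have "(\<lambda>z. of_real l * h z) = (\<lambda>z. f z * of_real (exp ((t - \<theta>) * b z)))"
      using l by (auto simp: h_def)
    ultimately show ?thesis using l by (simp add: CA_def ennreal_mult'[symmetric] mult.commute)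
  qed
  have "N0 (\<lambda>z. f z * of_real (exp ((0 - \<theta>) * b z))) \<le> ennreal (CA p0 q0 * l)"
  proof (rule one[OF p01(1) q01(1)])
    show "s - s0 + (0 - \<theta>) * (s1 - s0) = 0" by (simp add: s_def algebra_simps)
    have "1 + (0 - \<theta>) * (y - x) = x" if "(1 - \<theta>) * x + \<theta> * y = 1" for x y using that by (simp add: algebra_simps)
    from this[OF q_kappa'] show "1 + (0 - \<theta>) * (q / q1 - q / q0) = q / q0" .
    show "(0 - \<theta>) * (\<beta>1 - \<beta>0) = p * enn2real (inverse p0) - q / q0"
      using \<beta>_zero unfolding \<rho>0_def[symmetric] \<beta>0_def[symmetric] by (simp add: algebra_simps)
  qed
  moreover have "N1 (\<lambda>z. f z * of_real (exp ((1 - \<theta>) * b z))) \<le> ennreal (CA p1 q1 * l)"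
  proof (rule one[OF p01(2) q01(2)])
    show "s - s1 + (1 - \<theta>) * (s1 - s0) = 0" by (simp add: s_def algebra_simps)
    have "1 + (1 - \<theta>) * (y - x) = y" if "(1 - \<theta>) * x + \<theta> * y = 1" for x y using that by (simp add: algebra_simps)
    from this[OF q_kappa'] show "1 + (1 - \<theta>) * (q / q1 - q / q0) = q / q1" .
    show "(1 - \<theta>) * (\<beta>1 - \<beta>0) = p * enn2real (inverse p1) - q / q1"
      using \<beta>_zero unfolding \<rho>1_def[symmetric] \<beta>1_def[symmetric] by (simp add: algebra_simps)
  qed
  ultimately show ?thesis using b_meas bB by (intro exI[of _ b]) auto
qed

text \<open>\<open>exp 1\<close> is the Gaussian factor on the right boundary line, 4 is the sum of
  \<open>2 * (1 / 2) ^ k\<close> over all pieces, and the summand 1 ensures positivity.\<close>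

definition C1 :: real where "C1 = exp 1 * (4 * (1 + \<bar>CA p0 q0\<bar> + \<bar>CA p1 q1\<bar>))"

lemma C1_pos: "0 < C1"
  by (simp add: C1_def add_pos_nonneg)

text \<open>The function is cut along level sets chosen so sparsely that the pieces have
  geometrically decreasing norms. Each piece receives its own weight and its own bounded logarithm;
  \<open>analytic_family\<close> joins them.\<close>

lemma ex_calderon_extension:
  assumes f [measurable]: "f \<in> L" and l: "0 < l" and N: "N\<theta> f \<le> ennreal l"
  shows "\<exists>F. calderon L N0 N1 F \<and> F (of_real \<theta>) = f \<and> calderon_norm N0 N1 F \<le> ennreal (C1 * l)"
proof -
  have tail: "(\<lambda>n. N\<theta> (\<lambda>z. f z - cut f n z)) \<longlonglongrightarrow> 0"
    unfolding N\<theta>_eq using N p_ge_1 q_kappa(2) unfolding N\<theta>_eq by (intro tail_tendsto_0 f) (auto intro: le_less_trans)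
  have "\<exists>n. \<forall>m\<ge>n. N\<theta> (\<lambda>z. f z - cut f m z) \<le> ennreal (l * (1 / 2) ^ k)" for k
  proof -
    have "0 < ennreal (l * (1 / 2) ^ k)" using l by (simp add: ennreal_less_zero_iff)
    then have "\<forall>\<^sub>F n in sequentially. N\<theta> (\<lambda>z. f z - cut f n z) < ennreal (l * (1 / 2) ^ k)" using order_tendstoD(2)[OF tail] by blast
    then show ?thesis unfolding eventually_sequentially by (auto intro: less_imp_le)
  qed
  then obtain n where n: "\<And>k m. n k \<le> m \<Longrightarrow> N\<theta> (\<lambda>z. f z - cut f m z) \<le> ennreal (l * (1 / 2) ^ k)" by metis
  \<comment> \<open>At least \<open>n k\<close>, so that the tail beyond this level is small, and at
    least \<open>k\<close>, so that the levels exhaust the support.\<close>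
  define m where "m k = (\<Sum>i\<le>k. n i) + k" for k :: nat
  have m: "n k \<le> m k" "k \<le> m k" for k unfolding m_def by (auto intro: trans_le_add1 member_le_sum)
  \<comment> \<open>The first level containing \<open>z\<close>. In the half space the default 0 is
    used only at zeros of \<open>f\<close>.\<close>
  define \<kappa> where "\<kappa> z = (if \<exists>k. z \<in> level f (m k) then LEAST k. z \<in> level f (m k) else 0)" for z
  have \<kappa>_meas [measurable]: "\<kappa> \<in> measurable (Xplus M) (count_space UNIV)"
  proof -
    have [measurable]: "Measurable.pred (Xplus M) (\<lambda>z. z \<in> level f (m k))" for k by (rule pred_level[OF f])
    show ?thesis unfolding \<kappa>_def[abs_def] by measurable
  qed
  define fk where "fk k z = (if \<kappa> z = k then f z else 0)" for k z
  have fk_meas [measurable]: "fk k \<in> L" for k unfolding fk_def[abs_def] by measurable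
  have in_level: "z \<in> level f (m (\<kappa> z))" if z: "z \<in> space (Xplus M)" "f z \<noteq> 0" for z
  proof -
    obtain j where "z \<in> level f j" using level_exhausts[of z f, OF space_XplusD[OF z(1)] z(2)] by blast
    then have ex: "\<exists>k. z \<in> level f (m k)" using level_mono[OF m(2)] by blast
    show ?thesis unfolding \<kappa>_def if_P[OF ex] by (rule LeastI_ex[OF ex])
  qed
  have supp: "z \<in> level (fk k) (m k)" if z: "z \<in> space (Xplus M)" "fk k z \<noteq> 0" for k z
  proof -
    have "\<kappa> z = k" "f z \<noteq> 0" using z(2) by (auto simp: fk_def split: if_splits)
    then show ?thesis using in_level[OF z(1)] by (simp add: level_def fk_def)
  qed
  \<comment> \<open>The piece \<open>Suc j\<close> avoids the level \<open>m j\<close> and is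
    dominated by a tail of norm at most \<open>l * (1 / 2) ^ j\<close>; the factor 2 absorbs this
    index shift.\<close>
  define lk where "lk k = 2 * l * (1 / 2) ^ k" for k :: nat
  have lk: "0 < lk k" for k using l by (simp add: lk_def)
  have fk_norm: "N\<theta> (fk k) \<le> ennreal (lk k)" for k
  proof (cases k)
    case 0
    have "N\<theta> (fk k) \<le> N\<theta> f" by (rule lattice_norm_mono[OF lattice(3)]) (auto simp: fk_def)
    also have "\<dots> \<le> ennreal (lk k)" using N l 0 by (auto simp: lk_def intro: order_trans ennreal_leI)
    finally show ?thesis .
  next
    case (Suc j)
    have "N\<theta> (fk k) \<le> N\<theta> (\<lambda>z. f z - cut f (m j) z)"
    proof (rule lattice_norm_mono[OF lattice(3)])
      fix z
      show "cmod (fk k z) \<le> cmod (f z - cut f (m j) z)"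
      proof (cases "\<kappa> z = k")
        case True
        then have ex: "\<exists>k. z \<in> level f (m k)" using Suc by (auto simp: \<kappa>_def split: if_splits)
        then have "(LEAST k. z \<in> level f (m k)) = Suc j" using True Suc by (simp add: \<kappa>_def)
        then have "z \<notin> level f (m j)" using not_less_Least[of j "\<lambda>k. z \<in> level f (m k)"] by simp
        then show ?thesis by (simp add: fk_def cut_def)
      qed (simp add: fk_def)
    qed measurable
    also have "\<dots> \<le> ennreal (l * (1 / 2) ^ j)" by (rule n[OF m(1)])
    also have "l * (1 / 2) ^ j = lk k" by (simp add: lk_def Suc)
    finally show ?thesis .
  qed
  have "\<forall>k. \<exists>b. b \<in> borel_measurable (Xplus M) \<and> (\<exists>B. \<forall>z. \<bar>b z\<bar> \<le> B) \<and>
     N0 (\<lambda>z. fk k z * of_real (exp (- \<theta> * b z))) \<le> ennreal (CA p0 q0 * lk k) \<and>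
     N1 (\<lambda>z. fk k z * of_real (exp ((1 - \<theta>) * b z))) \<le> ennreal (CA p1 q1 * lk k)"
    by (intro allI nice_piece[OF fk_meas supp lk fk_norm])
  from choice[OF this] obtain b where bk: "\<forall>k. b k \<in> borel_measurable (Xplus M) \<and> (\<exists>B. \<forall>z. \<bar>b k z\<bar> \<le> B) \<and>
     N0 (\<lambda>z. fk k z * of_real (exp (- \<theta> * b k z))) \<le> ennreal (CA p0 q0 * lk k) \<and>
     N1 (\<lambda>z. fk k z * of_real (exp ((1 - \<theta>) * b k z))) \<le> ennreal (CA p1 q1 * lk k)" ..
  then have b [measurable]: "\<And>k. b k \<in> borel_measurable (Xplus M)" and bB: "\<And>k. \<exists>B. \<forall>z. \<bar>b k z\<bar> \<le> B"
    and b0: "\<And>k. N0 (\<lambda>z. fk k z * of_real (exp (- \<theta> * b k z))) \<le> ennreal (CA p0 q0 * lk k)"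
    and b1: "\<And>k. N1 (\<lambda>z. fk k z * of_real (exp ((1 - \<theta>) * b k z))) \<le> ennreal (CA p1 q1 * lk k)"
    by (simp_all only:)
  define c where "c k = (\<bar>CA p0 q0\<bar> + \<bar>CA p1 q1\<bar>) * lk k" for k
  have ck: "CA p0 q0 * lk k \<le> c k" "CA p1 q1 * lk k \<le> c k" for k
    unfolding c_def using lk[of k] by (intro mult_right_mono; simp)+
  have "(\<lambda>k. (1 / 2 :: real) ^ k) sums 2" using geometric_sums[of "1 / 2 :: real"] by simp
  then have sums: "c sums ((\<bar>CA p0 q0\<bar> + \<bar>CA p1 q1\<bar>) * (2 * l * 2))"
    unfolding c_def[abs_def] lk_def by (intro sums_mult)
  interpret F: analytic_family "Xplus M" N0 N1 \<theta> f "\<lambda>z. b (\<kappa> z) z" \<kappa> c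
  proof unfold_locales
    show "lattice_norm (Xplus M) N0" "lattice_norm (Xplus M) N1" by (rule lattice)+
    show "f \<in> L" "\<kappa> \<in> measurable (Xplus M) (count_space UNIV)" by (rule f \<kappa>_meas)+
    show "(\<lambda>z. b (\<kappa> z) z) \<in> borel_measurable (Xplus M)"
      by (rule measurable_compose_countable[OF b \<kappa>_meas])
    show "\<exists>B. \<forall>y. \<kappa> y = k \<longrightarrow> \<bar>b (\<kappa> y) y\<bar> \<le> B" for k using bB[of k] by auto
    show "0 \<le> c k" for k using lk[of k] by (simp add: c_def)
    show "summable c" using sums by (rule sums_summable)
    have "(\<lambda>y. if \<kappa> y = k then f y * of_real (exp (e * b (\<kappa> y) y)) else 0) = (\<lambda>z. fk k z * of_real (exp (e * b k z)))" for k e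
      by (auto simp: fk_def)
    then show "N0 (\<lambda>y. if \<kappa> y = k then f y * of_real (exp (- \<theta> * b (\<kappa> y) y)) else 0) \<le> ennreal (c k)"
      "N1 (\<lambda>y. if \<kappa> y = k then f y * of_real (exp ((1 - \<theta>) * b (\<kappa> y) y)) else 0) \<le> ennreal (c k)" for k
      using order_trans[OF b0 ennreal_leI[OF ck(1)]] order_trans[OF b1 ennreal_leI[OF ck(2)]] by (simp_all only:)
  qed
  have "exp 1 * suminf c \<le> C1 * l"
    using l unfolding sums_unique[OF sums, symmetric] C1_def by (simp add: algebra_simps)
  then have "calderon_norm N0 N1 F.F \<le> ennreal (C1 * l)"
    using F.F_calderon_norm by (meson ennreal_leI order_trans)
  then show ?thesis using F.F_calderon F.F_theta by blast
qed

text \<open>The first factor is the constant of \<open>integral_G_lower\<close>, the second that of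
  the pairing; the absolute value gives nonnegativity without a weight at hand.\<close>

definition C2 :: real where
  "C2 = (1 + tent_weight.Cb M p r A powr (q / p - 1)) * \<bar>tent_weight.CP M p r A\<bar>"

text \<open>The dual family has on each boundary line the exponents of the corresponding dual
  factor. At \<open>\<theta>\<close> they become \<open>- s\<close>, \<open>q - 1\<close> and
  \<open>p - q\<close>, so the pairing there equals \<open>l\<close> times the integral of
  \<open>Gf * w powr (p - q)\<close>. The maximum principle bounds it above and
  \<open>integral_G_lower\<close> below. Cutting makes the norm \<open>l\<close> finite and all
  exponents bounded beforehand.\<close>

lemma interpolation_upper_bound:
  assumes cal: "calderon L N0 N1 F" and cn: "calderon_norm N0 N1 F \<le> ennreal cn" "0 \<le> cn"
  shows "N\<theta> (cut (F (of_real \<theta>)) n) \<le> ennreal (C2 * cn)"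
proof -
  have \<theta>_strip: "of_real \<theta> \<in> strip" using \<theta> by (simp add: strip_def)
  have sum: "F (of_real \<theta>) \<in> sum_space L N0 N1" using cal \<theta>_strip unfolding calderon_def by blast
  then have F_meas [measurable]: "F (of_real \<theta>) \<in> L" by (auto simp: sum_space_def nspace_def)
  define f where "f = cut (F (of_real \<theta>)) n"
  have f_meas [measurable]: "f \<in> L" unfolding f_def by measurable
  have supp: "z \<in> level f n" if "z \<in> space (Xplus M)" "f z \<noteq> 0" for z
    using that(2) by (auto simp: f_def cut_def level_def split: if_splits)
  have fF: "f z = F (of_real \<theta>) z" if "z \<in> level f n" for z
    using level_bounds(4)[OF that] by (auto simp: f_def cut_def split: if_splits)
  obtain l where l: "N\<theta> f = ennreal l" "0 \<le> l" using norm_nice_finite[OF f_meas supp] by (cases "N\<theta> f") auto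
  show ?thesis
  proof (cases "l = 0")
    case True
    then show ?thesis using l by (simp add: f_def)
  next
    case False
    then have l0: "0 < l" using l by simp
    obtain a c where tw: "tent_weight M p q r A a (Gf f n l)" and c: "0 < c"
      "\<forall>z\<in>box (real (Suc n)). c \<le> tent_weight.w M r a z \<and> tent_weight.w M r a z \<le> 1 / c"
      using ex_weight[OF f_meas supp l0] l(1) by auto
    interpret W: tent_weight M p q r A a "Gf f n l" by (rule tw)
    have w: "0 < W.w z" if "z \<in> level f n" for z
      using bspec[OF c(2) level_bounds(2)[OF that]] abs_ln_le(1)[OF c(1)] by blast
    \<comment> \<open>Constant terms and slopes of the exponents of the modulus (\<open>k0\<close>,
      \<open>k1\<close>) and of the weight (\<open>e0\<close>, \<open>e1\<close>); at
      \<open>z = 0\<close> and \<open>z = 1\<close> they are those of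
      \<open>tent_norm_pairing\<close>.\<close>
    define k0 where "k0 = q * (1 - 1 / q0)"
    define k1 where "k1 = q * (1 / q0 - 1 / q1)"
    define e0 where "e0 = p * (1 - \<rho>0) - k0"
    define e1 where "e1 = p * (\<rho>0 - \<rho>1) - k1"
    define T where "T x y e z = (if z \<in> level f n then x * ln (V z) + y * \<phi> f l z + e * ln (W.w z) else 0)" for x y e z
    have T_meas [measurable]: "T x y e \<in> borel_measurable (Xplus M)" for x y e
      unfolding T_def[abs_def] by (intro measurable_level_If f_meas) measurable
    have T_bound: "\<exists>B\<ge>0. \<forall>z. \<bar>T x y e z\<bar> \<le> B" for x y e
      unfolding T_def by (rule log_combination_bounded[OF c])
    define c0 where "c0 = T (- s0) k0 e0"
    define c1 where "c1 = T (s0 - s1) k1 e1"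
    obtain B0 where B0: "0 \<le> B0" "\<And>z. \<bar>c0 z\<bar> \<le> B0" using T_bound unfolding c0_def by blast
    obtain B1 where B1: "0 \<le> B1" "\<And>z. \<bar>c1 z\<bar> \<le> B1" using T_bound unfolding c1_def by blast
    define B where "B = B0 + B1"
    have cB: "0 \<le> B" "\<bar>c0 z\<bar> \<le> B" "\<bar>c1 z\<bar> \<le> B" "\<bar>c0 z + c1 z\<bar> \<le> B" for z
      using B0(1) B0(2)[of z] B1(1) B1(2)[of z] by (auto simp: B_def)
    have c_sum: "c0 z + t * c1 z = T (- (s0 + t * (s1 - s0))) (k0 + t * k1) (e0 + t * e1) z" for z t
      by (simp add: c0_def c1_def T_def algebra_simps)
    have pairing: "(\<integral>\<^sup>+z. indicator (level f n) z * ennreal (cmod (u z) * exp (T (- s') (q * (1 - 1 / Q)) (p * (1 - enn2real (inverse pj)) - q * (1 - 1 / Q)) z)) \<partial>Xplus M)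
        \<le> ennreal W.CP * tent_norm M pj Q s' u"
      if pj: "1 \<le> pj" and Q: "1 < Q" and [measurable]: "u \<in> L" for pj Q s' u
    proof (rule order_trans[OF nn_integral_mono W.tent_norm_pairing[OF pj Q, of u s']])
      fix z
      show "indicator (level f n) z * ennreal (cmod (u z) * exp (T (- s') (q * (1 - 1 / Q)) (p * (1 - enn2real (inverse pj)) - q * (1 - 1 / Q)) z))
        \<le> modw s' u z * epow (Gf f n l z) (1 - 1 / Q) * ennreal (W.w z powr (p * (1 - enn2real (inverse pj)) - q * (1 - 1 / Q)))"
      proof (cases "z \<in> level f n")
        case True
        then show ?thesis using level_bounds(3)[OF True] w[OF True]
          by (simp add: T_def Gf_def modw_def epow_ennreal powr_def ennreal_mult[symmetric] exp_add exp_diff exp_minus divide_inverse mult_ac)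
      qed simp
    qed measurable
    have 0: "exp (c0 z) = exp (T (- s0) (q * (1 - 1 / q0)) (p * (1 - enn2real (inverse p0)) - q * (1 - 1 / q0)) z)" for z
      by (simp add: c0_def k0_def e0_def \<rho>0_def)
    have 1: "exp (c0 z + c1 z) = exp (T (- s1) (q * (1 - 1 / q1)) (p * (1 - enn2real (inverse p1)) - q * (1 - 1 / q1)) z)" for z
    proof -
      have "- (s0 + 1 * (s1 - s0)) = - s1" "k0 + 1 * k1 = q * (1 - 1 / q1)" "e0 + 1 * e1 = p * (1 - enn2real (inverse p1)) - q * (1 - 1 / q1)"
        by (simp_all add: k0_def k1_def e0_def e1_def \<rho>1_def algebra_simps)
      then show ?thesis using c_sum[of z 1] by simp
    qed
    note pair0 = pairing[OF p01(1) q01(1), of _ s0, folded 0]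
    note pair1 = pairing[OF p01(2) q01(2), of _ s1, folded 1]
    \<comment> \<open>A crude lower bound of the dual family on the level set. It gives the control
      of integrals required by \<open>analytic_pairing\<close>; \<open>exp B\<close> does not reach
      the final estimate.\<close>
    have low: "indicator (level f n) z * ennreal (cmod (u z)) \<le> ennreal (exp B) * (indicator (level f n) z * ennreal (cmod (u z) * exp t))"
      if "\<bar>t\<bar> \<le> B" for t u z
    proof -
      have "1 \<le> exp B * exp t" using that by (simp add: mult_exp_exp)
      then have "cmod (u z) * 1 \<le> cmod (u z) * (exp B * exp t)" by (intro mult_left_mono) auto
      then have "ennreal (cmod (u z)) \<le> ennreal (exp B * (cmod (u z) * exp t))" by (intro ennreal_leI) (simp add: mult_ac)
      then show ?thesis by (auto simp: ennreal_mult split: split_indicator)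
    qed
    define CK where "CK = exp B * W.CP"
    have CK: "0 < CK" using W.CP_pos by (simp add: CK_def)
    have ind_meas [measurable]: "(\<lambda>z. indicator (level f n) z :: ennreal) \<in> borel_measurable (Xplus M)"
      using level_meas[OF f_meas, of n] by (simp add: borel_measurable_indicator_iff)
    have c_meas [measurable]: "c0 \<in> borel_measurable (Xplus M)" "c1 \<in> borel_measurable (Xplus M)"
      unfolding c0_def c1_def by measurable
    interpret P: analytic_pairing "Xplus M" N0 N1 F "level f n" "\<lambda>z. cnj (sgn (f z))" c0 c1 CK B
    proof unfold_locales
      show "calderon L N0 N1 F" by (rule cal)
      show "level f n \<inter> space (Xplus M) \<in> sets (Xplus M)" by (rule level_meas[OF f_meas])
      show "(\<lambda>z. cnj (sgn (f z))) \<in> L"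
        unfolding sgn_div_norm by (intro borel_measurable_continuous_on[OF continuous_on_cnj[OF continuous_on_id]]) measurable
      show "c0 \<in> borel_measurable (Xplus M)" "c1 \<in> borel_measurable (Xplus M)" by (rule c_meas)+
      show "cmod (cnj (sgn (f y))) \<le> 1" for y by (simp add: norm_sgn)
      show "\<bar>c0 y\<bar> \<le> B" "\<bar>c1 y\<bar> \<le> B" for y by (rule cB)+
      show "0 < CK" "0 \<le> B" by (rule CK cB)+
      fix u :: "'a \<times> real \<Rightarrow> complex" assume [measurable]: "u \<in> L"
      have "(\<integral>\<^sup>+y. indicator (level f n) y * ennreal (cmod (u y)) \<partial>Xplus M) \<le> (\<integral>\<^sup>+y. ennreal (exp B) * (indicator (level f n) y * ennreal (cmod (u y) * exp (c0 y))) \<partial>Xplus M)"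
        by (intro nn_integral_mono low cB)
      also have "\<dots> = ennreal (exp B) * (\<integral>\<^sup>+y. indicator (level f n) y * ennreal (cmod (u y) * exp (c0 y)) \<partial>Xplus M)"
        by (rule nn_integral_cmult) measurable
      also have "\<dots> \<le> ennreal (exp B) * (ennreal W.CP * N0 u)" by (intro mult_left_mono pair0) auto
      finally show "(\<integral>\<^sup>+y. indicator (level f n) y * ennreal (cmod (u y)) \<partial>Xplus M) \<le> ennreal CK * N0 u"
        using W.CP_pos by (simp add: CK_def ennreal_mult mult.assoc)
      have "(\<integral>\<^sup>+y. indicator (level f n) y * ennreal (cmod (u y)) \<partial>Xplus M) \<le> (\<integral>\<^sup>+y. ennreal (exp B) * (indicator (level f n) y * ennreal (cmod (u y) * exp (c0 y + c1 y))) \<partial>Xplus M)"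
        by (intro nn_integral_mono low cB)
      also have "\<dots> = ennreal (exp B) * (\<integral>\<^sup>+y. indicator (level f n) y * ennreal (cmod (u y) * exp (c0 y + c1 y)) \<partial>Xplus M)"
        by (rule nn_integral_cmult) measurable
      also have "\<dots> \<le> ennreal (exp B) * (ennreal W.CP * N1 u)" by (intro mult_left_mono pair1) auto
      finally show "(\<integral>\<^sup>+y. indicator (level f n) y * ennreal (cmod (u y)) \<partial>Xplus M) \<le> ennreal CK * N1 u"
        using W.CP_pos by (simp add: CK_def ennreal_mult mult.assoc)
    qed
    have Gle: "cmod (P.G (Complex t v) y) \<le> indicator (level f n) y * exp (c0 y + t * c1 y)" for t v y
    proof -
      have "cmod (P.G (Complex t v) y) \<le> indicator (level f n) y * 1 * exp (c0 y + t * c1 y)"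
        unfolding P.G_def norm_mult by (intro mult_mono) (auto simp: norm_sgn split: split_indicator)
      then show ?thesis by simp
    qed
    have prod: "ennreal (cmod (u y) * cmod (P.G (Complex t v) y)) \<le> indicator (level f n) y * ennreal (cmod (u y) * exp (c0 y + t * c1 y))" for u t v y
    proof -
      have "cmod (u y) * cmod (P.G (Complex t v) y) \<le> cmod (u y) * (indicator (level f n) y * exp (c0 y + t * c1 y))"
        by (intro mult_left_mono Gle) auto
      then have "ennreal (cmod (u y) * cmod (P.G (Complex t v) y)) \<le> ennreal (cmod (u y) * (indicator (level f n) y * exp (c0 y + t * c1 y)))"
        by (rule ennreal_leI)
      then show ?thesis by (cases "y \<in> level f n") (simp_all add: P.G_def)
    qed
    have mem: "F (Complex 0 t) \<in> L" "F (Complex 1 t) \<in> L" for t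
      using cal unfolding calderon_def nspace_def by blast+
    have cn0: "N0 (F (Complex 0 t)) \<le> ennreal cn" for t
    proof -
      have "N0 (F (Complex 0 t)) \<le> (SUP t. N0 (F (Complex 0 t)))" by (rule SUP_upper) simp
      also have "\<dots> \<le> calderon_norm N0 N1 F" by (simp add: calderon_norm_def)
      finally show ?thesis using cn(1) by (rule order_trans)
    qed
    have cn1: "N1 (F (Complex 1 t)) \<le> ennreal cn" for t
    proof -
      have "N1 (F (Complex 1 t)) \<le> (SUP t. N1 (F (Complex 1 t)))" by (rule SUP_upper) simp
      also have "\<dots> \<le> calderon_norm N0 N1 F" by (simp add: calderon_norm_def)
      finally show ?thesis using cn(1) by (rule order_trans)
    qed
    have \<Phi>_le: "cmod (P.\<Phi> (of_real \<theta>)) \<le> W.CP * cn"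
    proof (rule P.pairing_le)
      fix t
      have "(\<integral>\<^sup>+y. ennreal (cmod (F (Complex 0 t) y) * cmod (P.G (Complex 0 t) y)) \<partial>Xplus M)
          \<le> (\<integral>\<^sup>+y. indicator (level f n) y * ennreal (cmod (F (Complex 0 t) y) * exp (c0 y)) \<partial>Xplus M)"
        using prod[of "F (Complex 0 t)" _ 0 t] by (intro nn_integral_mono) simp
      also have "\<dots> \<le> ennreal W.CP * N0 (F (Complex 0 t))" by (intro pair0 mem)
      also have "\<dots> \<le> ennreal W.CP * ennreal cn" by (intro mult_left_mono cn0) auto
      finally show "(\<integral>\<^sup>+y. ennreal (cmod (F (Complex 0 t) y) * cmod (P.G (Complex 0 t) y)) \<partial>Xplus M) \<le> ennreal (W.CP * cn)"
        using W.CP_pos cn by (simp add: ennreal_mult)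
      have "(\<integral>\<^sup>+y. ennreal (cmod (F (Complex 1 t) y) * cmod (P.G (Complex 1 t) y)) \<partial>Xplus M)
          \<le> (\<integral>\<^sup>+y. indicator (level f n) y * ennreal (cmod (F (Complex 1 t) y) * exp (c0 y + c1 y)) \<partial>Xplus M)"
        using prod[of "F (Complex 1 t)" _ 1 t] by (intro nn_integral_mono) simp
      also have "\<dots> \<le> ennreal W.CP * N1 (F (Complex 1 t))" by (intro pair1 mem)
      also have "\<dots> \<le> ennreal W.CP * ennreal cn" by (intro mult_left_mono cn1) auto
      finally show "(\<integral>\<^sup>+y. ennreal (cmod (F (Complex 1 t) y) * cmod (P.G (Complex 1 t) y)) \<partial>Xplus M) \<le> ennreal (W.CP * cn)"
        using W.CP_pos cn by (simp add: ennreal_mult)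
    qed (use W.CP_pos cn \<theta>_strip in auto)
    define R where "R y = (if y \<in> level f n then cmod (f y) * exp (c0 y + \<theta> * c1 y) else 0)" for y
    have R_meas [measurable]: "R \<in> borel_measurable (Xplus M)"
      unfolding R_def[abs_def] by (intro measurable_level_If f_meas) measurable
    have FR: "F (of_real \<theta>) y * P.G (of_real \<theta>) y = of_real (R y)" for y
    proof (cases "y \<in> level f n")
      case True
      have "f y * cnj (sgn (f y)) = inverse (of_real (cmod (f y))) * (f y * cnj (f y))"
        by (simp add: sgn_div_norm scaleR_conv_of_real mult_ac)
      also have "f y * cnj (f y) = of_real (cmod (f y)) * of_real (cmod (f y))"
        by (simp add: complex_norm_square[symmetric] power2_eq_square)
      finally have "f y * cnj (sgn (f y)) = of_real (cmod (f y))" using level_bounds(4)[OF True] by simp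
      moreover have "exp (of_real (c0 y) + of_real \<theta> * of_real (c1 y)) = (of_real (exp (c0 y + \<theta> * c1 y)) :: complex)"
        by (simp add: exp_of_real[symmetric])
      ultimately show ?thesis using True fF[OF True] by (simp add: P.G_def R_def mult.assoc[symmetric])
    qed (simp add: P.G_def R_def)
    define X where "X = (\<integral>\<^sup>+z. Gf f n l z * ennreal (W.w z powr (p - q)) \<partial>Xplus M)"
    have RX: "(\<integral>\<^sup>+y. ennreal (R y) \<partial>Xplus M) = ennreal l * X"
    proof -
      have "ennreal (R y) = ennreal l * (Gf f n l y * ennreal (W.w y powr (p - q)))" for y
      proof (cases "y \<in> level f n")
        case True
        have 1: "s0 + \<theta> * (s1 - s0) = s" by (simp add: s_def algebra_simps)
        have 2: "k0 + \<theta> * k1 = q - 1"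
        proof -
          have "k0 + \<theta> * k1 = q - ((1 - \<theta>) * (q / q0) + \<theta> * (q / q1))"
            by (simp add: k0_def k1_def algebra_simps diff_divide_distrib)
          then show ?thesis by (simp only: q_kappa')
        qed
        have 3: "e0 + \<theta> * e1 = p - q"
        proof -
          have "e0 + \<theta> * e1 = p - p * ((1 - \<theta>) * \<rho>0 + \<theta> * \<rho>1) - (k0 + \<theta> * k1)" by (simp add: e0_def e1_def algebra_simps)
          then show ?thesis by (simp only: p_rho 2)
        qed
        have "R y = exp (ln (cmod (f y)) + (- s * ln (V y) + (q - 1) * \<phi> f l y + (p - q) * ln (W.w y)))"
          using True level_bounds(4)[OF True] unfolding R_def c_sum 1 2 3 by (simp add: T_def exp_add)
        also have "ln (cmod (f y)) + (- s * ln (V y) + (q - 1) * \<phi> f l y + (p - q) * ln (W.w y)) = ln l + (q * \<phi> f l y + (p - q) * ln (W.w y))"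
          by (simp add: \<phi>_def algebra_simps)
        also have "exp \<dots> = l * (exp (q * \<phi> f l y) * W.w y powr (p - q))"
          using l0 w[OF True] by (simp add: exp_add powr_def)
        finally show ?thesis using True l0 by (simp add: Gf_def ennreal_mult)
      qed (simp add: R_def Gf_def)
      then show ?thesis unfolding X_def by (simp only:) (rule nn_integral_cmult, measurable)
    qed
    have "X \<le> ennreal W.Cb" unfolding X_def by (rule W.integral_G_self)
    then obtain x where x: "X = ennreal x" "0 \<le> x" by (cases X) (auto simp: top_unique)
    have "cmod (P.\<Phi> (of_real \<theta>)) = l * x"
    proof -
      have R0: "0 \<le> R y" for y by (simp add: R_def)
      have "P.\<Phi> (of_real \<theta>) = of_real (LINT y|Xplus M. R y)" unfolding P.\<Phi>_def FR by (rule integral_complex_of_real)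
      moreover have "(LINT y|Xplus M. R y) = enn2real (\<integral>\<^sup>+y. ennreal (R y) \<partial>Xplus M)" using R0 by (intro integral_eq_nn_integral) auto
      moreover have "\<dots> = l * x" unfolding RX x using l0 x by (simp add: ennreal_mult[symmetric])
      ultimately show ?thesis using l0 x by (simp add: norm_mult)
    qed
    then have lx: "l * x \<le> W.CP * cn" using \<Phi>_le by simp
    \<comment> \<open>In fact an equality, since \<open>Gf\<close> is normalised by the norm
      \<open>l\<close> of \<open>f\<close> itself.\<close>
    have int1: "1 \<le> (\<integral>\<^sup>+x. epow (cone_int (Gf f n l) x) (p / q) \<partial>M)"
    proof -
      have "(\<integral>\<^sup>+x. epow (cone_int (Gf f n l) x) (p / q) \<partial>M) = epow (ennreal (1 / l) * N\<theta> f) p"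
        by (rule Gf_integral[OF f_meas _ l0]) (rule supp)
      then show ?thesis using l0 unfolding l(1) by (simp add: ennreal_mult[symmetric])
    qed
    have rq: "r = p - q" if "q < p" using that by (simp add: r_def wexp_def)
    have "1 \<le> ennreal (1 + W.Cb powr (q / p - 1)) * ennreal x"
      using W.integral_G_lower[OF rq int1] unfolding X_def[symmetric] x(1) .
    moreover have "ennreal ((1 + W.Cb powr (q / p - 1)) * x) = ennreal (1 + W.Cb powr (q / p - 1)) * ennreal x"
      using x(2) by (intro ennreal_mult) auto
    ultimately have "ennreal 1 \<le> ennreal ((1 + W.Cb powr (q / p - 1)) * x)" by (simp only: ennreal_1)
    then have "1 \<le> (1 + W.Cb powr (q / p - 1)) * x"
      using x(2) by (subst (asm) ennreal_le_iff) (auto intro!: mult_nonneg_nonneg)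
    then have "l * 1 \<le> l * ((1 + W.Cb powr (q / p - 1)) * x)" using l0 by (intro mult_left_mono) auto
    also have "\<dots> = (1 + W.Cb powr (q / p - 1)) * (l * x)" by (simp add: mult_ac)
    also have "\<dots> \<le> (1 + W.Cb powr (q / p - 1)) * (W.CP * cn)" by (intro mult_left_mono lx) (simp add: add_nonneg_nonneg)
    also have "\<dots> = C2 * cn" using W.CP_pos by (simp add: C2_def)
    finally show ?thesis using l(1) by (simp add: f_def ennreal_leI)
  qed
qed

lemma C2_nonneg: "0 \<le> C2"
  by (simp add: C2_def add_nonneg_nonneg)

text \<open>The norm of the value at \<open>\<theta>\<close> is the supremum over its cuts, which
  all obey the same bound; thus its finiteness is obtained rather than presupposed.\<close>

lemma calderon_imp_norm_bound:
  assumes cal: "calderon L N0 N1 F"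
  shows "F (of_real \<theta>) \<in> L" "N\<theta> (F (of_real \<theta>)) \<le> ennreal C2 * calderon_norm N0 N1 F" "calderon_norm N0 N1 F < top"
proof -
  have "of_real \<theta> \<in> strip" using \<theta> by (simp add: strip_def)
  then have "F (of_real \<theta>) \<in> sum_space L N0 N1" using cal unfolding calderon_def by blast
  then show mem: "F (of_real \<theta>) \<in> L" by (auto simp: sum_space_def nspace_def)
  show fin: "calderon_norm N0 N1 F < top" by (rule calderon_norm_finite[OF lattice(1,2) cal])
  obtain cn where cn: "calderon_norm N0 N1 F = ennreal cn" "0 \<le> cn" using fin by (cases "calderon_norm N0 N1 F") auto
  have "N\<theta> (F (of_real \<theta>)) = (SUP n. N\<theta> (cut (F (of_real \<theta>)) n))"
    unfolding N\<theta>_eq using p_ge_1 q_kappa(2) by (intro norm_cut_SUP mem) auto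
  also have "\<dots> \<le> ennreal (C2 * cn)" using cn by (intro SUP_least interpolation_upper_bound[OF cal]) auto
  finally show "N\<theta> (F (of_real \<theta>)) \<le> ennreal C2 * calderon_norm N0 N1 F"
    using cn C2_nonneg by (simp add: ennreal_mult)
qed

lemma interp_norm_le:
  assumes f: "f \<in> nspace L N\<theta>"
  shows "interp_norm L N0 N1 \<theta> f \<le> ennreal C1 * N\<theta> f"
proof -
  obtain x where x: "N\<theta> f = ennreal x" "0 \<le> x" using f by (cases "N\<theta> f") (auto simp: nspace_def)
  have fL: "f \<in> L" using f by (simp add: nspace_def)
  have "interp_norm L N0 N1 \<theta> f \<le> ennreal (C1 * x)"
  proof (rule ennreal_le_epsilon)
    fix e :: real assume e: "0 < e"
    \<comment> \<open>The construction needs \<open>0 < l\<close>, also when the norm is 0; the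
      excess contributes exactly \<open>e\<close> after multiplication by \<open>C1\<close>.\<close>
    define l where "l = x + e / C1"
    have l: "0 < l" "N\<theta> f \<le> ennreal l" using x e C1_pos by (auto simp: l_def add_nonneg_pos intro: ennreal_leI)
    obtain F where F: "calderon L N0 N1 F" "F (of_real \<theta>) = f" "calderon_norm N0 N1 F \<le> ennreal (C1 * l)"
      using ex_calderon_extension[OF fL l] by blast
    have "interp_norm L N0 N1 \<theta> f \<le> calderon_norm N0 N1 F" unfolding interp_norm_def using F by (intro INF_lower) auto
    also have "\<dots> \<le> ennreal (C1 * l)" by (rule F(3))
    also have "C1 * l = C1 * x + e" using C1_pos by (simp add: l_def distrib_left)
    finally show "interp_norm L N0 N1 \<theta> f \<le> ennreal (C1 * x) + ennreal e"
      using x e C1_pos by (simp add: ennreal_plus[symmetric] del: ennreal_plus)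
  qed
  then show ?thesis using x C1_pos by (simp add: ennreal_mult)
qed

text \<open>The summand 1 makes the constant invertible, so that it can be moved across the infimum.
  For \<open>f\<close> outside the interpolation space the infimum is over the empty set and equals
  \<open>top\<close>.\<close>

lemma tent_norm_le_interp_norm: "N\<theta> f \<le> ennreal (C2 + 1) * interp_norm L N0 N1 \<theta> f"
proof -
  have C: "0 < C2 + 1" using C2_nonneg by simp
  have inv: "ennreal (1 / (C2 + 1)) * ennreal (C2 + 1) = 1" using C by (subst ennreal_mult[symmetric]) auto
  have "ennreal (1 / (C2 + 1)) * N\<theta> f \<le> interp_norm L N0 N1 \<theta> f"
    unfolding interp_norm_def
  proof (intro INF_greatest)
    fix F assume "F \<in> {F. calderon L N0 N1 F \<and> F (complex_of_real \<theta>) = f}"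
    then have "N\<theta> f \<le> ennreal C2 * calderon_norm N0 N1 F" using calderon_imp_norm_bound(2)[of F] by auto
    also have "\<dots> \<le> ennreal (C2 + 1) * calderon_norm N0 N1 F" by (intro mult_right_mono ennreal_leI) auto
    finally have "ennreal (1 / (C2 + 1)) * N\<theta> f \<le> ennreal (1 / (C2 + 1)) * (ennreal (C2 + 1) * calderon_norm N0 N1 F)"
      by (intro mult_left_mono) auto
    then show "ennreal (1 / (C2 + 1)) * N\<theta> f \<le> calderon_norm N0 N1 F" unfolding mult.assoc[symmetric] inv by simp
  qed
  then have "ennreal (C2 + 1) * (ennreal (1 / (C2 + 1)) * N\<theta> f) \<le> ennreal (C2 + 1) * interp_norm L N0 N1 \<theta> f"
    by (intro mult_left_mono) auto
  then show ?thesis unfolding mult.assoc[symmetric] mult.commute[of "ennreal (C2 + 1)" "ennreal (1 / (C2 + 1))"] inv by simp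
qed

theorem interpolation:
  "interp_space L N0 N1 \<theta> = nspace L N\<theta> \<and>
     (\<exists>C::real. C > 0 \<and> (\<forall>f \<in> nspace L N\<theta>.
        interp_norm L N0 N1 \<theta> f \<le> ennreal C * N\<theta> f \<and> N\<theta> f \<le> ennreal C * interp_norm L N0 N1 \<theta> f))"
proof (intro conjI)
  show "interp_space L N0 N1 \<theta> = nspace L N\<theta>"
  proof (intro set_eqI iffI)
    fix f assume "f \<in> interp_space L N0 N1 \<theta>"
    then obtain F where F: "calderon L N0 N1 F" "f = F (of_real \<theta>)" by (auto simp: interp_space_def)
    have "N\<theta> f < top"
      using calderon_imp_norm_bound(2,3)[OF F(1)] unfolding F(2)
      by (auto intro: le_less_trans simp: ennreal_mult_less_top)
    then show "f \<in> nspace L N\<theta>" using calderon_imp_norm_bound(1)[OF F(1)] F(2) by (simp add: nspace_def)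
  next
    fix f assume f: "f \<in> nspace L N\<theta>"
    then obtain x where x: "N\<theta> f = ennreal x" "0 \<le> x" by (cases "N\<theta> f") (auto simp: nspace_def)
    have "\<exists>F. calderon L N0 N1 F \<and> F (of_real \<theta>) = f \<and> calderon_norm N0 N1 F \<le> ennreal (C1 * (x + 1))"
      using f x by (intro ex_calderon_extension) (auto simp: nspace_def intro!: ennreal_leI)
    then show "f \<in> interp_space L N0 N1 \<theta>" unfolding interp_space_def by blast
  qed
  have C: "C1 \<le> C1 + C2 + 1" "C2 + 1 \<le> C1 + C2 + 1" "0 < C1 + C2 + 1" using C1_pos C2_nonneg by auto
  show "\<exists>C::real. C > 0 \<and> (\<forall>f \<in> nspace L N\<theta>.
        interp_norm L N0 N1 \<theta> f \<le> ennreal C * N\<theta> f \<and> N\<theta> f \<le> ennreal C * interp_norm L N0 N1 \<theta> f)"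
  proof (intro exI[of _ "C1 + C2 + 1"] conjI ballI)
    fix f assume f: "f \<in> nspace L N\<theta>"
    show "interp_norm L N0 N1 \<theta> f \<le> ennreal (C1 + C2 + 1) * N\<theta> f"
      by (rule order_trans[OF interp_norm_le[OF f]]) (intro mult_right_mono ennreal_leI C, simp)
    show "N\<theta> f \<le> ennreal (C1 + C2 + 1) * interp_norm L N0 N1 \<theta> f"
      by (rule order_trans[OF tent_norm_le_interp_norm]) (intro mult_right_mono ennreal_leI C, simp)
  qed (rule C)
qed

end

theorem mainTheorem7:
  fixes M :: "'a::metric_space measure"
    and p0 p1 :: ennreal and q0 q1 s0 s1 \<theta> :: real
  assumes "sets M = sets borel"
    and "nondegenerate M" and "doubling M"
    and "1 \<le> p0" and "1 \<le> p1" and "\<not> (p0 = \<infinity> \<and> p1 = \<infinity>)"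
    and "1 < q0" and "1 < q1"
    and "0 < \<theta>" and "\<theta> < 1"
  shows "let p\<theta> = inverse (ennreal (1 - \<theta>) * inverse p0 + ennreal \<theta> * inverse p1);
             q\<theta> = 1 / ((1 - \<theta>) / q0 + \<theta> / q1);
             s\<theta> = (1 - \<theta>) * s0 + \<theta> * s1;
             L = L0plus M;
             N0 = tent_norm M p0 q0 s0;
             N1 = tent_norm M p1 q1 s1;
             N\<theta> = tent_norm M p\<theta> q\<theta> s\<theta>
         in interp_space L N0 N1 \<theta> = nspace L N\<theta> \<and>
            (\<exists>C::real. C > 0 \<and> (\<forall>f \<in> nspace L N\<theta>.
                interp_norm L N0 N1 \<theta> f \<le> ennreal C * N\<theta> f \<and>
                N\<theta> f \<le> ennreal C * interp_norm L N0 N1 \<theta> f))"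
proof -
  interpret tent_interpolation M p0 p1 q0 q1 s0 s1 \<theta>
    using assms by unfold_locales
  show ?thesis
    unfolding Let_def p_theta L0plus_def q_def[symmetric] s_def[symmetric] by (rule interpolation)
qed

end
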